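(* Let $p$ be an odd prime and let $M$ be a closed oriented rational homology $3$-sphere whose first homology $H_1(M;\mathbb Z)$ has exponent $p$. Suppose $M$ embeds locally flatly in $S^4$, or in an integer homology $4$-sphere, with complementary regions $X$ and $Y$, and let $$A=\ker\{H_1(M;\mathbb Z)\to H_1(X;\mathbb Z)\},\qquad B=\ker\{H_1(M;\mathbb Z)\to H_1(Y;\mathbb Z)\}$$ be the two Hantzsche Lagrangians coming from the complementary regions. Then $$\left\langle u\cup v\cup w,[M]\right\rangle=0$$ for all $u,v,w\in A^\lambda$, and also for all $u,v,w\in B^\lambda$. Consequently, if there is no dual Hantzsche pair $H_1(M;\mathbb Z)=A'\oplus B'$ for which the mod-$p$ triple cup product $(u,v,w)\mapsto\langle u\cup v\cup w,[M]\rangle$ vanishes on both $A'^\lambda$ and $B'^\lambda$, then $M$ admits no locally flat embedding in $S^4$ and no locally flat embedding in any integer homology $4$-sphere.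
   Context: Ordinary torsion linking form: $\lambda_2\colon H_1(M;\mathbb Z)\times H_1(M;\mathbb Z)\to\mathbb Q/\mathbb Z$, $\lambda_2(a,b)=\frac1p(C\cdot b)$, where $C$ is a singular $2$-chain with $\partial C=pa$; it is nonsingular and symmetric. $\kappa_p\colon\frac1p\mathbb Z/\mathbb Z\to\mathbb F_p$ is $\kappa_p(a/p)=a\bmod p$. For $x\in H_1(M;\mathbb Z)$, the linking-dual class $x^\lambda\in H^1(M;\mathbb F_p)\cong\operatorname{Hom}(H_1(M;\mathbb Z),\mathbb F_p)$ is $x^\lambda(u)=\kappa_p(\lambda_2(x,u))$; for a subgroup $A\subset H_1(M;\mathbb Z)$, $A^\lambda=\{x^\lambda:x\in A\}\subset H^1(M;\mathbb F_p)$. A subgroup $L\le H_1(M;\mathbb Z)$ is a Hantzsche Lagrangian if $\lambda_2|_{L\times L}=0$ and $|L|^2=|H_1(M;\mathbb Z)|$. A dual Hantzsche pair is a direct sum decomposition $H_1(M;\mathbb Z)=A\oplus B$ with $A,B$ Hantzsche Lagrangians. It is a known theorem (Hantzsche, Freedman--Krushkal) that for an embedding as in the statement the kernels $A$, $B$ form a dual Hantzsche pair. An integer homology $4$-sphere is a closed $4$-manifold with the integral homology of $S^4$. *)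

theory Defs
  imports "HOL-Algebra.IntRing" "HOL-Analysis.Abstract_Topological_Spaces" "HOL-Homology.Homology" "HOL-Number_Theory.Residues"
begin

section \<open>Manifolds and locally flat embeddings\<close>

definition topological_manifold :: "nat \<Rightarrow> 'a topology \<Rightarrow> bool" where
  "topological_manifold n M \<longleftrightarrow>
     Hausdorff_space M \<and> second_countable M \<and>
     (\<forall>x \<in> topspace M. \<exists>U. openin M U \<and> x \<in> U \<and>
        subtopology M U homeomorphic_space Euclidean_space n)"

definition closed_manifold :: "nat \<Rightarrow> 'a topology \<Rightarrow> bool" where
  "closed_manifold n M \<longleftrightarrow> topological_manifold n M \<and> compact_space M"

text \<open>An orientation of a closed \<open>n\<close>-manifold is given by its fundamental class: a class that
  restricts to a generator of the local homology group at every point.\<close>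

definition fundamental_class :: "nat \<Rightarrow> 'a topology \<Rightarrow> 'a chain set \<Rightarrow> bool" where
  "fundamental_class n M \<mu> \<longleftrightarrow>
     \<mu> \<in> carrier (homology_group (int n) M) \<and>
     (\<forall>x \<in> topspace M.
        carrier (subgroup_generated (relative_homology_group (int n) M (topspace M - {x}))
          {hom_induced (int n) M {} M (topspace M - {x}) id \<mu>})
        = carrier (relative_homology_group (int n) M (topspace M - {x})))"

text \<open>Codimension one. The library's \<open>Euclidean_space n\<close> is literally the hyperplane
  of points of \<open>Euclidean_space (Suc n)\<close> whose last coordinate vanishes.\<close>

definition locally_flat_embedding ::
    "nat \<Rightarrow> 'a topology \<Rightarrow> 'b topology \<Rightarrow> ('a \<Rightarrow> 'b) \<Rightarrow> bool" where
  "locally_flat_embedding n M W f \<longleftrightarrow>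
     embedding_map M W f \<and>
     (\<forall>x \<in> topspace M. \<exists>U h. openin W U \<and> f x \<in> U \<and>
        homeomorphic_map (subtopology W U) (Euclidean_space (Suc n)) h \<and>
        h ` (U \<inter> f ` topspace M) = topspace (Euclidean_space n))"

text \<open>The two complementary regions of \<open>N\<close> in \<open>W\<close> are the closures of the two components
  of \<open>W - N\<close>, so that \<open>W = X \<union> Y\<close> with \<open>X\<close> and \<open>Y\<close> meeting along \<open>N\<close>.\<close>

definition complementary_regions :: "'b topology \<Rightarrow> 'b set \<Rightarrow> 'b set \<Rightarrow> 'b set \<Rightarrow> bool" where
  "complementary_regions W N X Y \<longleftrightarrow>
     (\<exists>U V. U \<noteq> V \<and> connected_components_of (subtopology W (topspace W - N)) = {U, V} \<and>
        X = W closure_of U \<and> Y = W closure_of V)"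

section \<open>Singular homology with coefficients in a ring\<close>

definition rat_ring :: "rat ring" where
  "rat_ring = \<lparr>carrier = UNIV, monoid.mult = (*), one = 1, ring.zero = 0, add = (+)\<rparr>"

definition coeff_chain_group ::
    "('r, 'm) ring_scheme \<Rightarrow> nat \<Rightarrow> 'a topology \<Rightarrow> (((nat \<Rightarrow> real) \<Rightarrow> 'a) \<Rightarrow> 'r) monoid" where
  "coeff_chain_group R n X = sum_group (singular_simplex_set n X) (\<lambda>_. add_monoid R)"

text \<open>The coefficient at \<open>\<tau>\<close> of the boundary of \<open>\<Sum>\<sigma>. c \<sigma> \<cdot> \<sigma>\<close>; the integer
  \<open>Poly_Mapping.lookup (chain_boundary n (frag_of \<sigma>)) \<tau>\<close> is the incidence number
  of \<open>\<sigma>\<close> and \<open>\<tau>\<close>. In degree \<open>0\<close> the boundary is zero.\<close>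

definition coeff_boundary ::
    "('r, 'm) ring_scheme \<Rightarrow> nat \<Rightarrow> 'a topology \<Rightarrow>
      (((nat \<Rightarrow> real) \<Rightarrow> 'a) \<Rightarrow> 'r) \<Rightarrow> (((nat \<Rightarrow> real) \<Rightarrow> 'a) \<Rightarrow> 'r)" where
  "coeff_boundary R n X c =
     (\<lambda>\<tau> \<in> singular_simplex_set (n - 1) X.
        \<Oplus>\<^bsub>R\<^esub>\<sigma> \<in> {\<sigma> \<in> singular_simplex_set n X. c \<sigma> \<noteq> \<zero>\<^bsub>R\<^esub>}.
          [Poly_Mapping.lookup (chain_boundary n (frag_of \<sigma>)) \<tau>] \<cdot>\<^bsub>R\<^esub> c \<sigma>)"

definition coeff_homology_group ::
    "('r, 'm) ring_scheme \<Rightarrow> nat \<Rightarrow> 'a topology \<Rightarrow> (((nat \<Rightarrow> real) \<Rightarrow> 'a) \<Rightarrow> 'r) set monoid" where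
  "coeff_homology_group R n X =
     subgroup_generated (coeff_chain_group R n X)
       (kernel (coeff_chain_group R n X) (coeff_chain_group R (n - 1) X) (coeff_boundary R n X))
     Mod (coeff_boundary R (Suc n) X ` carrier (coeff_chain_group R (Suc n) X))"

definition rational_homology_sphere :: "nat \<Rightarrow> 'a topology \<Rightarrow> bool" where
  "rational_homology_sphere n M \<longleftrightarrow>
     closed_manifold n M \<and>
     (\<forall>k. coeff_homology_group rat_ring k M \<cong> coeff_homology_group rat_ring k (nsphere n))"

definition integer_homology_sphere :: "nat \<Rightarrow> 'a topology \<Rightarrow> bool" where
  "integer_homology_sphere n W \<longleftrightarrow>
     closed_manifold n W \<and> (\<forall>k. homology_group k W \<cong> homology_group k (nsphere n))"

section \<open>Singular cohomology and products\<close>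

definition cochain_group ::
    "('r, 'm) ring_scheme \<Rightarrow> nat \<Rightarrow> 'a topology \<Rightarrow> (((nat \<Rightarrow> real) \<Rightarrow> 'a) \<Rightarrow> 'r) monoid" where
  "cochain_group R n X = product_group (singular_simplex_set n X) (\<lambda>_. add_monoid R)"

definition cochain_eval ::
    "('r, 'm) ring_scheme \<Rightarrow> (((nat \<Rightarrow> real) \<Rightarrow> 'a) \<Rightarrow> 'r) \<Rightarrow> 'a chain \<Rightarrow> 'r" where
  "cochain_eval R \<phi> c =
     (\<Oplus>\<^bsub>R\<^esub>\<sigma> \<in> Poly_Mapping.keys c. [Poly_Mapping.lookup c \<sigma>] \<cdot>\<^bsub>R\<^esub> \<phi> \<sigma>)"

definition coboundary ::
    "('r, 'm) ring_scheme \<Rightarrow> nat \<Rightarrow> 'a topology \<Rightarrow>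
      (((nat \<Rightarrow> real) \<Rightarrow> 'a) \<Rightarrow> 'r) \<Rightarrow> (((nat \<Rightarrow> real) \<Rightarrow> 'a) \<Rightarrow> 'r)" where
  "coboundary R n X \<phi> =
     (\<lambda>\<sigma> \<in> singular_simplex_set (Suc n) X.
        cochain_eval R \<phi> (chain_boundary (Suc n) (frag_of \<sigma>)))"

definition cocycle_set ::
    "('r, 'm) ring_scheme \<Rightarrow> nat \<Rightarrow> 'a topology \<Rightarrow> (((nat \<Rightarrow> real) \<Rightarrow> 'a) \<Rightarrow> 'r) set" where
  "cocycle_set R n X =
     kernel (cochain_group R n X) (cochain_group R (Suc n) X) (coboundary R n X)"

definition coboundary_set ::
    "('r, 'm) ring_scheme \<Rightarrow> nat \<Rightarrow> 'a topology \<Rightarrow> (((nat \<Rightarrow> real) \<Rightarrow> 'a) \<Rightarrow> 'r) set" where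
  "coboundary_set R n X =
     (if n = 0 then {\<one>\<^bsub>cochain_group R 0 X\<^esub>}
      else coboundary R (n - 1) X ` carrier (cochain_group R (n - 1) X))"

definition cohomology_group ::
    "('r, 'm) ring_scheme \<Rightarrow> nat \<Rightarrow> 'a topology \<Rightarrow> (((nat \<Rightarrow> real) \<Rightarrow> 'a) \<Rightarrow> 'r) set monoid" where
  "cohomology_group R n X =
     subgroup_generated (cochain_group R n X) (cocycle_set R n X) Mod coboundary_set R n X"

text \<open>The restrictions of a singular simplex to the face spanned by its first \<open>k + 1\<close> vertices,
  and to the face spanned by the \<open>l + 1\<close> vertices numbered \<open>k, \<dots>, k + l\<close>.\<close>

definition front_face :: "nat \<Rightarrow> ((nat \<Rightarrow> real) \<Rightarrow> 'a) \<Rightarrow> ((nat \<Rightarrow> real) \<Rightarrow> 'a)" where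
  "front_face k \<sigma> = restrict \<sigma> (standard_simplex k)"

definition back_face :: "nat \<Rightarrow> nat \<Rightarrow> ((nat \<Rightarrow> real) \<Rightarrow> 'a) \<Rightarrow> ((nat \<Rightarrow> real) \<Rightarrow> 'a)" where
  "back_face k l \<sigma> =
     restrict (\<lambda>x. \<sigma> (\<lambda>i. if i < k then 0 else x (i - k))) (standard_simplex l)"

definition cup_cochain ::
    "('r, 'm) ring_scheme \<Rightarrow> nat \<Rightarrow> nat \<Rightarrow> 'a topology \<Rightarrow> (((nat \<Rightarrow> real) \<Rightarrow> 'a) \<Rightarrow> 'r) \<Rightarrow>
      (((nat \<Rightarrow> real) \<Rightarrow> 'a) \<Rightarrow> 'r) \<Rightarrow> (((nat \<Rightarrow> real) \<Rightarrow> 'a) \<Rightarrow> 'r)" where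
  "cup_cochain R k l X \<phi> \<psi> =
     (\<lambda>\<sigma> \<in> singular_simplex_set (k + l) X. \<phi> (front_face k \<sigma>) \<otimes>\<^bsub>R\<^esub> \<psi> (back_face k l \<sigma>))"

text \<open>The union over all representatives is a single coset, because the coset of the
  cup product of two cocycles does not depend on the representatives.\<close>

definition cup_product ::
    "('r, 'm) ring_scheme \<Rightarrow> nat \<Rightarrow> nat \<Rightarrow> 'a topology \<Rightarrow> (((nat \<Rightarrow> real) \<Rightarrow> 'a) \<Rightarrow> 'r) set \<Rightarrow>
      (((nat \<Rightarrow> real) \<Rightarrow> 'a) \<Rightarrow> 'r) set \<Rightarrow> (((nat \<Rightarrow> real) \<Rightarrow> 'a) \<Rightarrow> 'r) set" where
  "cup_product R k l X \<xi> \<eta> =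
     (\<Union>\<phi>\<in>\<xi>. \<Union>\<psi>\<in>\<eta>.
        coboundary_set R (k + l) X #>\<^bsub>cochain_group R (k + l) X\<^esub> cup_cochain R k l X \<phi> \<psi>)"

text \<open>The Kronecker pairing of a cohomology class with an integral homology class; the set
  of values on representatives is a singleton.\<close>

definition kronecker ::
    "('r, 'm) ring_scheme \<Rightarrow> (((nat \<Rightarrow> real) \<Rightarrow> 'a) \<Rightarrow> 'r) set \<Rightarrow> 'a chain set \<Rightarrow> 'r" where
  "kronecker R \<xi> h = the_elem {cochain_eval R \<phi> c | \<phi> c. \<phi> \<in> \<xi> \<and> c \<in> h}"

text \<open>Cap product of an integral \<open>(k + l)\<close>-chain with an integral \<open>k\<close>-cochain, with the
  convention \<open>\<sigma> \<frown> \<phi> = \<phi>(\<sigma>|[v\<^sub>0,\<dots>,v\<^sub>k]) \<sigma>|[v\<^sub>k,\<dots>,v\<^sub>k\<^sub>+\<^sub>l]\<close>.\<close>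

definition cap_chain ::
    "nat \<Rightarrow> nat \<Rightarrow> 'a chain \<Rightarrow> (((nat \<Rightarrow> real) \<Rightarrow> 'a) \<Rightarrow> int) \<Rightarrow> 'a chain" where
  "cap_chain k l c \<phi> =
     frag_extend (\<lambda>\<sigma>. frag_cmul (\<phi> (front_face k \<sigma>)) (frag_of (back_face k l \<sigma>))) c"

section \<open>The torsion linking form of an oriented 3-manifold\<close>

text \<open>The intersection number of a singular 2-chain \<open>C\<close> with a class \<open>b\<close> in the first homology
  group is the value on \<open>C\<close> of an integral 2-cocycle \<open>\<beta>\<close> Poincare dual to \<open>b\<close>. If the boundary
  of \<open>C\<close> is divisible by \<open>p\<close> then it is well defined modulo \<open>p\<close>, since another choice
  of \<open>\<beta>\<close> changes it by \<open>\<gamma>(\<partial>C)\<close> for a 1-cochain \<open>\<gamma>\<close>.\<close>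

definition intersection_numbers ::
    "'a topology \<Rightarrow> 'a chain set \<Rightarrow> 'a chain \<Rightarrow> 'a chain set \<Rightarrow> int set" where
  "intersection_numbers M \<mu> C b =
     {cochain_eval \<Z> \<beta> C | \<beta>. \<beta> \<in> cocycle_set \<Z> 2 M \<and> (\<exists>m \<in> \<mu>. cap_chain 2 1 m \<beta> \<in> b)}"

definition rat_mod_int :: "rat set monoid" where
  "rat_mod_int = add_monoid rat_ring Mod \<int>"

definition rat_class :: "rat \<Rightarrow> rat set" where
  "rat_class q = \<int> #>\<^bsub>add_monoid rat_ring\<^esub> q"

text \<open>The value does not depend on the choices: the homology classes involved are torsion, so a
  cocycle dual to \<open>b\<close> vanishes on 2-cycles and changing the representative \<open>z\<close> of \<open>a\<close> by a
  boundary changes \<open>C\<close> by \<open>p\<close> times a 2-chain, up to 2-cycles.\<close>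

definition linking_form ::
    "'a topology \<Rightarrow> 'a chain set \<Rightarrow> nat \<Rightarrow> 'a chain set \<Rightarrow> 'a chain set \<Rightarrow> rat set" where
  "linking_form M \<mu> p a b =
     (THE q. \<exists>z \<in> a. \<exists>C. singular_chain 2 M C \<and> chain_boundary 2 C = frag_cmul (int p) z \<and>
        (\<exists>k \<in> intersection_numbers M \<mu> C b. q = rat_class (of_int k / of_nat p)))"

text \<open>The map from the subgroup of \<open>rat_mod_int\<close> of classes of fractions \<open>a/p\<close> to the
  field \<open>residue_ring p\<close>.\<close>

definition kappa :: "nat \<Rightarrow> rat set \<Rightarrow> int" where
  "kappa p q = (THE r. \<exists>a::int. q = rat_class (of_int a / of_nat p) \<and> r = a mod int p)"

text \<open>The class in the first cohomology group corresponding to \<open>u \<mapsto> kappa p (linking_form M \<mu> p x u)\<close>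
  under the identification of cohomology with homomorphisms given by the Kronecker pairing.\<close>

definition linking_dual ::
    "'a topology \<Rightarrow> 'a chain set \<Rightarrow> nat \<Rightarrow> 'a chain set \<Rightarrow> (((nat \<Rightarrow> real) \<Rightarrow> 'a) \<Rightarrow> int) set" where
  "linking_dual M \<mu> p x =
     (THE \<xi>. \<xi> \<in> carrier (cohomology_group (residue_ring (int p)) 1 M) \<and>
        (\<forall>u \<in> carrier (homology_group 1 M).
           kronecker (residue_ring (int p)) \<xi> u = kappa p (linking_form M \<mu> p x u)))"

definition triple_cup ::
    "'a topology \<Rightarrow> 'a chain set \<Rightarrow> nat \<Rightarrow> (((nat \<Rightarrow> real) \<Rightarrow> 'a) \<Rightarrow> int) set \<Rightarrow>
      (((nat \<Rightarrow> real) \<Rightarrow> 'a) \<Rightarrow> int) set \<Rightarrow> (((nat \<Rightarrow> real) \<Rightarrow> 'a) \<Rightarrow> int) set \<Rightarrow> int" where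
  "triple_cup M \<mu> p u v w =
     (let F = residue_ring (int p)
      in kronecker F (cup_product F 2 1 M (cup_product F 1 1 M u v) w) \<mu>)"

definition triple_cup_vanishes ::
    "'a topology \<Rightarrow> 'a chain set \<Rightarrow> nat \<Rightarrow> 'a chain set set \<Rightarrow> bool" where
  "triple_cup_vanishes M \<mu> p L \<longleftrightarrow>
     (\<forall>u \<in> linking_dual M \<mu> p ` L. \<forall>v \<in> linking_dual M \<mu> p ` L. \<forall>w \<in> linking_dual M \<mu> p ` L.
        triple_cup M \<mu> p u v w = \<zero>\<^bsub>residue_ring (int p)\<^esub>)"

section \<open>Hantzsche Lagrangians\<close>

definition has_exponent :: "('g, 'm) monoid_scheme \<Rightarrow> nat \<Rightarrow> bool" where
  "has_exponent G n \<longleftrightarrow>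
     0 < n \<and> (\<forall>x \<in> carrier G. x [^]\<^bsub>G\<^esub> n = \<one>\<^bsub>G\<^esub>) \<and>
     (\<forall>m. 0 < m \<and> (\<forall>x \<in> carrier G. x [^]\<^bsub>G\<^esub> m = \<one>\<^bsub>G\<^esub>) \<longrightarrow> n \<le> m)"

definition hantzsche_lagrangian ::
    "'a topology \<Rightarrow> 'a chain set \<Rightarrow> nat \<Rightarrow> 'a chain set set \<Rightarrow> bool" where
  "hantzsche_lagrangian M \<mu> p L \<longleftrightarrow>
     subgroup L (homology_group 1 M) \<and>
     (\<forall>a \<in> L. \<forall>b \<in> L. linking_form M \<mu> p a b = \<one>\<^bsub>rat_mod_int\<^esub>) \<and>
     (card L)\<^sup>2 = order (homology_group 1 M)"

definition dual_hantzsche_pair ::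
    "'a topology \<Rightarrow> 'a chain set \<Rightarrow> nat \<Rightarrow> 'a chain set set \<Rightarrow> 'a chain set set \<Rightarrow> bool" where
  "dual_hantzsche_pair M \<mu> p A B \<longleftrightarrow>
     hantzsche_lagrangian M \<mu> p A \<and> hantzsche_lagrangian M \<mu> p B \<and>
     A \<inter> B = {\<one>\<^bsub>homology_group 1 M\<^esub>} \<and>
     A <#>\<^bsub>homology_group 1 M\<^esub> B = carrier (homology_group 1 M)"

definition region_kernel ::
    "'a topology \<Rightarrow> 'b topology \<Rightarrow> ('a \<Rightarrow> 'b) \<Rightarrow> 'b set \<Rightarrow> 'a chain set set" where
  "region_kernel M W f X =
     kernel (homology_group 1 M) (homology_group 1 (subtopology W X))
       (hom_induced 1 M {} (subtopology W X) {} f)"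

end

theory Submission
  imports Defs
begin

text \<open>Write \<open>W = X \<union> Y\<close> with \<open>X \<inter> Y = M\<close>. As \<open>W\<close> has no homology in degrees \<open>1\<close> to \<open>3\<close>, every 1-cocycle modulo
  \<open>p\<close> on \<open>M\<close> is a sum of cocycles extending over \<open>X\<close> and over \<open>Y\<close>, and \<open>H\<^sub>1(M) = A + B\<close>. The Poincare dual of a
  1-cycle in \<open>A\<close> can be chosen to extend over \<open>X\<close>, so that \<open>A\<close> is isotropic for the linking form; thus a class
  in \<open>A\<^sup>\<lambda>\<close> vanishes on \<open>A\<close>, and this makes it the restriction of a class on \<open>X\<close>. Since \<open>[M]\<close> bounds in \<open>X\<close>
  modulo \<open>p\<close>, triple cup products of such classes vanish on \<open>[M]\<close>. For the second part, \<open>A\<close> and \<open>B\<close> are paired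
  nondegenerately by the linking form and therefore have the same order, so they form a dual Hantzsche pair.\<close>

text \<open>The regions enter without a collar and without any duality of their own: duality is used
  for 1-cycles of \<open>M\<close> only, and whatever concerns X and Y comes from splitting chains
  of \<open>W\<close> close to \<open>M\<close>. In place of a collar there is a homotopy of
  \<open>W\<close> that pushes a neighbourhood of \<open>M\<close> into \<open>M\<close> and never
  moves a point to the other side. The class [M] bounds a chain in \<open>W\<close>, and this chain
  can be taken off the other region because a multiple of the fundamental class of \<open>W\<close>
  cancels its local degree there; modulo a prime such a multiple always exists. The resulting error,
  \<open>p\<close> times a 3-cycle of X, is harmless even for integral cocycles, since
  \<open>p\<close> kills the first homology of X. Cochains are integer-valued functions throughout,
  and coefficients modulo \<open>m\<close> appear as divisibility, so that \<open>m = 0\<close>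
  covers the integral case; groups and cosets are entered only for the comparison with the
  definitions. Cochains with prescribed values on cycles exist because subgroups of free abelian
  groups are free.\<close>

abbreviation (input) "schain \<equiv> singular_chain"
abbreviation (input) "cmul \<equiv> frag_cmul"
abbreviation (input) "cap \<equiv> cap_chain"
abbreviation (input) "bdry \<equiv> chain_boundary"
abbreviation (input) "wt \<equiv> Poly_Mapping.lookup"
abbreviation (input) "supp \<equiv> Poly_Mapping.keys"
abbreviation (input) "Simplex \<equiv> standard_simplex"
abbreviation (input) "Eucl \<equiv> Euclidean_space"

section \<open>Relative homology modulo an integer\<close>

text \<open>The relations below express homology relative to \<open>S\<close> with coefficients modulo \<open>m\<close>, where \<open>m = 0\<close> means
  integral coefficients. In degree \<open>0\<close> the boundary, and with it the condition \<open>rcycle\<close>, is void.\<close>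

definition rchain :: "int => nat => 'a topology => 'a set => 'a chain => bool" where
  "rchain m k X S c \<longleftrightarrow> schain k X c \<and>
     (\<forall>s \<in> supp c. s ` Simplex k \<subseteq> S \<or> m dvd wt c s)"

definition rcycle :: "int => nat => 'a topology => 'a set => 'a chain => bool" where
  "rcycle m k X S c \<longleftrightarrow> schain k X c \<and> rchain m (k - 1) X S (bdry k c)"

definition rbound :: "int => nat => 'a topology => 'a set => 'a chain => bool" where
  "rbound m k X S c \<longleftrightarrow>
     (\<exists>b. schain (Suc k) X b \<and> rchain m k X S (c - bdry (Suc k) b))"

section \<open>Calculus of chains, cycles and boundaries relative to a subset and modulo
  \<open>m\<close>\<close>

lemma frag_cmul_diff: "cmul m (a - b) = cmul m a - cmul m b"
  by (simp add: poly_mapping_eqI lookup_minus right_diff_distrib)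

lemma additive_cmul:
  fixes G :: "('a \<Rightarrow>\<^sub>0 int) => ('b \<Rightarrow>\<^sub>0 int)"
  assumes G: "!!a b. G (a - b) = G a - G b"
  shows "G (cmul m d) = cmul m (G d)"
proof -
  have G0: "G 0 = 0" using G[of 0 0] by simp
  have Gm: "G (- a) = - G a" for a using G[of 0 a] G0 by simp
  have Ga: "G (a + b) = G a + G b" for a b using G[of a "- b"] Gm by simp
  show ?thesis
  proof (induction m rule: int_induct[where k=0])
    case (step1 i) then show ?case by (simp add: frag_cmul_distrib Ga)
  next
    case (step2 i) then show ?case by (simp add: frag_cmul_diff_distrib G)
  qed (simp add: G0)
qed

lemma rchain_chain: "rchain m k X S c ==> schain k X c" by (simp add: rchain_def)

lemma rchain_sub: "schain k (subtopology X S) c ==> rchain m k X S c"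
  unfolding rchain_def by (auto simp: singular_chain_subtopology)

lemma rchain_cmul: "schain k X d ==> rchain m k X S (cmul m d)"
  unfolding rchain_def by (auto simp: singular_chain_cmul)

lemma rchain_iff_lookup: "rchain m k X S c \<longleftrightarrow> schain k X c \<and>
     (\<forall>s. s ` Simplex k \<subseteq> S \<or> m dvd wt c s)"
  unfolding rchain_def by (metis dvd_0_right in_keys_iff)

lemma rchain_0 [simp]: "rchain m k X S 0" by (simp add: rchain_def)

lemma rchain_add: "rchain m k X S a ==> rchain m k X S b ==> rchain m k X S (a + b)"
  unfolding rchain_iff_lookup by (simp add: singular_chain_add lookup_add) (metis dvd_add)

lemma rchain_diff: "rchain m k X S a ==> rchain m k X S b ==> rchain m k X S (a - b)"
  unfolding rchain_iff_lookup by (simp add: singular_chain_diff lookup_minus) (metis dvd_diff)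

lemma rchain_uminus: "rchain m k X S a ==> rchain m k X S (- a)" using rchain_diff[of m k X S 0 a] by simp

lemma rchain_scale: "rchain m k X S a ==> rchain m k X S (cmul n a)"
  unfolding rchain_iff_lookup by (simp add: singular_chain_cmul) (metis dvd_mult)

lemma rchain_sum: "(!!i. i \<in> I ==> rchain m k X S (f i)) ==> rchain m k X S (sum f I)"
  by (induction I rule: infinite_finite_induct) (auto simp: rchain_add)

lemma rchain_mono: "rchain m k X S c ==> S \<subseteq> T ==> rchain m k X T c" unfolding rchain_def by blast

lemma rchain_Int: "rchain m k X S c ==> rchain m k X T c ==> rchain m k X (S \<inter> T) c"
  unfolding rchain_def by blast

lemma rchain_dvd: "rchain m k X S c ==> m' dvd m ==> rchain m' k X S c" unfolding rchain_def by (meson dvd_trans)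

lemma rchain_zero: "rchain 0 k X S c \<longleftrightarrow> schain k (subtopology X S) c"
  unfolding rchain_def by (auto simp: singular_chain_subtopology in_keys_iff)

lemma rchain_subtopology: "rchain m k X S c ==> schain k (subtopology X T) c ==>
   rchain m k (subtopology X T) S c" unfolding rchain_def by auto

lemma rchain_from_subtopology: "rchain m k (subtopology X T) S c ==> rchain m k X S c"
  unfolding rchain_def by (auto simp: singular_chain_subtopology)

lemma rchain_subtopology_mono:
  assumes "rchain m k (subtopology X U) S c" "S \<inter> U \<subseteq> S'"
  shows "rchain m k (subtopology X U) S' c" unfolding rchain_def
proof (intro conjI ballI)
  show c: "schain k (subtopology X U) c" using assms rchain_chain by blast
  fix s assume s: "s \<in> supp c"
  then have "s ` Simplex k \<subseteq> U" using c singular_chain_subtopology[of k X U c] by simp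
  moreover have "s ` Simplex k \<subseteq> S \<or> m dvd wt c s" using assms(1) s unfolding rchain_def by simp
  ultimately show "s ` Simplex k \<subseteq> S' \<or> m dvd wt c s" using assms(2) by (meson le_inf_iff subset_trans)
qed

text \<open>The simplices inside \<open>S\<close> go into \<open>e\<close>; all others have
  coefficients divisible by \<open>m\<close> and make up \<open>cmul m d\<close>. Divisibility of
  coefficients thus becomes an equation between chains, to which additive operators apply.\<close>

lemma rchain_decomp:
  assumes "rchain m k X S c"
  obtains d e where "schain k X d" "schain k (subtopology X S) e"
    "c = cmul m d + e"
proof -
  let ?K = "supp c"
  let ?P = "{s \<in> ?K. s ` Simplex k \<subseteq> S}"
  define e where "e = (\<Sum>s\<in>?P. cmul (wt c s) (frag_of s))"
  define d where "d = (\<Sum>s\<in>?K - ?P. cmul (wt c s div m) (frag_of s))"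
  have K: "s \<in> ?K ==> singular_simplex k X s" for s using assms by (auto simp: rchain_def singular_chain_def)
  have "c = (\<Sum>s\<in>?K. cmul (wt c s) (frag_of s))" using frag_expansion[of c] by (simp add: frag_extend_def)
  also have "\<dots> = (\<Sum>s\<in>?K - ?P. cmul (wt c s) (frag_of s)) + e"
    unfolding e_def by (subst sum.subset_diff[of ?P]) auto
  also have "(\<Sum>s\<in>?K - ?P. cmul (wt c s) (frag_of s)) = cmul m d" unfolding d_def frag_cmul_sum
  proof (rule sum.cong)
    fix s assume "s \<in> ?K - ?P"
    then have "m dvd wt c s" using assms unfolding rchain_def by blast
    then show "cmul (wt c s) (frag_of s) =
        cmul m (cmul (wt c s div m) (frag_of s))" by (simp only: frag_cmul_cmul dvd_mult_div_cancel)
  qed simp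
  finally have "c = cmul m d + e" .
  moreover have "schain k X d"
    unfolding d_def by (intro singular_chain_sum singular_chain_cmul) (simp add: singular_chain_of K)
  moreover have "schain k (subtopology X S) e" unfolding e_def by (intro singular_chain_sum singular_chain_cmul)
      (simp add: singular_chain_of singular_simplex_subtopology K)
  ultimately show thesis using that by blast
qed

text \<open>By the decomposition into \<open>cmul m d + e\<close>, an additive operator only has to
  respect chains of the whole space and chains of the subspace. Boundary, induced maps and
  subdivision are instances.\<close>

lemma rchain_additive:
  assumes c: "rchain m k X S c"
    and G: "!!a b. G (a - b) = G a - G b"
    and 1: "!!c. schain k X c ==> schain l Y (G c)"
    and 2: "!!c. schain k (subtopology X S) c ==> schain l (subtopology Y T) (G c)"
  shows "rchain m l Y T (G c)"
proof -
  obtain d e where de: "schain k X d" "schain k (subtopology X S) e"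
    "c = cmul m d + e" using c rchain_decomp by blast
  have "G c = cmul m (G d) + G e" using additive_cmul[of G, OF G] de(3)
    by (metis (no_types, lifting) G add_diff_cancel_right' diff_add_cancel)
  then show ?thesis using de 1 2 by (metis rchain_add rchain_cmul rchain_sub)
qed

lemma rchain_boundary:
  assumes "rchain m k X S c"
  shows "rchain m (k - 1) X S (bdry k c)"
  by (rule rchain_additive[OF assms]) (auto simp: chain_boundary_diff intro: singular_chain_boundary)

lemma rchain_boundary_Suc:
  "rchain m (Suc k) X S c ==> rchain m k X S (bdry (Suc k) c)" using rchain_boundary by fastforce

lemma continuous_map_subtopologies:
  "continuous_map X Y g ==> g ` (topspace X \<inter> S) \<subseteq> T ==>
    continuous_map (subtopology X S) (subtopology Y T) g"
  by (auto simp: continuous_map_in_subtopology continuous_map_from_subtopology)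

lemma rchain_map:
  assumes "rchain m k X S c" "continuous_map X Y g" "g ` (topspace X \<inter> S) \<subseteq> T"
  shows "rchain m k Y T (chain_map k g c)" by (rule rchain_additive[OF assms(1)])
    (auto simp: chain_map_diff intro: singular_chain_chain_map[OF _ assms(2)]
      singular_chain_chain_map[OF _ continuous_map_subtopologies[OF assms(2,3)]])

lemma rcycle_chain: "rcycle m k X S c ==> schain k X c" by (simp add: rcycle_def)

lemma rcycle_zero: "rcycle 0 k X S c \<longleftrightarrow> singular_relcycle k X S c"
  by (simp add: rcycle_def rchain_zero singular_relcycle)

lemma rbound_zero: "rbound 0 k X S c \<longleftrightarrow> singular_relboundary k X S c"
proof -
  have *: "c - a = e \<longleftrightarrow> c = a + e" for a e :: "'a chain" by (auto simp: algebra_simps)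
  show ?thesis unfolding rbound_def rchain_zero singular_relboundary using * by metis
qed

lemma rbound_rchain: "rchain m k X S c ==> rbound m k X S c" unfolding rbound_def by (intro exI[of _ 0]) auto

lemma rbound_boundary:
  "schain (Suc k) X b ==> rbound m k X S (bdry (Suc k) b)" unfolding rbound_def by (intro exI[of _ b]) auto

lemma rbound_0 [simp]: "rbound m k X S 0" by (simp add: rbound_rchain)

lemma rbound_add: "rbound m k X S a ==> rbound m k X S b ==> rbound m k X S (a + b)" unfolding rbound_def
proof clarify
  fix a' b' assume "schain (Suc k) X a'" "schain (Suc k) X b'"
    "rchain m k X S (a - bdry (Suc k) a')" "rchain m k X S (b - bdry (Suc k) b')"
  then show "\<exists>c. schain (Suc k) X c \<and> rchain m k X S (a + b - bdry (Suc k) c)"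
    by (intro exI[of _ "a' + b'"])
      (metis add_diff_add chain_boundary_add rchain_add singular_chain_add)
qed

lemma rbound_scale: "rbound m k X S a ==> rbound m k X S (cmul n a)" unfolding rbound_def
  by (metis chain_boundary_cmul frag_cmul_diff rchain_scale singular_chain_cmul)

lemma rbound_uminus: "rbound m k X S a ==> rbound m k X S (- a)" using rbound_scale[of m k X S a "-1"] by simp

lemma rbound_diff: "rbound m k X S a ==> rbound m k X S b ==> rbound m k X S (a - b)"
  using rbound_add[of m k X S a "- b"] rbound_uminus[of m k X S b] by simp

lemma rbound_sum: "(!!i. i \<in> I ==> rbound m k X S (f i)) ==> rbound m k X S (sum f I)"
  by (induction I rule: infinite_finite_induct) (auto simp: rbound_add)

lemma rbound_mono: "rbound m k X S c ==> S \<subseteq> T ==> rbound m k X T c"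
  unfolding rbound_def using rchain_mono by blast

lemma rbound_dvd: "rbound m k X S c ==> m' dvd m ==> rbound m' k X S c" unfolding rbound_def using rchain_dvd by blast

lemma rbound_cmul: "schain k X c ==> rbound m k X S (cmul m c)" by (simp add: rbound_rchain rchain_cmul)

lemma rbound_chain:
  assumes "rbound m k X S c" shows "schain k X c"
proof -
  obtain b where "schain (Suc k) X b" "rchain m k X S (c - bdry (Suc k) b)" using assms unfolding rbound_def by blast
  then have "schain k X (bdry (Suc k) b)" "schain k X (c - bdry (Suc k) b)"
    using singular_chain_boundary_alt rchain_chain by blast+
  then show ?thesis using singular_chain_add by fastforce
qed

lemma rcycle_add: "rcycle m k X S a ==> rcycle m k X S b ==> rcycle m k X S (a + b)"
  unfolding rcycle_def by (simp add: chain_boundary_add rchain_add singular_chain_add)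

lemma rcycle_diff: "rcycle m k X S a ==> rcycle m k X S b ==> rcycle m k X S (a - b)"
  unfolding rcycle_def by (simp add: chain_boundary_diff rchain_diff singular_chain_diff)

lemma rcycle_scale: "rcycle m k X S a ==> rcycle m k X S (cmul n a)"
  unfolding rcycle_def by (simp add: chain_boundary_cmul rchain_scale singular_chain_cmul)

lemma rcycle_mono: "rcycle m k X S c ==> S \<subseteq> T ==> rcycle m k X T c"
  unfolding rcycle_def using rchain_mono by blast

lemma rcycle_dvd: "rcycle m k X S c ==> m' dvd m ==> rcycle m' k X S c" unfolding rcycle_def using rchain_dvd by blast

lemma rcycle_rchain: "rchain m k X S c ==> rcycle m k X S c"
  unfolding rcycle_def using rchain_boundary rchain_chain by blast

lemma rcycle_boundary:
  "schain (Suc k) X b ==> rcycle m k X S (bdry (Suc k) b)"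
  by (simp add: rcycle_def chain_boundary_boundary_alt singular_chain_boundary_alt)

lemma rcycle_rbound:
  assumes "rbound m k X S c" shows "rcycle m k X S c"
proof -
  obtain b where "schain (Suc k) X b" "rchain m k X S (c - bdry (Suc k) b)" using assms unfolding rbound_def by blast
  then show ?thesis using rcycle_add[OF rcycle_rchain rcycle_boundary] by fastforce
qed

lemma rcycle_map:
  assumes "rcycle m k X S c" "continuous_map X Y g" "g ` (topspace X \<inter> S) \<subseteq> T"
  shows "rcycle m k Y T (chain_map k g c)" using assms unfolding rcycle_def
  by (metis chain_boundary_chain_map One_nat_def rchain_map singular_chain_chain_map)

lemma rbound_map:
  assumes "rbound m k X S c" "continuous_map X Y g" "g ` (topspace X \<inter> S) \<subseteq> T"
  shows "rbound m k Y T (chain_map k g c)"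
proof -
  obtain b where b: "schain (Suc k) X b" "rchain m k X S (c - bdry (Suc k) b)"
    using assms unfolding rbound_def by blast
  have "bdry (Suc k) (chain_map (Suc k) g b) = chain_map k g (bdry (Suc k) b)"
    using chain_boundary_chain_map[OF b(1), of g] by simp
  then show ?thesis unfolding rbound_def
    using rchain_map[OF b(2) assms(2,3)] singular_chain_chain_map[OF b(1) assms(2)]
    by (intro exI[of _ "chain_map (Suc k) g b"]) (simp add: chain_map_diff)
qed

lemma rcycle_from_subtopology: "rcycle m k (subtopology X T) S c ==> rcycle m k X S c"
  unfolding rcycle_def using rchain_from_subtopology singular_chain_subtopology by blast

lemma rbound_from_subtopology: "rbound m k (subtopology X T) S c ==> rbound m k X S c"
  unfolding rbound_def using rchain_from_subtopology singular_chain_subtopology by blast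

lemma rcycle_subtopology:
  "rcycle m k X S c ==> schain k (subtopology X T) c ==> rcycle m k (subtopology X T) S c"
  unfolding rcycle_def using rchain_subtopology by (metis One_nat_def singular_chain_boundary)

section \<open>Subdivision, Mayer-Vietoris and excision\<close>

text \<open>Being required for every space at once, the conditions include naturality: both
  operators preserve the chains of all subspaces. The last equation makes \<open>T\<close> a chain
  homotopy from the identity to \<open>Sd\<close>.\<close>

definition subdivision_ops ::
    "(nat => 'a chain => 'a chain) => (nat => 'a chain => 'a chain) => bool" where
  "subdivision_ops Sd T \<longleftrightarrow>
     (\<forall>p a b. Sd p (a - b) = Sd p a - Sd p b) \<and> (\<forall>p a b. T p (a - b) = T p a - T p b) \<and>
     (\<forall>p X c. schain p X c --> schain p X (Sd p c) \<and> schain (Suc p) X (T p c) \<and>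
        bdry p (Sd p c) = Sd (p - 1) (bdry p c) \<and>
        bdry (Suc p) (T p c) = Sd p c - c - T (p - 1) (bdry p c))"

lemma chain_boundary_singular_subdivision_power:
  assumes "schain p X c"
  shows "bdry p ((singular_subdivision p ^^ n) c) =
     (singular_subdivision (p - Suc 0) ^^ n) (bdry p c)"
proof -
  have ch: "schain p X ((singular_subdivision p ^^ n) c)" for n
    by (induction n) (auto simp: assms singular_chain_singular_subdivision)
  show ?thesis by (induction n) (auto simp: chain_boundary_singular_subdivision[OF ch])
qed

lemma subdivision_ops_small:
  fixes X :: "'a topology"
  assumes "!!U. U \<in> \<C> ==> openin X U" "topspace X \<subseteq> \<Union>\<C>" "schain p X c"
  obtains Sd T :: "nat => 'a chain => 'a chain" where "subdivision_ops Sd T"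
    "!!s. s \<in> supp (Sd p c) ==> \<exists>V\<in>\<C>. s ` Simplex p \<subseteq> V"
proof -
  obtain n where n: "!!m f. [|n \<le> m; f \<in> supp ((singular_subdivision p ^^ m) c)|]
                      ==> \<exists>V \<in> \<C>. f \<in> (Simplex p) \<rightarrow> V"
    using sufficient_iterated_singular_subdivision_exists[OF assms] by blast
  obtain h where h: "!!p. h p 0 = (0 :: 'a chain)"
        "!!p c1 c2. h p (c1-c2) = h p c1 - h p c2"
        "!!p X c. schain p X c ==> schain (Suc p) X (h p c)"
        "!!p X c. schain p X c
                 ==> bdry (Suc p) (h p c) + h (p - Suc 0) (bdry p c)
                   = (singular_subdivision p ^^ n) c - c"
    using chain_homotopic_iterated_singular_subdivision[of n thesis] by blast
  have ch: "schain p X ((singular_subdivision p ^^ n) c)"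
    if "schain p X c" for p X and c :: "'a chain"
    by (induction n) (auto simp: that singular_chain_singular_subdivision)
  show thesis
  proof
    show "subdivision_ops (%p. singular_subdivision p ^^ n) h" unfolding subdivision_ops_def
      using h ch chain_boundary_singular_subdivision_power by (auto simp: singular_subdivision_power_diff eq_diff_eq)
    show "!!s. s \<in> supp ((singular_subdivision p ^^ n) c)
         ==> \<exists>V\<in>\<C>. s ` Simplex p \<subseteq> V" by (metis n order_refl image_subset_iff_funcset)
  qed
qed

context
  fixes Sd T :: "nat => 'a chain => 'a chain"
  assumes ops: "subdivision_ops Sd T"
begin

lemma subdivision_ops_diff: "Sd p (a - b) = Sd p a - Sd p b" "T p (a - b) = T p a - T p b"
  using ops unfolding subdivision_ops_def by blast+

lemma subdivision_ops_chain:
  assumes "schain p X c"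
  shows "schain p X (Sd p c)" "schain (Suc p) X (T p c)"
    "bdry p (Sd p c) = Sd (p - 1) (bdry p c)"
    "bdry (Suc p) (T p c) = Sd p c - c - T (p - 1) (bdry p c)" using ops assms unfolding subdivision_ops_def by blast+

lemma rchain_subdivision:
  assumes "rchain m p X S c"
  shows "rchain m p X S (Sd p c)" "rchain m (Suc p) X S (T p c)"
  by (rule rchain_additive[OF assms], auto simp: subdivision_ops_diff subdivision_ops_chain)+

lemma rcycle_subdivision:
  assumes "rcycle m p X S c"
  shows "rcycle m p X S (Sd p c)"
  using assms rchain_subdivision unfolding rcycle_def by (metis subdivision_ops_chain(1,3))

lemma rbound_subdivision:
  assumes "rcycle m p X S c" "p > 0"
  shows "rbound m p X S (Sd p c - c)"
proof -
  have "rchain m p X S (T (p - 1) (bdry p c))"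
    using assms rchain_subdivision(2)[of m "p - 1" X S "bdry p c"] unfolding rcycle_def by simp
  moreover have "Sd p c - c - bdry (Suc p) (T p c) = T (p - 1) (bdry p c)"
    using subdivision_ops_chain(4)[OF rcycle_chain[OF assms(1)]] by simp
  ultimately show ?thesis unfolding rbound_def using assms(1) rcycle_chain subdivision_ops_chain(2) by metis
qed

lemma rbound_subdivision_iff:
  assumes "rcycle m p X S c" "p > 0"
  shows "rbound m p X S (Sd p c) \<longleftrightarrow> rbound m p X S c"
  using rbound_diff[OF _ rbound_subdivision[OF assms], of "Sd p c"]
    rbound_add[OF _ rbound_subdivision[OF assms], of c] by auto

end

lemma chain_split:
  assumes "schain p X c"
    "!!s. s \<in> supp c ==> \<exists>V\<in>{A, B}. s ` Simplex p \<subseteq> V"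
  obtains a b where "schain p (subtopology X A) a" "schain p (subtopology X B) b"
    "c = a + b"
proof -
  have "supp c \<subseteq> singular_simplex_set p (subtopology X A) \<union> singular_simplex_set p (subtopology X B)"
    using assms by (fastforce simp: singular_chain_def singular_simplex_subtopology)
  then show thesis using frag_split that unfolding singular_chain_def by metis
qed

lemma chain_split_open:
  fixes X :: "'a topology"
  assumes "openin X A" "openin X B" "topspace X \<subseteq> A \<union> B" "schain p X c"
  obtains Sd T :: "nat => 'a chain => 'a chain" and a b where "subdivision_ops Sd T"
    "schain p (subtopology X A) a" "schain p (subtopology X B) b" "Sd p c = a + b"
proof -
  obtain Sd T :: "nat => 'a chain => 'a chain" where *: "subdivision_ops Sd T"
    "!!s. s \<in> supp (Sd p c) ==> \<exists>V\<in>{A, B}. s ` Simplex p \<subseteq> V"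
    using subdivision_ops_small[of "{A, B}" X p c] assms by auto
  with chain_split[OF subdivision_ops_chain(1)[OF *(1) assms(4)] *(2)] that show thesis by metis
qed

text \<open>Injectivity in the relative Mayer-Vietoris sequence: the two bounding chains differ by a
  cycle of one higher degree relative to \<open>A \<union> B\<close>, which bounds by
  \<open>H\<close>. What remains of it in \<open>A \<union> B\<close> is subdivided and divided
  between the two open sets, and the part in \<open>A\<close> corrects \<open>b1\<close>.\<close>

lemma rbound_Mayer_Vietoris:
  assumes A: "openin X A" and B: "openin X B" and "k > 0"
    and c: "rcycle m k X (A \<inter> B) c"
    and cA: "rbound m k X A c" and cB: "rbound m k X B c"
    and H: "!!b. rcycle m (Suc k) X (A \<union> B) b ==> rbound m (Suc k) X (A \<union> B) b"
  shows "rbound m k X (A \<inter> B) c"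
proof -
  obtain b1 where b1: "schain (Suc k) X b1" "rchain m k X A (c - bdry (Suc k) b1)"
    using cA unfolding rbound_def by blast
  obtain b2 where b2: "schain (Suc k) X b2" "rchain m k X B (c - bdry (Suc k) b2)"
    using cB unfolding rbound_def by blast
  have "rchain m k X (A \<union> B) ((c - bdry (Suc k) b2) - (c - bdry (Suc k) b1))"
    by (meson b1(2) b2(2) rchain_diff rchain_mono sup_ge1 sup_ge2)
  then have "rcycle m (Suc k) X (A \<union> B) (b1 - b2)"
    unfolding rcycle_def by (simp add: b1 b2 singular_chain_diff chain_boundary_diff)
  then obtain g where g: "schain (Suc (Suc k)) X g"
    "rchain m (Suc k) X (A \<union> B) (b1 - b2 - bdry (Suc (Suc k)) g)" using H unfolding rbound_def by blast
  obtain h f where hf: "schain (Suc k) X h" "schain (Suc k) (subtopology X (A \<union> B)) f"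
    "b1 - b2 - bdry (Suc (Suc k)) g = cmul m h + f" using g(2) rchain_decomp by blast
  have "openin (subtopology X (A \<union> B)) A" "openin (subtopology X (A \<union> B)) B"
    by (simp_all add: A B openin_subset_topspace_eq openin_open_subtopology openin_Un)
  then obtain Sd T fA fB where Sd: "subdivision_ops Sd T"
     and "schain (Suc k) (subtopology (subtopology X (A \<union> B)) A) fA"
         "schain (Suc k) (subtopology (subtopology X (A \<union> B)) B) fB"
     and f: "Sd (Suc k) f = fA + fB" by (rule chain_split_open[OF _ _ _ hf(2)]) auto
  then have fA: "rchain m (Suc k) X A fA" and fB: "rchain m (Suc k) X B fB"
    by (auto simp: subtopology_subtopology Int_absorb1 intro!: rchain_sub)
  note Sdd = subdivision_ops_diff[OF Sd] and Sdc = subdivision_ops_chain[OF Sd]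
  have cc: "schain k X c" using c rcycle_chain by blast
  \<comment> \<open>This chain has two expressions modulo \<open>m\<close>: through
    \<open>b1\<close> it lies in \<open>A\<close>, and through \<open>b2\<close>, after substituting
    the split remainder, it lies in \<open>B\<close>.\<close>
  define c' where "c' = Sd k c - bdry (Suc k) (Sd (Suc k) b1 - fA)"
  have bS: "bdry (Suc k) (Sd (Suc k) b) = Sd k (bdry (Suc k) b)"
    if "schain (Suc k) X b" for b using Sdc(3)[OF that] by simp
  have "c' = Sd k (c - bdry (Suc k) b1) + bdry (Suc k) fA"
    unfolding c'_def by (simp add: chain_boundary_diff Sdd bS b1)
  then have c'A: "rchain m k X A c'"
    using rchain_add[OF rchain_subdivision(1)[OF Sd b1(2)] rchain_boundary_Suc[OF fA]] by simp
  have SdP: "Sd (Suc k) (a + b) = Sd (Suc k) a + Sd (Suc k) b" for a b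
    using Sdd(1)[of "Suc k" "a + b" b] by (simp add: eq_diff_eq)
  have "b1 = b2 + bdry (Suc (Suc k)) g + cmul m h + f" using hf(3) by (simp add: diff_eq_eq ac_simps)
  then have "Sd (Suc k) b1 = Sd (Suc k) b2 + Sd (Suc k) (bdry (Suc (Suc k)) g) + Sd (Suc k) (cmul m h)
      + (fA + fB)" by (simp add: SdP f)
  moreover have "bdry (Suc k) (Sd (Suc k) (bdry (Suc (Suc k)) g)) = 0"
    by (metis Sdc(3) bS chain_boundary_boundary_alt diff_Suc_1 g(1) singular_chain_boundary_alt Sdd(1) diff_self)
  ultimately have "c' = Sd k (c - bdry (Suc k) b2) - bdry (Suc k) (Sd (Suc k) (cmul m h))
       - bdry (Suc k) fB" unfolding c'_def by (simp add: chain_boundary_diff chain_boundary_add Sdd bS b2)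
  moreover have "rchain m k X B (Sd k (c - bdry (Suc k) b2))" using rchain_subdivision(1)[OF Sd b2(2)] .
  moreover have "rchain m k X B (bdry (Suc k) (Sd (Suc k) (cmul m h)))"
    using rchain_boundary_Suc rchain_cmul rchain_subdivision(1)[OF Sd] hf(1) by blast
  ultimately have c'B: "rchain m k X B c'" using rchain_boundary_Suc[OF fB] by (simp add: rchain_diff)
  have "rbound m k X (A \<inter> B) (Sd k c)" unfolding rbound_def
    using rchain_Int[OF c'A c'B] c'_def Sdc(1) b1(1) fA rchain_chain singular_chain_diff by metis
  then show ?thesis using rbound_subdivision_iff[OF Sd c \<open>k > 0\<close>] by blast
qed

text \<open>Surjectivity half of excision: subdivision splits \<open>c\<close> into a part in
  \<open>U\<close> and a part missing \<open>K\<close>, and dropping the second does not change the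
  relative class.\<close>

lemma rbound_excision:
  assumes O: "openin X U" and K: "closedin X K" "K \<subseteq> U" and "k > 0"
    and c: "rcycle m k X (topspace X - K) c"
  obtains c' where "rcycle m k (subtopology X U) (U - K) c'"
    "rbound m k X (topspace X - K) (c - c')"
proof -
  have "openin X (topspace X - K)" using K by blast
  moreover have "topspace X \<subseteq> U \<union> (topspace X - K)" using K by blast
  ultimately obtain Sd T c1 c2 where Sd: "subdivision_ops Sd T"
    and c1: "schain k (subtopology X U) c1"
    and c2: "schain k (subtopology X (topspace X - K)) c2" and eq: "Sd k c = c1 + c2"
    by (rule chain_split_open[OF O _ _ rcycle_chain[OF c]])
  have "rcycle m k X (topspace X - K) (Sd k c - c2)"
    using rcycle_subdivision[OF Sd c] rcycle_rchain[OF rchain_sub[OF c2]] rcycle_diff by blast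
  then have 1: "rcycle m k X (topspace X - K) c1" using eq by simp
  then have "rcycle m k (subtopology X U) (topspace X - K) c1" using c1 rcycle_subtopology by blast
  then have 2: "rcycle m k (subtopology X U) (U - K) c1"
    unfolding rcycle_def using rchain_subtopology_mono[of m "k - 1" X U "topspace X - K" _ "U - K"] by auto
  have "c - c1 = c2 - (Sd k c - c)" using eq by (simp add: algebra_simps)
  then have "rbound m k X (topspace X - K) (c - c1)"
    using rbound_diff[OF rbound_rchain[OF rchain_sub[OF c2], of m] rbound_subdivision[OF Sd c \<open>k > 0\<close>]]
    by (simp only:)
  with 2 show thesis using that by blast
qed

section \<open>Homology groups read on chains, and universal coefficients\<close>

lemma relhom_class_add:
  assumes "singular_relcycle k X S a" "singular_relcycle k X S b"
  shows "homologous_rel_set k X S a \<otimes>\<^bsub>relative_homology_group (int k) X S\<^esub> homologous_rel_set k X S b =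
         homologous_rel_set k X S (a + b)"
proof -
  have "\<exists>r s. homologous_rel k X S a r \<and> homologous_rel k X S b s \<and> x = r + s"
    if "homologous_rel k X S (a + b) x" for x
  proof (intro exI conjI)
    show "homologous_rel k X S a (x - b)" using that unfolding homologous_rel_def by (simp add: algebra_simps)
  qed auto
  then show ?thesis unfolding mult_relative_homology_group by (auto intro: homologous_rel_add)
qed

lemma relhom_trivialD:
  assumes "trivial_group (relative_homology_group (int k) X S)" "singular_relcycle k X S c"
  shows "singular_relboundary k X S c"
proof -
  have "homologous_rel_set k X S c \<in> carrier (relative_homology_group (int k) X S)"
    using assms(2) by (auto simp: carrier_relative_homology_group)
  then have "homologous_rel_set k X S c = singular_relboundary_set k X S"
    using assms(1) by (auto simp: trivial_group_def)
  then show ?thesis by (simp add: homologous_rel_set_eq_relboundary)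
qed

text \<open>Infinite cyclic homology is replaced by an integer-valued function on chains, so that
  later arguments compute with degrees of cycles and not with cosets. \<open>F\<close> is meaningful
  on relative cycles only.\<close>

lemma relhom_integerE:
  assumes iso: "relative_homology_group (int k) X S \<cong> integer_group"
  obtains F :: "'a chain => int" and t where
    "!!a b. singular_relcycle k X S a ==> singular_relcycle k X S b ==> F (a + b) = F a + F b"
    "!!a b. singular_relcycle k X S a ==> singular_relcycle k X S b ==> F (a - b) = F a - F b"
    "!!j a. singular_relcycle k X S a ==> F (cmul j a) = j * F a"
    "!!a. singular_relcycle k X S a ==> F a = 0 \<longleftrightarrow> singular_relboundary k X S a"
    "singular_relcycle k X S t" "F t = 1"
proof -
  let ?G = "relative_homology_group (int k) X S"
  obtain f where f: "f \<in> iso ?G integer_group" using iso unfolding is_iso_def by blast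
  interpret group ?G by simp
  define F where "F = (%a. f (homologous_rel_set k X S a))"
  have inG: "homologous_rel_set k X S a \<in> carrier ?G" if "singular_relcycle k X S a" for a
    using that by (auto simp: carrier_relative_homology_group)
  have hom: "f \<in> hom ?G integer_group" using f by (simp add: iso_def)
  have add: "F (a + b) = F a + F b" if "singular_relcycle k X S a" "singular_relcycle k X S b" for a b
    using hom_mult[OF hom inG[OF that(1)] inG[OF that(2)]] relhom_class_add[OF that]  by (simp add: F_def)
  have diff: "F (a - b) = F a - F b" if "singular_relcycle k X S a" "singular_relcycle k X S b" for a b
    using add[of "a - b" b] that by (simp add: singular_relcycle_diff)
  have cmul: "F (cmul j a) = j * F a" if "singular_relcycle k X S a" for j a
  proof (induction j rule: int_induct[where k=0])
    case base
    then show ?case using add[of 0 0] by simp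
  next
    case (step1 i)
    then show ?case using that by (simp add: frag_cmul_distrib add singular_relcycle_cmul algebra_simps)
  next
    case (step2 i)
    then show ?case using that by (simp add: frag_cmul_diff_distrib diff singular_relcycle_cmul algebra_simps)
  qed
  have inj: "inj_on f (carrier ?G)" using f by (auto simp: iso_def bij_betw_def)
  have one: "f \<one>\<^bsub>?G\<^esub> = 0" using hom_one[OF hom] by simp
  have ker: "F a = 0 \<longleftrightarrow> singular_relboundary k X S a" if "singular_relcycle k X S a" for a
  proof -
    have "F a = f \<one>\<^bsub>?G\<^esub> \<longleftrightarrow> homologous_rel_set k X S a = \<one>\<^bsub>?G\<^esub>"
      unfolding F_def by (rule inj_on_eq_iff[OF inj inG[OF that] one_closed])
    then show ?thesis unfolding one by (simp add: homologous_rel_set_eq_relboundary)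
  qed
  have "1 \<in> f ` carrier ?G" using f by (auto simp: iso_def bij_betw_def)
  then obtain Q where Q: "Q \<in> carrier ?G" "f Q = 1" by auto
  obtain t where t: "singular_relcycle k X S t" "Q = homologous_rel_set k X S t"
    using Q(1) unfolding carrier_relative_homology_group by blast
  then have "F t = 1" using Q(2) by (simp only: F_def)
  show thesis by (rule that[of F t]) (fact add diff cmul ker t(1) \<open>F t = 1\<close>)+
qed

text \<open>A cycle modulo \<open>m\<close> has boundary \<open>m d + e\<close>. Then
  \<open>d\<close> is an integral relative cycle and \<open>m d\<close> bounds; absence of such
  torsion in degree \<open>k - 1\<close> lets \<open>c\<close> be corrected by a multiple of
  \<open>m\<close> to an integral relative cycle.\<close>

lemma rbound_universal_coefficients:
  assumes "k > 0"
    and 1: "!!c. rcycle 0 k X S c ==> rbound 0 k X S c"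
    and 2: "!!c. rcycle 0 (k - 1) X S c ==> rbound m (k - 1) X S (cmul m c) ==>
        rbound 0 (k - 1) X S (cmul m c) ==> rbound 0 (k - 1) X S c"
    and c: "rcycle m k X S c"
  shows "rbound m k X S c"
proof (cases "m = 0")
  case True
  then show ?thesis using 1 c by simp
next
  case False
  have cc: "schain k X c" using c rcycle_chain by blast
  obtain d e where de: "schain (k - 1) X d" "schain (k - 1) (subtopology X S) e"
    "bdry k c = cmul m d + e" using c unfolding rcycle_def by (meson rchain_decomp)
  have "bdry (k - 1) (bdry k c) = 0" using chain_boundary_boundary[OF cc] by simp
  then have "cmul m (bdry (k - 1) d) = - bdry (k - 1) e"
    unfolding de(3) chain_boundary_add chain_boundary_cmul by (simp add: eq_neg_iff_add_eq_0)
  moreover have "rchain 0 (k - 1 - 1) X S (- bdry (k - 1) e)" by (intro rchain_uminus rchain_boundary rchain_sub de)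
  ultimately have "rchain 0 (k - 1 - 1) X S (cmul m (bdry (k - 1) d))" by simp
  \<comment> \<open>Multiplication by a nonzero \<open>m\<close> does not change the set of
    simplices that occur.\<close>
  then have "rchain 0 (k - 1 - 1) X S (bdry (k - 1) d)"
    using False singular_chain_boundary[OF de(1)] unfolding rchain_iff_lookup by simp
  then have d: "rcycle 0 (k - 1) X S d" using de(1) unfolding rcycle_def by simp
  have b0: "rbound 0 (k - 1) X S (cmul m d)"
  proof -
    have "cmul m d = bdry k c - e" using de(3) by simp
    moreover have "rbound 0 (k - 1) X S (bdry k c)"
      using rbound_boundary[of "k - 1" X c] cc \<open>k > 0\<close> by simp
    ultimately show ?thesis using rbound_diff rbound_rchain[OF rchain_sub[OF de(2)]] by metis
  qed
  have "rbound 0 (k - 1) X S d" using 2[OF d _ b0] rbound_cmul[OF de(1)] by blast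
  then obtain d' where d': "schain k X d'" "rchain 0 (k - 1) X S (d - bdry k d')"
    unfolding rbound_def using \<open>k > 0\<close> by auto
  define c' where "c' = c - cmul m d'"
  have "bdry k c' = cmul m (d - bdry k d') + e"
    unfolding c'_def by (simp add: chain_boundary_diff chain_boundary_cmul de(3) frag_cmul_diff)
  then have "rcycle 0 k X S c'" unfolding rcycle_def
    using rchain_add[OF rchain_scale[OF d'(2), of m] rchain_sub[OF de(2)]]
      singular_chain_diff[OF cc singular_chain_cmul[OF d'(1)]] by (simp add: c'_def)
  then have "rbound m k X S c'" using 1 rbound_dvd by (metis dvd_0_right)
  moreover have "c = c' + cmul m d'" by (simp add: c'_def)
  ultimately show ?thesis using rbound_add rbound_cmul[OF d'(1)] by metis
qed

section \<open>Local homology of Euclidean space\<close>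

abbreviation EE :: "nat => (nat => real) set" where
  "EE n \<equiv> topspace (Eucl n)"

lemma Euclidean_space_eq: "Eucl n = top_of_set {x. \<forall>i\<ge>n. x i = 0}"
  by (simp add: Euclidean_space_def euclidean_product_topology)

lemma subtopology_Euclidean_space: "A \<subseteq> EE n ==> subtopology (Eucl n) A = top_of_set A"
  by (simp add: Euclidean_space_eq subtopology_subtopology Int_absorb1)

lemma EE_iff: "x \<in> EE n \<longleftrightarrow> (\<forall>i\<ge>n. x i = 0)" by (simp add: topspace_Euclidean_space)

text \<open>Adding coordinates shifts degrees: starting from the point \<open>Eucl 0\<close>
  relative to nothing, \<open>n\<close> further coordinates give \<open>Eucl n\<close> relative to
  the complement of the origin.\<close>

lemma Euclidean_local_homology_origin:
  "relative_homology_group k (Eucl n) (EE n - {%_. 0}) \<cong>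
   homology_group (k - int n) (Eucl 0)"
proof -
  have E0: "EE 0 = {%_. 0}" by (auto simp: EE_iff)
  have "closedin (Eucl 0) {%_. 0}" using closedin_topspace[of "Eucl 0"] by (simp only: E0)
  from relative_homology_group_Euclidean_complement_step[OF this, of "k - int n" n]
  have "homology_group (k - int n) (Eucl 0) \<cong>
        relative_homology_group k (Eucl n) (EE n - {%_. 0})" by (simp only: E0) simp
  then show ?thesis by (simp add: group.iso_sym)
qed

lemma closedin_Euclidean_singleton: "y \<in> EE n ==> closedin (Eucl n) {y}"
  using closedin_Hausdorff_singleton[OF Hausdorff_Euclidean_space] by blast

text \<open>The origin is exchanged for \<open>y\<close> by the invariance of the homology of
  complements under homeomorphisms of closed subsets; both subsets are single points here.\<close>

lemma Euclidean_local_homology: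
  assumes "y \<in> EE n"
  shows "relative_homology_group k (Eucl n) (EE n - {y}) \<cong>
   homology_group (k - int n) (Eucl 0)"
proof -
  have 0: "(%_. 0) \<in> EE n" by (simp add: EE_iff)
  have "subtopology (Eucl n) {y} homeomorphic_space subtopology (Eucl n) {%_. 0}" using assms 0
    unfolding homeomorphic_space_def homeomorphic_maps_def by (intro exI[of _ "%_ _. 0"] exI[of _ "%_. y"]) auto
  then have "relative_homology_group k (Eucl n) (EE n - {y}) \<cong>
     relative_homology_group k (Eucl n) (EE n - {%_. 0})"
    using isomorphic_relative_homology_groups_Euclidean_complements closedin_Euclidean_singleton assms 0 by blast
  then show ?thesis using Euclidean_local_homology_origin iso_trans by blast
qed

lemma Euclidean_local_trivial:
  assumes "y \<in> EE n" "k \<noteq> n" "rcycle 0 k (Eucl n) (EE n - {y}) c"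
  shows "rbound 0 k (Eucl n) (EE n - {y}) c"
proof -
  have E0: "EE 0 = {%_. 0}" by (auto simp: EE_iff)
  have "trivial_group (homology_group (int k - int n) (Eucl 0))"
    using homology_dimension_axiom[OF E0, of "int k - int n"] assms(2) by simp
  then have "trivial_group (relative_homology_group (int k) (Eucl n) (EE n - {y}))"
    using Euclidean_local_homology[OF assms(1), of "int k"] isomorphic_group_triviality
    by (metis group_relative_homology_group)
  then show ?thesis using assms(3) relhom_trivialD by (metis rbound_zero rcycle_zero)
qed

lemma Euclidean_local_integer:
  assumes "y \<in> EE n"
  shows "relative_homology_group (int n) (Eucl n) (EE n - {y}) \<cong> integer_group"
proof -
  have E0: "EE 0 = {%_. 0}" by (auto simp: EE_iff)
  show ?thesis
    using Euclidean_local_homology[OF assms, of "int n"] homology_coefficients[OF E0] iso_trans by simp blast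
qed

text \<open>Pushing radially away from \<open>y\<close> deforms the complement of \<open>y\<close>
  into the complement of \<open>C\<close>, so the pair of these two complements has no
  homology.\<close>

lemma rbound_star_shaped:
  assumes C: "compactin (Eucl n) C" and y: "y \<in> C"
    and star: "!!x t. x \<in> C ==> 0 \<le> t ==> t \<le> 1 ==> (%i. y i + t * (x i - y i)) \<in> C"
    and "k > 0" and c: "rcycle m k (Eucl n) (EE n - C) c"
    and b: "rbound m k (Eucl n) (EE n - {y}) c"
  shows "rbound m k (Eucl n) (EE n - C) c"
proof -
  let ?E = "Eucl n" and ?Y = "subtopology (Eucl n) (EE n - {y})"
  let ?V = "EE n - C"
  have CE: "C \<subseteq> EE n" using C compactin_subset_topspace by blast
  define N where "N x = (\<Sum>i<n. \<bar>x i - y i\<bar>)" for x :: "nat => real"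
  have Npos: "N x > 0" if "x \<in> EE n" "x \<noteq> y" for x
  proof -
    have "\<exists>i<n. x i \<noteq> y i" using that CE y by (metis EE_iff ext not_le subsetD)
    then show ?thesis unfolding N_def by (auto intro!: sum_pos2)
  qed
  have contN: "continuous_on A N" for A unfolding N_def
    by (intro continuous_intros continuous_on_subset[OF continuous_on_product_coordinates subset_UNIV])
  have "compact C" using C by (simp add: Euclidean_space_eq compactin_subtopology)
  then have "compact (N ` C)" using contN compact_continuous_image by blast
  then obtain R where R: "!!x. x \<in> C ==> N x \<le> R"
    using compact_imp_bounded bounded_real by (metis abs_le_D1 imageI)
  then have R0: "R \<ge> 0" using y by (fastforce simp: N_def)
  \<comment> \<open>The factor makes the l1-distance \<open>N\<close> from \<open>y\<close> grow by
    exactly \<open>t * R\<close>. Since \<open>C\<close> lies within distance \<open>R\<close>,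
    everything has left \<open>C\<close> at time \<open>1\<close>.\<close>
  define F where "F = (%(t, x) i. y i + (1 + t * R / N x) * (x i - y i))"
  have FE: "F (t, x) \<in> EE n" if "x \<in> EE n" for t x using that y CE by (auto simp: F_def EE_iff subset_iff)
  have NF: "N (F (t, x)) = N x + t * R" if "x \<in> EE n" "x \<noteq> y" "t \<ge> 0" for t x
  proof -
    have "N (F (t, x)) = \<bar>1 + t * R / N x\<bar> * N x" by (simp add: N_def F_def abs_mult sum_distrib_left)
    also have "\<dots> = (1 + t * R / N x) * N x" using Npos[OF that(1,2)] that R0 by simp
    moreover have "N x \<noteq> 0" using Npos[OF that(1,2)] by simp
    ultimately show ?thesis by (simp add: distrib_right)
  qed
  have FY: "F (t, x) \<in> EE n - {y}" if "x \<in> EE n - {y}" "t \<ge> 0" for t x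
  proof -
    have "N (F (t, x)) > 0" using NF[of x t] Npos[of x] that R0 by (simp add: add_pos_nonneg)
    moreover have "N y = 0" by (simp add: N_def)
    ultimately show ?thesis using FE[of x t] that by auto
  qed
  have FV: "F (t, x) \<in> ?V" if x: "x \<in> ?V" and t: "t \<ge> 0" for t x
  proof -
    have xy: "x \<in> EE n" "x \<noteq> y" using x y by auto
    have "F (t, x) \<notin> C"
    proof
      assume A: "F (t, x) \<in> C"
      \<comment> \<open>The point \<open>x\<close> lies on the segment from \<open>y\<close> to its
        image, so star-shapedness would put \<open>x\<close> into \<open>C\<close>.\<close>
      let ?s = "1 + t * R / N x"
      have s: "?s \<ge> 1" using Npos[OF xy] t R0 by simp
      have "(%i. y i + (1 / ?s) * (F (t, x) i - y i)) \<in> C" using star[OF A, of "1 / ?s"] s by simp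
      moreover have "(%i. y i + (1 / ?s) * (F (t, x) i - y i)) = x" using s by (auto simp: F_def)
      ultimately show False using x by simp
    qed
    then show ?thesis using FE xy by blast
  qed
  have cont: "continuous_on ({0..1} \<times> (EE n - {y})) F" unfolding F_def case_prod_beta
  proof (rule continuous_on_coordinatewise_then_product)
    fix i
    have sn: "continuous_on A (%z. snd z i)" for A :: "(real \<times> (nat => real)) set" and i
      by (rule continuous_on_compose2[OF continuous_on_product_coordinates continuous_on_snd[OF continuous_on_id]]) auto
    have "continuous_on ({0..1::real} \<times> (EE n - {y})) (%z. N (snd z))"
      unfolding N_def by (intro continuous_intros sn)
    moreover have "N (snd z) \<noteq> 0" if "z \<in> {0..1::real} \<times> (EE n - {y})" for z
      using Npos[of "snd z"] that by (auto simp: mem_Times_iff)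
    ultimately show "continuous_on ({0..1} \<times> (EE n - {y}))
      (%x. y i + (1 + fst x * R / N (snd x)) * (snd x i - y i))" by (intro continuous_intros sn) auto
  qed
  have Yeq: "?Y = top_of_set (EE n - {y})" by (simp add: subtopology_Euclidean_space)
  have FYs: "F z \<in> EE n - {y}" if "z \<in> {0..1} \<times> (EE n - {y})" for z
    using FY[of "snd z" "fst z"] that by (simp add: mem_Times_iff)
  have hom: "homotopic_with (%h. h \<in> ?V \<rightarrow> ?V) ?Y ?Y id (%x. F (1, x))" unfolding homotopic_with_def
  proof (intro exI[of _ F] conjI ballI allI)
    have "prod_topology (top_of_set {0..1}) ?Y = top_of_set ({0..1} \<times> (EE n - {y}))"
      by (simp add: Yeq prod_topology_subtopology_eu)
    then show "continuous_map (prod_topology (top_of_set {0..1}) ?Y) ?Y F"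
      using cont FYs by (simp add: Yeq continuous_map_in_subtopology image_subset_iff_funcset[symmetric] image_subset_iff del: Diff_iff)
  qed (use FV in \<open>auto simp: F_def\<close>)
  have acyc: "rbound 0 q ?Y ?V e" if e: "rcycle 0 q ?Y ?V e" for q e
  proof -
    have "homologous_rel q ?Y ?V (chain_map q id e) (chain_map q (%x. F (1, x)) e)"
      using homotopic_imp_homologous_rel_chain_maps[OF hom] e by (simp add: rcycle_zero)
    moreover have "chain_map q id e = e" using e rcycle_chain chain_map_ident by blast
    ultimately have 1: "rbound 0 q ?Y ?V (e - chain_map q (%x. F (1, x)) e)"
      by (simp add: homologous_rel_def rbound_zero)
    have cF: "continuous_map ?Y ?Y (%x. F (1, x))" using homotopic_with_imp_continuous_maps[OF hom] by blast
    have "F (1, x) \<in> ?V" if "x \<in> EE n - {y}" for x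
      using NF[of x 1] Npos[of x] R[of "F (1, x)"] FE[of x 1] that by fastforce
    then have "continuous_map ?Y (subtopology ?Y ?V) (%x. F (1, x))"
      using cF by (auto simp: continuous_map_in_subtopology)
    then have "rchain 0 q ?Y ?V (chain_map q (%x. F (1, x)) e)"
      using e rcycle_chain rchain_sub singular_chain_chain_map by blast
    then show ?thesis using 1 rbound_add rbound_rchain by fastforce
  qed
  \<comment> \<open>Modulo boundaries and multiples of \<open>m\<close>, only a part of
    \<open>c\<close> away from \<open>y\<close> is left; it is a cycle of the acyclic pair.\<close>
  obtain g where g: "schain (Suc k) ?E g" "rchain m k ?E (EE n - {y}) (c - bdry (Suc k) g)"
    using b unfolding rbound_def by blast
  obtain d e where de: "schain k ?E d" "schain k ?Y e"
     "c - bdry (Suc k) g = cmul m d + e" using g(2) rchain_decomp by blast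
  have e_eq: "e = c - bdry (Suc k) g - cmul m d" using de(3) by simp
  have "rcycle m k ?E ?V e" unfolding e_eq by (intro rcycle_diff c rcycle_boundary g rcycle_rchain rchain_cmul de)
  then have "rcycle m k ?Y ?V e" using de(2) rcycle_subtopology by blast
  then have "rbound m k ?Y ?V e"
    by (rule rbound_universal_coefficients[OF \<open>k > 0\<close>, rotated 2]) (simp_all add: acyc)
  then have "rbound m k ?E ?V e" using rbound_from_subtopology by blast
  then have "rbound m k ?E ?V (e + bdry (Suc k) g + cmul m d)"
    by (intro rbound_add rbound_boundary[OF g(1)] rbound_cmul[OF de(1)])
  then show ?thesis by (simp add: e_eq)
qed

section \<open>Coordinate charts and top-dimensional homology\<close>

text \<open>The new content is injectivity: a bounding chain is split by subdivision, and only its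
  part in \<open>U\<close> is kept.\<close>

lemma rbound_excision_iff:
  assumes O: "openin X U" and K: "closedin X K" "K \<subseteq> U" and "k > 0"
    and c: "rcycle m k (subtopology X U) (U - K) c"
  shows "rbound m k (subtopology X U) (U - K) c \<longleftrightarrow> rbound m k X (topspace X - K) c"
proof
  have UX: "U \<subseteq> topspace X" using O openin_subset by blast
  assume "rbound m k (subtopology X U) (U - K) c"
  then show "rbound m k X (topspace X - K) c"
    using UX rbound_from_subtopology rbound_mono by (metis Diff_mono order_refl)
next
  assume "rbound m k X (topspace X - K) c"
  then obtain b where b: "schain (Suc k) X b" "rchain m k X (topspace X - K) (c - bdry (Suc k) b)"
    unfolding rbound_def by blast
  have "openin X (topspace X - K)" using K by blast
  moreover have "topspace X \<subseteq> U \<union> (topspace X - K)" using K by blast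
  ultimately obtain Sd T b1 b2 where Sd: "subdivision_ops Sd T"
    and b1: "schain (Suc k) (subtopology X U) b1"
    and b2: "schain (Suc k) (subtopology X (topspace X - K)) b2" and eq: "Sd (Suc k) b = b1 + b2"
    by (rule chain_split_open[OF O _ _ b(1)])
  have bS: "bdry (Suc k) (Sd (Suc k) b) = Sd k (bdry (Suc k) b)" using subdivision_ops_chain(3)[OF Sd b(1)] by simp
  have cc: "schain k (subtopology X U) c" using c rcycle_chain by blast
  have "Sd k c - bdry (Suc k) b1 = Sd k (c - bdry (Suc k) b) + bdry (Suc k) b2"
    unfolding subdivision_ops_diff[OF Sd] bS[symmetric] eq chain_boundary_add by simp
  moreover have "rchain m k X (topspace X - K) \<dots>"
    by (intro rchain_add rchain_subdivision(1)[OF Sd b(2)] rchain_boundary_Suc rchain_sub b2)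
  moreover have "schain k (subtopology X U) (Sd k c - bdry (Suc k) b1)"
    by (intro singular_chain_diff subdivision_ops_chain(1)[OF Sd cc] singular_chain_boundary_alt b1)
  ultimately have "rchain m k (subtopology X U) (topspace X - K) (Sd k c - bdry (Suc k) b1)"
    using rchain_subtopology by metis
  then have "rchain m k (subtopology X U) (U - K) (Sd k c - bdry (Suc k) b1)" by (rule rchain_subtopology_mono) auto
  then have "rbound m k (subtopology X U) (U - K) (Sd k c)" unfolding rbound_def using b1 by blast
  then show "rbound m k (subtopology X U) (U - K) c"
    using rbound_subdivision_iff[OF Sd c \<open>k > 0\<close>] by blast
qed

text \<open>The inverse \<open>g\<close> is carried along because subsets of the manifold are
  described as images of Euclidean sets under it.\<close>

definition chart :: "nat => 'a topology => 'a set => ('a => nat => real) => ((nat => real) => 'a) => bool" where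
  "chart n X U h g \<longleftrightarrow> openin X U \<and> homeomorphic_maps (subtopology X U) (Eucl n) h g"

lemma topological_manifold_chart:
  assumes "topological_manifold n X" "x \<in> topspace X"
  obtains U h g where "chart n X U h g" "x \<in> U"
  using assms unfolding topological_manifold_def homeomorphic_space_def chart_def by metis

context
  fixes n and X :: "'a topology" and U h g
  assumes ch: "chart n X U h g"
begin

lemma chart_open: "openin X U" and chart_subset: "U \<subseteq> topspace X"
  using ch openin_subset unfolding chart_def by blast+

lemma chart_continuous:
  "continuous_map (subtopology X U) (Eucl n) h"
  "continuous_map (Eucl n) (subtopology X U) g" "continuous_map (Eucl n) X g"
  using ch unfolding chart_def homeomorphic_maps_def by (auto simp: continuous_map_in_subtopology)

lemma chart_inverse: "x \<in> U ==> g (h x) = x" "y \<in> EE n ==> h (g y) = y"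
  using ch chart_subset unfolding chart_def homeomorphic_maps_def by auto

lemma chart_in: "x \<in> U ==> h x \<in> EE n" "y \<in> EE n ==> g y \<in> U" using chart_continuous(1,2) chart_subset
  by (auto simp: continuous_map_def Pi_iff)

lemma chart_compact: "compactin (Eucl n) C ==> compactin X (g ` C)" using image_compactin chart_continuous(3) by blast

lemma chart_image_subset: "C \<subseteq> EE n ==> g ` C \<subseteq> U" using chart_in by blast

lemma chart_open_image: "openin (Eucl n) V ==> openin X (g ` V)"
proof -
  assume "openin (Eucl n) V"
  moreover have "homeomorphic_map (Eucl n) (subtopology X U) g"
    using ch unfolding chart_def by (meson homeomorphic_maps_map)
  ultimately have "openin (subtopology X U) (g ` V)" using homeomorphic_imp_open_map open_map_def by blast
  then show ?thesis using chart_open openin_trans_full by blast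
qed

lemma chart_image_Diff:
  assumes "C \<subseteq> EE n" shows "g ` (EE n - C) = U - g ` C"
proof (intro equalityI subsetI)
  fix u assume "u \<in> g ` (EE n - C)"
  then obtain x where x: "x \<in> EE n" "x \<notin> C" "u = g x" by blast
  have "g x \<noteq> g z" if "z \<in> C" for z using x that assms chart_inverse(2) by (metis subsetD)
  then have "u \<notin> g ` C" using x(3) by (metis imageE)
  then show "u \<in> U - g ` C" using x(1,3) chart_in(2) by (simp only: Diff_iff simp_thms)
next
  fix u assume u: "u \<in> U - g ` C"
  then have "u = g (h u)" "h u \<in> EE n" using chart_inverse(1) chart_in(1) by auto
  moreover have "h u \<notin> C" using u \<open>u = g (h u)\<close> by blast
  ultimately show "u \<in> g ` (EE n - C)" by blast
qed

lemma chart_inverse_Diff: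
  assumes "C \<subseteq> EE n" shows "h ` (U - g ` C) = EE n - C"
proof -
  have "h ` g ` (EE n - C) = id ` (EE n - C)" unfolding image_image by (rule image_cong) (auto simp: chart_inverse(2))
  then show ?thesis using chart_image_Diff[OF assms] by simp
qed

text \<open>One transported cycle \<open>c'\<close> serves for every compact \<open>D\<close> inside
  \<open>C\<close>, so that bounding off all of \<open>C\<close> and bounding off one of its points
  can be compared in Euclidean space.\<close>

lemma chart_transfer:
  assumes C: "compactin (Eucl n) C" and X: "Hausdorff_space X" and "k > 0"
    and c: "rcycle m k X (topspace X - g ` C) c"
  obtains c' where "rcycle m k (Eucl n) (EE n - C) c'"
    "!!D. D \<subseteq> C ==> compactin (Eucl n) D ==>
      rbound m k X (topspace X - g ` D) c \<longleftrightarrow> rbound m k (Eucl n) (EE n - D) c'"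
proof -
  have CE: "C \<subseteq> EE n" using C compactin_subset_topspace by blast
  have cl: "closedin X (g ` D)" if "compactin (Eucl n) D" for D
    using chart_compact[OF that] X compactin_imp_closedin by blast
  obtain c1 where c1: "rcycle m k (subtopology X U) (U - g ` C) c1"
    "rbound m k X (topspace X - g ` C) (c - c1)"
    using rbound_excision[OF chart_open cl[OF C] chart_image_subset[OF CE] \<open>k > 0\<close> c] by blast
  have tU: "topspace (subtopology X U) = U" using chart_subset by auto
  have g1: "chain_map k g (chain_map k h c1) = c1"
  proof -
    have "chain_map k (g \<circ> h) c1 = c1"
      using c1(1) rcycle_chain chain_map_id_gen[of k "subtopology X U" c1 "g \<circ> h"] chart_inverse(1) tU
      by (metis comp_apply)
    then show ?thesis by (simp add: chain_map_compose)
  qed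
  show thesis
  proof
    show 1: "rcycle m k (Eucl n) (EE n - C) (chain_map k h c1)" using chart_inverse_Diff[OF CE]
      by (intro rcycle_map[OF c1(1) chart_continuous(1)]) (auto simp: tU)
    fix D assume D: "D \<subseteq> C" "compactin (Eucl n) D"
    then have DE: "D \<subseteq> EE n" and sub: "g ` D \<subseteq> g ` C" using CE by auto
    have "rbound m k X (topspace X - g ` D) (c - c1)" using rbound_mono[OF c1(2)] sub by blast
    then have "rbound m k X (topspace X - g ` D) c \<longleftrightarrow> rbound m k X (topspace X - g ` D) c1"
      using rbound_add[of m k X "topspace X - g ` D" "c - c1" c1] rbound_diff[of m k X "topspace X - g ` D" c "c - c1"]
      by auto
    also have "\<dots> \<longleftrightarrow> rbound m k (subtopology X U) (U - g ` D) c1"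
      using rbound_excision_iff[OF chart_open cl[OF D(2)] chart_image_subset[OF DE] \<open>k > 0\<close>]
        rcycle_mono[OF c1(1)] sub by (metis Diff_mono order_refl)
    also have "\<dots> \<longleftrightarrow> rbound m k (Eucl n) (EE n - D) (chain_map k h c1)"
    proof
      assume "rbound m k (subtopology X U) (U - g ` D) c1"
      then show "rbound m k (Eucl n) (EE n - D) (chain_map k h c1)"
        using chart_inverse_Diff[OF DE] by (intro rbound_map[OF _ chart_continuous(1)]) (auto simp: tU)
    next
      assume "rbound m k (Eucl n) (EE n - D) (chain_map k h c1)"
      then have "rbound m k (subtopology X U) (U - g ` D) (chain_map k g (chain_map k h c1))"
        using chart_image_Diff[OF DE] by (intro rbound_map[OF _ chart_continuous(2)]) auto
      then show "rbound m k (subtopology X U) (U - g ` D) c1" by (simp only: g1)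
    qed
    finally show "rbound m k X (topspace X - g ` D) c \<longleftrightarrow>
       rbound m k (Eucl n) (EE n - D) (chain_map k h c1)" .
  qed
qed

lemma compactin_Euclidean_singleton: "y \<in> EE n ==> compactin (Eucl n) {y}" by simp

lemma chart_star_shaped:
  assumes C: "compactin (Eucl n) C" and y: "y \<in> C"
    and star: "!!x t. x \<in> C ==> 0 \<le> t ==> t \<le> 1 ==> (%i. y i + t * (x i - y i)) \<in> C"
    and X: "Hausdorff_space X" and "k > 0" and c: "rcycle m k X (topspace X - g ` C) c"
    and b: "rbound m k X (topspace X - {g y}) c"
  shows "rbound m k X (topspace X - g ` C) c"
proof -
  have yE: "y \<in> EE n" using C y compactin_subset_topspace by blast
  obtain c' where c': "rcycle m k (Eucl n) (EE n - C) c'"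
    "!!D. D \<subseteq> C ==> compactin (Eucl n) D ==>
      rbound m k X (topspace X - g ` D) c \<longleftrightarrow> rbound m k (Eucl n) (EE n - D) c'"
    using chart_transfer[OF C X \<open>k > 0\<close> c] by blast
  have "rbound m k (Eucl n) (EE n - {y}) c'" using c'(2)[of "{y}"] b y compactin_Euclidean_singleton[OF yE] by simp
  then have "rbound m k (Eucl n) (EE n - C) c'"
    using rbound_star_shaped[OF C y star \<open>k > 0\<close> c'(1)] by blast
  then show ?thesis using c'(2)[OF order_refl C] by blast
qed

end

section \<open>Local homology of a manifold\<close>

lemma manifold_Hausdorff: "topological_manifold n X ==> Hausdorff_space X" by (simp add: topological_manifold_def)

context
  fixes n and X :: "'a topology" and x
  assumes X: "topological_manifold n X" and x: "x \<in> topspace X" and n: "n > 0"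
begin

lemma local_homology_trivial:
  assumes "k > 0" "k \<noteq> n" "rcycle 0 k X (topspace X - {x}) c"
  shows "rbound 0 k X (topspace X - {x}) c"
proof -
  obtain U h g where ch: "chart n X U h g" and xU: "x \<in> U" using topological_manifold_chart[OF X x] by blast
  have y: "h x \<in> EE n" "g ` {h x} = {x}" using chart_in[OF ch] chart_inverse[OF ch] xU by auto
  then have cy: "compactin (Eucl n) {h x}" by simp
  obtain c' where c': "rcycle 0 k (Eucl n) (EE n - {h x}) c'"
    "!!D. D \<subseteq> {h x} ==> compactin (Eucl n) D ==>
      rbound 0 k X (topspace X - g ` D) c \<longleftrightarrow> rbound 0 k (Eucl n) (EE n - D) c'"
    using chart_transfer[OF ch cy manifold_Hausdorff[OF X] assms(1), of 0 c] y assms(3) by metis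
  show ?thesis using c'(2)[OF order_refl cy] Euclidean_local_trivial[OF y(1) assms(2) c'(1)] y(2) by simp
qed

text \<open>Excision to a chart identifies the top local homology with that of Euclidean space;
  \<open>F\<close> plays the role of a local degree, up to sign.\<close>

lemma local_homology_generator:
  obtains F :: "'a chain => int" and t where
    "!!a b. rcycle 0 n X (topspace X - {x}) a ==> rcycle 0 n X (topspace X - {x}) b ==> F (a + b) = F a + F b"
    "!!a b. rcycle 0 n X (topspace X - {x}) a ==> rcycle 0 n X (topspace X - {x}) b ==> F (a - b) = F a - F b"
    "!!j a. rcycle 0 n X (topspace X - {x}) a ==> F (cmul j a) = j * F a"
    "!!a. rcycle 0 n X (topspace X - {x}) a ==> F a = 0 \<longleftrightarrow> rbound 0 n X (topspace X - {x}) a"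
    "rcycle 0 n X (topspace X - {x}) t" "F t = 1"
proof -
  obtain U h g where ch: "chart n X U h g" and xU: "x \<in> U" using topological_manifold_chart[OF X x] by blast
  have y: "h x \<in> EE n" "g ` {h x} = {x}" "g (h x) = x" using chart_in[OF ch] chart_inverse[OF ch] xU by auto
  have UX: "U \<subseteq> topspace X" using chart_subset[OF ch] .
  have cl: "closedin X {x}" using closedin_Hausdorff_singleton[OF manifold_Hausdorff[OF X] x] .
  have i1: "hom_induced (int n) (subtopology X U) (U - {x}) X (topspace X - {x}) id
     \<in> iso (relative_homology_group (int n) (subtopology X U) (U - {x})) (relative_homology_group (int n) X (topspace X - {x}))"
  proof -
    have "hom_induced (int n) (subtopology X (topspace X - (topspace X - U))) (topspace X - {x} - (topspace X - U))
       (subtopology X (topspace X)) (topspace X - {x}) id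
       \<in> iso (relative_homology_group (int n) (subtopology X (topspace X - (topspace X - U))) (topspace X - {x} - (topspace X - U)))
             (relative_homology_group (int n) (subtopology X (topspace X)) (topspace X - {x}))"
    proof (rule homology_excision_axiom)
      have "openin X (topspace X - {x})" using cl by blast
      moreover have "closedin X (topspace X - U)" using chart_open[OF ch] by blast
      ultimately show "X closure_of (topspace X - U) \<subseteq> X interior_of (topspace X - {x})"
        using xU by (auto simp: interior_of_openin closure_of_closedin)
    qed auto
    moreover have "topspace X - (topspace X - U) = U" "topspace X - {x} - (topspace X - U) = U - {x}" using UX by auto
    ultimately show ?thesis by simp
  qed
  have "hom_induced (int n) (subtopology X U) (U - {x}) (Eucl n) (EE n - {h x}) h
      \<in> iso (relative_homology_group (int n) (subtopology X U) (U - {x}))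
            (relative_homology_group (int n) (Eucl n) (EE n - {h x}))"
  proof (rule homeomorphic_map_relative_homology_iso)
    show "homeomorphic_map (subtopology X U) (Eucl n) h" using ch unfolding chart_def by (meson homeomorphic_maps_map)
    show "U - {x} \<subseteq> topspace (subtopology X U)" using UX by auto
    show "h ` (U - {x}) = EE n - {h x}" using chart_inverse_Diff[OF ch, of "{h x}"] y by simp
  qed
  with i1 have "relative_homology_group (int n) X (topspace X - {x}) \<cong>
        relative_homology_group (int n) (Eucl n) (EE n - {h x})"
    by (meson group_relative_homology_group is_isoI group.iso_sym iso_trans)
  then have "relative_homology_group (int n) X (topspace X - {x}) \<cong> integer_group"
    using Euclidean_local_integer[OF y(1)] iso_trans by blast
  from relhom_integerE[OF this] show thesis using that unfolding rcycle_zero rbound_zero by blast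
qed

text \<open>Modulo \<open>m\<close> the only possible contribution is torsion one degree lower. In
  degree \<open>n\<close> there is none, as the local homology there is infinite cyclic; above
  \<open>n\<close> there is no homology at all.\<close>

lemma local_homology_vanish:
  assumes "k > n" "rcycle m k X (topspace X - {x}) c"
  shows "rbound m k X (topspace X - {x}) c"
proof (cases "m = 0")
  case True
  then show ?thesis using local_homology_trivial[of k c] assms by simp
next
  case False
  show ?thesis
  proof (rule rbound_universal_coefficients[OF _ _ _ assms(2)])
    fix d assume d: "rcycle 0 (k - 1) X (topspace X - {x}) d"
      "rbound 0 (k - 1) X (topspace X - {x}) (cmul m d)"
    show "rbound 0 (k - 1) X (topspace X - {x}) d"
    proof (cases "k - 1 = n")
      case True
      obtain F :: "'a chain => int" and t where F:
        "!!j a. rcycle 0 n X (topspace X - {x}) a ==> F (cmul j a) = j * F a"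
        "!!a. rcycle 0 n X (topspace X - {x}) a ==> F a = 0 \<longleftrightarrow> rbound 0 n X (topspace X - {x}) a"
        using local_homology_generator by metis
      have "F (cmul m d) = 0" using F(2) d True rcycle_rbound by blast
      then show ?thesis using F d(1) False True by simp
    next
      case False
      then show ?thesis using local_homology_trivial[of "k - 1" d] d(1) assms(1) n by linarith
    qed
  qed (use assms n local_homology_trivial in auto)
qed

end

section \<open>Homology of a manifold relative to the complement of a compact set\<close>

text \<open>The classical statement behind fundamental classes: nothing lives above the dimension,
  and a top-dimensional class is determined by its restrictions to the points of
  \<open>K\<close>.\<close>

definition top_vanishing :: "int => nat => 'a topology => 'a set => bool" where
  "top_vanishing m n X K \<longleftrightarrow>
     (\<forall>k>n. \<forall>c. rcycle m k X (topspace X - K) c --> rbound m k X (topspace X - K) c) \<and>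
     (\<forall>c. rcycle m n X (topspace X - K) c --> (\<forall>y\<in>K. rbound m n X (topspace X - {y}) c) -->
        rbound m n X (topspace X - K) c)"

lemma rbound_topspace: "schain k X c ==> rbound m k X (topspace X) c" by (intro rbound_rchain rchain_sub) simp

text \<open>Mayer-Vietoris for the complements of \<open>K\<close> and \<open>L\<close>: the
  obstruction lies in degree \<open>Suc k > n\<close> relative to the complement of
  \<open>K \<inter> L\<close>, where every cycle bounds.\<close>

lemma top_vanishing_Un:
  assumes K: "closedin X K" and L: "closedin X L" and n: "n > 0"
    and tK: "top_vanishing m n X K" and tL: "top_vanishing m n X L" and tI: "top_vanishing m n X (K \<inter> L)"
  shows "top_vanishing m n X (K \<union> L)"
proof -
  let ?A = "topspace X - K" and ?B = "topspace X - L"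
  have eqs: "?A \<inter> ?B = topspace X - (K \<union> L)" "?A \<union> ?B = topspace X - (K \<inter> L)" by auto
  have op: "openin X ?A" "openin X ?B" using K L by blast+
  have mv: "rbound m k X (topspace X - (K \<union> L)) c"
    if "k \<ge> n" "rcycle m k X (topspace X - (K \<union> L)) c" "rbound m k X ?A c" "rbound m k X ?B c" for k c
  proof -
    have "rbound m (Suc k) X (?A \<union> ?B) b" if "rcycle m (Suc k) X (?A \<union> ?B) b" for b
      using that tI \<open>k \<ge> n\<close> unfolding top_vanishing_def eqs by auto
    then show ?thesis using rbound_Mayer_Vietoris[OF op, of k m c] that n unfolding eqs(1) by auto
  qed
  have sub: "topspace X - (K \<union> L) \<subseteq> ?A" "topspace X - (K \<union> L) \<subseteq> ?B" by auto
  show ?thesis unfolding top_vanishing_def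
  proof (intro conjI allI impI)
    fix k c assume k: "k > n" and c: "rcycle m k X (topspace X - (K \<union> L)) c"
    show "rbound m k X (topspace X - (K \<union> L)) c"
      using mv[of k c] c k tK tL rcycle_mono[OF c sub(1)] rcycle_mono[OF c sub(2)] unfolding top_vanishing_def by auto
  next
    fix c assume c: "rcycle m n X (topspace X - (K \<union> L)) c"
      and y: "\<forall>y\<in>K \<union> L. rbound m n X (topspace X - {y}) c"
    show "rbound m n X (topspace X - (K \<union> L)) c"
      using mv[of n c] c y tK tL rcycle_mono[OF c sub(1)] rcycle_mono[OF c sub(2)] unfolding top_vanishing_def by auto
  qed
qed

definition coord_convex :: "(nat => real) set => bool" where
  "coord_convex C \<longleftrightarrow> (\<forall>x\<in>C. \<forall>y\<in>C. \<forall>t\<in>{0..1}. (%i. y i + t * (x i - y i)) \<in> C)"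

lemma coord_convex_Int: "coord_convex C ==> coord_convex D ==> coord_convex (C \<inter> D)"
  unfolding coord_convex_def by blast

definition ccube :: "nat => (nat => real) => real => (nat => real) set" where
  "ccube n a r = {x \<in> EE n. \<forall>i<n. \<bar>x i - a i\<bar> \<le> r}"

definition ocube :: "nat => (nat => real) => real => (nat => real) set" where
  "ocube n a r = {x \<in> EE n. \<forall>i<n. \<bar>x i - a i\<bar> < r}"

lemma ccube_convex: "coord_convex (ccube n a r)"
proof -
  have "\<bar>v + t * (u - v) - c\<bar> \<le> r" if "\<bar>u - c\<bar> \<le> r" "\<bar>v - c\<bar> \<le> r" "t \<in> {0..1}" for u v c t :: real
  proof -
    have "v + t * (u - v) - c = (1 - t) * (v - c) + t * (u - c)" by (simp add: algebra_simps)
    also have "\<bar>\<dots>\<bar> \<le> (1 - t) * r + t * r"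
      using that by (intro order_trans[OF abs_triangle_ineq] add_mono)
        (auto simp: abs_mult intro: mult_left_mono)
    finally show ?thesis by (simp add: algebra_simps)
  qed
  then show ?thesis unfolding coord_convex_def ccube_def by (auto simp: EE_iff)
qed

lemma ccube_compact: "compactin (Eucl n) (ccube n a r)"
proof -
  let ?P = "Pi\<^sub>E UNIV (%i. if i < n then {a i - r..a i + r} else {0})"
  have eq: "ccube n a r = ?P"
  proof (rule Set.set_eqI)
    fix x :: "nat => real"
    have "x \<in> ccube n a r \<longleftrightarrow> (\<forall>i. (i < n --> \<bar>x i - a i\<bar> \<le> r) \<and> (\<not> i < n --> x i = 0))"
      by (auto simp: ccube_def EE_iff not_less)
    also have "\<dots> \<longleftrightarrow> x \<in> ?P"
      unfolding PiE_UNIV_domain Pi_iff ball_UNIV by (rule all_cong1) (simp add: abs_diff_le_iff)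
    finally show "x \<in> ccube n a r \<longleftrightarrow> x \<in> ?P" .
  qed
  have "compactin (powertop_real UNIV) ?P" unfolding compactin_PiE by auto
  then show ?thesis unfolding eq[symmetric] Euclidean_space_def compactin_subtopology by (auto simp: ccube_def EE_iff)
qed

lemma ocube_open: "openin (Eucl n) (ocube n a r)"
proof -
  have "openin (Eucl n) {x \<in> EE n. \<bar>x i - a i\<bar> \<in> {..<r}}" for i
  proof (rule openin_continuous_map_preimage)
    show "continuous_map (Eucl n) euclideanreal (%x. \<bar>x i - a i\<bar>)"
      unfolding continuous_map_Euclidean_space_iff
      by (intro continuous_intros continuous_on_subset[OF continuous_on_product_coordinates subset_UNIV])
  qed simp
  then have "openin (Eucl n) (EE n \<inter> \<Inter>((%i. {x \<in> EE n. \<bar>x i - a i\<bar> \<in> {..<r}}) ` {..<n}))"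
    by (intro openin_Inter openin_Int_Inter) auto
  also have "EE n \<inter> \<Inter>((%i. {x \<in> EE n. \<bar>x i - a i\<bar> \<in> {..<r}}) ` {..<n}) = ocube n a r"
    by (auto simp: ocube_def)
  finally show ?thesis .
qed

lemma ocube_subset_ccube: "ocube n a r \<subseteq> ccube n a r" by (auto simp: ocube_def ccube_def less_imp_le)

lemma ocube_center: "a \<in> EE n ==> r > 0 ==> a \<in> ocube n a r" by (simp add: ocube_def)

lemma ccube_center: "a \<in> EE n ==> r > 0 ==> a \<in> ccube n a r" using ocube_center ocube_subset_ccube by blast

lemma ccube_subset_EE: "ccube n a r \<subseteq> EE n" by (auto simp: ccube_def)

lemma openin_Euclidean_ccube:
  assumes "openin (Eucl n) V" "a \<in> V"
  obtains r where "r > 0" "ccube n a r \<subseteq> V"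
proof -
  have aE: "a \<in> EE n" using assms openin_subset by blast
  obtain V' where V': "openin (powertop_real UNIV) V'" "V = V' \<inter> {x. \<forall>i\<ge>n. x i = 0}"
    using assms(1) unfolding Euclidean_space_def openin_subtopology by blast
  have "a \<in> V'" using V' assms by blast
  then obtain B where B: "!!i. openin euclideanreal (B i)" "a \<in> Pi\<^sub>E UNIV B" "Pi\<^sub>E UNIV B \<subseteq> V'"
    using V'(1) unfolding openin_product_topology_alt by (metis UNIV_I)
  have "\<exists>r>0. \<forall>y. \<bar>y - a i\<bar> \<le> r --> y \<in> B i" for i
  proof -
    have "open (B i)" "a i \<in> B i" using B by auto
    then obtain e where "e > 0" "cball (a i) e \<subseteq> B i" using open_contains_cball by blast
    then show ?thesis by (intro exI[of _ e]) (auto simp: dist_real_def subset_iff abs_minus_commute)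
  qed
  then obtain R where R: "!!i. R i > 0" "!!i y. \<bar>y - a i\<bar> \<le> R i ==> y \<in> B i" by metis
  \<comment> \<open>Only the first \<open>n\<close> coordinates restrict the radius, because beyond
    them points of the cube agree with \<open>a\<close>. The entry \<open>1\<close> keeps the
    minimum defined for \<open>n = 0\<close>.\<close>
  define r where "r = Min (insert 1 (R ` {..<n}))"
  have r: "r > 0" "!!i. i < n ==> r \<le> R i" unfolding r_def using R(1) by auto
  have "x \<in> V" if x: "x \<in> ccube n a r" for x
  proof -
    have "x i \<in> B i" for i
    proof (cases "i < n")
      case True
      then show ?thesis using x r(2)[OF True] R(2)[of "x i" i] unfolding ccube_def by force
    next
      case False
      then have "x i = a i" using x aE by (auto simp: ccube_def EE_iff)
      then show ?thesis using R(2)[of "x i" i] R(1)[of i] by simp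
    qed
    then have "x \<in> V'" using B(3) by (auto simp: PiE_UNIV_domain)
    then show ?thesis using V'(2) x by (auto simp: ccube_def EE_iff)
  qed
  then show thesis using that r(1) by blast
qed

context
  fixes n and X :: "'a topology" and m :: int
  assumes X: "topological_manifold n X" and n: "n > 0"
begin

lemma Hausdorff_X: "Hausdorff_space X" using X by (simp add: topological_manifold_def)

lemma top_vanishing_empty: "top_vanishing m n X {}"
  unfolding top_vanishing_def by (auto intro!: rbound_topspace dest: rcycle_chain)

lemma top_vanishing_convex:
  assumes ch: "chart n X U h g" and C: "compactin (Eucl n) C" "coord_convex C"
  shows "top_vanishing m n X (g ` C)"
proof (cases "C = {}")
  case True
  then show ?thesis by (simp add: top_vanishing_empty)
next
  case False
  then obtain y where y: "y \<in> C" by blast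
  then have yE: "y \<in> EE n" using C compactin_subset_topspace by blast
  have gy: "g y \<in> topspace X" using chart_in(2)[OF ch yE] chart_subset[OF ch] by blast
  have sub: "topspace X - g ` C \<subseteq> topspace X - {g y}" using y by blast
  have star: "(%i. y i + t * (x i - y i)) \<in> C" if "x \<in> C" "0 \<le> t" "t \<le> 1" for x t
    using that y C(2) unfolding coord_convex_def by auto
  have *: "rbound m k X (topspace X - g ` C) c"
    if "k > 0" "rcycle m k X (topspace X - g ` C) c" "rbound m k X (topspace X - {g y}) c" for k c
    using chart_star_shaped[OF ch C(1) y star Hausdorff_X that] .
  show ?thesis unfolding top_vanishing_def
  proof (intro conjI allI impI)
    fix k c assume "k > n" "rcycle m k X (topspace X - g ` C) c"
    then show "rbound m k X (topspace X - g ` C) c"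
      using * local_homology_vanish[OF X gy n] rcycle_mono[OF _ sub] by auto
  next
    fix c assume "rcycle m n X (topspace X - g ` C) c" "\<forall>y\<in>g ` C. rbound m n X (topspace X - {y}) c"
    then show "rbound m n X (topspace X - g ` C) c" using *[OF n] y by blast
  qed
qed

text \<open>The induction runs over a bound for the number of sets: intersecting \<open>C\<close>
  with the others again gives at most \<open>N\<close> compact convex sets, as needed for the
  intersection in \<open>top_vanishing_Un\<close>.\<close>

lemma top_vanishing_finite_convex:
  assumes ch: "chart n X U h g"
  shows "finite \<F> ==> card \<F> \<le> N ==> \<forall>C\<in>\<F>. compactin (Eucl n) C \<and> coord_convex C ==>
    top_vanishing m n X (g ` \<Union>\<F>)"
proof (induction N arbitrary: \<F>)
  case 0
  then show ?case by (simp add: top_vanishing_empty)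
next
  case (Suc N)
  show ?case
  proof (cases "\<F> = {}")
    case True
    then show ?thesis by (simp add: top_vanishing_empty)
  next
    case False
    then obtain C \<G> where CG: "\<F> = insert C \<G>" "C \<notin> \<G>" by (meson Set.set_insert ex_in_conv)
    then have G: "finite \<G>" "card \<G> \<le> N" using Suc.prems by auto
    have C: "compactin (Eucl n) C" "coord_convex C"
      and GG: "\<forall>C\<in>\<G>. compactin (Eucl n) C \<and> coord_convex C" using Suc.prems(3) CG by auto
    let ?I = "(\<inter>) C ` \<G>"
    have cl: "closedin (Eucl n) D" if "compactin (Eucl n) D" for D
      using that Hausdorff_Euclidean_space compactin_imp_closedin by blast
    have GI: "\<forall>D\<in>?I. compactin (Eucl n) D \<and> coord_convex D"
      using GG C by (auto intro!: coord_convex_Int compact_Int_closedin cl)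
    have cIG: "card ?I \<le> N" "finite ?I" using G card_image_le[of \<G>] order_trans by blast+
    have EEs: "C \<subseteq> EE n" "\<Union>\<G> \<subseteq> EE n" using C GG compactin_subset_topspace by blast+
    have inj: "inj_on g (EE n)" using chart_inverse(2)[OF ch] by (metis inj_onI)
    have int: "g ` C \<inter> g ` \<Union>\<G> = g ` \<Union>?I"
      using inj_on_image_Int[OF inj EEs] by (auto simp del: image_Int)
    have cG: "compactin (Eucl n) (\<Union>\<G>)" using G(1) GG by (intro compactin_Union) auto
    have closed: "closedin X (g ` C)" "closedin X (g ` \<Union>\<G>)"
      using chart_compact[OF ch] C(1) cG Hausdorff_X compactin_imp_closedin by blast+
    have "top_vanishing m n X (g ` C \<union> g ` \<Union>\<G>)"
      by (rule top_vanishing_Un[OF closed n top_vanishing_convex[OF ch C] Suc.IH[OF G GG]])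
         (simp only: int Suc.IH[OF cIG(2,1) GI])
    then show ?thesis using CG by (simp add: image_Un)
  qed
qed

text \<open>The boundary simplices lying off \<open>K\<close> fill a compact set; the others have
  coefficients divisible by \<open>m\<close> and impose no condition. So \<open>K\<close> may be
  enlarged as long as it avoids that compact set.\<close>

lemma rcycle_support:
  assumes c: "rcycle m k X (topspace X - K) c"
  obtains Z where "compactin X Z" "Z \<inter> K = {}" "!!K'. K' \<inter> Z = {} ==> rcycle m k X (topspace X - K') c"
proof -
  let ?b = "bdry k c" and ?S = "Simplex (k - 1)"
  let ?P = "{s \<in> supp ?b. s ` ?S \<subseteq> topspace X - K}"
  define Z where "Z = (\<Union>s\<in>?P. s ` ?S)"
  have bc: "schain (k - 1) X ?b" using c unfolding rcycle_def by (auto dest: rchain_chain)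
  have simp: "singular_simplex (k - 1) X s" if "s \<in> supp ?b" for s
    using bc that unfolding singular_chain_def by blast
  have "compactin X (s ` ?S)" if "s \<in> supp ?b" for s
  proof (rule image_compactin)
    show "continuous_map (subtopology (powertop_real UNIV) ?S) X s"
      using simp[OF that] unfolding singular_simplex_def by blast
    show "compactin (subtopology (powertop_real UNIV) ?S) ?S"
      using compactin_standard_simplex by (simp add: compactin_subtopology)
  qed
  then have "compactin X Z" unfolding Z_def by (intro compactin_Union) auto
  moreover have "Z \<inter> K = {}" unfolding Z_def by blast
  moreover have "rcycle m k X (topspace X - K') c" if "K' \<inter> Z = {}" for K' unfolding rcycle_def rchain_def
  proof (intro conjI ballI bc)
    show "schain k X c" using c rcycle_chain by blast
    fix s assume s: "s \<in> supp ?b"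
    have "s ` ?S \<subseteq> topspace X - K \<or> m dvd wt ?b s" using c s unfolding rcycle_def rchain_def by blast
    then show "s ` ?S \<subseteq> topspace X - K' \<or> m dvd wt ?b s"
    proof
      assume *: "s ` ?S \<subseteq> topspace X - K"
      then have "s ` ?S \<subseteq> Z" using s unfolding Z_def by blast
      then show ?thesis using * that by blast
    qed simp
  qed
  ultimately show thesis using that by blast
qed

text \<open>For a given cycle, the compact set is thickened to finitely many cubes that avoid the
  support of its boundary; cubes are convex, so the case of finitely many convex sets
  applies.\<close>

lemma top_vanishing_chart:
  assumes ch: "chart n X U h g" and L: "compactin (Eucl n) L"
  shows "top_vanishing m n X (g ` L)"
proof -
  have LE: "L \<subseteq> EE n" using L compactin_subset_topspace by blast
  have thick: "\<exists>\<F>. finite \<F> \<and> g ` L \<subseteq> g ` \<Union>\<F> \<and> (\<forall>C\<in>\<F>. compactin (Eucl n) C \<and> coord_convex C) \<and>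
      (\<forall>C\<in>\<F>. \<exists>a\<in>L. a \<in> C) \<and> rcycle m k X (topspace X - g ` \<Union>\<F>) c"
    if c: "rcycle m k X (topspace X - g ` L) c" for k c
  proof -
    obtain Z where Z: "compactin X Z" "Z \<inter> g ` L = {}" "!!K'. K' \<inter> Z = {} ==> rcycle m k X (topspace X - K') c"
      using rcycle_support[OF c] by blast
    have "closedin X Z" using Z(1) Hausdorff_X compactin_imp_closedin by blast
    then have "openin (Eucl n) {x \<in> EE n. g x \<in> topspace X - Z}"
      by (intro openin_continuous_map_preimage[OF chart_continuous(3)[OF ch]]) blast
    moreover have "L \<subseteq> {x \<in> EE n. g x \<in> topspace X - Z}"
      using Z(2) LE chart_in(2)[OF ch] chart_subset[OF ch] by blast
    ultimately have "\<forall>a\<in>L. \<exists>r>0. ccube n a r \<subseteq> {x \<in> EE n. g x \<in> topspace X - Z}"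
      by (meson openin_Euclidean_ccube subsetD)
    from bchoice[OF this] obtain R
      where R': "\<forall>a\<in>L. 0 < R a \<and> ccube n a (R a) \<subseteq> {x \<in> EE n. g x \<in> topspace X - Z}"
      by blast
    then have R: "!!a. a \<in> L ==> R a > 0"
      "!!a. a \<in> L ==> ccube n a (R a) \<subseteq> {x \<in> EE n. g x \<in> topspace X - Z}" by simp_all
    have "L \<subseteq> \<Union>((%a. ocube n a (R a)) ` L)" using R(1) LE ocube_center by blast
    moreover have "\<forall>V\<in>(%a. ocube n a (R a)) ` L. openin (Eucl n) V" using ocube_open by blast
    ultimately obtain \<V> where V: "finite \<V>" "\<V> \<subseteq> (%a. ocube n a (R a)) ` L" "L \<subseteq> \<Union>\<V>"
      using L unfolding compactin_def by meson
    from finite_subset_image[OF V(1,2)] obtain A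
      where "A \<subseteq> L" "finite A" "\<V> = (%a. ocube n a (R a)) ` A" by blast
    with V(3) have A: "finite A" "A \<subseteq> L" "L \<subseteq> (\<Union>a\<in>A. ocube n a (R a))" by simp_all
    let ?F = "(%a. ccube n a (R a)) ` A"
    have "L \<subseteq> \<Union>?F" using A(3) ocube_subset_ccube by blast
    moreover have "g ` \<Union>?F \<inter> Z = {}" using R(2) A(2) by blast
    moreover have "\<forall>C\<in>?F. \<exists>a\<in>L. a \<in> C" using A(2) R(1) LE ccube_center by blast
    ultimately show ?thesis using A(1) Z(3) ccube_compact ccube_convex by (intro exI[of _ ?F]) (auto 4 3)
  qed
  show ?thesis unfolding top_vanishing_def
  proof (intro conjI allI impI)
    fix k c assume "k > n" and c: "rcycle m k X (topspace X - g ` L) c"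
    obtain \<F> where F: "finite \<F>" "g ` L \<subseteq> g ` \<Union>\<F>"
      "\<forall>C\<in>\<F>. compactin (Eucl n) C \<and> coord_convex C" "rcycle m k X (topspace X - g ` \<Union>\<F>) c"
      using thick[OF c] by blast
    then have "rbound m k X (topspace X - g ` \<Union>\<F>) c"
      using top_vanishing_finite_convex[OF ch F(1) order_refl F(3)] \<open>k > n\<close> unfolding top_vanishing_def by blast
    then show "rbound m k X (topspace X - g ` L) c" using F(2) rbound_mono by (metis Diff_mono order_refl)
  next
    fix c assume c: "rcycle m n X (topspace X - g ` L) c" and y: "\<forall>y\<in>g ` L. rbound m n X (topspace X - {y}) c"
    obtain \<F> where F: "finite \<F>" "g ` L \<subseteq> g ` \<Union>\<F>"
      "\<forall>C\<in>\<F>. compactin (Eucl n) C \<and> coord_convex C" "rcycle m n X (topspace X - g ` \<Union>\<F>) c"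
      "\<forall>C\<in>\<F>. \<exists>a\<in>L. a \<in> C" using thick[OF c] by blast
    \<comment> \<open>Each cube contains a point \<open>a\<close> of \<open>L\<close>, where the
      cycle bounds; the cube is star-shaped about \<open>a\<close>, so the cycle bounds at all its
      points.\<close>
    have "rbound m n X (topspace X - {z}) c" if z: "z \<in> g ` \<Union>\<F>" for z
    proof -
      obtain C where C: "C \<in> \<F>" "z \<in> g ` C" using z by blast
      obtain a where a: "a \<in> L" "a \<in> C" using F(5) C by blast
      have C2: "compactin (Eucl n) C" "coord_convex C" using F(3) C by auto
      have star: "(%i. a i + t * (x i - a i)) \<in> C" if "x \<in> C" "0 \<le> t" "t \<le> 1" for x t
        using that a C2(2) unfolding coord_convex_def by auto
      have "g ` C \<subseteq> g ` \<Union>\<F>" using C by blast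
      then have "rcycle m n X (topspace X - g ` C) c" by (intro rcycle_mono[OF F(4)] Diff_mono order_refl)
      then have "rbound m n X (topspace X - g ` C) c"
        using chart_star_shaped[OF ch C2(1) a(2) star Hausdorff_X n] y a(1) by blast
      then show ?thesis using C(2) rbound_mono by (metis Diff_mono empty_subsetI insert_subset order_refl)
    qed
    then have "rbound m n X (topspace X - g ` \<Union>\<F>) c"
      using top_vanishing_finite_convex[OF ch F(1) order_refl F(3)] F(4) unfolding top_vanishing_def by blast
    then show "rbound m n X (topspace X - g ` L) c" using F(2) rbound_mono by (metis Diff_mono order_refl)
  qed
qed

lemma top_vanishing_in_chart:
  assumes ch: "chart n X U h g" and K: "compactin X K" "K \<subseteq> U"
  shows "top_vanishing m n X K"
proof -
  have "compactin (subtopology X U) K" using K by (simp add: compactin_subtopology)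
  then have "compactin (Eucl n) (h ` K)" using image_compactin chart_continuous(1)[OF ch] by blast
  moreover have "g ` h ` K = K" using chart_inverse(1)[OF ch] K(2) by (force simp: image_image)
  ultimately show ?thesis using top_vanishing_chart[OF ch] by metis
qed

lemma chart_at_box:
  assumes "x \<in> topspace X" "openin X V" "x \<in> V"
  obtains U h g r where "chart n X U h g" "x \<in> U" "r > 0" "g ` ccube n (h x) r \<subseteq> V" "x \<in> g ` ocube n (h x) r"
proof -
  obtain U h g where ch: "chart n X U h g" and xU: "x \<in> U"
    using topological_manifold_chart[OF X assms(1)] by blast
  have "openin (Eucl n) {y \<in> EE n. g y \<in> V}"
    using openin_continuous_map_preimage[OF chart_continuous(3)[OF ch] assms(2)] .
  moreover have "h x \<in> {y \<in> EE n. g y \<in> V}"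
    using chart_in(1)[OF ch xU] chart_inverse(1)[OF ch xU] assms(3) by simp
  ultimately obtain r where r: "r > 0" "ccube n (h x) r \<subseteq> {y \<in> EE n. g y \<in> V}"
    using openin_Euclidean_ccube by blast
  have "x \<in> g ` ocube n (h x) r"
    using ocube_center[OF chart_in(1)[OF ch xU] r(1)] chart_inverse(1)[OF ch xU] by (metis imageI)
  then show thesis using that ch xU r by blast
qed

text \<open>The set is cut into finitely many compact pieces inside charts. A piece intersected with
  the union of the others still lies in a chart, so pieces can be joined one at a time.\<close>

theorem top_vanishing_compact:
  assumes K: "compactin X K"
  shows "top_vanishing m n X K"
proof -
  define small where "small K \<longleftrightarrow> compactin X K \<and> (\<exists>U h g. chart n X U h g \<and> K \<subseteq> U)" for K
  have fin: "top_vanishing m n X (\<Union>\<F>)" if "finite \<F>" "\<forall>K\<in>\<F>. small K" for \<F> using that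
  proof (induction \<F> rule: finite_induct)
    case empty
    then show ?case by (simp add: top_vanishing_empty)
  next
    case (insert K \<F>)
    have K: "compactin X K" and F: "compactin X (\<Union>\<F>)"
      using insert by (auto simp: small_def intro!: compactin_Union)
    then have cl: "closedin X K" "closedin X (\<Union>\<F>)" using Hausdorff_X compactin_imp_closedin by blast+
    obtain U h g where ch: "chart n X U h g" "K \<subseteq> U" using insert unfolding small_def by blast
    have "compactin X (K \<inter> \<Union>\<F>)" using compact_Int_closedin[OF K cl(2)] .
    then have "top_vanishing m n X (K \<inter> \<Union>\<F>)" using top_vanishing_in_chart[OF ch(1)] ch(2) by blast
    moreover have "top_vanishing m n X (\<Union>\<F>)" using insert by blast
    ultimately show ?case using top_vanishing_Un[OF cl n top_vanishing_in_chart[OF ch(1) K ch(2)]] by simp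
  qed
  have "\<exists>V B. x \<in> V \<and> openin X V \<and> V \<subseteq> B \<and> small B" if "x \<in> K" for x
  proof -
    have xX: "x \<in> topspace X" using that K compactin_subset_topspace by blast
    obtain U h g r where c: "chart n X U h g" "x \<in> U" "r > 0" "x \<in> g ` ocube n (h x) r"
      by (rule chart_at_box[OF xX openin_topspace xX])
    have "small (g ` ccube n (h x) r)" unfolding small_def
      using c(1) chart_compact[OF c(1) ccube_compact] chart_image_subset[OF c(1) ccube_subset_EE] by blast
    then show ?thesis using chart_open_image[OF c(1) ocube_open] c(4) ocube_subset_ccube by (meson image_mono)
  qed
  then obtain V B where VB: "!!x. x \<in> K ==> x \<in> V x" "!!x. x \<in> K ==> openin X (V x)"
     "!!x. x \<in> K ==> V x \<subseteq> B x" "!!x. x \<in> K ==> small (B x)" by metis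
  have "K \<subseteq> \<Union>(V ` K)" using VB(1) by blast
  moreover have "\<forall>W\<in>V ` K. openin X W" using VB(2) by blast
  ultimately obtain \<V> where "finite \<V>" "\<V> \<subseteq> V ` K" "K \<subseteq> \<Union>\<V>"
    using K unfolding compactin_def by meson
  then obtain A where A: "finite A" "A \<subseteq> K" "K \<subseteq> \<Union>(V ` A)" by (metis finite_subset_image)
  have cK: "closedin X K" using K Hausdorff_X compactin_imp_closedin by blast
  have "small (K \<inter> B x)" if "x \<in> A" for x
  proof -
    have "compactin X (K \<inter> B x)"
      using compact_Int_closedin[of X "B x" K] VB(4) that A(2) cK unfolding small_def by (metis Int_commute subsetD)
    then show ?thesis using VB(4) that A(2) unfolding small_def by blast
  qed
  then have "\<forall>L\<in>(%x. K \<inter> B x) ` A. small L" by blast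
  from fin[OF finite_imageI[OF A(1)] this] have "top_vanishing m n X (\<Union>((%x. K \<inter> B x) ` A))" .
  moreover have "K \<subseteq> \<Union>(B ` A)"
  proof
    fix x assume "x \<in> K"
    then obtain a where "a \<in> A" "x \<in> V a" using A(3) by (auto dest: subsetD)
    then show "x \<in> \<Union>(B ` A)" using VB(3)[of a] A(2) by auto
  qed
  then have "\<Union>((%x. K \<inter> B x) ` A) = K" by auto
  ultimately show ?thesis by simp
qed

lemma locally_constant_box:
  assumes ch: "chart n X U h g" and a: "a \<in> ccube n b r" "a' \<in> ccube n b r"
    and c: "rcycle m n X (topspace X - g ` ccube n b r) c"
    and v: "rbound m n X (topspace X - {g a}) c"
  shows "rbound m n X (topspace X - {g a'}) c"
proof -
  have star: "(%i. a i + t * (x i - a i)) \<in> ccube n b r" if "x \<in> ccube n b r" "0 \<le> t" "t \<le> 1" for x t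
    using that a ccube_convex[of n b r] unfolding coord_convex_def by auto
  have "rbound m n X (topspace X - g ` ccube n b r) c"
    using chart_star_shaped[OF ch ccube_compact a(1) star Hausdorff_X n c v] .
  then show ?thesis using a(2) rbound_mono by (metis Diff_mono empty_subsetI image_eqI insert_subset order_refl)
qed

text \<open>Vanishing of the local class is constant on small cubes, so it and its negation are both
  open conditions in \<open>V\<close>.\<close>

lemma locally_constant_connected:
  assumes V: "openin X V" "connectedin X V" and c: "rcycle m n X (topspace X - V) c"
    and x: "x \<in> V" "y \<in> V" and v: "rbound m n X (topspace X - {x}) c"
  shows "rbound m n X (topspace X - {y}) c"
proof -
  let ?P = "%x. rbound m n X (topspace X - {x}) c"
  have VX: "V \<subseteq> topspace X" using V openin_subset by blast
  have nbhd: "\<exists>N. openin X N \<and> z \<in> N \<and> N \<subseteq> V \<and> (\<forall>w\<in>N. ?P w \<longleftrightarrow> ?P z)" if z: "z \<in> V" for z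
  proof -
    obtain U h g r where ch: "chart n X U h g" and zU: "z \<in> U" and r: "r > 0" "g ` ccube n (h z) r \<subseteq> V" "z \<in> g ` ocube n (h z) r"
      using chart_at_box[of z V] V(1) z VX by blast
    have c': "rcycle m n X (topspace X - g ` ccube n (h z) r) c" using rcycle_mono[OF c] r(2) by blast
    have loc: "?P w \<longleftrightarrow> ?P z" if "w \<in> g ` ocube n (h z) r" for w
    proof -
      obtain a where a: "w = g a" "a \<in> ccube n (h z) r" using \<open>w \<in> g ` ocube n (h z) r\<close> ocube_subset_ccube by blast
      obtain b where b: "z = g b" "b \<in> ccube n (h z) r" using r(3) ocube_subset_ccube by blast
      show ?thesis using locally_constant_box[OF ch a(2) b(2) c'] locally_constant_box[OF ch b(2) a(2) c'] a b
        by metis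
    qed
    have "g ` ocube n (h z) r \<subseteq> V" using r(2) ocube_subset_ccube by blast
    then show ?thesis
      by (intro exI[of _ "g ` ocube n (h z) r"] conjI ballI chart_open_image[OF ch ocube_open] r(3) loc)
  qed
  have op: "openin X {z \<in> V. ?P z}" "openin X {z \<in> V. \<not> ?P z}"
  proof -
    have "\<exists>N. openin X N \<and> z \<in> N \<and> N \<subseteq> {z \<in> V. ?P z = q}" if zV: "z \<in> V" and q: "?P z = q" for z q
    proof -
      obtain N where N: "openin X N" "z \<in> N" "N \<subseteq> V" "\<forall>w\<in>N. ?P w \<longleftrightarrow> ?P z"
        using nbhd[OF zV] by (elim exE conjE)
      have "N \<subseteq> {z \<in> V. ?P z = q}" using N(3,4) q by (simp add: subset_iff)
      then show ?thesis using N(1,2) by (intro exI[of _ N] conjI)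
    qed
    then have "openin X {z \<in> V. ?P z = q}" for q by (subst openin_subopen) simp
    from this[of True] this[of False] show "openin X {z \<in> V. ?P z}" "openin X {z \<in> V. \<not> ?P z}"
      by simp_all
  qed
  show ?thesis
  proof (rule ccontr)
    assume "\<not> ?thesis"
    then have "{z \<in> V. ?P z} \<noteq> {}" "{z \<in> V. \<not> ?P z} \<noteq> {}" using x v by auto
    moreover have "V \<subseteq> {z \<in> V. ?P z} \<union> {z \<in> V. \<not> ?P z}" "{z \<in> V. ?P z} \<inter> {z \<in> V. \<not> ?P z} \<inter> V = {}" by auto
    ultimately show False using V(2) op unfolding connectedin by blast
  qed
qed

end

section \<open>Cochains on free chain groups\<close>

definition span_of :: "'a set => ('a \<Rightarrow>\<^sub>0 int) set" where
  "span_of S = {c. supp c \<subseteq> S}"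

lemma span_of_0 [simp]: "0 \<in> span_of S" by (simp add: span_of_def)

lemma span_of_diff: "a \<in> span_of S ==> b \<in> span_of S ==> a - b \<in> span_of S"
  unfolding span_of_def using keys_diff[of a b] by auto

lemma span_of_add: "a \<in> span_of S ==> b \<in> span_of S ==> a + b \<in> span_of S"
  unfolding span_of_def using keys_add[of a b] by auto

lemma span_of_cmul: "a \<in> span_of S ==> cmul k a \<in> span_of S"
  unfolding span_of_def using keys_cmul[of k a] by auto

lemma span_of_sum: "(!!i. i \<in> I ==> f i \<in> span_of S) ==> sum f I \<in> span_of S"
  by (induction I rule: infinite_finite_induct) (auto intro: span_of_add)

lemma span_of_extend: "(!!i. i \<in> supp c ==> f i \<in> span_of S) ==> frag_extend f c \<in> span_of S"
  unfolding frag_extend_def by (intro span_of_sum span_of_cmul)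

lemma additive_sum:
  fixes d :: "('a \<Rightarrow>\<^sub>0 int) => ('b \<Rightarrow>\<^sub>0 int)"
  assumes d: "!!a b. d (a - b) = d a - d b"
  shows "d (sum f I) = (\<Sum>i\<in>I. d (f i))"
proof -
  have d0: "d 0 = 0" using d[of 0 0] by simp
  have da: "d (a + b) = d a + d b" for a b using d[of "a + b" b] by (simp add: eq_diff_eq)
  show ?thesis by (induction I rule: infinite_finite_induct) (auto simp: d0 da)
qed

lemma additive_extend:
  fixes d :: "('a \<Rightarrow>\<^sub>0 int) => ('b \<Rightarrow>\<^sub>0 int)"
  assumes d: "!!a b. d (a - b) = d a - d b"
  shows "d (frag_extend f c) = frag_extend (%i. d (f i)) c"
  unfolding frag_extend_def additive_sum[of d, OF d] additive_cmul[of d, OF d] ..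

lemma finite_order_maximum:
  assumes r: "well_order_on UNIV r" and "finite F" "F \<noteq> {}"
  shows "\<exists>m\<in>F. \<forall>x\<in>F. (x, m) \<in> r" using assms(2,3)
proof (induction F rule: finite_ne_induct)
  case (singleton x)
  then show ?case
    using r unfolding well_order_on_def linear_order_on_def partial_order_on_def preorder_on_def refl_on_def by auto
next
  case (insert x F)
  then obtain m where m: "m \<in> F" "\<forall>y\<in>F. (y, m) \<in> r" by blast
  have lin: "total_on UNIV r" "trans r" "refl_on UNIV r"
    using r unfolding well_order_on_def linear_order_on_def partial_order_on_def preorder_on_def by auto
  show ?case
  proof (cases "(x, m) \<in> r")
    case True
    then show ?thesis using m by blast
  next
    case False
    then have "(m, x) \<in> r" using lin m unfolding total_on_def refl_on_def by (metis UNIV_I)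
    then have "\<forall>y\<in>insert x F. (y, x) \<in> r" using m lin unfolding trans_def refl_on_def by (metis UNIV_I insert_iff)
    then show ?thesis by blast
  qed
qed

text \<open>Subgroups of free abelian groups are free. The basis used here consists, for each possible leading
  position with respect to a well-order, of one element whose leading coefficient is minimal.\<close>

lemma additive_section:
  fixes d :: "('a \<Rightarrow>\<^sub>0 int) => ('b \<Rightarrow>\<^sub>0 int)"
  assumes d: "!!a b. d (a - b) = d a - d b"
  obtains s :: "('b \<Rightarrow>\<^sub>0 int) => ('a \<Rightarrow>\<^sub>0 int)" where
    "!!x y. x \<in> d ` span_of S ==> y \<in> d ` span_of S ==> s (x - y) = s x - s y"
    "!!y. y \<in> d ` span_of S ==> s y \<in> span_of S \<and> d (s y) = y"
proof -
  obtain r :: "'b rel" where r: "well_order_on UNIV r" using well_order_on by blast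
  have lin: "total_on UNIV r" "trans r" "antisym r" "refl_on UNIV r" and wf: "wf (r - Id)"
    using r unfolding well_order_on_def linear_order_on_def partial_order_on_def preorder_on_def by auto
  define I where "I = d ` span_of S"
  have I_diff: "x - y \<in> I" if "x \<in> I" "y \<in> I" for x y
    using that unfolding I_def by (auto simp flip: d intro!: imageI span_of_diff)
  have I_cmul: "cmul k x \<in> I" if "x \<in> I" for k x
    using that unfolding I_def by (auto simp flip: additive_cmul[of d, OF d] intro!: imageI span_of_cmul)
  have I0: "0 \<in> I" unfolding I_def using d[of 0 0] by (auto intro!: image_eqI[of _ _ 0])
  \<comment> \<open>The coefficient of \<open>y\<close> at such a \<open>b\<close> is the leading
    one, possibly zero.\<close>
  define below where "below b y \<longleftrightarrow> (\<forall>x\<in>supp y. (x, b) \<in> r)" for b and y :: "'b \<Rightarrow>\<^sub>0 int"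
  have below_diff: "below b (x - y)" if "below b x" "below b y" for b x y
    using that keys_diff[of x y] unfolding below_def by blast
  have below_cmul: "below b (cmul k x)" if "below b x" for b x k using that unfolding below_def by simp
  define Q where "Q b k \<longleftrightarrow> k > 0 \<and> (\<exists>y\<in>I. below b y \<and> wt y b = int k)" for b and k :: nat
  define B where "B = {b. \<exists>k. Q b k}"
  define L where "L b = Least (Q b)" for b
  have QL: "Q b (L b)" if "b \<in> B" for b
    unfolding L_def by (rule LeastI_ex[of "Q b"]) (use that in \<open>simp add: B_def\<close>)
  define N where "N b = int (L b)" for b
  have "\<exists>y. b \<in> B --> y \<in> I \<and> below b y \<and> wt y b = N b" for b
  proof (cases "b \<in> B")
    case True
    then obtain y where "y \<in> I" "below b y" "wt y b = int (L b)" using QL[of b] unfolding Q_def by blast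
    then show ?thesis unfolding N_def by blast
  qed simp
  from choice[OF allI[OF this]] obtain Y
    where "\<forall>b. b \<in> B --> Y b \<in> I \<and> below b (Y b) \<and> wt (Y b) b = N b" ..
  then have Y: "!!b. b \<in> B ==> Y b \<in> I" "!!b. b \<in> B ==> below b (Y b)"
    "!!b. b \<in> B ==> wt (Y b) b = N b" by simp_all
  have Npos: "N b > 0" if "b \<in> B" for b using QL[OF that] unfolding N_def Q_def by simp
  have Nmin: "N b \<le> k" if "y \<in> I" "below b y" "wt y b = k" "k > 0" for b y k
  proof -
    have "Q b (nat k)" unfolding Q_def using that by auto
    then show ?thesis unfolding N_def L_def using Least_le[of "Q b" "nat k"] that by simp
  qed
  \<comment> \<open>Division with remainder: a nonzero remainder would be a smaller positive leading
    coefficient at \<open>b\<close>.\<close>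
  have lead: "b \<in> B \<and> N b dvd wt y b"
    if y: "y \<in> I" "below b y" "wt y b \<noteq> 0" for b y
  proof -
    have bB: "b \<in> B"
    proof (cases "wt y b > 0")
      case True
      then have "Q b (nat (wt y b))" unfolding Q_def using y by auto
      then show ?thesis unfolding B_def by blast
    next
      case False
      have "Q b (nat (- wt y b))" unfolding Q_def using y False I_cmul[OF y(1), of "-1"] below_cmul[OF y(2), of "-1"]
        by (auto intro!: bexI[of _ "- y"])
      then show ?thesis unfolding B_def by blast
    qed
    let ?q = "wt y b div N b" and ?m = "wt y b mod N b"
    have "wt (y - cmul ?q (Y b)) b = ?m" using Y(3)[OF bB] by (simp add: lookup_minus minus_div_mult_eq_mod)
    then have "\<not> ?m > 0"
      using Nmin[of "y - cmul ?q (Y b)" b ?m] I_diff I_cmul Y(1,2)[OF bB] y below_diff below_cmul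
        Npos[OF bB] pos_mod_bound[of "N b" "wt y b"] by (metis linorder_not_less)
    then have "?m = 0" using pos_mod_sign[OF Npos[OF bB]] by (simp add: order_less_le)
    then show ?thesis using bB by auto
  qed
  have max: "\<exists>b\<in>supp y. below b y" if "y \<noteq> 0" for y :: "'b \<Rightarrow>\<^sub>0 int"
    unfolding below_def using finite_order_maximum[OF r, of "supp y"] that by auto
  \<comment> \<open>The largest position \<open>b\<close> of \<open>k\<close> survives in the
    combination: the other \<open>Y i\<close> that occur have smaller leading positions.\<close>
  have unique: "k = 0" if k: "supp k \<subseteq> B" "frag_extend Y k = 0" for k
  proof (rule ccontr)
    assume "k \<noteq> 0"
    then obtain b where b: "b \<in> supp k" "below b k" using max by blast
    have "wt (frag_extend Y k) b =
       (\<Sum>i\<in>supp k. wt k i * wt (Y i) b)" unfolding frag_extend_def by (simp add: lookup_sum)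
    also have "\<dots> = wt k b * wt (Y b) b"
    proof -
      have "wt (Y i) b = 0" if i: "i \<in> supp k" "i \<noteq> b" for i
      proof (rule ccontr)
        assume "wt (Y i) b \<noteq> 0"
        then have "(b, i) \<in> r" using Y(2) i k(1) unfolding below_def by (metis in_keys_iff subsetD)
        moreover have "(i, b) \<in> r" using b i unfolding below_def by blast
        ultimately show False using lin(3) i(2) unfolding antisym_def by blast
      qed
      then show ?thesis using b(1) by (subst sum.remove[OF finite_keys b(1)]) simp
    qed
    finally have "wt k b * N b = 0" using k Y(3) b(1) by (metis lookup_zero subsetD)
    moreover have "b \<in> B" using b(1) k(1) by blast
    ultimately show False using Npos[of b] b(1) by (simp add: in_keys_iff)
  qed
  have exist: "\<exists>k. supp k \<subseteq> B \<and> frag_extend Y k = y" if "y \<in> I" for y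
  proof (cases "y = 0")
    case True
    then show ?thesis by (intro exI[of _ 0]) auto
  next
    case False
    then obtain b where "b \<in> supp y" "below b y" using max by blast
    \<comment> \<open>Subtracting the right multiple of \<open>Y b\<close> lowers the leading
      position, and the order is well-founded.\<close>
    then show ?thesis using that
    proof (induction b arbitrary: y rule: wf_induct_rule[OF wf])
      case (1 b)
      have b: "b \<in> B" "N b dvd wt y b" using lead 1 by (auto simp: in_keys_iff)
      define q where "q = wt y b div N b"
      define y' where "y' = y - cmul q (Y b)"
      have y'I: "y' \<in> I" and y'b: "below b y'"
        unfolding y'_def using 1 b Y I_diff I_cmul below_diff below_cmul by auto
      have y'0: "wt y' b = 0" using b Y(3)[OF b(1)] by (simp add: y'_def q_def lookup_minus)
      have "\<exists>k. supp k \<subseteq> B \<and> frag_extend Y k = y'"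
      proof (cases "y' = 0")
        case True
        then show ?thesis by (intro exI[of _ 0]) auto
      next
        case False
        then obtain b' where b': "b' \<in> supp y'" "below b' y'" using max by blast
        then have "(b', b) \<in> r - Id" using y'b y'0 unfolding below_def by (auto simp: in_keys_iff)
        then show ?thesis using 1(1) b' y'I by blast
      qed
      then obtain k where k: "supp k \<subseteq> B" "frag_extend Y k = y'" by blast
      have "frag_extend Y (k + cmul q (frag_of b)) = y" by (simp add: frag_extend_add frag_extend_cmul k y'_def)
      moreover have "supp (k + cmul q (frag_of b)) \<subseteq> B"
        using span_of_add[of k B "cmul q (frag_of b)"] span_of_cmul[of "frag_of b" B q] k(1) b(1)
        unfolding span_of_def by simp
      ultimately show ?case by blast
    qed
  qed
  obtain K where K: "!!y. y \<in> I ==> supp (K y) \<subseteq> B" "!!y. y \<in> I ==> frag_extend Y (K y) = y"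
    using exist by metis
  have K_diff: "K (x - y) = K x - K y" if "x \<in> I" "y \<in> I" for x y
  proof -
    have "K (x - y) - (K x - K y) = 0"
    proof (rule unique)
      show "supp (K (x - y) - (K x - K y)) \<subseteq> B"
      proof -
        have s: "K y \<in> span_of B" if "y \<in> I" for y using K(1)[OF that] by (simp add: span_of_def)
        have "K (x - y) - (K x - K y) \<in> span_of B" by (intro span_of_diff s I_diff that)
        then show ?thesis unfolding span_of_def by (rule CollectD)
      qed
      show "frag_extend Y (K (x - y) - (K x - K y)) = 0" by (simp add: frag_extend_diff K I_diff that)
    qed
    then show ?thesis by simp
  qed
  have "\<exists>x. b \<in> B --> x \<in> span_of S \<and> d x = Y b" for b
    using Y(1)[of b] unfolding I_def by (metis imageE)
  then obtain x where x: "!!b. b \<in> B ==> x b \<in> span_of S" "!!b. b \<in> B ==> d (x b) = Y b" by metis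
  show thesis
  proof (rule that[of "%y. frag_extend x (K y)"])
    fix y z assume "y \<in> d ` span_of S" "z \<in> d ` span_of S"
    then show "frag_extend x (K (y - z)) = frag_extend x (K y) - frag_extend x (K z)"
      by (simp add: K_diff frag_extend_diff flip: I_def)
  next
    fix y assume y: "y \<in> d ` span_of S"
    then have ky: "supp (K y) \<subseteq> B" using K(1) by (simp add: I_def)
    have "d (frag_extend x (K y)) = frag_extend Y (K y)"
      unfolding additive_extend[of d, OF d] using ky x(2) by (intro frag_extend_eq) auto
    then show "frag_extend x (K y) \<in> span_of S \<and> d (frag_extend x (K y)) = y"
      using K(2)[of y] y ky x(1) by (auto simp: I_def intro!: span_of_extend)
  qed
qed

text \<open>A section \<open>s\<close> of \<open>d\<close> over its image gives the projection
  \<open>c - s (d c)\<close>: the kernel is a direct summand.\<close>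

lemma kernel_retraction:
  fixes d :: "('a \<Rightarrow>\<^sub>0 int) => ('b \<Rightarrow>\<^sub>0 int)"
  assumes d: "!!a b. d (a - b) = d a - d b"
  obtains r :: "('a \<Rightarrow>\<^sub>0 int) => ('a \<Rightarrow>\<^sub>0 int)" where
    "!!c. c \<in> span_of S ==> r c \<in> span_of S \<and> d (r c) = 0"
    "!!c. c \<in> span_of S ==> d c = 0 ==> r c = c"
    "!!a b. a \<in> span_of S ==> b \<in> span_of S ==> r (a - b) = r a - r b"
proof -
  obtain s where s:
    "!!x y. x \<in> d ` span_of S ==> y \<in> d ` span_of S ==> s (x - y) = s x - s y"
    "!!y. y \<in> d ` span_of S ==> s y \<in> span_of S \<and> d (s y) = y"
    using additive_section[of d S, OF d] by blast
  have s0: "s 0 = 0"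
  proof -
    have "0 \<in> d ` span_of S" using d[of 0 0] by (auto intro!: image_eqI[of _ _ 0])
    then show ?thesis using s(1)[of 0 0] by simp
  qed
  show thesis
  proof (rule that[of "%c. c - s (d c)"])
    fix c assume "c \<in> span_of S"
    then show "c - s (d c) \<in> span_of S \<and> d (c - s (d c)) = 0"
      using s(2)[of "d c"] by (simp add: span_of_diff d)
  next
    fix a b assume "a \<in> span_of S" "b \<in> span_of S"
    then have "s (d a - d b) = s (d a) - s (d b)" by (intro s(1)) auto
    then show "a - b - s (d (a - b)) = a - s (d a) - (b - s (d b))" by (simp add: d)
  qed (simp add: s0)
qed

section \<open>Evaluation of integer cochains\<close>

text \<open>Integer-valued functions serve as cochains for all coefficients modulo \<open>m\<close>,
  their values being compared by divisibility. Values on functions that are not simplices of the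
  space are arbitrary.\<close>

definition ev :: "('b => int) => ('b \<Rightarrow>\<^sub>0 int) => int" where
  "ev \<phi> c = (\<Sum>s\<in>supp c. wt c s * \<phi> s)"

lemma ev_superset: "finite A ==> supp c \<subseteq> A ==> ev \<phi> c = (\<Sum>s\<in>A. wt c s * \<phi> s)"
  unfolding ev_def by (rule sum.mono_neutral_left) (auto simp: in_keys_iff)

lemma ev_0 [simp]: "ev \<phi> 0 = 0" by (simp add: ev_def)

lemma ev_of [simp]: "ev \<phi> (frag_of s) = \<phi> s" by (simp add: ev_def)

lemma ev_cmul [simp]: "ev \<phi> (cmul k c) = k * ev \<phi> c"
  by (subst ev_superset[of "supp c"]) (auto simp: keys_cmul ev_def sum_distrib_left mult_ac)

lemma ev_add: "ev \<phi> (a + b) = ev \<phi> a + ev \<phi> b"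
proof -
  let ?A = "supp a \<union> supp b"
  have "supp (a + b) \<subseteq> ?A" using keys_add[of a b] .
  then show ?thesis by (simp add: ev_superset[of ?A] lookup_add distrib_right sum.distrib)
qed

lemma ev_uminus: "ev \<phi> (- a) = - ev \<phi> a" using ev_cmul[of \<phi> "-1" a] by simp

lemma ev_diff: "ev \<phi> (a - b) = ev \<phi> a - ev \<phi> b"
  using ev_add[of \<phi> a "- b"] ev_uminus[of \<phi> b] by simp

lemma ev_sum: "ev \<phi> (sum f I) = (\<Sum>i\<in>I. ev \<phi> (f i))"
  by (induction I rule: infinite_finite_induct) (auto simp: ev_add)

lemma ev_extend: "ev \<phi> (frag_extend f c) = ev (%s. ev \<phi> (f s)) c"
  by (simp add: frag_extend_def ev_sum) (simp add: ev_def)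

lemma ev_cong: "(!!s. s \<in> supp c ==> \<phi> s = \<psi> s) ==> ev \<phi> c = ev \<psi> c" by (simp add: ev_def)

lemma ev_dvd: "(!!s. s \<in> supp c ==> m dvd \<phi> s) ==> m dvd ev \<phi> c"
  unfolding ev_def by (intro dvd_sum dvd_mult) auto

lemma ev_fun_add: "ev (%s. \<phi> s + \<psi> s) c = ev \<phi> c + ev \<psi> c"
  by (simp add: ev_def distrib_left sum.distrib)

lemma ev_fun_diff: "ev (%s. \<phi> s - \<psi> s) c = ev \<phi> c - ev \<psi> c"
  by (simp add: ev_def right_diff_distrib sum_subtractf)

lemma ev_fun_cmul: "ev (%s. k * \<phi> s) c = k * ev \<phi> c" by (simp add: ev_def sum_distrib_left mult_ac)

lemma ev_cong_mod: "(!!s. s \<in> supp c ==> m dvd \<phi> s - \<psi> s) ==> m dvd ev \<phi> c - ev \<psi> c"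
  using ev_dvd[of c m "%s. \<phi> s - \<psi> s"] by (simp add: ev_fun_diff)

text \<open>The boundary operators are abstract so that relative and small chains are covered.\<close>

lemma cochain_vanishing_on_cycles:
  fixes d1 :: "('a \<Rightarrow>\<^sub>0 int) => ('b \<Rightarrow>\<^sub>0 int)" and d0 :: "('b \<Rightarrow>\<^sub>0 int) => ('c \<Rightarrow>\<^sub>0 int)"
  assumes d1: "!!a b. d1 (a - b) = d1 a - d1 b" and d0: "!!a b. d0 (a - b) = d0 a - d0 b"
    and exact: "!!z. z \<in> span_of S0 ==> d0 z = 0 ==> \<exists>w\<in>span_of S1. d1 w = z"
    and comp: "!!w. w \<in> span_of S1 ==> d1 w \<in> span_of S0 \<and> d0 (d1 w) = 0"
    and van: "!!w. w \<in> span_of S1 ==> d1 w = 0 ==> m dvd ev \<phi> w"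
  obtains \<eta> :: "'b => int" where "!!w. w \<in> span_of S1 ==> m dvd ev \<phi> w - ev \<eta> (d1 w)"
    "!!s. s \<notin> S0 ==> \<eta> s = 0"
proof -
  obtain r where r:
    "!!c. c \<in> span_of S0 ==> r c \<in> span_of S0 \<and> d0 (r c) = 0"
    "!!c. c \<in> span_of S0 ==> d0 c = 0 ==> r c = c"
    "!!a b. a \<in> span_of S0 ==> b \<in> span_of S0 ==> r (a - b) = r a - r b"
    using kernel_retraction[of d0 S0, OF d0] by blast
  \<comment> \<open>Each basis element is projected to a cycle, which bounds; \<open>\<eta>\<close>
    is then the value of \<open>\<phi>\<close> on a bounding chain.\<close>
  have "\<exists>w. s \<in> S0 --> w \<in> span_of S1 \<and> d1 w = r (frag_of s)" for s
    using exact[of "r (frag_of s)"] r(1)[of "frag_of s"] by (auto simp: span_of_def)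
  then obtain w where w: "!!s. s \<in> S0 ==> w s \<in> span_of S1" "!!s. s \<in> S0 ==> d1 (w s) = r (frag_of s)"
    by metis
  define \<eta> where "\<eta> s = (if s \<in> S0 then ev \<phi> (w s) else 0)" for s
  have rext: "r c = frag_extend (%s. r (frag_of s)) c" if "c \<in> span_of S0" for c
  proof -
    have "supp c \<subseteq> S0" using that by (simp add: span_of_def)
    then have "c \<in> span_of S0 \<and> r c = frag_extend (%s. r (frag_of s)) c"
    proof (induction c rule: frag_induction)
      case zero
      then show ?case using r(2)[of 0] d0[of 0 0] by simp
    next
      case (one s)
      then show ?case by (simp add: span_of_def)
    next
      case (diff a b)
      then show ?case by (simp add: frag_extend_diff r(3) span_of_diff)
    qed
    then show ?thesis by blast
  qed
  have "m dvd ev \<phi> c - ev \<eta> (d1 c)" if c: "c \<in> span_of S1" for c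
  proof -
    let ?b = "d1 c"
    have b: "?b \<in> span_of S0" "d0 ?b = 0" using comp[OF c] by auto
    then have bk: "s \<in> supp ?b ==> s \<in> S0" for s by (auto simp: span_of_def)
    \<comment> \<open>Subtracting this chain from \<open>c\<close> leaves a cycle, on which
      \<open>\<phi>\<close> vanishes modulo \<open>m\<close>.\<close>
    have wS: "frag_extend w ?b \<in> span_of S1" using bk w(1) by (intro span_of_extend) auto
    have "d1 (frag_extend w ?b) = frag_extend (%s. r (frag_of s)) ?b"
      unfolding additive_extend[of d1, OF d1] using bk w(2) by (intro frag_extend_eq) auto
    also have "\<dots> = ?b" using rext[OF b(1)] r(2)[OF b] by simp
    finally have "m dvd ev \<phi> (c - frag_extend w ?b)" using van[OF span_of_diff[OF c wS]] by (simp add: d1)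
    moreover have "ev \<phi> (frag_extend w ?b) = ev \<eta> ?b"
      unfolding ev_extend using bk by (intro ev_cong) (simp add: \<eta>_def)
    ultimately show ?thesis by (simp add: ev_diff)
  qed
  then show thesis using that[of \<eta>] by (simp add: \<eta>_def)
qed

section \<open>Cup and cap products\<close>

abbreviation shift :: "nat => (nat => real) => nat => real" where
  "shift k x \<equiv> %i. if i < k then 0 else x (i - k)"

lemma shift_in_standard_simplex:
  assumes "x \<in> Simplex l"
  shows "shift k x \<in> Simplex (k + l)"
proof -
  have "(\<Sum>i\<le>k + l. shift k x i) = (\<Sum>i\<in>(+) k ` {..l}. shift k x i)"
  proof (rule sum.mono_neutral_right)
    show "\<forall>i\<in>{..k + l} - (+) k ` {..l}. shift k x i = 0"
    proof
      fix i assume i: "i \<in> {..k + l} - (+) k ` {..l}"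
      have "i < k"
      proof (rule ccontr)
        assume "\<not> i < k"
        then have "i = k + (i - k)" "i - k \<le> l" using i by auto
        then show False using i by blast
      qed
      then show "shift k x i = 0" by simp
    qed
  qed auto
  also have "\<dots> = (\<Sum>i\<le>l. x i)" by (simp add: sum.reindex)
  finally show ?thesis using assms by (auto simp: standard_simplex_def)
qed

lemma standard_simplex_zero: "x \<in> Simplex p ==> i > p ==> x i = 0" by (simp add: standard_simplex_def)

lemma front_face_apply: "x \<in> Simplex k ==> front_face k s x = s x" by (simp add: front_face_def)

lemma back_face_apply: "x \<in> Simplex l ==> back_face k l s x = s (shift k x)" by (simp add: back_face_def)

lemma singular_face_apply: "x \<in> Simplex (p - 1) ==> singular_face p i s x = s (simplical_face i x)"
  by (simp add: singular_face_def)

lemma face_eqI: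
  assumes "f \<in> extensional (Simplex p)" "g \<in> extensional (Simplex p)"
    and "!!x. x \<in> Simplex p ==> f x = g x"
  shows "f = g" using assms extensionalityI by blast

lemma face_extensional [simp]: "front_face k s \<in> extensional (Simplex k)"
  "back_face k l s \<in> extensional (Simplex l)"
  "singular_face (Suc p) i s \<in> extensional (Simplex p)"
  "simplex_map p f s \<in> extensional (Simplex p)"
  by (simp_all add: front_face_def back_face_def singular_face_def simplex_map_def)

lemma simplical_face_Suc_in: "i \<le> Suc p ==> x \<in> Simplex p ==> simplical_face i x \<in> Simplex (Suc p)"
  using simplical_face_in_standard_simplex[of "Suc p" i x] by simp

lemma singular_face_Suc_apply: "x \<in> Simplex p ==> singular_face (Suc p) i s x = s (simplical_face i x)"
  using singular_face_apply[of x "Suc p"] by simp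

lemma simplical_face_shift_low: "i \<le> k ==> simplical_face i (shift k x) = shift (Suc k) x"
  by (auto simp: simplical_face_def fun_eq_iff)

lemma simplical_face_shift_high: "i > k ==> simplical_face i (shift k x) = shift k (simplical_face (i - k) x)"
  by (auto simp: simplical_face_def fun_eq_iff Suc_diff_le diff_Suc split: nat.splits)
    (metis diff_commute diff_Suc_1 One_nat_def)?

lemma simplical_face_id: "i > k ==> x \<in> Simplex k ==> simplical_face i x = x"
  by (auto simp: simplical_face_def fun_eq_iff standard_simplex_zero)

context
  fixes k l :: nat
begin

lemma front_face_singular_face_low:
  assumes "i \<le> k"
  shows "front_face k (singular_face (Suc (k + l)) i s) = singular_face (Suc k) i (front_face (Suc k) s)"
proof (rule face_eqI)
  fix x assume x: "x \<in> Simplex k"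
  then have "x \<in> Simplex (k + l)" "simplical_face i x \<in> Simplex (Suc k)"
    using standard_simplex_mono[of k "k + l"] simplical_face_Suc_in[of i k x] assms by auto
  then show "front_face k (singular_face (Suc (k + l)) i s) x = singular_face (Suc k) i (front_face (Suc k) s) x"
    using x by (simp add: front_face_apply singular_face_Suc_apply)
qed simp_all

lemma back_face_singular_face_low:
  assumes "i \<le> k"
  shows "back_face k l (singular_face (Suc (k + l)) i s) = back_face (Suc k) l s"
proof (rule face_eqI)
  fix x assume x: "x \<in> Simplex l"
  show "back_face k l (singular_face (Suc (k + l)) i s) x = back_face (Suc k) l s x"
    using x shift_in_standard_simplex[OF x, of k] simplical_face_shift_low[OF assms, of x]
    by (simp only: back_face_apply singular_face_Suc_apply)
qed simp_all

lemma front_face_singular_face_high: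
  assumes "i > k"
  shows "front_face k (singular_face (Suc (k + l)) i s) = front_face k s"
proof (rule face_eqI)
  fix x assume x: "x \<in> Simplex k"
  then have "x \<in> Simplex (k + l)" using standard_simplex_mono[of k "k + l"] by auto
  then show "front_face k (singular_face (Suc (k + l)) i s) x = front_face k s x"
    using x by (simp add: front_face_apply singular_face_Suc_apply simplical_face_id[OF assms])
qed simp_all

lemma back_face_singular_face_high:
  assumes "i > k" "i \<le> Suc (k + l)"
  shows "back_face k l (singular_face (Suc (k + l)) i s) = singular_face (Suc l) (i - k) (back_face k (Suc l) s)"
proof (rule face_eqI)
  fix x assume x: "x \<in> Simplex l"
  have "simplical_face (i - k) x \<in> Simplex (Suc l)" using x assms by (intro simplical_face_Suc_in) auto
  then show "back_face k l (singular_face (Suc (k + l)) i s) x = singular_face (Suc l) (i - k) (back_face k (Suc l) s) x"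
    using x shift_in_standard_simplex[OF x, of k] simplical_face_shift_high[OF assms(1), of x]
    by (simp only: back_face_apply singular_face_Suc_apply)
qed simp_all

lemma singular_face_last_front_face:
  "singular_face (Suc k) (Suc k) (front_face (Suc k) s) = front_face k s"
proof (rule face_eqI)
  fix x assume x: "x \<in> Simplex k"
  have "simplical_face (Suc k) x = x" using x by (intro simplical_face_id) auto
  moreover have "x \<in> Simplex (Suc k)" using x standard_simplex_mono[of k "Suc k"] by auto
  ultimately show "singular_face (Suc k) (Suc k) (front_face (Suc k) s) x = front_face k s x"
    using x by (simp add: front_face_apply singular_face_Suc_apply)
qed simp_all

lemma singular_face_first_back_face:
  "singular_face (Suc l) 0 (back_face k (Suc l) s) = back_face (Suc k) l s"
proof (rule face_eqI)
  fix x assume x: "x \<in> Simplex l"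
  have "simplical_face 0 x \<in> Simplex (Suc l)" using x by (intro simplical_face_Suc_in) auto
  moreover have "shift k (simplical_face 0 x) = shift (Suc k) x" by (auto simp: simplical_face_def fun_eq_iff)
  ultimately show "singular_face (Suc l) 0 (back_face k (Suc l) s) x = back_face (Suc k) l s x"
    using x by (simp only: back_face_apply singular_face_Suc_apply)
qed simp_all

end

section \<open>Coboundaries, the Leibniz rule and cocycles\<close>

definition cobdry :: "nat => (((nat => real) => 'a) => int) => ((nat => real) => 'a) => int" where
  "cobdry k \<phi> t = ev \<phi> (bdry (Suc k) (frag_of t))"

lemma chain_boundary_Suc: "bdry (Suc p) c =
    frag_extend (%f. \<Sum>i\<le>Suc p. cmul ((-1) ^ i) (frag_of (singular_face (Suc p) i f))) c"
  by (simp add: chain_boundary_def)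

lemma ev_cobdry: "ev (cobdry k \<phi>) c = ev \<phi> (bdry (Suc k) c)"
  unfolding chain_boundary_Suc ev_extend by (intro ev_cong) (simp add: cobdry_def chain_boundary_Suc del: sum.atMost_Suc)

lemma cap_chain_add: "cap k l (a + b) \<phi> = cap k l a \<phi> + cap k l b \<phi>"
  and cap_chain_diff: "cap k l (a - b) \<phi> = cap k l a \<phi> - cap k l b \<phi>"
  and cap_chain_0 [simp]: "cap k l 0 \<phi> = 0"
  and cap_chain_cmul: "cap k l (cmul n a) \<phi> = cmul n (cap k l a \<phi>)"
  by (simp_all add: cap_chain_def frag_extend_add frag_extend_diff frag_extend_cmul)

lemma cap_chain_of: "cap k l (frag_of s) \<phi> = cmul (\<phi> (front_face k s)) (frag_of (back_face k l s))"
  by (simp add: cap_chain_def)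

lemma cap_chain_sum: "cap k l (sum f I) \<phi> = (\<Sum>i\<in>I. cap k l (f i) \<phi>)"
  by (induction I rule: infinite_finite_induct) (auto simp: cap_chain_add)

lemma frag_extend_fun_add: "frag_extend (%x. f x + g x) c = frag_extend f c + frag_extend g c"
  by (simp add: frag_extend_def frag_cmul_distrib2 sum.distrib)

lemma frag_extend_fun_diff: "frag_extend (%x. f x - g x) c = frag_extend f c - frag_extend g c"
  by (simp add: frag_extend_def frag_cmul_diff sum_subtractf)

lemma frag_cmul_sum_left: "cmul (\<Sum>i\<in>I. f i) c = (\<Sum>i\<in>I. cmul (f i) c)"
  by (induction I rule: infinite_finite_induct) (auto simp: frag_cmul_distrib)

lemma cap_chain_fun_add: "cap k l c (%s. \<phi> s + \<psi> s) = cap k l c \<phi> + cap k l c \<psi>"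
  by (simp add: cap_chain_def frag_cmul_distrib frag_extend_fun_add)

lemma cap_chain_fun_diff: "cap k l c (%s. \<phi> s - \<psi> s) = cap k l c \<phi> - cap k l c \<psi>"
  by (simp add: cap_chain_def frag_cmul_diff_distrib frag_extend_fun_diff)

text \<open>Faces numbered at most \<open>k\<close> act on the front face, the others on the back
  face. The last term of the coboundary of \<open>\<phi>\<close> restores the zeroth face of the
  back face, which the faces of \<open>s\<close> do not produce.\<close>

lemma cap_chain_boundary_of:
  "bdry (Suc l) (cap k (Suc l) (frag_of s) \<phi>) =
   cmul ((-1) ^ k) (cap k l (bdry (Suc (k + l)) (frag_of s)) \<phi>
      - cap (Suc k) l (frag_of s) (cobdry k \<phi>))"
proof -
  let ?n = "Suc (k + l)"
  let ?B = "back_face k (Suc l) s" and ?f = "\<phi> (front_face k s)"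
  define G where "G = (%i. frag_of (singular_face (Suc l) i ?B))"
  define T where "T i = cmul ((-1) ^ i * \<phi> (singular_face (Suc k) i (front_face (Suc k) s)))
      (frag_of (back_face (Suc k) l s))" for i
  have low: "cmul ((-1) ^ i) (cap k l (frag_of (singular_face ?n i s)) \<phi>) = T i" if "i \<le> k" for i
    unfolding cap_chain_of T_def front_face_singular_face_low[OF that] back_face_singular_face_low[OF that] by simp
  have high: "cmul ((-1) ^ (Suc k + j)) (cap k l (frag_of (singular_face ?n (Suc k + j) s)) \<phi>) =
      cmul ((-1) ^ k * ?f) (cmul ((-1) ^ Suc j) (G (Suc j)))" if "j \<le> l" for j
    unfolding cap_chain_of G_def using that
    by (subst front_face_singular_face_high, simp, subst back_face_singular_face_high)
       (auto simp: power_add mult_ac)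
  have "cap k l (bdry ?n (frag_of s)) \<phi> =
      (\<Sum>i\<le>?n. cmul ((-1) ^ i) (cap k l (frag_of (singular_face ?n i s)) \<phi>))"
    by (simp add: chain_boundary_Suc cap_chain_sum cap_chain_cmul del: sum.atMost_Suc)
  also have "{..?n} = {..k} \<union> (+) (Suc k) ` {..l}"
  proof (intro equalityI subsetI)
    fix i assume "i \<in> {..?n}"
    then show "i \<in> {..k} \<union> (+) (Suc k) ` {..l}"
      by (cases "i \<le> k") (auto simp: image_iff intro!: bexI[of _ "i - Suc k"])
  qed auto
  also have "(\<Sum>i\<in>{..k} \<union> (+) (Suc k) ` {..l}. cmul ((-1) ^ i) (cap k l (frag_of (singular_face ?n i s)) \<phi>))
     = (\<Sum>i\<le>k. cmul ((-1) ^ i) (cap k l (frag_of (singular_face ?n i s)) \<phi>)) +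
       (\<Sum>i\<in>(+) (Suc k) ` {..l}. cmul ((-1) ^ i) (cap k l (frag_of (singular_face ?n i s)) \<phi>))"
    by (rule sum.union_disjoint) auto
  also have "(\<Sum>i\<le>k. cmul ((-1) ^ i) (cap k l (frag_of (singular_face ?n i s)) \<phi>)) = (\<Sum>i\<le>k. T i)"
    by (rule sum.cong) (auto simp: low)
  also have "(\<Sum>i\<in>(+) (Suc k) ` {..l}. cmul ((-1) ^ i) (cap k l (frag_of (singular_face ?n i s)) \<phi>)) =
     (\<Sum>j\<le>l. cmul ((-1) ^ (Suc k + j)) (cap k l (frag_of (singular_face ?n (Suc k + j) s)) \<phi>))"
    by (subst sum.reindex) (auto simp: o_def)
  also have "\<dots> = (\<Sum>j\<le>l. cmul ((-1) ^ k * ?f) (cmul ((-1) ^ Suc j) (G (Suc j))))"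
    by (rule sum.cong) (simp_all only: atMost_iff high)
  finally have 1: "cap k l (bdry ?n (frag_of s)) \<phi> = (\<Sum>i\<le>k. T i) +
     cmul ((-1) ^ k * ?f) (\<Sum>j\<le>l. cmul ((-1) ^ Suc j) (G (Suc j)))" by (simp only: frag_cmul_sum)
  have "cap (Suc k) l (frag_of s) (cobdry k \<phi>) = (\<Sum>i\<le>Suc k. T i)"
    unfolding cap_chain_of cobdry_def chain_boundary_Suc frag_extend_of ev_sum ev_cmul ev_of T_def
    by (simp only: frag_cmul_sum_left)
  also have "\<dots> = (\<Sum>i\<le>k. T i) + cmul ((-1) ^ Suc k * ?f) (G 0)"
    unfolding sum.atMost_Suc T_def singular_face_last_front_face G_def singular_face_first_back_face ..
  finally have 2: "cap (Suc k) l (frag_of s) (cobdry k \<phi>) =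
      (\<Sum>i\<le>k. T i) - cmul ((-1) ^ k * ?f) (G 0)" by simp
  have "bdry (Suc l) (cap k (Suc l) (frag_of s) \<phi>) =
     cmul ?f (\<Sum>i\<le>Suc l. cmul ((-1) ^ i) (G i))"
    unfolding cap_chain_of chain_boundary_cmul by (simp add: chain_boundary_Suc G_def del: sum.atMost_Suc)
  also have "(\<Sum>i\<le>Suc l. cmul ((-1) ^ i) (G i)) = G 0 + (\<Sum>j\<le>l. cmul ((-1) ^ Suc j) (G (Suc j)))"
    by (subst sum.atMost_Suc_shift) simp
  finally have 3: "bdry (Suc l) (cap k (Suc l) (frag_of s) \<phi>) =
     cmul ?f (G 0 + (\<Sum>j\<le>l. cmul ((-1) ^ Suc j) (G (Suc j))))" .
  have "(-1 :: int) ^ k * ((-1) ^ k * ?f) = ?f" by (simp flip: mult.assoc power_add)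
  then show ?thesis unfolding 1 2 3 by (simp add: frag_cmul_distrib2 frag_cmul_diff)
qed

lemma cap_chain_boundary:
  "bdry (Suc l) (cap k (Suc l) c \<phi>) =
   cmul ((-1) ^ k) (cap k l (bdry (Suc (k + l)) c) \<phi> - cap (Suc k) l c (cobdry k \<phi>))" using subset_UNIV
proof (induction c rule: frag_induction)
  case (one x)
  show ?case by (rule cap_chain_boundary_of)
next
  case (diff a b)
  then show ?case by (simp add: cap_chain_diff chain_boundary_diff frag_cmul_diff)
qed simp

text \<open>For \<open>m = 0\<close> divisibility forces the value zero, so integral cocycles are
  included.\<close>

definition cocyc :: "int => nat => 'a topology => (((nat => real) => 'a) => int) => bool" where
  "cocyc m k X \<phi> \<longleftrightarrow> (\<forall>c. schain (Suc k) X c --> m dvd ev \<phi> (bdry (Suc k) c))"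

lemma cocycI:
  assumes "!!t. singular_simplex (Suc k) X t ==> m dvd cobdry k \<phi> t"
  shows "cocyc m k X \<phi>" unfolding cocyc_def ev_cobdry[symmetric] using assms
  by (auto intro!: ev_dvd simp: singular_chain_def)

lemma cocycD: "cocyc m k X \<phi> ==> schain (Suc k) X c ==> m dvd ev \<phi> (bdry (Suc k) c)"
  by (simp add: cocyc_def)

lemma cocyc_cobdry: "cocyc m k X \<phi> ==> singular_simplex (Suc k) X t ==> m dvd cobdry k \<phi> t"
  by (simp add: cobdry_def cocyc_def singular_chain_of)

lemma cocyc_dvd: "cocyc m k X \<phi> ==> m' dvd m ==> cocyc m' k X \<phi>"
  unfolding cocyc_def using dvd_trans by blast

lemma front_face_singular:
  assumes "singular_simplex (k + l) X s"
  shows "singular_simplex k X (front_face k s)" "front_face k s ` Simplex k \<subseteq> s ` Simplex (k + l)"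
proof -
  have sub: "Simplex k \<subseteq> Simplex (k + l)" by (simp add: standard_simplex_mono)
  have "continuous_map (subtopology (powertop_real UNIV) (Simplex k)) X s"
    using assms sub unfolding singular_simplex_def by (meson continuous_map_from_subtopology_mono)
  then have "continuous_map (subtopology (powertop_real UNIV) (Simplex k)) X (front_face k s)"
    by (rule continuous_map_eq) (simp add: front_face_apply)
  then show "singular_simplex k X (front_face k s)" by (simp add: singular_simplex_def)
  show "front_face k s ` Simplex k \<subseteq> s ` Simplex (k + l)" using sub by (auto simp: front_face_apply)
qed

lemma back_face_singular:
  assumes "singular_simplex (k + l) X s"
  shows "singular_simplex l X (back_face k l s)" "back_face k l s ` Simplex l \<subseteq> s ` Simplex (k + l)"
proof -
  have "continuous_map (powertop_real UNIV) (powertop_real UNIV) (%x. shift k x)"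
    unfolding continuous_map_componentwise_UNIV by (auto intro: continuous_map_product_projection)
  then have "continuous_map (subtopology (powertop_real UNIV) (Simplex l))
     (subtopology (powertop_real UNIV) (Simplex (k + l))) (%x. shift k x)"
    using shift_in_standard_simplex by (auto simp: continuous_map_in_subtopology continuous_map_from_subtopology)
  then have "continuous_map (subtopology (powertop_real UNIV) (Simplex l)) X (s \<circ> (%x. shift k x))"
    using assms unfolding singular_simplex_def by (meson continuous_map_compose)
  then have "continuous_map (subtopology (powertop_real UNIV) (Simplex l)) X (back_face k l s)"
    by (rule continuous_map_eq) (simp add: back_face_apply)
  then show "singular_simplex l X (back_face k l s)" by (simp add: singular_simplex_def)
  show "back_face k l s ` Simplex l \<subseteq> s ` Simplex (k + l)"
    using shift_in_standard_simplex by (auto simp: back_face_apply)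
qed

lemma singular_chain_cap:
  "schain (k + l) X c ==> schain l X (cap k l c \<phi>)" unfolding cap_chain_def
  by (intro singular_chain_extend singular_chain_cmul)
     (auto simp: singular_chain_of singular_chain_def intro: back_face_singular)

lemma rchain_cap:
  assumes "schain (k + l) X c" "!!s. s \<in> supp c ==> m dvd \<phi> (front_face k s)"
  shows "rchain m l X {} (cap k l c \<phi>)" unfolding cap_chain_def frag_extend_def
proof (rule rchain_sum)
  fix s assume s: "s \<in> supp c"
  have "schain l X (frag_of (back_face k l s))"
    using assms(1) s by (auto simp: singular_chain_of singular_chain_def intro: back_face_singular)
  moreover obtain q where "\<phi> (front_face k s) = m * q" using assms(2)[OF s] by blast
  ultimately have "rchain m l X {} (cmul (\<phi> (front_face k s)) (frag_of (back_face k l s)))"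
    using rchain_cmul[of l X "cmul q (frag_of (back_face k l s))" m "{}"] by (simp add: singular_chain_cmul)
  then show "rchain m l X {} (cmul (wt c s)
      (cmul (\<phi> (front_face k s)) (frag_of (back_face k l s))))" by (rule rchain_scale)
qed

lemma cap_cocycle_boundary:
  assumes "cocyc m k X \<phi>" "schain (Suc (k + l)) X c"
  shows "rchain m l X {} (bdry (Suc l) (cap k (Suc l) c \<phi>) -
           cmul ((-1) ^ k) (cap k l (bdry (Suc (k + l)) c) \<phi>))"
proof -
  have "rchain m l X {} (cap (Suc k) l c (cobdry k \<phi>))"
  proof (rule rchain_cap)
    show "schain (Suc k + l) X c" using assms(2) by simp
    fix s assume "s \<in> supp c"
    then have "singular_simplex (Suc k + l) X s" using assms(2) by (auto simp: singular_chain_def)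
    then show "m dvd cobdry k \<phi> (front_face (Suc k) s)"
      using front_face_singular(1) cocyc_cobdry[OF assms(1)] by blast
  qed
  then have "rchain m l X {} (- cmul ((-1) ^ k) (cap (Suc k) l c (cobdry k \<phi>)))"
    by (intro rchain_uminus rchain_scale)
  then show ?thesis by (simp add: cap_chain_boundary frag_cmul_diff)
qed

definition cup :: "nat => nat => (((nat => real) => 'a) => int) => (((nat => real) => 'a) => int) =>
    ((nat => real) => 'a) => int" where
  "cup k l \<phi> \<psi> s = \<phi> (front_face k s) * \<psi> (back_face k l s)"

text \<open>Cup products are handled in this form: what is known about boundaries of cap products
  becomes a statement about cup products.\<close>

lemma ev_cup: "ev (cup k l \<phi> \<psi>) c = ev \<psi> (cap k l c \<phi>)"
  unfolding cap_chain_def ev_extend by (intro ev_cong) (simp add: cup_def)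

lemma ev_rchain_empty:
  assumes c: "rchain m k X {} c" shows "m dvd ev \<phi> c"
proof -
  have "m dvd wt c s" for s using c nonempty_standard_simplex unfolding rchain_iff_lookup by fastforce
  then show ?thesis unfolding ev_def by (intro dvd_sum dvd_mult2)
qed

lemma ev_cup_boundary:
  assumes "cocyc m k X \<phi>" "cocyc m l X \<psi>" "schain (Suc (k + l)) X c"
  shows "m dvd ev (cup k l \<phi> \<psi>) (bdry (Suc (k + l)) c)"
proof -
  have "m dvd ev \<psi> (bdry (Suc l) (cap k (Suc l) c \<phi>))"
    using assms by (intro cocycD[OF assms(2)] singular_chain_cap) simp
  moreover have "m dvd ev \<psi> (bdry (Suc l) (cap k (Suc l) c \<phi>)) -
      (-1) ^ k * ev \<psi> (cap k l (bdry (Suc (k + l)) c) \<phi>)"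
    using ev_rchain_empty[OF cap_cocycle_boundary[OF assms(1,3)], of \<psi>] by (simp add: ev_diff)
  ultimately have "m dvd (-1) ^ k * ev \<psi> (cap k l (bdry (Suc (k + l)) c) \<phi>)"
    by (simp add: dvd_diff_right_iff)
  then have "m dvd (-1) ^ k * ((-1) ^ k * ev \<psi> (cap k l (bdry (Suc (k + l)) c) \<phi>))" by (rule dvd_mult)
  then show ?thesis by (simp add: ev_cup flip: mult.assoc power_add)
qed

lemma cocyc_cup: "cocyc m k X \<phi> ==> cocyc m l X \<psi> ==> cocyc m (k + l) X (cup k l \<phi> \<psi>)"
  unfolding cocyc_def[of m "k + l"] using ev_cup_boundary by blast

abbreviation pull :: "nat => ('a => 'b) => (((nat => real) => 'b) => int) => ((nat => real) => 'a) => int" where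
  "pull k f \<phi> \<equiv> %s. \<phi> (simplex_map k f s)"

lemma ev_pull: "ev (pull k f \<phi>) c = ev \<phi> (chain_map k f c)"
  unfolding chain_map_def ev_extend by (simp add: o_def)

lemma cocyc_pull:
  assumes "cocyc m k Y \<phi>" "continuous_map X Y f"
  shows "cocyc m k X (pull k f \<phi>)" unfolding cocyc_def ev_pull
proof (intro allI impI)
  fix c assume c: "schain (Suc k) X c"
  show "m dvd ev \<phi> (chain_map k f (bdry (Suc k) c))"
    using cocycD[OF assms(1) singular_chain_chain_map[OF c assms(2)]] by (simp add: chain_boundary_chain_map[OF c])
qed

lemma front_face_simplex_map: "front_face k (simplex_map (k + l) f s) = simplex_map k f (front_face k s)"
proof (rule face_eqI)
  fix x assume x: "x \<in> Simplex k"
  then have "x \<in> Simplex (k + l)" using standard_simplex_mono[of k "k + l"] by auto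
  then show "front_face k (simplex_map (k + l) f s) x = simplex_map k f (front_face k s) x"
    using x by (simp add: front_face_apply simplex_map_def)
qed simp_all

lemma back_face_simplex_map: "back_face k l (simplex_map (k + l) f s) = simplex_map l f (back_face k l s)"
proof (rule face_eqI)
  fix x assume x: "x \<in> Simplex l"
  then show "back_face k l (simplex_map (k + l) f s) x = simplex_map l f (back_face k l s) x"
    using shift_in_standard_simplex[OF x, of k] by (simp add: back_face_apply simplex_map_def)
qed simp_all

lemma cap_chain_map:
  "cap k l (chain_map (k + l) f c) \<phi> = chain_map l f (cap k l c (pull k f \<phi>))" using subset_UNIV
proof (induction c rule: frag_induction)
  case (one x)
  then show ?case by (simp add: cap_chain_of front_face_simplex_map back_face_simplex_map)
next
  case (diff a b)
  then show ?case by (simp add: chain_map_diff cap_chain_diff)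
qed simp

lemma singular_face_face:
  assumes "i \<le> j" "j \<le> Suc p"
  shows "singular_face (Suc p) i (singular_face (Suc (Suc p)) (Suc j) s) =
         singular_face (Suc p) j (singular_face (Suc (Suc p)) i s)"
proof (rule face_eqI)
  fix x assume x: "x \<in> Simplex p"
  have 1: "simplical_face i x \<in> Simplex (Suc p)" "simplical_face j x \<in> Simplex (Suc p)"
    using assms x by (auto intro: simplical_face_Suc_in)
  have "simplical_face (Suc j) (simplical_face i x) = simplical_face i (simplical_face j x)"
    using assms(1) unfolding simplical_face_def by fastforce
  then show "singular_face (Suc p) i (singular_face (Suc (Suc p)) (Suc j) s) x =
         singular_face (Suc p) j (singular_face (Suc (Suc p)) i s) x" using 1 x by (simp add: singular_face_Suc_apply)
qed simp_all

text \<open>Steenrod's cup-one product of a 1-cochain and a 2-cochain, \<open>\<gamma>([0,2]) \<beta>([0,1,2])\<close>, gives the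
  commutativity of the cup product in these degrees.\<close>

lemma cup_commute_1_2:
  assumes \<gamma>: "cocyc m 1 X \<gamma>" and \<beta>: "cocyc m 2 X \<beta>" and c: "schain 3 X c" "bdry 3 c = 0"
  shows "m dvd ev (cup 1 2 \<gamma> \<beta>) c - ev (cup 2 1 \<beta> \<gamma>) c"
proof -
  define s where "s t = \<gamma> (singular_face 2 1 t) * \<beta> t" for t :: "(nat => real) => 'a"
  have key: "m dvd (cup 1 2 \<gamma> \<beta> \<sigma> - cup 2 1 \<beta> \<gamma> \<sigma>) - - cobdry 2 s \<sigma>" if \<sigma>: "singular_simplex 3 X \<sigma>" for \<sigma>
  proof -
    define d where "d i = singular_face 3 i \<sigma>" for i
    \<comment> \<open>The \<open>j\<close>-th edge of the \<open>i\<close>-th face. Every edge lies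
      in two faces; the relations \<open>fc\<close> record this.\<close>
    define e where "e i j = singular_face 2 j (d i)" for i j
    have sd: "singular_simplex 2 X (d i)" if "i \<le> 3" for i
      using singular_simplex_singular_face[OF \<sigma>, of i] that by (simp add: d_def numeral_2_eq_2 numeral_3_eq_3)
    have fc: "e (Suc j) i = e i j" if "i \<le> j" "j \<le> 2" for i j
      using singular_face_face[of i j 1 \<sigma>] that by (simp add: e_def d_def numeral_2_eq_2 numeral_3_eq_3)
    have b\<beta>: "m dvd \<beta> (d 0) - \<beta> (d 1) + \<beta> (d 2) - \<beta> (d 3)"
    proof -
      have "{..3::nat} = {0,1,2,3}" by auto
      then have "cobdry 2 \<beta> \<sigma> = \<beta> (d 0) - \<beta> (d 1) + \<beta> (d 2) - \<beta> (d 3)"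
        by (simp add: cobdry_def chain_boundary_of ev_sum ev_add ev_diff d_def)
      then show ?thesis using cocyc_cobdry[OF \<beta>, of \<sigma>] \<sigma> by simp
    qed
    have cs: "cobdry 2 s \<sigma> = s (d 0) - s (d 1) + s (d 2) - s (d 3)"
    proof -
      have "{..3::nat} = {0,1,2,3}" by auto
      then show ?thesis by (simp add: cobdry_def chain_boundary_of ev_sum ev_add ev_diff d_def)
    qed
    have b\<gamma>: "m dvd \<gamma> (e i 0) - \<gamma> (e i 1) + \<gamma> (e i 2)" if "i \<le> 3" for i
    proof -
      have "{..2::nat} = {0,1,2}" by auto
      then have "cobdry 1 \<gamma> (d i) = \<gamma> (e i 0) - \<gamma> (e i 1) + \<gamma> (e i 2)"
        by (simp add: cobdry_def chain_boundary_of ev_sum ev_add ev_diff e_def numeral_2_eq_2)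
      then show ?thesis using cocyc_cobdry[OF \<gamma>, of "d i"] sd[OF that] by (simp add: numeral_2_eq_2)
    qed
    have f2: "front_face 2 \<sigma> = d 3" and b2: "back_face 1 2 \<sigma> = d 0" and f1: "front_face 1 \<sigma> = e 2 2"
      and b1: "back_face 2 1 \<sigma> = e 1 0"
    proof -
      have fr: "front_face 3 \<sigma> = \<sigma>"
        using \<sigma> unfolding front_face_def singular_simplex_def by (simp add: extensional_restrict)
      show "front_face 2 \<sigma> = d 3" using singular_face_last_front_face[of 2 \<sigma>] fr by (simp add: d_def)
      then have "front_face 1 \<sigma> = e 3 2"
        using singular_face_last_front_face[of 1 \<sigma>] by (simp add: e_def numeral_2_eq_2)
      then show "front_face 1 \<sigma> = e 2 2" using fc[of 2 2] by simp
      have bk: "back_face 0 3 \<sigma> = \<sigma>"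
        using \<sigma> unfolding back_face_def singular_simplex_def by (simp add: extensional_restrict)
      show "back_face 1 2 \<sigma> = d 0" using singular_face_first_back_face[of 2 0 \<sigma>] bk by (simp add: d_def)
      then have "back_face 2 1 \<sigma> = e 0 0"
        using singular_face_first_back_face[of 1 1 \<sigma>] by (simp add: e_def numeral_2_eq_2)
      then show "back_face 2 1 \<sigma> = e 1 0" using fc[of 0 0] by simp
    qed
    have E: "e 0 1 = e 2 0" "e 1 1 = e 2 1" "e 3 1 = e 1 2"
      using fc[of 0 1] fc[of 1 1] fc[of 1 2] by (simp_all add: numeral_2_eq_2 numeral_3_eq_3)
    \<comment> \<open>The digits name the end vertices of the edge in the tetrahedron.\<close>
    define g01 g02 g03 g13 g23 where "g01 = \<gamma> (e 2 2)" and "g02 = \<gamma> (e 1 2)" and "g03 = \<gamma> (e 2 1)"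
      and "g13 = \<gamma> (e 2 0)" and "g23 = \<gamma> (e 1 0)"
    have A: "m dvd g13 - g03 + g01" "m dvd g23 - g03 + g02"
      using b\<gamma>[of 2] b\<gamma>[of 1] E by (simp_all add: g01_def g02_def g03_def g13_def g23_def)
    have "(cup 1 2 \<gamma> \<beta> \<sigma> - cup 2 1 \<beta> \<gamma> \<sigma>) - - cobdry 2 s \<sigma> =
       g01 * \<beta> (d 0) - \<beta> (d 3) * g23 + (g13 * \<beta> (d 0) - g03 * \<beta> (d 1) + g03 * \<beta> (d 2) - g02 * \<beta> (d 3))"
      unfolding cup_def cs f1 f2 b1 b2 s_def e_def[symmetric] E by (simp add: g01_def g02_def g03_def g13_def g23_def)
    \<comment> \<open>The difference is a combination of two values of the coboundary of
      \<open>\<gamma>\<close> and one of that of \<open>\<beta>\<close>.\<close>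
    also have "\<dots> = \<beta> (d 0) * (g13 - g03 + g01) - \<beta> (d 3) * (g23 - g03 + g02)
        + g03 * (\<beta> (d 0) - \<beta> (d 1) + \<beta> (d 2) - \<beta> (d 3))" by (simp add: algebra_simps)
    also have "m dvd \<dots>" by (rule dvd_add[OF dvd_diff[OF dvd_mult[OF A(1)] dvd_mult[OF A(2)]] dvd_mult[OF b\<beta>]])
    finally show ?thesis .
  qed
  have "m dvd ev (%\<sigma>. cup 1 2 \<gamma> \<beta> \<sigma> - cup 2 1 \<beta> \<gamma> \<sigma>) c - ev (%\<sigma>. - cobdry 2 s \<sigma>) c"
    using c(1) by (intro ev_cong_mod key) (auto simp: singular_chain_def)
  moreover have "ev (%\<sigma>. - cobdry 2 s \<sigma>) c = 0"
    using ev_fun_cmul[of "-1" "cobdry 2 s" c] c(2) by (simp add: ev_cobdry numeral_3_eq_3)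
  ultimately show ?thesis by (simp add: ev_fun_diff)
qed

text \<open>The kernel of \<open>d\<close> is a direct summand, so a functional on it that is
  additive modulo \<open>m\<close> is represented by a cochain: evaluate it on the retraction of
  each simplex.\<close>

lemma functional_extension:
  fixes d :: "('a \<Rightarrow>\<^sub>0 int) => ('b \<Rightarrow>\<^sub>0 int)" and G :: "('a \<Rightarrow>\<^sub>0 int) => int"
  assumes d: "!!a b. d (a - b) = d a - d b"
    and G: "!!a b. a \<in> span_of S ==> b \<in> span_of S ==> d a = 0 ==> d b = 0 ==> m dvd G (a - b) - (G a - G b)"
  obtains \<omega> :: "'a => int" where "!!c. c \<in> span_of S ==> d c = 0 ==> m dvd ev \<omega> c - G c" "!!s. s \<notin> S ==> \<omega> s = 0"
proof -
  obtain r where r: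
    "!!c. c \<in> span_of S ==> r c \<in> span_of S \<and> d (r c) = 0"
    "!!c. c \<in> span_of S ==> d c = 0 ==> r c = c"
    "!!a b. a \<in> span_of S ==> b \<in> span_of S ==> r (a - b) = r a - r b"
    using kernel_retraction[of d S, OF d] by blast
  define \<omega> where "\<omega> s = (if s \<in> S then G (r (frag_of s)) else 0)" for s
  have d0: "d 0 = 0" using d[of 0 0] by simp
  have *: "c \<in> span_of S \<and> m dvd ev \<omega> c - G (r c)" if "supp c \<subseteq> S" for c using that
  proof (induction c rule: frag_induction)
    case zero
    have "m dvd - G 0" using G[of 0 0] d0 by simp
    then show ?case using r(2)[of 0] d0 by simp
  next
    case (one s)
    then show ?case by (simp add: span_of_def \<omega>_def)
  next
    case (diff a b)
    then have "m dvd G (r (a - b)) - (G (r a) - G (r b))"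
      using G[of "r a" "r b"] r(1)[of a] r(1)[of b] by (simp add: r(3))
    then have "m dvd (ev \<omega> a - G (r a)) - (ev \<omega> b - G (r b)) - (G (r (a - b)) - (G (r a) - G (r b)))"
      using dvd_diff[OF dvd_diff[of m "ev \<omega> a - G (r a)" "ev \<omega> b - G (r b)"]] diff by blast
    then show ?case using diff by (simp add: span_of_diff ev_diff algebra_simps)
  qed
  then have "m dvd ev \<omega> c - G c" if "c \<in> span_of S" "d c = 0" for c
    using *[of c] that r(2)[OF that] by (simp add: span_of_def)
  then show thesis using that[of \<omega>] by (simp add: \<omega>_def)
qed

section \<open>Cochains relative to a subset\<close>

text \<open>Dropping the simplices inside \<open>O'\<close> models the quotient by the chains of
  \<open>O'\<close> as the free group on the remaining simplices, to which the results on free chain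
  groups apply.\<close>

definition off_part :: "nat => 'a set => 'a chain => 'a chain" where
  "off_part k O' = frag_extend (%t. if t ` Simplex k \<subseteq> O' then 0 else frag_of t)"

definition off_simplices :: "nat => 'a topology => 'a set => ((nat => real) => 'a) set" where
  "off_simplices k X O' = {s. singular_simplex k X s \<and> \<not> s ` Simplex k \<subseteq> O'}"

lemma off_part_diff: "off_part k O' (a - b) = off_part k O' a - off_part k O' b"
  by (simp add: off_part_def frag_extend_diff)

lemma lookup_off_part: "wt (off_part k O' c) t =
    (if t ` Simplex k \<subseteq> O' then 0 else wt c t)" using subset_UNIV
proof (induction c rule: frag_induction)
  case (one x)
  show ?case by (auto simp: off_part_def)
next
  case (diff a b)
  then show ?case by (simp add: off_part_diff lookup_minus)
qed (simp add: off_part_def)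

lemma off_part_in_span: "schain k X c ==> off_part k O' c \<in> span_of (off_simplices k X O')"
  unfolding span_of_def off_simplices_def singular_chain_def
  by (auto simp: in_keys_iff lookup_off_part split: if_splits)

lemma span_off_chain: "c \<in> span_of (off_simplices k X O') ==> schain k X c"
  unfolding span_of_def off_simplices_def singular_chain_def by auto

lemma off_part_remainder: "schain k X c ==> schain k (subtopology X O') (c - off_part k O' c)"
  unfolding singular_chain_def
  by (auto simp: in_keys_iff lookup_off_part lookup_minus singular_simplex_subtopology split: if_splits)

lemma off_part_inside:
  assumes "schain k (subtopology X O') c" shows "off_part k O' c = 0"
proof (rule poly_mapping_eqI)
  fix t
  show "wt (off_part k O' c) t = wt 0 t"
  proof (cases "t \<in> supp c")
    case True
    then have "t ` Simplex k \<subseteq> O'" using assms unfolding singular_chain_subtopology by blast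
    then show ?thesis by (simp add: lookup_off_part)
  next
    case False
    then show ?thesis by (simp add: lookup_off_part in_keys_iff)
  qed
qed

lemma off_part_eq_0: "schain k X c ==> off_part k O' c = 0 ==> schain k (subtopology X O') c"
  using off_part_remainder[of k X c O'] by simp

lemma off_part_span: "c \<in> span_of (off_simplices k X O') ==> off_part k O' c = c"
  unfolding span_of_def off_simplices_def
  by (intro poly_mapping_eqI) (auto simp: lookup_off_part in_keys_iff subset_iff)

lemma rcycle_off_part:
  assumes "schain k X c"
  shows "rcycle 0 k X O' c \<longleftrightarrow> off_part (k - 1) O' (bdry k c) = 0" unfolding rcycle_def rchain_zero
  using assms off_part_inside off_part_eq_0 singular_chain_boundary[OF assms] by (metis One_nat_def)

lemma ev_off_part:
  assumes "!!s. s ` Simplex k \<subseteq> O' ==> \<phi> s = 0"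
  shows "ev \<phi> (off_part k O' c) = ev \<phi> c"
  unfolding off_part_def ev_extend by (intro ev_cong) (auto simp: assms)

text \<open>\<open>cochain_vanishing_on_cycles\<close> is applied to the quotient complex, whose
  boundary is the usual one followed by \<open>off_part\<close>.\<close>

lemma relative_cochain_coboundary:
  assumes k: "k > 0"
    and H: "!!c. rcycle 0 k X O' c ==> rbound 0 k X O' c"
    and \<phi>0: "!!s. s ` Simplex (Suc k) \<subseteq> O' ==> \<phi> s = 0"
    and van: "!!c. rcycle 0 (Suc k) X O' c ==> ev \<phi> c = 0"
  obtains \<eta> where "!!s. s ` Simplex k \<subseteq> O' ==> \<eta> s = 0"
    "!!c. schain (Suc k) X c ==> ev \<phi> c = ev \<eta> (bdry (Suc k) c)"
proof -
  let ?d1 = "%c. off_part k O' (bdry (Suc k) c)" and ?d0 = "%c. off_part (k - 1) O' (bdry k c)"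
  let ?S1 = "off_simplices (Suc k) X O'" and ?S0 = "off_simplices k X O'"
  have 1: "\<exists>w\<in>span_of ?S1. ?d1 w = z" if z: "z \<in> span_of ?S0" "?d0 z = 0" for z
  proof -
    have zc: "schain k X z" using z span_off_chain by blast
    then have "rcycle 0 k X O' z" using z(2) rcycle_off_part by blast
    then obtain b where b: "schain (Suc k) X b" "rchain 0 k X O' (z - bdry (Suc k) b)"
      using H unfolding rbound_def by blast
    have e: "off_part k O' (z - bdry (Suc k) b) = 0" using b(2) off_part_inside unfolding rchain_zero by blast
    let ?w = "off_part (Suc k) O' b"
    have "off_part k O' (bdry (Suc k) (b - ?w)) = 0"
      using off_part_inside singular_chain_boundary_alt off_part_remainder[OF b(1)] by blast
    then have "?d1 ?w = ?d1 b" by (simp add: chain_boundary_diff off_part_diff)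
    also have "\<dots> = z" using e off_part_span[OF z(1)] by (simp add: off_part_diff)
    finally show ?thesis using off_part_in_span[OF b(1)] by blast
  qed
  have 2: "?d1 w \<in> span_of ?S0 \<and> ?d0 (?d1 w) = 0" if w: "w \<in> span_of ?S1" for w
  proof -
    have wc: "schain k X (bdry (Suc k) w)" using span_off_chain[OF w] singular_chain_boundary_alt by blast
    have "schain (k - 1) (subtopology X O') (bdry k (bdry (Suc k) w - ?d1 w))"
      using singular_chain_boundary[OF off_part_remainder[OF wc]] by simp
    then have "?d0 (bdry (Suc k) w - ?d1 w) = 0" using off_part_inside by blast
    then have "?d0 (?d1 w) = ?d0 (bdry (Suc k) w)" by (simp add: chain_boundary_diff off_part_diff)
    also have "\<dots> = 0"  using chain_boundary_boundary_alt[OF span_off_chain[OF w]] by (simp add: off_part_def)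
    finally show ?thesis using off_part_in_span[OF wc] by blast
  qed
  have 3: "0 dvd ev \<phi> w" if "w \<in> span_of ?S1" "?d1 w = 0" for w
    using van[of w] rcycle_off_part[OF span_off_chain[OF that(1)]] that(2) by simp
  obtain \<eta> where \<eta>: "!!w. w \<in> span_of ?S1 ==> 0 dvd ev \<phi> w - ev \<eta> (?d1 w)" "!!s. s \<notin> ?S0 ==> \<eta> s = 0"
    by (rule cochain_vanishing_on_cycles[of ?d1 ?d0 ?S0 ?S1 0 \<phi>])
       (simp_all add: chain_boundary_diff off_part_diff 1 2 3[simplified] del: One_nat_def)
  have \<eta>0: "\<eta> s = 0" if "s ` Simplex k \<subseteq> O'" for s
    using that \<eta>(2) by (simp add: off_simplices_def)
  have "ev \<phi> c = ev \<eta> (bdry (Suc k) c)" if c: "schain (Suc k) X c" for c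
  proof -
    let ?w = "off_part (Suc k) O' c"
    have "ev \<phi> c = ev \<phi> ?w" using ev_off_part[of "Suc k" O' \<phi>] \<phi>0 by simp
    also have "\<dots> = ev \<eta> (?d1 ?w)" using \<eta>(1)[OF off_part_in_span[OF c]] by simp
    also have "\<dots> = ev \<eta> (bdry (Suc k) ?w)" using ev_off_part[of k O' \<eta>] \<eta>0 by simp
    also have "\<dots> = ev \<eta> (bdry (Suc k) c)"
    proof -
      have "schain k (subtopology X O') (bdry (Suc k) (c - ?w))"
        using singular_chain_boundary_alt off_part_remainder[OF c] by blast
      then have "ev \<eta> (bdry (Suc k) (c - ?w)) = 0"
        using ev_off_part[of k O' \<eta>, OF \<eta>0] off_part_inside by (metis ev_0)
      then show ?thesis by (simp add: chain_boundary_diff ev_diff)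
    qed
    finally show ?thesis .
  qed
  then show thesis using that \<eta>0 by blast
qed

section \<open>Zero-chains, contractible charts and small subdivisions\<close>

lemma manifold_locally_path_connected:
  assumes X: "topological_manifold n X"
  shows "locally_path_connected_space X" unfolding locally_path_connected_space
proof (intro allI impI)
  fix V x assume V: "openin X V \<and> x \<in> V"
  then have "x \<in> topspace X" using openin_subset by blast
  then obtain U h g where ch: "chart n X U h g" "x \<in> U" using topological_manifold_chart[OF X] by blast
  have "subtopology X U homeomorphic_space Eucl n" using ch unfolding chart_def homeomorphic_space_def by blast
  then have "locally_path_connected_space (subtopology X U)"
    using homeomorphic_locally_path_connected_space locally_path_connected_Euclidean_space by blast
  moreover have "openin (subtopology X U) (U \<inter> V)" using V by (simp add: openin_subtopology_Int2)
  ultimately obtain P where P: "openin (subtopology X U) P" "path_connectedin (subtopology X U) P" "x \<in> P" "P \<subseteq> U \<inter> V"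
    unfolding locally_path_connected_space using V ch(2) by (metis IntI)
  then have "openin X P" using chart_open[OF ch(1)] openin_trans_full by blast
  moreover have "path_connectedin X P" using P(2) path_connectedin_subtopology by blast
  ultimately show "\<exists>U. openin X U \<and> path_connectedin X U \<and> x \<in> U \<and> U \<subseteq> V" using P by blast
qed

abbreviation vertex0 :: "nat => real" where "vertex0 \<equiv> %j. if j = 0 then 1 else 0"

definition point_simplex :: "'a => (nat => real) => 'a" where
  "point_simplex v = (\<lambda>_\<in>Simplex 0. v)"

lemma point_simplex_image [simp]: "point_simplex v ` Simplex 0 = {v}"
  by (auto simp: point_simplex_def standard_simplex_0)

lemma point_simplex_apply [simp]: "point_simplex v vertex0 = v" by (simp add: point_simplex_def)

lemma singular_point_simplex: "v \<in> topspace X ==> singular_simplex 0 X (point_simplex v)"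
  by (simp add: singular_simplex_def point_simplex_def)

lemma singular_simplex_0_eq: "singular_simplex 0 X t ==> t = point_simplex (t vertex0)"
  unfolding singular_simplex_def point_simplex_def standard_simplex_0 by (rule extensionalityI[of _ "{vertex0}"]) auto

lemma singular_simplex_0_in: "singular_simplex 0 X t ==> t vertex0 \<in> topspace X"
  unfolding singular_simplex_def by (auto simp: standard_simplex_0 continuous_map_def)

lemma path_connected_zero_chains:
  assumes X: "path_connected_space X" and v: "v \<in> topspace X" and q: "schain 0 X q"
  obtains s where "schain 1 X s" "bdry 1 s = q - cmul (ev (%_. 1) q) (frag_of (point_simplex v))"
proof -
  have "rbound 0 0 X {} (q - cmul (ev (%_. 1) q) (frag_of (point_simplex v)))" using q unfolding singular_chain_def
  proof (induction q rule: frag_induction)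
    case (one t)
    then show ?case
      using iso_integer_zeroth_homology_group_aux[OF X, of t "point_simplex v"] singular_point_simplex[OF v]
      by (simp add: homologous_rel_def rbound_zero)
  next
    case (diff a b)
    have "a - b - cmul (ev (%_. 1) (a - b)) (frag_of (point_simplex v)) =
      (a - cmul (ev (%_. 1) a) (frag_of (point_simplex v))) - (b - cmul (ev (%_. 1) b) (frag_of (point_simplex v)))"
      by (simp add: ev_diff frag_cmul_diff_distrib)
    then show ?case using rbound_diff[OF diff] by (simp only:)
  qed simp
  then show thesis using that unfolding rbound_zero singular_boundary by auto
qed

lemma homologous_zero_iff: "rbound 0 k X {} c \<longleftrightarrow> (\<exists>b. schain (Suc k) X b \<and> bdry (Suc k) b = c)"
  by (simp add: rbound_zero singular_boundary)

lemma rcycle_empty_zero: "rcycle 0 k X {} c \<longleftrightarrow> schain k X c \<and> bdry k c = 0"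
  by (simp add: rcycle_zero singular_cycle)

lemma contractible_cycle_bounds:
  assumes "contractible_space X" "k > 0" "rcycle 0 k X {} c"
  shows "rbound 0 k X {} c"
proof -
  have "trivial_group (homology_group (int k) X)"
    using trivial_reduced_homology_group_contractible_space[OF assms(1), of "int k"] assms(2)
    by (simp add: un_reduced_homology_group)
  then show ?thesis using relhom_trivialD assms(3) by (metis rbound_zero rcycle_zero)
qed

lemma chart_contractible:
  assumes "chart n X U h g" shows "contractible_space (subtopology X U)"
proof -
  have "subtopology X U homeomorphic_space Eucl n" using assms unfolding chart_def homeomorphic_space_def by blast
  then show ?thesis using homeomorphic_space_contractibility contractible_Euclidean_space by blast
qed

text \<open>This keeps cap products with locally supported cochains inside charts: a simplex
  contributes only if it meets the closed set, and then it lies in the open one.\<close>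

lemma small_pairs_subdivision:
  fixes X :: "'a topology"
  assumes I: "finite I" and K: "!!i. i \<in> I ==> closedin X (K i)" and G: "!!i. i \<in> I ==> openin X (G i)"
    and KG: "!!i. i \<in> I ==> K i \<subseteq> G i" and c: "schain p X c"
  obtains Sd T :: "nat => 'a chain => 'a chain" where "subdivision_ops Sd T"
    "!!s i. s \<in> supp (Sd p c) ==> i \<in> I ==> s ` Simplex p \<inter> K i = {} \<or> s ` Simplex p \<subseteq> G i"
proof -
  \<comment> \<open>One open set for each set \<open>J\<close> of indices. A point \<open>x\<close>
    is covered by the one for \<open>J = {i. x \<in> K i}\<close>.\<close>
  define C where "C J = topspace X \<inter> (\<Inter>i\<in>I. if i \<in> J then G i else topspace X - K i)" for J
  have oC: "openin X (C J)" for J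
  proof (cases "I = {}")
    case True
    then show ?thesis by (simp add: C_def)
  next
    case False
    have "openin X (\<Inter>i\<in>I. if i \<in> J then G i else topspace X - K i)"
    proof (intro openin_Inter finite_imageI I)
      show "(%i. if i \<in> J then G i else topspace X - K i) ` I \<noteq> {}" using False by (simp only: image_is_empty not_False_eq_True)
      fix V assume "V \<in> (%i. if i \<in> J then G i else topspace X - K i) ` I"
      then obtain i where "i \<in> I" "V = (if i \<in> J then G i else topspace X - K i)" by (rule imageE)
      then show "openin X V" using K[of i] G[of i] by (simp add: openin_diff)
    qed
    then show ?thesis unfolding C_def by blast
  qed
  have op: "openin X V" if "V \<in> range C" for V using that oC by (elim rangeE) simp
  have cov: "topspace X \<subseteq> \<Union>(range C)"
  proof
    fix x assume "x \<in> topspace X"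
    then have "x \<in> C {i. x \<in> K i}" using KG by (auto simp: C_def)
    then show "x \<in> \<Union>(range C)" by blast
  qed
  obtain Sd T :: "nat => 'a chain => 'a chain" where *: "subdivision_ops Sd T"
    "!!s. s \<in> supp (Sd p c) ==> \<exists>V\<in>range C. s ` Simplex p \<subseteq> V"
    by (rule subdivision_ops_small[OF op cov c]) (assumption | rule that)+
  show thesis
  proof (rule that[OF *(1)])
    fix s i assume "s \<in> supp (Sd p c)" and i: "i \<in> I"
    then obtain J where J: "s ` Simplex p \<subseteq> C J" using *(2) by blast
    have "C J \<subseteq> (if i \<in> J then G i else topspace X - K i)"
      unfolding C_def by (rule Int_lower2[THEN order_trans]) (rule INF_lower[OF i])
    then have "s ` Simplex p \<subseteq> (if i \<in> J then G i else topspace X - K i)"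
      using J by (rule order_trans[rotated])
    then show "s ` Simplex p \<inter> K i = {} \<or> s ` Simplex p \<subseteq> G i" by (cases "i \<in> J") auto
  qed
qed

section \<open>Poincare duality for 1-cycles\<close>

text \<open>Chain-level form of an orientation: the integral cycle \<open>m\<^sub>0\<close> generates every local homology group.\<close>

locale oriented_manifold =
  fixes n q :: nat and M :: "'a topology" and m0 :: "'a chain"
  assumes M: "topological_manifold n M" and n: "n = Suc q" and q: "q > 0"
    and m0: "rcycle 0 n M {} m0"
    and fund: "!!x c. x \<in> topspace M ==> rcycle 0 n M (topspace M - {x}) c ==>
       \<exists>j. rbound 0 n M (topspace M - {x}) (c - cmul j m0)"
begin

lemma n_pos: "n > 0" by (simp add: n)

lemma m0_rel: "rcycle m n M S m0" using rcycle_mono[OF rcycle_dvd[OF m0]] by simp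

text \<open>As \<open>m0\<close> generates, the degree \<open>F m0\<close> of a generator function
  is a unit; multiplying by it normalises the degree of \<open>m0\<close> to one.\<close>

lemma local_degree:
  assumes "x \<in> topspace M"
  obtains D where "!!a b. rcycle 0 n M (topspace M - {x}) a ==> rcycle 0 n M (topspace M - {x}) b ==> D (a - b) = D a - D b"
    "!!c j. rcycle 0 n M (topspace M - {x}) c ==> rbound 0 n M (topspace M - {x}) (c - cmul j m0) ==> D c = (j::int)"
    "!!c. rcycle 0 n M (topspace M - {x}) c ==> rbound 0 n M (topspace M - {x}) c \<longleftrightarrow> D c = 0"
    "D m0 = 1" "!!j. D (cmul j m0) = j"
proof -
  let ?S = "topspace M - {x}"
  obtain F :: "'a chain => int" and t where F:
    "!!a b. rcycle 0 n M ?S a ==> rcycle 0 n M ?S b ==> F (a - b) = F a - F b"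
    "!!j a. rcycle 0 n M ?S a ==> F (cmul j a) = j * F a"
    "!!a. rcycle 0 n M ?S a ==> F a = 0 \<longleftrightarrow> rbound 0 n M ?S a"
    "rcycle 0 n M ?S t" "F t = 1" by (rule local_homology_generator[OF M assms n_pos]) (assumption | rule that)+
  have Fj: "F c = j * F m0" if "rcycle 0 n M ?S c" "rbound 0 n M ?S (c - cmul j m0)" for c j
  proof -
    have "F (c - cmul j m0) = 0" using F(3) that rcycle_rbound by blast
    then show ?thesis using F(1)[OF that(1) rcycle_scale[OF m0_rel]] F(2)[OF m0_rel] by simp
  qed
  obtain j where "rbound 0 n M ?S (t - cmul j m0)" using fund[OF assms F(4)] by blast
  then have "1 = j * F m0" using Fj[OF F(4)] F(5) by simp
  then have F1: "F m0 * F m0 = 1" "F m0 \<noteq> 0" by (auto simp: zmult_eq_1_iff eq_commute[of 1])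
  show thesis
  proof (rule that[of "%c. F m0 * F c"])
    show "F m0 * F c = j" if "rcycle 0 n M ?S c" "rbound 0 n M ?S (c - cmul j m0)" for c j
      using Fj[OF that] F1(1) by (simp add: mult.left_commute)
    show "F m0 * F (cmul j m0) = j" for j using F(2)[OF m0_rel] F1(1) by (simp add: mult.left_commute)
  qed (use F F1 in \<open>auto simp: right_diff_distrib\<close>)
qed

text \<open>If \<open>m0\<close> were \<open>m d\<close> up to boundaries and chains off
  \<open>x\<close>, then \<open>d\<close> would have an integral degree \<open>j\<close> with
  \<open>m * j = 1\<close>; for \<open>m = 0\<close> the degree of \<open>m0\<close> would be
  zero.\<close>

lemma m0_not_torsion:
  assumes "x \<in> topspace M" "m = 0 \<or> m > 1"
  shows "\<not> rbound m n M (topspace M - {x}) m0"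
proof
  let ?S = "topspace M - {x}"
  obtain D where D: "!!a b. rcycle 0 n M ?S a ==> rcycle 0 n M ?S b ==> D (a - b) = D a - D b"
    "!!c j. rcycle 0 n M ?S c ==> rbound 0 n M ?S (c - cmul j m0) ==> D c = (j::int)"
    "!!c. rcycle 0 n M ?S c ==> rbound 0 n M ?S c \<longleftrightarrow> D c = 0"
    "D m0 = 1" "!!j. D (cmul j m0) = j" by (rule local_degree[OF assms(1)]) (assumption | rule that)+
  assume "rbound m n M ?S m0"
  then obtain b where b: "schain (Suc n) M b" "rchain m n M ?S (m0 - bdry (Suc n) b)" unfolding rbound_def by blast
  then obtain d e where de: "schain n M d" "schain n (subtopology M ?S) e"
    "m0 - bdry (Suc n) b = cmul m d + e" using rchain_decomp by blast
  have re: "rcycle 0 n M ?S (m0 - bdry (Suc n) b - e)"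
    by (intro rcycle_diff m0_rel rcycle_boundary b rcycle_rchain rchain_sub de)
  then have rmd: "rcycle 0 n M ?S (cmul m d)" using de(3) by simp
  have b0: "rbound 0 n M ?S (m0 - cmul m d)"
  proof -
    have "m0 - cmul m d = bdry (Suc n) b + e" using de(3) by (simp add: algebra_simps)
    then show ?thesis using rbound_add[OF rbound_boundary[OF b(1)] rbound_rchain[OF rchain_sub[OF de(2)]]] by metis
  qed
  then have Dmd: "D (cmul m d) = 1" using D(1)[OF m0_rel rmd] D(3)[OF rcycle_diff[OF m0_rel rmd]] D(4) by simp
  show False
  proof (cases "m = 0")
    case True
    then show ?thesis using Dmd D(5)[of 0] by simp
  next
    case False
    then have m: "m > 1" using assms(2) by simp
    have "rcycle 0 n M ?S d" using rmd de(1) False unfolding rcycle_def rchain_iff_lookup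
      by (auto simp: chain_boundary_cmul singular_chain_boundary[OF de(1), simplified])
    then obtain j where j: "rbound 0 n M ?S (d - cmul j m0)" using fund[OF assms(1)] by blast
    then have "rbound 0 n M ?S (cmul m d - cmul (m * j) m0)"
      using rbound_scale[OF j, of m] by (simp add: frag_cmul_diff)
    then have "m * j = 1" using D(2)[OF rmd] Dmd by simp
    then show False using m by (simp add: zmult_eq_1_iff)
  qed
qed

section \<open>Cochains dual to points and to short paths\<close>

text \<open>The local degree is defined on relative cycles; \<open>functional_extension\<close> in
  the quotient complex turns it into a cochain supported at \<open>v\<close>.\<close>

lemma point_cocycle:
  assumes v: "v \<in> topspace M"
  obtains \<omega> where "!!s. s ` Simplex n \<subseteq> topspace M - {v} ==> \<omega> s = 0"
    "!!c j. rcycle 0 n M (topspace M - {v}) c ==> rbound 0 n M (topspace M - {v}) (c - cmul j m0) ==> ev \<omega> c = j"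
proof -
  let ?S = "topspace M - {v}"
  obtain D where D: "!!a b. rcycle 0 n M ?S a ==> rcycle 0 n M ?S b ==> D (a - b) = D a - D b"
    "!!c j. rcycle 0 n M ?S c ==> rbound 0 n M ?S (c - cmul j m0) ==> D c = (j::int)"
    "!!c. rcycle 0 n M ?S c ==> rbound 0 n M ?S c \<longleftrightarrow> D c = 0"
    "D m0 = 1" "!!j. D (cmul j m0) = j" by (rule local_degree[OF v]) (assumption | rule that)+
  let ?d = "%c. off_part (n - 1) ?S (bdry n c)" and ?T = "off_simplices n M ?S"
  have dd: "?d (a - b) = ?d a - ?d b" for a b by (simp add: chain_boundary_diff off_part_diff)
  have cyc: "rcycle 0 n M ?S c" if "c \<in> span_of ?T" "?d c = 0" for c
    using that rcycle_off_part[OF span_off_chain[OF that(1)]] by blast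
  obtain \<omega> where \<omega>: "!!c. c \<in> span_of ?T ==> ?d c = 0 ==> 0 dvd ev \<omega> c - D c" "!!s. s \<notin> ?T ==> \<omega> s = 0"
    by (rule functional_extension[of ?d ?T 0 D, OF dd]) (auto simp: D(1) cyc simp del: One_nat_def)
  show thesis
  proof (rule that[of \<omega>])
    show w0: "\<omega> s = 0" if "s ` Simplex n \<subseteq> ?S" for s
      using \<omega>(2) that by (simp add: off_simplices_def)
    fix c j assume c: "rcycle 0 n M ?S c" "rbound 0 n M ?S (c - cmul j m0)"
    have cc: "schain n M c" using c(1) rcycle_chain by blast
    let ?w = "off_part n ?S c"
    have cw: "rchain 0 n M ?S (c - ?w)" using off_part_remainder[OF cc] by (simp add: rchain_zero)
    have "rcycle 0 n M ?S (c - (c - ?w))" using c(1) rcycle_rchain[OF cw] rcycle_diff by blast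
    then have w: "rcycle 0 n M ?S ?w" by simp
    have "ev \<omega> c = ev \<omega> ?w" using ev_off_part[of n ?S \<omega>, OF w0] by simp
    also have "\<dots> = D ?w"
      using \<omega>(1)[OF off_part_in_span[OF cc]] w rcycle_off_part[OF rcycle_chain[OF w]] by simp
    also have "\<dots> = D c" using D(1)[OF c(1) w] D(3)[OF rcycle_rchain[OF cw]] rbound_rchain[OF cw] by simp
    finally show "ev \<omega> c = j" using D(2)[OF c] by simp
  qed
qed

text \<open>One fixed choice per point, so that the cochains at a common end point of two edges are
  equal and telescope along a 1-cycle.\<close>

definition \<omega> :: "'a => ((nat => real) => 'a) => int" where
  "\<omega> v = (SOME w. (\<forall>s. s ` Simplex n \<subseteq> topspace M - {v} --> w s = 0) \<and>
    (\<forall>c j. rcycle 0 n M (topspace M - {v}) c --> rbound 0 n M (topspace M - {v}) (c - cmul j m0) --> ev w c = j))"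

lemma \<omega>:
  assumes "v \<in> topspace M"
  shows "s ` Simplex n \<subseteq> topspace M - {v} ==> \<omega> v s = 0"
    "rcycle 0 n M (topspace M - {v}) c ==> rbound 0 n M (topspace M - {v}) (c - cmul j m0) ==> ev (\<omega> v) c = j"
proof -
  have "\<exists>w. (\<forall>s. s ` Simplex n \<subseteq> topspace M - {v} --> w s = 0) \<and>
    (\<forall>c j. rcycle 0 n M (topspace M - {v}) c --> rbound 0 n M (topspace M - {v}) (c - cmul j m0) --> ev w c = j)"
    using point_cocycle[OF assms] by metis
  from someI_ex[OF this, folded \<omega>_def]
  show "s ` Simplex n \<subseteq> topspace M - {v} ==> \<omega> v s = 0"
    "rcycle 0 n M (topspace M - {v}) c ==> rbound 0 n M (topspace M - {v}) (c - cmul j m0) ==> ev (\<omega> v) c = j"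
    by blast+
qed

lemma \<omega>_m0: "v \<in> topspace M ==> ev (\<omega> v) m0 = 1" using \<omega>(2)[OF _ m0_rel, of v 1] by simp

lemma \<omega>_boundary:
  assumes "v \<in> topspace M" "schain (Suc n) M b"
  shows "ev (\<omega> v) (bdry (Suc n) b) = 0"
  using \<omega>(2)[OF assms(1) rcycle_boundary[OF assms(2)], of 0] rbound_boundary[OF assms(2)] by simp

text \<open>On cycles relative to the complement of the cube both point cochains give the same
  degree, by star-shapedness. As there is no homology in degree \<open>q\<close> relative to that
  complement, their difference is a coboundary of a cochain vanishing on simplices that miss the
  cube.\<close>

lemma \<omega>_difference:
  assumes ch: "chart n M U h g" and v: "v \<in> g ` ccube n a r" and w: "w \<in> g ` ccube n a r"
  obtains \<eta> where "!!s. s ` Simplex q \<subseteq> topspace M - g ` ccube n a r ==> \<eta> s = 0"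
    "!!c. schain n M c ==> ev (\<omega> w) c - ev (\<omega> v) c = ev \<eta> (bdry n c)"
proof -
  let ?C = "ccube n a r" and ?K = "g ` ccube n a r"
  let ?S = "topspace M - ?K"
  have H: "Hausdorff_space M" using M manifold_Hausdorff by blast
  have KM: "?K \<subseteq> topspace M" using chart_image_subset[OF ch ccube_subset_EE] chart_subset[OF ch] by blast
  have star: "rbound 0 k M ?S c" if "k > 0" "rcycle 0 k M ?S c" "y \<in> ?K" "rbound 0 k M (topspace M - {y}) c" for k c y
  proof -
    obtain z where z: "y = g z" "z \<in> ?C" using \<open>y \<in> ?K\<close> by blast
    have st: "(%i. z i + t * (x i - z i)) \<in> ?C" if "x \<in> ?C" "0 \<le> t" "t \<le> 1" for x t
      using that z(2) ccube_convex[of n a r] unfolding coord_convex_def by auto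
    show ?thesis using chart_star_shaped[OF ch ccube_compact z(2) st H that(1,2)] that(4) z(1) by blast
  qed
  have sub: "?S \<subseteq> topspace M - {y}" if "y \<in> ?K" for y using that by blast
  have H2: "rbound 0 q M ?S c" if c: "rcycle 0 q M ?S c" for c
    using local_homology_trivial[OF M _ n_pos q _ rcycle_mono[OF c sub[OF v]]] KM v star[OF q c v] n by auto
  have van: "ev (%s. \<omega> w s - \<omega> v s) c = 0" if c': "rcycle 0 (Suc q) M ?S c" for c
  proof -
    have c: "rcycle 0 n M ?S c" using c' by (simp add: n)
    have vM: "v \<in> topspace M" "w \<in> topspace M" using v w KM by auto
    have cv: "rcycle 0 n M (topspace M - {v}) c" "rcycle 0 n M (topspace M - {w}) c"
      using rcycle_mono[OF c sub] v w by auto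
    obtain j where j: "rbound 0 n M (topspace M - {v}) (c - cmul j m0)" using fund[OF vM(1) cv(1)] by blast
    have "rbound 0 n M ?S (c - cmul j m0)"
      using star[OF n_pos _ v j] rcycle_diff[OF c rcycle_scale[OF m0_rel]] by blast
    then have "rbound 0 n M (topspace M - {w}) (c - cmul j m0)" using rbound_mono sub[OF w] by blast
    then show ?thesis using \<omega>(2)[OF vM(1) cv(1) j] \<omega>(2)[OF vM(2) cv(2)] by (simp add: ev_fun_diff)
  qed
  have zero: "\<omega> w s - \<omega> v s = 0" if "s ` Simplex (Suc q) \<subseteq> ?S" for s
  proof -
    have "s ` Simplex n \<subseteq> ?S" using that by (simp add: n)
    then have "s ` Simplex n \<subseteq> topspace M - {v}" "s ` Simplex n \<subseteq> topspace M - {w}"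
      using sub[OF v] sub[OF w] by (meson order_trans)+
    moreover have "v \<in> topspace M" "w \<in> topspace M" using v w KM by auto
    ultimately show ?thesis using \<omega>(1) by simp
  qed
  obtain \<eta> where e: "!!s. s ` Simplex q \<subseteq> ?S ==> \<eta> s = 0"
    "!!c. schain (Suc q) M c ==> ev (%s. \<omega> w s - \<omega> v s) c = ev \<eta> (bdry (Suc q) c)"
    by (rule relative_cochain_coboundary[OF q H2 zero van]) (assumption | rule that)+
  show thesis by (rule that[of \<eta>]) (use e in \<open>simp_all add: n ev_fun_diff\<close>)
qed

lemma path_pieces:
  assumes ch: "chart n M U h g" and \<sigma>: "singular_simplex 1 M \<sigma>" "\<sigma> ` Simplex 1 \<subseteq> g ` ccube n a r"
  defines "v \<equiv> singular_face 1 1 \<sigma> vertex0" and "w \<equiv> singular_face 1 0 \<sigma> vertex0"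
  shows "v \<in> g ` ccube n a r" "w \<in> g ` ccube n a r"
    "bdry 1 (frag_of \<sigma>) = frag_of (point_simplex w) - frag_of (point_simplex v)"
proof -
  let ?K = "g ` ccube n a r"
  have s: "singular_simplex 1 (subtopology M ?K) \<sigma>" using \<sigma> by (simp add: singular_simplex_subtopology)
  have f: "singular_simplex 0 (subtopology M ?K) (singular_face 1 i \<sigma>)" if "i \<le> 1" for i
    using singular_simplex_singular_face[OF s _ that] by simp
  show "v \<in> ?K" "w \<in> ?K"
    using singular_simplex_0_in[OF f[of 1]] singular_simplex_0_in[OF f[of 0]] by (auto simp: v_def w_def)
  have "singular_face 1 0 \<sigma> = point_simplex w" "singular_face 1 1 \<sigma> = point_simplex v"
    using singular_simplex_0_eq[OF f[of 1]] singular_simplex_0_eq[OF f[of 0]] by (simp_all add: v_def w_def)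
  then show "bdry 1 (frag_of \<sigma>) = frag_of (point_simplex w) - frag_of (point_simplex v)"
    by (simp add: chain_boundary_of)
qed

text \<open>The Poincare dual of a path in a coordinate cube is a cochain \<open>\<eta>\<close> with coboundary the difference of
  the point cocycles at its end points; the duals of the pieces of a 1-cycle add up to a cocycle.\<close>

theorem Poincare_dual_exists:
  assumes z: "rcycle 0 1 M {} z"
  obtains \<beta> m1 where "cocyc 0 q M \<beta>" "rcycle 0 n M {} m1" "rbound 0 n M {} (m1 - m0)"
    "rbound 0 1 M {} (z - cap q 1 m1 \<beta>)"
proof -
  define good where "good V \<longleftrightarrow> (\<exists>U h g a r. chart n M U h g \<and> V = g ` ocube n a r)" for V
  have opg: "openin M V" if "V \<in> Collect good" for V
    using that chart_open_image[OF _ ocube_open] unfolding good_def by auto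
  have cov: "topspace M \<subseteq> \<Union>(Collect good)"
  proof
    fix x assume x: "x \<in> topspace M"
    obtain U h g r where "chart n M U h g" "x \<in> g ` ocube n (h x) r"
      by (rule chart_at_box[OF M n_pos x openin_topspace x]) (rule that)
    then show "x \<in> \<Union>(Collect good)" unfolding good_def by blast
  qed
  obtain Sd1 T1 :: "nat => 'a chain => 'a chain" where S1: "subdivision_ops Sd1 T1"
    "!!\<sigma>. \<sigma> \<in> supp (Sd1 1 z) ==> \<exists>V\<in>Collect good. \<sigma> ` Simplex 1 \<subseteq> V"
    by (rule subdivision_ops_small[OF opg cov rcycle_chain[OF z]]) (assumption | rule that)+
  define y where "y = Sd1 1 z"
  have y: "rcycle 0 1 M {} y" unfolding y_def using rcycle_subdivision[OF S1(1) z] .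
  have yz: "rbound 0 1 M {} (y - z)" unfolding y_def using rbound_subdivision[OF S1(1) z] by simp
  let ?Y = "supp y"
  have ys: "singular_simplex 1 M \<sigma>" if "\<sigma> \<in> ?Y" for \<sigma>
    using rcycle_chain[OF y] that by (auto simp: singular_chain_def)
  have "\<forall>\<sigma>\<in>?Y. \<exists>U h g a r. chart n M U h g \<and> \<sigma> ` Simplex 1 \<subseteq> g ` ocube n a r"
    using S1(2) unfolding y_def good_def by blast
  then obtain U h g a r where ch: "!!\<sigma>. \<sigma> \<in> ?Y ==> chart n M (U \<sigma>) (h \<sigma>) (g \<sigma>)"
    and in_o: "!!\<sigma>. \<sigma> \<in> ?Y ==> \<sigma> ` Simplex 1 \<subseteq> g \<sigma> ` ocube n (a \<sigma>) (r \<sigma>)"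
    by metis
  define K where "K \<sigma> = g \<sigma> ` ccube n (a \<sigma>) (r \<sigma>)" for \<sigma>
  \<comment> \<open>Face \<open>1\<close> of an edge is its initial point and face \<open>0\<close>
    its end point.\<close>
  define v w where "v \<sigma> = singular_face 1 1 \<sigma> vertex0" and "w \<sigma> = singular_face 1 0 \<sigma> vertex0" for \<sigma> :: "(nat => real) => 'a"
  have in_K: "\<sigma> ` Simplex 1 \<subseteq> K \<sigma>" if "\<sigma> \<in> ?Y" for \<sigma>
    using in_o[OF that] ocube_subset_ccube unfolding K_def by (meson image_mono order_trans)
  have KU: "K \<sigma> \<subseteq> U \<sigma>" if "\<sigma> \<in> ?Y" for \<sigma>
    unfolding K_def using chart_image_subset[OF ch[OF that] ccube_subset_EE] .
  have UM: "U \<sigma> \<subseteq> topspace M" "openin M (U \<sigma>)" if "\<sigma> \<in> ?Y" for \<sigma>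
    using chart_subset[OF ch[OF that]] chart_open[OF ch[OF that]] by auto
  have Kcl: "closedin M (K \<sigma>)" if "\<sigma> \<in> ?Y" for \<sigma>
    unfolding K_def using chart_compact[OF ch[OF that] ccube_compact] manifold_Hausdorff[OF M] compactin_imp_closedin by blast
  have vw: "v \<sigma> \<in> K \<sigma>" "w \<sigma> \<in> K \<sigma>" "bdry 1 (frag_of \<sigma>) = frag_of (point_simplex (w \<sigma>)) - frag_of (point_simplex (v \<sigma>))"
    if "\<sigma> \<in> ?Y" for \<sigma>
    using path_pieces[OF ch[OF that] ys[OF that] in_K[OF that, unfolded K_def]] unfolding v_def w_def K_def by auto
  have vwM: "v \<sigma> \<in> topspace M" "w \<sigma> \<in> topspace M" if "\<sigma> \<in> ?Y" for \<sigma>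
    using vw[OF that] KU[OF that] UM[OF that] by auto
  \<comment> \<open>The end points of the edges cancel because \<open>y\<close> is a cycle. The
    values of \<open>\<theta>\<close> may lie in any free abelian group.\<close>
  have tele: "frag_extend (%\<sigma>. \<theta> (w \<sigma>) - \<theta> (v \<sigma>)) y = 0" for \<theta> :: "'a => 'c \<Rightarrow>\<^sub>0 int"
  proof -
    have "0 = frag_extend (%t. \<theta> (t vertex0)) (bdry 1 y)" using y by (simp add: rcycle_empty_zero)
    also have "bdry 1 y = frag_extend (%\<sigma>. bdry 1 (frag_of \<sigma>)) y" by (simp add: chain_boundary_def)
    also have "frag_extend (%t. \<theta> (t vertex0)) \<dots> = frag_extend (%\<sigma>. \<theta> (w \<sigma>) - \<theta> (v \<sigma>)) y"
      unfolding additive_extend[of "frag_extend (%t. \<theta> (t vertex0))", OF frag_extend_diff]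
      by (intro frag_extend_eq) (simp only: vw(3) frag_extend_diff frag_extend_of point_simplex_apply)
    finally show ?thesis by simp
  qed
  have telew: "(\<Sum>\<sigma>\<in>?Y. wt y \<sigma> * (f (w \<sigma>) - f (v \<sigma>))) = 0" for f :: "'a => int"
  proof -
    have "(\<Sum>\<sigma>\<in>?Y. wt y \<sigma> * (f (w \<sigma>) - f (v \<sigma>))) =
      wt (frag_extend (%\<sigma>. cmul (f (w \<sigma>)) (frag_of ()) - cmul (f (v \<sigma>)) (frag_of ())) y) ()"
      by (simp add: frag_extend_def lookup_sum lookup_minus)
    then show ?thesis using tele[of "%x. cmul (f x) (frag_of ())"] by simp
  qed
  have "\<exists>\<eta>. \<sigma> \<in> ?Y --> (\<forall>t. t ` Simplex q \<subseteq> topspace M - K \<sigma> --> \<eta> t = 0) \<and>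
      (\<forall>c. schain n M c --> ev (\<omega> (w \<sigma>)) c - ev (\<omega> (v \<sigma>)) c = ev \<eta> (bdry n c))" for \<sigma>
  proof (cases "\<sigma> \<in> ?Y")
    case True
    obtain \<eta> where "!!t. t ` Simplex q \<subseteq> topspace M - K \<sigma> ==> \<eta> t = 0"
      "!!c. schain n M c ==> ev (\<omega> (w \<sigma>)) c - ev (\<omega> (v \<sigma>)) c = ev \<eta> (bdry n c)"
      by (rule \<omega>_difference[OF ch[OF True] vw(1,2)[OF True, unfolded K_def], folded K_def]) (assumption | rule that)+
    then show ?thesis by blast
  qed simp
  from choice[OF allI[OF this]] obtain \<eta> where \<eta>:
    "\<forall>\<sigma>. \<sigma> \<in> ?Y --> (\<forall>t. t ` Simplex q \<subseteq> topspace M - K \<sigma> --> \<eta> \<sigma> t = 0) \<and>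
      (\<forall>c. schain n M c --> ev (\<omega> (w \<sigma>)) c - ev (\<omega> (v \<sigma>)) c = ev (\<eta> \<sigma>) (bdry n c))" ..
  define \<beta> where "\<beta> t = (\<Sum>\<sigma>\<in>?Y. wt y \<sigma> * \<eta> \<sigma> t)" for t
  have ev\<beta>: "ev \<beta> c = (\<Sum>\<sigma>\<in>?Y. wt y \<sigma> * ev (\<eta> \<sigma>) c)" for c
  proof -
    have "ev \<beta> c = (\<Sum>t\<in>supp c. \<Sum>\<sigma>\<in>?Y. wt y \<sigma> * (wt c t * \<eta> \<sigma> t))"
      by (simp add: ev_def \<beta>_def sum_distrib_left mult_ac)
    also have "\<dots> = (\<Sum>\<sigma>\<in>?Y. \<Sum>t\<in>supp c. wt y \<sigma> * (wt c t * \<eta> \<sigma> t))"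
      by (rule sum.swap)
    finally show ?thesis by (simp add: ev_def sum_distrib_left)
  qed
  have "cocyc 0 q M \<beta>" unfolding cocyc_def n[symmetric]
  proof (intro allI impI)
    fix c assume c: "schain n M c"
    have "ev \<beta> (bdry n c) = (\<Sum>\<sigma>\<in>?Y. wt y \<sigma> * (ev (\<omega> (w \<sigma>)) c - ev (\<omega> (v \<sigma>)) c))"
      unfolding ev\<beta> using \<eta> c by (intro sum.cong refl) simp
    then show "0 dvd ev \<beta> (bdry n c)" using telew[of "%x. ev (\<omega> x) c"] by simp
  qed
  let ?P = "v ` ?Y \<union> w ` ?Y"
  \<comment> \<open>A path-connected neighbourhood inside the charts of all edges ending at
    \<open>x\<close>, so that one connecting chain at \<open>x\<close> can be used for each of
    them.\<close>
  have "\<exists>G. x \<in> ?P --> openin M G \<and> path_connectedin M G \<and> x \<in> G \<and> (\<forall>\<sigma>\<in>?Y. x = v \<sigma> \<or> x = w \<sigma> --> G \<subseteq> U \<sigma>)" for x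
  proof (cases "x \<in> ?P")
    case True
    then have xM: "x \<in> topspace M" using vwM by auto
    let ?N = "topspace M \<inter> \<Inter>(U ` {\<sigma>\<in>?Y. x = v \<sigma> \<or> x = w \<sigma>})"
    have "{\<sigma>\<in>?Y. x = v \<sigma> \<or> x = w \<sigma>} \<noteq> {}" using True by auto
    then have "openin M (\<Inter>(U ` {\<sigma>\<in>?Y. x = v \<sigma> \<or> x = w \<sigma>}))"
      using UM(2) by (intro openin_Inter) auto
    then have "openin M ?N" by blast
    moreover have "x \<in> U \<sigma>" if "\<sigma> \<in> ?Y" "x = v \<sigma> \<or> x = w \<sigma>" for \<sigma>
      using vw[OF that(1)] KU[OF that(1)] that(2) by auto
    then have "x \<in> ?N" using xM by blast
    ultimately obtain G where "openin M G" "path_connectedin M G" "x \<in> G" "G \<subseteq> ?N"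
      using manifold_locally_path_connected[OF M] unfolding locally_path_connected_space by meson
    then show ?thesis by (intro exI[of _ G]) auto
  qed simp
  from choice[OF allI[OF this]] obtain G where G: "\<forall>x. x \<in> ?P --> openin M (G x) \<and> path_connectedin M (G x) \<and> x \<in> G x \<and>
     (\<forall>\<sigma>\<in>?Y. x = v \<sigma> \<or> x = w \<sigma> --> G x \<subseteq> U \<sigma>)" ..
  \<comment> \<open>Two kinds of pairs: the cube of an edge inside its chart, and an end point
    inside its neighbourhood.\<close>
  define KK where "KK = case_sum K (%x. {x})"
  define GG where "GG = case_sum U G"
  obtain Sd T :: "nat => 'a chain => 'a chain" where Sd: "subdivision_ops Sd T"
    "!!\<sigma> i. \<sigma> \<in> supp (Sd n m0) ==> i \<in> ?Y <+> ?P ==>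
       \<sigma> ` Simplex n \<inter> KK i = {} \<or> \<sigma> ` Simplex n \<subseteq> GG i"
  proof (rule small_pairs_subdivision[of "?Y <+> ?P" M KK GG n m0])
    show "finite (?Y <+> ?P)" by simp
    show "closedin M (KK i)" if "i \<in> ?Y <+> ?P" for i
    proof (cases i)
      case (Inl \<sigma>)
      then show ?thesis using that Kcl by (auto simp: KK_def)
    next
      case (Inr x)
      then have "x \<in> topspace M" using that vwM by auto
      then show ?thesis using closedin_Hausdorff_singleton[OF manifold_Hausdorff[OF M]] Inr by (simp add: KK_def)
    qed
    show "openin M (GG i)" if "i \<in> ?Y <+> ?P" for i using that UM(2) G by (cases i) (auto simp: GG_def)
    show "KK i \<subseteq> GG i" if "i \<in> ?Y <+> ?P" for i using that KU G by (cases i) (auto simp: GG_def KK_def)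
    show "schain n M m0" using m0 rcycle_chain by blast
  qed (assumption | rule that)+
  define m1 where "m1 = Sd n m0"
  have m1: "rcycle 0 n M {} m1" unfolding m1_def using rcycle_subdivision[OF Sd(1) m0] .
  have m1c: "schain n M m1" "bdry n m1 = 0" using m1 by (auto simp: rcycle_empty_zero)
  have m1m0: "rbound 0 n M {} (m1 - m0)" unfolding m1_def using rbound_subdivision[OF Sd(1) m0 n_pos] .
  have ev_m1: "ev (\<omega> x) m1 = 1" if "x \<in> topspace M" for x
  proof -
    obtain b where "schain (Suc n) M b" "m1 - m0 = bdry (Suc n) b" using m1m0 unfolding homologous_zero_iff by auto
    then have "ev (\<omega> x) (m1 - m0) = 0" using \<omega>_boundary[OF that] by simp
    then show ?thesis using \<omega>_m0[OF that] by (simp add: ev_diff)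
  qed
  have m1s: "singular_simplex n M t" if "t \<in> supp m1" for t using m1c(1) that by (auto simp: singular_chain_def)
  \<comment> \<open>The cap product with the point cochain is a 0-chain near \<open>x\<close> of
    total weight one, hence homologous to the point \<open>x\<close> within
    \<open>G x\<close>.\<close>
  define Q where "Q x = cap n 0 m1 (\<omega> x)" for x
  have ff: "front_face n t = t" if "singular_simplex n M t" for t
    using that unfolding front_face_def singular_simplex_def by (simp add: extensional_restrict)
  have "\<exists>s. x \<in> ?P --> schain 1 (subtopology M (G x)) s \<and> bdry 1 s = Q x - frag_of (point_simplex x)" for x
  proof (cases "x \<in> ?P")
    case True
    then have xM: "x \<in> topspace M" using vwM by auto
    have Gx: "path_connectedin M (G x)" "x \<in> G x" "openin M (G x)" using G True by auto
    have Qx: "schain 0 (subtopology M (G x)) (Q x)" unfolding Q_def cap_chain_def frag_extend_def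
    proof (rule singular_chain_sum, rule singular_chain_cmul)
      fix t assume t: "t \<in> supp m1"
      show "schain 0 (subtopology M (G x)) (cmul (\<omega> x (front_face n t)) (frag_of (back_face n 0 t)))"
      proof (cases "t ` Simplex n \<subseteq> G x")
        case True
        then have "singular_simplex (n + 0) (subtopology M (G x)) t"
          using m1s[OF t] by (simp add: singular_simplex_subtopology)
        then show ?thesis
          using back_face_singular(1)[of n 0] by (intro singular_chain_cmul) (simp only: singular_chain_of)
      next
        case False
        have "t ` Simplex n \<inter> KK (Inr x) = {} \<or> t ` Simplex n \<subseteq> GG (Inr x)"
          using t True by (intro Sd(2)) (auto simp: m1_def)
        then have "t ` Simplex n \<inter> {x} = {}" using False by (simp add: KK_def GG_def)
        moreover have "t ` Simplex n \<subseteq> topspace M"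
          using m1s[OF t] singular_simplex_subtopology[of n M "topspace M" t] by simp
        ultimately have "t ` Simplex n \<subseteq> topspace M - {x}" by blast
        then have "\<omega> x (front_face n t) = 0" using \<omega>(1)[OF xM] ff[OF m1s[OF t]] by simp
        then show ?thesis by simp
      qed
    qed
    have "ev (%_. 1) (Q x) = ev (\<omega> x) m1"
      unfolding Q_def ev_cup[symmetric] using ff m1s by (intro ev_cong) (simp add: cup_def)
    then have e1: "ev (%_. 1) (Q x) = 1" using ev_m1[OF xM] by simp
    have pc: "path_connected_space (subtopology M (G x))" using Gx(1) by (simp add: path_connectedin_def)
    have xG: "x \<in> topspace (subtopology M (G x))" using Gx(2) xM by simp
    obtain s where "schain 1 (subtopology M (G x)) s" "bdry 1 s = Q x - frag_of (point_simplex x)"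
      using path_connected_zero_chains[OF pc xG Qx] unfolding e1 frag_cmul_one by blast
    then show ?thesis by blast
  qed simp
  from choice[OF allI[OF this]] obtain s where s: "\<forall>x. x \<in> ?P --> schain 1 (subtopology M (G x)) (s x) \<and>
    bdry 1 (s x) = Q x - frag_of (point_simplex x)" ..
  \<comment> \<open>The sign of the Leibniz rule in degree \<open>q\<close>.\<close>
  define \<epsilon> :: int where "\<epsilon> = (-1) ^ q"
  have \<epsilon>: "\<epsilon> * \<epsilon> = 1" by (simp add: \<epsilon>_def flip: power_add)
  define b where "b \<sigma> = cap q 1 m1 (\<eta> \<sigma>)" for \<sigma>
  have bU: "schain 1 (subtopology M (U \<sigma>)) (b \<sigma>)" if \<sigma>: "\<sigma> \<in> ?Y" for \<sigma>
    unfolding b_def cap_chain_def frag_extend_def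
  proof (rule singular_chain_sum, rule singular_chain_cmul)
    fix t assume t: "t \<in> supp m1"
    have ts: "singular_simplex (q + 1) M t" using m1s[OF t] n by simp
    show "schain 1 (subtopology M (U \<sigma>)) (cmul (\<eta> \<sigma> (front_face q t)) (frag_of (back_face q 1 t)))"
    proof (cases "t ` Simplex n \<subseteq> U \<sigma>")
      case True
      then have "singular_simplex (q + 1) (subtopology M (U \<sigma>)) t"
        using ts n by (simp add: singular_simplex_subtopology)
      then show ?thesis
        using back_face_singular(1)[of q 1] by (intro singular_chain_cmul) (simp only: singular_chain_of)
    next
      case False
      have "t ` Simplex n \<inter> KK (Inl \<sigma>) = {} \<or> t ` Simplex n \<subseteq> GG (Inl \<sigma>)"
        using t \<sigma> by (intro Sd(2)) (auto simp: m1_def)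
      then have "t ` Simplex n \<inter> K \<sigma> = {}" using False by (simp add: KK_def GG_def)
      moreover have "t ` Simplex n \<subseteq> topspace M"
        using m1s[OF t] singular_simplex_subtopology[of n M "topspace M" t] by simp
      moreover have "front_face q t ` Simplex q \<subseteq> t ` Simplex n"
        using front_face_singular(2)[OF ts] n by simp
      ultimately have "front_face q t ` Simplex q \<subseteq> topspace M - K \<sigma>" by blast
      then have "\<eta> \<sigma> (front_face q t) = 0" using \<eta> \<sigma> by blast
      then show ?thesis by simp
    qed
  qed
  have db: "bdry 1 (b \<sigma>) = cmul (- \<epsilon>) (Q (w \<sigma>) - Q (v \<sigma>))" if \<sigma>: "\<sigma> \<in> ?Y" for \<sigma>
  proof -
    have "bdry (Suc 0) (cap q (Suc 0) m1 (\<eta> \<sigma>)) =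
       cmul ((-1) ^ q) (cap q 0 (bdry (Suc (q + 0)) m1) (\<eta> \<sigma>) - cap (Suc q) 0 m1 (cobdry q (\<eta> \<sigma>)))"
      by (rule cap_chain_boundary)
    also have "bdry (Suc (q + 0)) m1 = 0" using m1c(2) n by simp
    also have "cap (Suc q) 0 m1 (cobdry q (\<eta> \<sigma>)) = cap n 0 m1 (%t. \<omega> (w \<sigma>) t - \<omega> (v \<sigma>) t)"
      unfolding n[symmetric] cap_chain_def
    proof (rule frag_extend_eq)
      fix t assume "t \<in> supp m1"
      then have ts: "singular_simplex n M t" using m1s by blast
      then have "ev (\<omega> (w \<sigma>)) (frag_of t) - ev (\<omega> (v \<sigma>)) (frag_of t) = ev (\<eta> \<sigma>) (bdry n (frag_of t))"
        using \<eta> \<sigma> by (simp only: singular_chain_of)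
      then have "cobdry q (\<eta> \<sigma>) (front_face n t) = \<omega> (w \<sigma>) (front_face n t) - \<omega> (v \<sigma>) (front_face n t)"
        using ff[OF ts] by (simp add: cobdry_def n)
      then show "cmul (cobdry q (\<eta> \<sigma>) (front_face n t)) (frag_of (back_face n 0 t)) =
        cmul (\<omega> (w \<sigma>) (front_face n t) - \<omega> (v \<sigma>) (front_face n t)) (frag_of (back_face n 0 t))" by simp
    qed
    also have "cap n 0 m1 (%t. \<omega> (w \<sigma>) t - \<omega> (v \<sigma>) t) = Q (w \<sigma>) - Q (v \<sigma>)"
      by (simp add: Q_def cap_chain_fun_diff)
    finally show ?thesis
      by (simp add: b_def \<epsilon>_def del: frag_cmul_eq_0_iff) (intro poly_mapping_eqI, simp add: lookup_minus algebra_simps)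
  qed
  \<comment> \<open>The cap product with the dual of an edge, the edge itself and the two connecting
    chains close up to a cycle in the contractible chart of the edge.\<close>
  define Z where "Z \<sigma> = cmul \<epsilon> (b \<sigma>) + frag_of \<sigma> + (s (w \<sigma>) - s (v \<sigma>))" for \<sigma>
  have Zb: "rbound 0 1 M {} (Z \<sigma>)" if \<sigma>: "\<sigma> \<in> ?Y" for \<sigma>
  proof -
    have P: "v \<sigma> \<in> ?P" "w \<sigma> \<in> ?P" using \<sigma> by auto
    have GU: "G (v \<sigma>) \<subseteq> U \<sigma>" "G (w \<sigma>) \<subseteq> U \<sigma>" using G P \<sigma> by blast+
    have sU: "schain 1 (subtopology M (U \<sigma>)) (s (v \<sigma>))" "schain 1 (subtopology M (U \<sigma>)) (s (w \<sigma>))"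
      using s P GU singular_chain_mono by blast+
    have "schain 1 (subtopology M (U \<sigma>)) (frag_of \<sigma>)"
      using in_K[OF \<sigma>] KU[OF \<sigma>] ys[OF \<sigma>] by (auto simp: singular_chain_of singular_simplex_subtopology)
    then have "schain 1 (subtopology M (U \<sigma>)) (Z \<sigma>)"
      unfolding Z_def by (intro singular_chain_add singular_chain_cmul singular_chain_diff bU[OF \<sigma>] sU)
    moreover have "bdry 1 (Z \<sigma>) = 0"
    proof -
      have "bdry 1 (s (w \<sigma>)) = Q (w \<sigma>) - frag_of (point_simplex (w \<sigma>))"
        "bdry 1 (s (v \<sigma>)) = Q (v \<sigma>) - frag_of (point_simplex (v \<sigma>))" using s P by blast+
      moreover have "cmul \<epsilon> (cmul (- \<epsilon>) (Q (w \<sigma>) - Q (v \<sigma>))) = Q (v \<sigma>) - Q (w \<sigma>)"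
        using \<epsilon> by simp
      ultimately show ?thesis
        unfolding Z_def chain_boundary_add chain_boundary_diff chain_boundary_cmul db[OF \<sigma>] vw(3)[OF \<sigma>]
        by (simp only:) simp
    qed
    ultimately have "rcycle 0 1 (subtopology M (U \<sigma>)) {} (Z \<sigma>)" by (simp add: rcycle_empty_zero)
    then have "rbound 0 1 (subtopology M (U \<sigma>)) {} (Z \<sigma>)"
      using contractible_cycle_bounds[OF chart_contractible[OF ch[OF \<sigma>]]] by simp
    then show ?thesis using rbound_from_subtopology by blast
  qed
  have "rbound 0 1 M {} (frag_extend Z y)" unfolding frag_extend_def by (intro rbound_sum rbound_scale Zb)
  moreover have "frag_extend Z y = cmul \<epsilon> (cap q 1 m1 \<beta>) + y"
  proof -
    have "frag_extend b y = cap q 1 m1 \<beta>"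
    proof -
      have "cap q 1 m1 \<beta> = (\<Sum>t\<in>supp m1. \<Sum>\<sigma>\<in>?Y. cmul (wt y \<sigma> * (wt m1 t * \<eta> \<sigma> (front_face q t))) (frag_of (back_face q 1 t)))"
        by (simp add: cap_chain_def frag_extend_def \<beta>_def frag_cmul_sum_left[symmetric] sum_distrib_left mult_ac)
      also have "\<dots> = (\<Sum>\<sigma>\<in>?Y. \<Sum>t\<in>supp m1. cmul (wt y \<sigma> * (wt m1 t * \<eta> \<sigma> (front_face q t))) (frag_of (back_face q 1 t)))"
        by (rule sum.swap)
      finally show ?thesis by (simp add: b_def cap_chain_def frag_extend_def frag_cmul_sum)
    qed
    then show ?thesis unfolding Z_def frag_extend_fun_add tele
      using additive_extend[of "cmul \<epsilon>", OF frag_cmul_diff, of b y] frag_expansion[of y] by simp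
  qed
  ultimately have res: "rbound 0 1 M {} (cmul \<epsilon> (cap q 1 m1 \<beta>) + y)" by simp
  show thesis
  proof (rule that[of "%t. - \<epsilon> * \<beta> t" m1])
    show "cocyc 0 q M (%t. - \<epsilon> * \<beta> t)"
      using \<open>cocyc 0 q M \<beta>\<close> unfolding cocyc_def ev_fun_cmul by auto
    have "cap q 1 m1 (%t. - \<epsilon> * \<beta> t) = cmul (- \<epsilon>) (cap q 1 m1 \<beta>)"
      by (simp add: cap_chain_def frag_extend_def frag_cmul_sum mult_ac)
    then have "z - cap q 1 m1 (%t. - \<epsilon> * \<beta> t) = (cmul \<epsilon> (cap q 1 m1 \<beta>) + y) - (y - z)"
      by (simp flip: minus_frag_cmul)
    then show "rbound 0 1 M {} (z - cap q 1 m1 (%t. - \<epsilon> * \<beta> t))" using rbound_diff[OF res yz] by metis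
  qed (fact m1 m1m0)+
qed

end

section \<open>Complements of locally flat submanifolds\<close>

lemma coord_convex_connected:
  assumes "coord_convex S" "S \<subseteq> EE n"
  shows "connectedin (Eucl n) S"
proof -
  have "path_connected S" unfolding path_connected_def
  proof (intro ballI)
    fix x y assume xy: "x \<in> S" "y \<in> S"
    let ?g = "%t i. x i + t * (y i - x i)"
    have "path ?g" unfolding path_def by (intro continuous_on_coordinatewise_then_product continuous_intros)
    moreover have "path_image ?g \<subseteq> S" using assms(1) xy unfolding coord_convex_def path_image_def by blast
    moreover have "pathstart ?g = x" "pathfinish ?g = y" by (auto simp: pathstart_def pathfinish_def)
    ultimately show "\<exists>g. path g \<and> path_image g \<subseteq> S \<and> pathstart g = x \<and> pathfinish g = y" by blast
  qed
  then have "connected S" by (rule path_connected_imp_connected)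
  then show ?thesis using assms(2) by (simp add: Euclidean_space_eq connectedin_subtopology)
qed

definition flat_chart :: "nat => 'b topology => 'b set => 'b set => ('b => nat => real) => ((nat => real) => 'b) => bool" where
  "flat_chart n W N U h g \<longleftrightarrow> chart (Suc n) W U h g \<and> h ` (U \<inter> N) = EE n"

lemma flat_chart_in_iff:
  assumes "flat_chart n W N U h g" "z \<in> EE (Suc n)"
  shows "g z \<in> N \<longleftrightarrow> z n = 0"
proof -
  have ch: "chart (Suc n) W U h g" and im: "h ` (U \<inter> N) = EE n" using assms(1) by (auto simp: flat_chart_def)
  have "g z \<in> N \<longleftrightarrow> h (g z) \<in> h ` (U \<inter> N)"
  proof
    assume "g z \<in> N"
    then show "h (g z) \<in> h ` (U \<inter> N)" using chart_in(2)[OF ch assms(2)] by blast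
  next
    assume "h (g z) \<in> h ` (U \<inter> N)"
    then obtain u where u: "u \<in> U" "u \<in> N" "h (g z) = h u" by blast
    then have "g z = u" using chart_inverse(1)[OF ch] chart_in(2)[OF ch assms(2)] by metis
    then show "g z \<in> N" using u by simp
  qed
  also have "\<dots> \<longleftrightarrow> z \<in> EE n" using im chart_inverse(2)[OF ch assms(2)] by simp
  also have "\<dots> \<longleftrightarrow> z n = 0"
    using assms(2) unfolding EE_iff by (metis Suc_leI le_neq_implies_less order_refl)
  finally show ?thesis .
qed

locale flat_submanifold =
  fixes n :: nat and W :: "'b topology" and N :: "'b set"
  assumes W: "topological_manifold (Suc n) W" and Wc: "compact_space W"
    and N: "compactin W N" and flat: "!!x. x \<in> N ==> \<exists>U h g. flat_chart n W N U h g \<and> x \<in> U"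
begin

lemma W_Hausdorff: "Hausdorff_space W" using W manifold_Hausdorff by blast

lemma N_closed: "closedin W N" using N W_Hausdorff compactin_imp_closedin by blast

lemma N_subset: "N \<subseteq> topspace W" using N compactin_subset_topspace by blast

abbreviation "comps \<equiv> connected_components_of (subtopology W (topspace W - N))"

lemma comps_open: "C \<in> comps ==> openin W C"
  using manifold_locally_path_connected[OF W] locally_path_connected_imp_locally_connected_space
    locally_connected_space_open_connected_components N_closed by blast

lemma comps_subset: "C \<in> comps ==> C \<subseteq> topspace W - N" using connected_components_of_subset by fastforce

lemma comps_nonempty: "C \<in> comps ==> C \<noteq> {}" using nonempty_connected_components_of by blast

lemma comps_absorb:
  assumes "C \<in> comps" "connectedin W S" "S \<subseteq> topspace W - N" "S \<inter> C \<noteq> {}"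
  shows "S \<subseteq> C"
proof -
  have "connectedin (subtopology W (topspace W - N)) S" using assms by (simp add: connectedin_subtopology)
  then show ?thesis using connected_components_of_maximal[OF assms(1)] assms(4) by (metis disjnt_def Int_commute)
qed

lemma comps_connected: "C \<in> comps ==> connectedin W C"
  using connectedin_connected_components_of connectedin_subtopology by blast

lemma comps_Union: "\<Union>comps = topspace W - N"
  using Union_connected_components_of[of "subtopology W (topspace W - N)"] by auto

lemma comps_closure_subset:
  assumes "C \<in> comps" shows "W closure_of C \<subseteq> C \<union> N"
proof -
  have "C \<union> N = topspace W - \<Union>(comps - {C})"
  proof -
    have disj: "C \<inter> D = {}" if D: "D \<in> comps - {C}" for D
      using pairwiseD[OF pairwise_disjoint_connected_components_of assms, of D] D by (auto simp: disjnt_def)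
    define R where "R = \<Union>(comps - {C})"
    have "C \<inter> R = {}" unfolding R_def using disj by (simp add: Int_Union)
    moreover have "\<Union>comps = C \<union> R" unfolding R_def using assms by auto
    then have "topspace W - N = C \<union> R" by (simp only: comps_Union)
    ultimately show ?thesis using N_subset unfolding R_def[symmetric] by auto
  qed
  moreover have "openin W (\<Union>(comps - {C}))" using comps_open by blast
  ultimately have "closedin W (C \<union> N)" by auto
  then show ?thesis by (simp add: closure_of_minimal)
qed

section \<open>The two sides of a flat chart and the push towards the submanifold\<close>

text \<open>The flag has a meaning in one chart only: no choice of sides along all of
  \<open>N\<close> is presupposed.\<close>

definition half :: "bool => ((nat => real) => 'b) => 'b set" where
  "half s g = g ` {z \<in> EE (Suc n). if s then z n > 0 else z n < 0}"

lemma half_facts: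
  assumes fc: "flat_chart n W N U h g"
  shows "connectedin W (half s g)" "half s g \<subseteq> topspace W - N" "half s g \<noteq> {}"
    "U - N \<subseteq> half True g \<union> half False g" "U \<inter> N \<subseteq> W closure_of (half s g)"
proof -
  have ch: "chart (Suc n) W U h g" using fc by (simp add: flat_chart_def)
  let ?H = "{z \<in> EE (Suc n). if s then z n > 0 else z n < 0}"
  have conv: "coord_convex ?H" unfolding coord_convex_def
  proof (intro ballI)
    fix x y :: "nat => real" and t :: real
    assume x: "x \<in> ?H" and y: "y \<in> ?H" and t: "t \<in> {0..1}"
    have eq: "y n + t * (x n - y n) = (1 - t) * y n + t * x n" by (simp add: algebra_simps)
    have "if s then y n + t * (x n - y n) > 0 else y n + t * (x n - y n) < 0"
    proof (cases s)
      case True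
      then have "y n > 0" "x n > 0" using x y by auto
      then show ?thesis unfolding eq using t True by (cases "t = 0") (auto intro!: add_nonneg_pos mult_nonneg_nonneg)
    next
      case False
      then have "y n < 0" "x n < 0" using x y by auto
      then show ?thesis unfolding eq using t False
        by (cases "t = 0") (auto intro!: add_nonpos_neg mult_nonneg_nonpos mult_pos_neg)
    qed
    then show "(%i. y i + t * (x i - y i)) \<in> ?H" using x y by (simp add: EE_iff)
  qed
  then have "connectedin (Eucl (Suc n)) ?H" by (rule coord_convex_connected) auto
  then show "connectedin W (half s g)"
    unfolding half_def using chart_continuous(3)[OF ch] connectedin_continuous_map_image by blast
  show "half s g \<subseteq> topspace W - N"
    unfolding half_def using chart_in(2)[OF ch] chart_subset[OF ch] flat_chart_in_iff[OF fc] by (force split: if_splits)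
  have "(%i. if i = n then (if s then 1 else -1) else 0) \<in> ?H" by (auto simp: EE_iff)
  then show "half s g \<noteq> {}" unfolding half_def by blast
  show "U - N \<subseteq> half True g \<union> half False g"
  proof
    fix u assume u: "u \<in> U - N"
    then have "h u n \<noteq> 0" using flat_chart_in_iff[OF fc chart_in(1)[OF ch]] chart_inverse(1)[OF ch] by auto
    then have "h u \<in> {z \<in> EE (Suc n). z n > 0} \<union> {z \<in> EE (Suc n). z n < 0}" using chart_in(1)[OF ch] u by auto
    then have "g (h u) \<in> half True g \<union> half False g" unfolding half_def by auto
    then show "u \<in> half True g \<union> half False g" using chart_inverse(1)[OF ch] u by auto
  qed
  show "U \<inter> N \<subseteq> W closure_of (half s g)"
  proof
    fix u assume u: "u \<in> U \<inter> N"
    let ?z = "h u"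
    have zE: "?z \<in> EE (Suc n)" and gz: "g ?z = u" using chart_in(1)[OF ch] chart_inverse(1)[OF ch] u by auto
    have z0: "?z n = 0" using flat_chart_in_iff[OF fc zE] gz u by simp
    show "u \<in> W closure_of (half s g)" unfolding in_closure_of
    proof (intro conjI allI impI)
      show "u \<in> topspace W" using u N_subset by blast
      fix T assume T: "u \<in> T \<and> openin W T"
      then have "openin (Eucl (Suc n)) {z \<in> EE (Suc n). g z \<in> T}"
        using openin_continuous_map_preimage[OF chart_continuous(3)[OF ch]] by blast
      moreover have "?z \<in> {z \<in> EE (Suc n). g z \<in> T}" using zE gz T by simp
      ultimately obtain r where r: "r > 0" "ccube (Suc n) ?z r \<subseteq> {z \<in> EE (Suc n). g z \<in> T}"
        using openin_Euclidean_ccube by blast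
      let ?w = "?z(n := if s then r else - r)"
      have "?w \<in> ccube (Suc n) ?z r" using zE r(1) z0 by (auto simp: ccube_def EE_iff)
      moreover have "g ?w \<in> half s g" unfolding half_def using zE r(1) by (intro imageI) (auto simp: EE_iff)
      ultimately show "\<exists>y. y \<in> half s g \<and> y \<in> T" using r(2) by blast
    qed
  qed
qed

text \<open>In a flat chart the last coordinate \<open>t\<close> is moved towards \<open>0\<close> by the amount of a bump function;
  \<open>max (t - b) 0 + min (t + b) 0\<close> is \<open>t\<close> shrunk by \<open>b\<close>, and it vanishes if \<open>\<bar>t\<bar> \<le> b\<close>.\<close>

definition push_homotopy :: "(real \<times> 'b => 'b) => 'b set => bool" where
  "push_homotopy H V \<longleftrightarrow> continuous_map (prod_topology (top_of_set {0..1}) W) W H \<and>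
     (\<forall>w \<in> topspace W. H (0, w) = w) \<and> (\<forall>s \<in> {0..1}. \<forall>w \<in> N. H (s, w) = w) \<and>
     (\<forall>s \<in> {0..1}. \<forall>C \<in> comps. \<forall>w \<in> C. H (s, w) \<in> C \<union> N) \<and> (\<forall>w \<in> V. H (1, w) \<in> N)"

lemma local_push:
  assumes x: "x \<in> N"
  shows "\<exists>H V. push_homotopy H V \<and> openin W V \<and> x \<in> V"
proof -
  obtain U h g where fc: "flat_chart n W N U h g" and xU: "x \<in> U" using flat[OF x] by blast
  then have ch: "chart (Suc n) W U h g" by (simp add: flat_chart_def)
  define a where "a = h x"
  have aE: "a \<in> EE (Suc n)" using chart_in(1)[OF ch xU] by (simp add: a_def)
  have an: "a n = 0" using flat_chart_in_iff[OF fc aE] chart_inverse(1)[OF ch xU] x by (simp add: a_def)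
  \<comment> \<open>A bump of height one at \<open>a\<close>, zero from l1-distance one
    onwards.\<close>
  define b where "b z = max 0 (1 - (\<Sum>i<Suc n. \<bar>z i - a i\<bar>))" for z :: "nat => real"
  define G where "G = (%(s, z) i. if i = n then max (z n - s * b z) 0 + min (z n + s * b z) 0 else z i)"
  have bpos: "b z \<ge> 0" for z by (simp add: b_def)
  have GE: "G (s, z) \<in> EE (Suc n)" if "z \<in> EE (Suc n)" for s z using that by (auto simp: G_def EE_iff)
  have G0: "G (s, z) = z" if "s * b z = 0" for s z using that by (auto simp: G_def fun_eq_iff max_def min_def)
  have Gn: "G (s, z) = z" if "z n = 0" "s \<ge> 0" for s z
    using that bpos[of z] by (auto simp: G_def fun_eq_iff max_absorb2 min_absorb2)
  have Gpos: "G (s, z) n \<ge> 0" if "z n > 0" "s \<ge> 0" for s z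
    using that bpos[of z] by (simp add: G_def min_absorb2)
  have Gneg: "G (s, z) n \<le> 0" if "z n < 0" "s \<ge> 0" for s z
  proof -
    have "s * b z \<ge> 0" using that bpos[of z] by simp
    then show ?thesis using that by (simp add: G_def max_absorb2)
  qed
  have pc: "continuous_on A (%z. snd z i)" for A :: "(real \<times> (nat => real)) set" and i
    by (rule continuous_on_compose2[OF continuous_on_product_coordinates continuous_on_snd[OF continuous_on_id]]) auto
  have cb: "continuous_on A (%z. b (snd z))" for A :: "(real \<times> (nat => real)) set"
    unfolding b_def by (intro continuous_intros pc)
  have contG: "continuous_on ({0..1} \<times> EE (Suc n)) G"
  proof (rule continuous_on_coordinatewise_then_product)
    fix i
    have "continuous_on ({0..1} \<times> EE (Suc n)) (%z. max (snd z n - fst z * b (snd z)) 0 + min (snd z n + fst z * b (snd z)) 0)"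
      by (intro continuous_intros pc cb)
    then show "continuous_on ({0..1} \<times> EE (Suc n)) (%z. G z i)"
      using pc by (cases "i = n") (auto simp: G_def case_prod_beta)
  qed
  have cG: "continuous_map (prod_topology (top_of_set {0..1}) (Eucl (Suc n))) (Eucl (Suc n)) G"
  proof -
    have "G ` ({0..1} \<times> EE (Suc n)) \<subseteq> EE (Suc n)" using GE by auto
    then show ?thesis
      using contG by (simp add: Euclidean_space_eq prod_topology_subtopology_eu continuous_map_in_subtopology image_subset_iff_funcset)
  qed
  \<comment> \<open>The bump vanishes outside the unit cube, so the homotopy in the chart extends by
    the identity.\<close>
  define H where "H = (%(s, w). if w \<in> U then g (G (s, h w)) else w)"
  let ?C = "ccube (Suc n) a 1" and ?I = "top_of_set {0..1::real}"
  have big: "b z = 0" if z: "z \<in> EE (Suc n)" "z \<notin> ?C" for z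
  proof -
    obtain j where "j < Suc n" "\<bar>z j - a j\<bar> > 1" using z unfolding ccube_def mem_Collect_eq by (meson not_le)
    moreover have "\<bar>z j - a j\<bar> \<le> (\<Sum>i<Suc n. \<bar>z i - a i\<bar>)"
      using \<open>j < Suc n\<close> by (intro member_le_sum) auto
    ultimately show ?thesis by (simp add: b_def)
  qed
  have Kcl: "closedin W (g ` ?C)" using chart_compact[OF ch ccube_compact] W_Hausdorff compactin_imp_closedin by blast
  let ?K' = "topspace W - g ` ?C"
  have c1: "continuous_map (prod_topology ?I (subtopology W U)) W H"
  proof (rule continuous_map_eq)
    have "continuous_map (prod_topology ?I (subtopology W U)) (prod_topology ?I (Eucl (Suc n))) (%z. (fst z, h (snd z)))"
      by (intro continuous_map_pairedI continuous_map_fst continuous_map_compose[OF continuous_map_snd chart_continuous(1)[OF ch], unfolded o_def])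
    then show "continuous_map (prod_topology ?I (subtopology W U)) W (g \<circ> (G \<circ> (%z. (fst z, h (snd z)))))"
      by (intro continuous_map_compose[OF _ chart_continuous(3)[OF ch]] continuous_map_compose[OF _ cG])
  qed (auto simp: H_def)
  have out: "H (s, w) = w" if "w \<in> ?K'" for s w
  proof (cases "w \<in> U")
    case True
    have "h w \<notin> ?C" using that chart_inverse(1)[OF ch True] by (metis DiffD2 imageI)
    then have "b (h w) = 0" using big chart_in(1)[OF ch True] by blast
    then show ?thesis using True G0 chart_inverse(1)[OF ch True] by (simp add: H_def)
  qed (simp add: H_def)
  have c2: "continuous_map (prod_topology ?I (subtopology W ?K')) W H"
  proof (rule continuous_map_eq)
    show "continuous_map (prod_topology ?I (subtopology W ?K')) W snd"
      using continuous_map_snd continuous_map_in_subtopology by blast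
  qed (use out in auto)
  have KU: "g ` ?C \<subseteq> U" using chart_image_subset[OF ch ccube_subset_EE] .
  have tK: "?K' \<subseteq> topspace W" "U \<subseteq> topspace W" using chart_subset[OF ch] by auto
  have sub_prod: "subtopology (prod_topology ?I W) ({0..1} \<times> A) = prod_topology ?I (subtopology W A)" for A
    by (simp add: prod_topology_subtopology subtopology_subtopology subtopology_Times flip: prod_topology_subtopology)
  have h1: "continuous_map (prod_topology ?I W) W H"
  proof (rule pasting_lemma[where I = "UNIV :: bool set" and T = "%i. {0..1} \<times> (if i then U else ?K')" and f = "%_. H"])
    have "openin ?I {0..1}" using openin_topspace[of ?I] by simp
    then show "openin (prod_topology ?I W) ({0..1} \<times> (if i then U else ?K'))" for i
      using chart_open[OF ch] Kcl by (cases i) (auto simp: openin_prod_Times_iff)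
    show "continuous_map (subtopology (prod_topology ?I W) ({0..1} \<times> (if i then U else ?K'))) W H" for i
      unfolding sub_prod using c1 c2 by (cases i) auto
    show "\<exists>j. j \<in> UNIV \<and> w \<in> {0..1} \<times> (if j then U else ?K') \<and> H w = H w" if "w \<in> topspace (prod_topology ?I W)" for w
      using KU that by (cases "snd w \<in> U") (auto intro: exI[of _ True] exI[of _ False])
  qed simp
  have h2: "H (0, w) = w" if "w \<in> topspace W" for w using G0[of 0] chart_inverse(1)[OF ch] by (simp add: H_def)
  have h3: "H (s, w) = w" if "w \<in> N" "s \<in> {0..1}" for w s
  proof (cases "w \<in> U")
    case True
    have "h w n = 0" using flat_chart_in_iff[OF fc chart_in(1)[OF ch True]] chart_inverse(1)[OF ch True] that by simp
    then show ?thesis using True Gn[of "h w" s] that(2) chart_inverse(1)[OF ch True] by (simp add: H_def)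
  qed (simp add: H_def)
  have h4: "H (s, w) \<in> C \<union> N" if C: "C \<in> comps" and w: "w \<in> C" and s: "s \<in> {0..1}" for s C w
  proof (cases "w \<in> U")
    case True
    let ?z = "h w"
    have zE: "?z \<in> EE (Suc n)" and gz: "g ?z = w" using chart_in(1)[OF ch True] chart_inverse(1)[OF ch True] by auto
    have wN: "w \<notin> N" using comps_subset[OF C] w by blast
    then have z0: "?z n \<noteq> 0" using flat_chart_in_iff[OF fc zE] gz by simp
    define t where "t \<longleftrightarrow> ?z n > 0"
    have "w \<in> half t g" unfolding half_def using zE gz z0 t_def by (intro image_eqI[of _ _ ?z]) auto
    then have hC: "half t g \<subseteq> C" using comps_absorb[OF C half_facts(1,2)[OF fc]] w by blast
    have Hw: "H (s, w) = g (G (s, ?z))" using True by (simp add: H_def)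
    show ?thesis
    proof (cases "G (s, ?z) n = 0")
      case True
      then show ?thesis using flat_chart_in_iff[OF fc GE[OF zE]] Hw by simp
    next
      case False
      then have "if t then G (s, ?z) n > 0 else G (s, ?z) n < 0"
        using Gpos[of ?z s] Gneg[of ?z s] z0 s unfolding t_def by (auto simp: less_le)
      then have "g (G (s, ?z)) \<in> half t g" unfolding half_def using GE[OF zE] by (intro imageI) auto
      then show ?thesis using hC Hw by auto
    qed
  qed (use w in \<open>simp add: H_def\<close>)
  \<comment> \<open>This radius keeps the l1-distance from \<open>a\<close> at most
    \<open>1/2\<close>, so the bump is at least \<open>1/2\<close> while the last coordinate is at
    most \<open>1/2\<close> in absolute value, and time \<open>1\<close> reaches the
    hyperplane.\<close>
  define V where "V = g ` ocube (Suc n) a (1 / (2 * real (Suc n)))"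
  have h5: "openin W V" unfolding V_def by (rule chart_open_image[OF ch ocube_open])
  have "a \<in> ocube (Suc n) a (1 / (2 * real (Suc n)))" using aE by (intro ocube_center) auto
  then have h6: "x \<in> V" unfolding V_def using chart_inverse(1)[OF ch xU] a_def by (metis imageI)
  have h7: "H (1, w) \<in> N" if w: "w \<in> V" for w
  proof -
    obtain z where z: "z \<in> ocube (Suc n) a (1 / (2 * real (Suc n)))" "w = g z" using w V_def by blast
    then have zE: "z \<in> EE (Suc n)" by (auto simp: ocube_def)
    have le: "\<bar>z i - a i\<bar> \<le> 1 / (2 * real (Suc n))" if "i < Suc n" for i
      using z(1) that by (auto simp: ocube_def intro: less_imp_le)
    have "(\<Sum>i<Suc n. \<bar>z i - a i\<bar>) \<le> (\<Sum>i<Suc n. 1 / (2 * real (Suc n)))"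
      by (rule sum_mono) (use le in auto)
    also have "\<dots> = 1 / 2" by simp
    finally have "b z \<ge> 1 - 1 / 2" unfolding b_def by (intro max.coboundedI2) linarith
    then have b: "b z \<ge> 1 / 2" by simp
    have "\<bar>z n\<bar> \<le> 1 / (2 * real (Suc n))" using le[of n] an by simp
    also have "\<dots> \<le> 1 / 2" by (simp add: field_simps)
    finally have "\<bar>z n\<bar> \<le> b z" using b by simp
    then have "z n - b z \<le> 0" "z n + b z \<ge> 0" by linarith+
    then have "G (1, z) n = 0" by (simp add: G_def max_absorb2 min_absorb2)
    then have "g (G (1, z)) \<in> N" using flat_chart_in_iff[OF fc GE[OF zE]] by simp
    then show ?thesis using z(2) chart_in(2)[OF ch zE] chart_inverse(2)[OF ch zE] by (simp add: H_def)
  qed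
  have "push_homotopy H V" unfolding push_homotopy_def by (intro conjI ballI h1 h2 h3 h4 h7)
  then show ?thesis using h5 h6 by blast
qed

text \<open>Both homotopies fix \<open>N\<close> and move a side only into itself or
  \<open>N\<close>. Hence they can be performed one after the other, and the sets that end in
  \<open>N\<close> accumulate.\<close>

lemma push_homotopy_compose:
  assumes H: "push_homotopy H V" and K: "push_homotopy K V'"
  shows "push_homotopy (%z. K (fst z, H z)) (V \<union> {w \<in> topspace W. H (1, w) \<in> V'})"
proof -
  let ?P = "prod_topology (top_of_set {0..1}) W"
  have "continuous_map ?P ?P (%z. (fst z, H z))"
    using H unfolding push_homotopy_def by (intro continuous_map_pairedI continuous_map_fst) blast
  then have "continuous_map ?P W (K \<circ> (%z. (fst z, H z)))"
    using K unfolding push_homotopy_def by (blast intro: continuous_map_compose)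
  moreover have "K (s, H (s, w)) \<in> C \<union> N" if "s \<in> {0..1}" "C \<in> comps" "w \<in> C" for s C w
  proof -
    have "H (s, w) \<in> C \<union> N" using H that unfolding push_homotopy_def by blast
    then show ?thesis using K that unfolding push_homotopy_def by (metis UnE UnCI)
  qed
  ultimately show ?thesis using H K unfolding push_homotopy_def o_def by auto
qed

text \<open>The substitute for a collar: by compactness finitely many local pushes suffice, and as
  each fixes \<open>N\<close>, none undoes an earlier one.\<close>

lemma neighbourhood_push:
  obtains H V where "push_homotopy H V" "openin W V" "N \<subseteq> V"
proof -
  have "\<forall>x\<in>N. \<exists>V. openin W V \<and> x \<in> V \<and> (\<exists>H. push_homotopy H V)"
    using local_push by blast
  from bchoice[OF this] obtain V where V: "\<forall>x\<in>N. openin W (V x) \<and> x \<in> V x \<and> (\<exists>H. push_homotopy H (V x))" ..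
  have "N \<subseteq> \<Union>(V ` N)" using V by blast
  moreover have "\<forall>S\<in>V ` N. openin W S" using V by blast
  ultimately obtain \<V> where v: "finite \<V>" "\<V> \<subseteq> V ` N" "N \<subseteq> \<Union>\<V>"
    using N unfolding compactin_def by meson
  from finite_subset_image[OF v(1,2)] obtain A where A: "A \<subseteq> N" "finite A" "\<V> = V ` A" by blast
  have "\<exists>H Q. push_homotopy H Q \<and> openin W Q \<and> N \<inter> \<Union>(V ` A) \<subseteq> Q"
    using A(2,1)
  proof (induction A rule: finite_induct)
    case empty
    have "push_homotopy snd {}" unfolding push_homotopy_def by (auto intro: continuous_map_snd)
    then show ?case by (intro exI[of _ snd] exI[of _ "{}"]) auto
  next
    case (insert x A)
    then obtain H Q where IH: "push_homotopy H Q" "openin W Q" "N \<inter> \<Union>(V ` A) \<subseteq> Q" by auto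
    obtain K where K: "push_homotopy K (V x)" using V insert.prems by auto
    let ?Q = "Q \<union> {w \<in> topspace W. H (1, w) \<in> V x}"
    have "continuous_map W (prod_topology (top_of_set {0..1}) W) (%w. (1::real, w))"
      by (intro continuous_map_pairedI) (auto simp: continuous_map_in_subtopology)
    then have cH: "continuous_map W W (H \<circ> (%w. (1, w)))"
      using IH(1) unfolding push_homotopy_def by (blast intro: continuous_map_compose)
    then have "openin W {w \<in> topspace W. (H \<circ> (%w. (1, w))) w \<in> V x}"
      using V insert.prems by (intro openin_continuous_map_preimage[OF cH]) auto
    then have "openin W ?Q" using IH(2) by (auto simp: o_def)
    moreover have "H (1, w) = w" if "w \<in> N" for w using IH(1) that unfolding push_homotopy_def by auto
    then have "N \<inter> \<Union>(V ` insert x A) \<subseteq> ?Q" using IH(3) N_subset by auto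
    ultimately show ?case using push_homotopy_compose[OF IH(1) K] by blast
  qed
  then obtain H Q where "push_homotopy H Q" "openin W Q" "N \<inter> \<Union>(V ` A) \<subseteq> Q" by blast
  moreover have "N \<subseteq> \<Union>(V ` A)" using v(3) A(3) by simp
  ultimately show thesis using that[of H Q] by blast
qed

section \<open>Components of the complement of a connected submanifold\<close>

context
  assumes Wconn: "connected_space W" and Nconn: "connectedin W N" and Nne: "N \<noteq> {}"
begin

text \<open>A component that comes close to a point of \<open>N\<close> contains a half of the chart
  there and so touches all of \<open>N\<close> nearby. The touched points thus form an open and
  closed part of \<open>N\<close>, nonempty because the component would otherwise be open and closed
  in \<open>W\<close>.\<close>

lemma comps_closure:
  assumes C: "C \<in> comps" shows "W closure_of C = C \<union> N"
proof -
  let ?S = "N \<inter> W closure_of C"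
  have Cne: "C \<noteq> {}" using comps_nonempty[OF C] .
  have CW: "C \<subseteq> topspace W" using comps_subset[OF C] by blast
  have nb: "\<exists>V. openin W V \<and> x \<in> V \<and> (V \<inter> N \<subseteq> W closure_of C \<or> V \<inter> N \<inter> W closure_of C = {})" if x: "x \<in> N" for x
  proof -
    obtain U h g where fc: "flat_chart n W N U h g" and xU: "x \<in> U" using flat[OF x] by blast
    have oU: "openin W U" using fc chart_open unfolding flat_chart_def by blast
    have "U \<inter> N \<subseteq> W closure_of C" if y: "y \<in> U \<inter> N" "y \<in> W closure_of C" for y
    proof -
      obtain c where c: "c \<in> C" "c \<in> U" using y oU unfolding in_closure_of by blast
      then have "c \<in> half True g \<union> half False g" using half_facts(4)[OF fc] comps_subset[OF C] by blast
      then obtain s where s: "c \<in> half s g" by blast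
      then have "half s g \<subseteq> C" using comps_absorb[OF C half_facts(1,2)[OF fc]] c by blast
      then show ?thesis using half_facts(5)[OF fc, of s] closure_of_mono by blast
    qed
    then show ?thesis using oU xU by (intro exI[of _ U]) blast
  qed
  have "?S \<noteq> {}"
  proof
    assume "?S = {}"
    then have "W closure_of C \<subseteq> C" using comps_closure_subset[OF C] by blast
    then have "closedin W C" using CW by (metis closure_of_subset closure_of_subset_eq subset_antisym)
    then have "C = topspace W" using Wconn comps_open[OF C] Cne unfolding connected_space_clopen_in by blast
    then show False using Nne N_subset comps_subset[OF C] by blast
  qed
  moreover have "N \<subseteq> W closure_of C"
  proof (rule ccontr)
    assume "\<not> N \<subseteq> W closure_of C"
    then have ne: "N - W closure_of C \<noteq> {}" by blast
    have "\<forall>x\<in>N. \<exists>V. openin W V \<and> x \<in> V \<and> (V \<inter> N \<subseteq> W closure_of C \<or> V \<inter> N \<inter> W closure_of C = {})" using nb by simp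
    from bchoice[OF this] obtain V where V': "\<forall>x\<in>N. openin W (V x) \<and> x \<in> V x \<and>
       (V x \<inter> N \<subseteq> W closure_of C \<or> V x \<inter> N \<inter> W closure_of C = {})" ..
    then have V: "!!x. x \<in> N ==> openin W (V x)" "!!x. x \<in> N ==> x \<in> V x"
      "!!x. x \<in> N ==> V x \<inter> N \<subseteq> W closure_of C \<or> V x \<inter> N \<inter> W closure_of C = {}" by simp_all
    let ?E1 = "\<Union>(V ` ?S)" and ?E2 = "topspace W - W closure_of C"
    have "openin W ?E1" using V(1) by blast
    moreover have "openin W ?E2" by (simp add: openin_diff)
    moreover have "N \<subseteq> ?E1 \<union> ?E2" using V(2) N_subset by blast
    moreover have "?E1 \<inter> ?E2 \<inter> N = {}" using V(2,3) by blast
    moreover have "?E1 \<inter> N \<noteq> {}" using \<open>?S \<noteq> {}\<close> V(2) by blast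
    moreover have "?E2 \<inter> N \<noteq> {}" using ne N_subset by blast
    ultimately show False using Nconn unfolding connectedin by (metis Int_commute)
  qed
  ultimately show ?thesis using comps_closure_subset[OF C] closure_of_subset[OF CW] by blast
qed

text \<open>Every component touches a fixed point of \<open>N\<close> and therefore contains one of
  the two halves of a chart there.\<close>

lemma comps_two:
  assumes C: "C \<in> comps" and C': "C' \<in> comps" "C' \<noteq> C"
  shows "comps = {C, C'}"
proof -
  obtain x where x: "x \<in> N" using Nne by blast
  obtain U h g where fc: "flat_chart n W N U h g" and xU: "x \<in> U" using flat[OF x] by blast
  have oU: "openin W U" using fc chart_open unfolding flat_chart_def by blast
  have ex: "\<exists>s. half s g \<subseteq> D" if D: "D \<in> comps" for D
  proof -
    have "x \<in> W closure_of D" using comps_closure[OF D] x by blast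
    then obtain c where c: "c \<in> D" "c \<in> U" using xU oU unfolding in_closure_of by blast
    then have "c \<in> half True g \<union> half False g" using half_facts(4)[OF fc] comps_subset[OF D] by blast
    then obtain s where s: "c \<in> half s g" by blast
    then show ?thesis using comps_absorb[OF D half_facts(1,2)[OF fc]] c by blast
  qed
  have uniq: "D = D'" if "D \<in> comps" "D' \<in> comps" "half s g \<subseteq> D" "half s g \<subseteq> D'" for D D' s
    using pairwiseD[OF pairwise_disjoint_connected_components_of that(1,2)] that(3,4) half_facts(3)[OF fc, of s]
    by (auto simp: disjnt_def)
  obtain s s' where s: "half s g \<subseteq> C" "half s' g \<subseteq> C'" using ex C C' by blast
  then have "s \<noteq> s'" using uniq C C' by blast
  have "D = C \<or> D = C'" if D: "D \<in> comps" for D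
  proof -
    obtain t where "half t g \<subseteq> D" using ex D by blast
    then show ?thesis using uniq[OF D] C C' s \<open>s \<noteq> s'\<close> by (cases t; cases s; cases s') auto
  qed
  then show ?thesis using C C' by blast
qed

lemma complement_nonempty: "topspace W - N \<noteq> {}"
proof -
  obtain x where x: "x \<in> N" using Nne by blast
  obtain U h g where fc: "flat_chart n W N U h g" using flat[OF x] by blast
  show ?thesis using half_facts(2,3)[OF fc, of True] by blast
qed

end

end

declare One_nat_def [simp del]

section \<open>Fundamental classes and the neighbourhood of the embedded manifold\<close>

text \<open>Connectedness spreads vanishing from one point to all points, and then
  \<open>top_vanishing\<close> applies with the whole compact manifold as \<open>K\<close>.\<close>

lemma top_class_vanishes:
  assumes X: "topological_manifold n X" and n: "n > 0" and comp: "compact_space X" and conn: "connected_space X"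
    and c: "rcycle m n X {} c" and y: "y \<in> topspace X" "rbound m n X (topspace X - {y}) c"
  shows "rbound m n X {} c"
proof -
  have c': "rcycle m n X (topspace X - topspace X) c" using c by simp
  have "rbound m n X (topspace X - {x}) c" if "x \<in> topspace X" for x
    using locally_constant_connected[OF X n openin_topspace _ c' y(1) that y(2)] conn
    by (simp add: connectedin_topspace)
  moreover have "top_vanishing m n X (topspace X)"
    using top_vanishing_compact[OF X n] comp by (simp add: compact_space_def)
  ultimately have "rbound m n X (topspace X - topspace X) c" using c' unfolding top_vanishing_def by blast
  then show ?thesis by simp
qed

lemma chain_Int:
  "schain k (subtopology X A) c ==> schain k (subtopology X B) c ==>
     schain k (subtopology X (A \<inter> B)) c" unfolding singular_chain_subtopology by blast

lemma chain_subset: "schain k (subtopology X A) c ==> A \<subseteq> B ==> schain k (subtopology X B) c"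
  using singular_chain_mono by blast

lemma rchain_empty_iff: "rchain m k X {} c \<longleftrightarrow> (\<exists>d. schain k X d \<and> c = cmul m d)"
proof
  assume "rchain m k X {} c"
  then obtain d e where "schain k X d" "schain k (subtopology X {}) e" "c = cmul m d + e" using rchain_decomp by blast
  then show "\<exists>d. schain k X d \<and> c = cmul m d" by (auto simp: singular_chain_empty)
qed (auto simp: rchain_cmul)

lemma rbound_empty_iff: "rbound m k X {} c \<longleftrightarrow> (\<exists>b d. schain (Suc k) X b \<and> schain k X d \<and>
    c = bdry (Suc k) b + cmul m d)"
  unfolding rbound_def rchain_empty_iff by (metis add.commute diff_add_cancel add_diff_cancel_right')

lemma rcycle_0_rel: "rcycle 0 k X {} c ==> rcycle m k X S c"
  using rcycle_mono[OF rcycle_dvd[of 0 k X "{}" c m]] by auto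

lemma rbound_0_rel: "rbound 0 k X {} c ==> rbound m k X S c"
  using rbound_mono[OF rbound_dvd[of 0 k X "{}" c m]] by auto

text \<open>Modulo \<open>p\<close> the top local homology is one-dimensional over a field, so the
  nonzero class of \<open>a\<close> spans it; \<open>u\<close> inverts its degree.\<close>

lemma local_class_multiple:
  assumes X: "topological_manifold n X" and x: "x \<in> topspace X" and n: "n > 0" and p: "prime (p::int)"
    and c: "rcycle 0 n X (topspace X - {x}) c" and a: "rcycle 0 n X (topspace X - {x}) a"
    and na: "\<not> rbound p n X (topspace X - {x}) a"
  obtains k where "rbound p n X (topspace X - {x}) (c - cmul k a)"
proof -
  let ?S = "topspace X - {x}"
  obtain F :: "'a chain => int" and t where F:
    "!!a b. rcycle 0 n X ?S a ==> rcycle 0 n X ?S b ==> F (a - b) = F a - F b"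
    "!!j a. rcycle 0 n X ?S a ==> F (cmul j a) = j * F a"
    "!!a. rcycle 0 n X ?S a ==> F a = 0 \<longleftrightarrow> rbound 0 n X ?S a" "rcycle 0 n X ?S t" "F t = 1"
    by (rule local_homology_generator[OF X x n]) (assumption | rule that)+
  have red: "rbound p n X ?S (e - cmul (F e) t)" if e: "rcycle 0 n X ?S e" for e
  proof -
    have "F (e - cmul (F e) t) = 0" using F(1)[OF e rcycle_scale[OF F(4)]] F(2)[OF F(4)] F(5) by simp
    then show ?thesis using F(3)[OF rcycle_diff[OF e rcycle_scale[OF F(4)]]] rbound_dvd[of 0 n X ?S _ p] by simp
  qed
  have mult: "rbound p n X ?S (cmul (p * j) t)" for j
    using rbound_cmul[OF singular_chain_cmul[OF rcycle_chain[OF F(4)]], of p ?S j] by simp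
  have "\<not> p dvd F a"
  proof
    assume "p dvd F a"
    then have "rbound p n X ?S ((a - cmul (F a) t) + cmul (F a) t)" using red[OF a] mult by (intro rbound_add) auto
    then show False using na by simp
  qed
  then have "coprime (F a) p" using prime_imp_coprime[OF p] coprime_commute by metis
  then obtain u where "[F a * u = 1] (mod p)" using cong_solve_coprime_int by blast
  then have "p dvd 1 - F a * u" using cong_sym cong_iff_dvd_diff by blast
  then obtain s where s: "1 - F a * u = p * s" by (rule dvdE)
  let ?k = "F c * u"
  have "rbound p n X ?S ((c - cmul (F c) t) - cmul ?k (a - cmul (F a) t) + cmul (p * (F c * s)) t)"
    by (intro rbound_add rbound_diff rbound_scale red c a mult)
  moreover have "p * (F c * s) = F c * (1 - F a * u)" by (simp add: s)
  then have "p * (F c * s) = F c - ?k * F a" by (simp add: algebra_simps)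
  ultimately have "rbound p n X ?S (c - cmul ?k a)" by (simp add: frag_cmul_diff frag_cmul_diff_distrib)
  then show thesis by (rule that)
qed

text \<open>Beyond being a compact connected manifold, \<open>W\<close> contributes the vanishing of
  homology in degrees one to three and a 4-cycle \<open>a\<close>, nonzero modulo \<open>p\<close>,
  in the role of its fundamental class.\<close>

locale embedded = oriented_manifold 3 2 M m0 + flat_submanifold 3 W "f ` topspace M"
  for M :: "'a topology" and m0 and W :: "'b topology" and f +
  fixes p :: int and a
  assumes p: "prime p"
    and emb: "embedding_map M W f"
    and Mconn: "connected_space M" and Mne: "topspace M \<noteq> {}" and Mcomp: "compact_space M"
    and Wconn: "connected_space W"
    and HW: "!!k z. k \<in> {1, 2, 3} ==> rcycle 0 k W {} z ==> rbound 0 k W {} z"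
    and a: "rcycle 0 4 W {} a" "\<not> rbound p 4 W {} a"
begin

abbreviation "N \<equiv> f ` topspace M"

lemma W4: "topological_manifold 4 W" using W by simp

lemma p1: "p > 1" using p prime_gt_1_int by blast

lemma f_cont: "continuous_map M W f" "continuous_map M (subtopology W N) f"
  using emb embedding_map_def homeomorphic_imp_continuous_map continuous_map_in_subtopology by blast+

lemma N_connected: "connectedin W N" and N_ne: "N \<noteq> {}"
  using connectedin_continuous_map_image[OF f_cont(1)] Mconn Mne by (auto simp: connectedin_topspace)

lemma fi_exists: "\<exists>fi. continuous_map (subtopology W N) M fi \<and> (\<forall>x\<in>topspace M. fi (f x) = x)"
proof -
  have "homeomorphic_map M (subtopology W N) f" using emb by (simp add: embedding_map_def)
  then obtain g where "homeomorphic_maps M (subtopology W N) f g" using homeomorphic_map_maps by blast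
  then show ?thesis unfolding homeomorphic_maps_def by auto
qed

definition "fi = (SOME fi. continuous_map (subtopology W N) M fi \<and> (\<forall>x\<in>topspace M. fi (f x) = x))"

lemma fi: "continuous_map (subtopology W N) M fi" "!!x. x \<in> topspace M ==> fi (f x) = x"
  using someI_ex[OF fi_exists] unfolding fi_def by auto

definition "HV = (SOME HV. push_homotopy (fst HV) (snd HV) \<and> openin W (snd HV) \<and> N \<subseteq> snd HV)"

definition "H = fst HV"
definition "Np = snd HV"
definition "\<gamma> w = H (1, w)"

lemma HV: "push_homotopy H Np" "openin W Np" "N \<subseteq> Np"
proof -
  have "\<exists>HV. push_homotopy (fst HV) (snd HV) \<and> openin W (snd HV) \<and> N \<subseteq> snd HV"
    using neighbourhood_push by (metis fst_conv snd_conv)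
  from someI_ex[OF this, folded HV_def] show "push_homotopy H Np" "openin W Np" "N \<subseteq> Np"
    by (auto simp: H_def Np_def)
qed

lemma gamma: "continuous_map W W \<gamma>" "!!w. w \<in> N ==> \<gamma> w = w" "!!w. w \<in> Np ==> \<gamma> w \<in> N"
  "!!C w. C \<in> comps ==> w \<in> C ==> \<gamma> w \<in> C \<union> N"
proof -
  have "continuous_map W (prod_topology (top_of_set {0..1}) W) (%w. (1::real, w))"
    by (intro continuous_map_pairedI) (auto simp: continuous_map_in_subtopology)
  then have "continuous_map W W (H \<circ> (%w. (1, w)))"
    by (rule continuous_map_compose) (use HV(1) in \<open>simp add: push_homotopy_def\<close>)
  then show "continuous_map W W \<gamma>" by (simp add: \<gamma>_def[abs_def] o_def)
qed (use HV(1) in \<open>auto simp: push_homotopy_def \<gamma>_def\<close>)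

text \<open>On \<open>Np\<close> this is the retraction onto the embedded copy of \<open>M\<close>,
  read in \<open>M\<close> itself; elsewhere the values have no meaning.\<close>

definition "R w = fi (\<gamma> w)"

lemma R_cont: "continuous_map (subtopology W Np) M R"
proof -
  have "continuous_map (subtopology W Np) (subtopology W N) \<gamma>"
    using gamma(1,3) by (auto simp: continuous_map_in_subtopology continuous_map_from_subtopology)
  then have "continuous_map (subtopology W Np) M (fi \<circ> \<gamma>)" using fi(1) continuous_map_compose by blast
  then show ?thesis by (simp add: R_def[abs_def] o_def)
qed

lemma R_f: "x \<in> topspace M ==> R (f x) = x" using gamma(2) fi(2) by (simp add: R_def)

lemma f_R: "w \<in> Np ==> f (R w) = \<gamma> w" using gamma(3)[of w] fi(2) by (auto simp: R_def)

lemma chain_R_f: "schain k M c ==> chain_map k R (chain_map k f c) = c"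
  using chain_map_id_gen[of k M c "R \<circ> f"] R_f by (simp add: chain_map_compose)

lemma chain_f_R: "schain k (subtopology W Np) c ==> chain_map k f (chain_map k R c) = chain_map k \<gamma> c"
  using chain_map_eq[of k "subtopology W Np" c "f \<circ> R" \<gamma>] f_R by (simp add: chain_map_compose)

lemma f_chain: "schain k M c ==> schain k (subtopology W N) (chain_map k f c)"
  using singular_chain_chain_map f_cont(2) by blast

lemma f_chain_sub: "schain k M c ==> N \<subseteq> A ==> schain k (subtopology W A) (chain_map k f c)"
  using f_chain chain_subset by blast

lemma m0_nonzero: "\<not> rbound p 3 M {} m0"
proof
  assume b: "rbound p 3 M {} m0"
  obtain x where x: "x \<in> topspace M" using Mne by blast
  have "rbound p 3 M (topspace M - {x}) m0" using rbound_mono[OF b] by blast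
  then show False using m0_not_torsion[OF x, of p] p1 by simp
qed

lemma a_nonzero:
  assumes "y \<in> topspace W" shows "\<not> rbound p 4 W (topspace W - {y}) a"
  using top_class_vanishes[OF W4 _ Wc Wconn rcycle_0_rel[OF a(1)] assms] a(2) by auto

text \<open>A chain bounding the image of the fundamental class is corrected by a multiple of the fundamental class
  of \<open>W\<close> so as to vanish modulo \<open>p\<close> at the points of \<open>V\<close>, and hence away from \<open>Q\<close>.\<close>

lemma fundamental_bounds_near:
  assumes V: "openin W V" "connectedin W V" "V \<inter> N = {}" and y: "y \<in> V"
    and Q: "openin W Q" "N \<subseteq> Q" "topspace W - Q \<subseteq> V"
  shows "rbound p 3 (subtopology W Q) {} (chain_map 3 f m0)"
proof -
  have VW: "V \<subseteq> topspace W" "Q \<subseteq> topspace W" using openin_subset[OF V(1)] openin_subset[OF Q(1)] .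
  have m0c: "schain 3 M m0" using m0 rcycle_chain by blast
  have "rcycle 0 3 W {} (chain_map 3 f m0)" by (rule rcycle_map[OF m0 f_cont(1)]) simp
  then obtain E where E: "schain 4 W E" "bdry 4 E = chain_map 3 f m0"
    using HW[of 3] unfolding homologous_zero_iff by (auto simp: numeral_eq_Suc)
  have rE: "rcycle 0 4 W S E" if "N \<subseteq> S" for S
    unfolding rcycle_def using E f_chain_sub[OF m0c that] by (simp add: rchain_sub)
  have yW: "y \<in> topspace W" "N \<subseteq> topspace W - {y}" using y V(3) VW N_subset by auto
  \<comment> \<open>This multiple of \<open>a\<close> cancels the local class of \<open>E\<close> at
    \<open>y\<close> modulo \<open>p\<close>, and by local constancy on all of
    \<open>V\<close>.\<close>
  obtain k where k: "rbound p 4 W (topspace W - {y}) (E - cmul k a)"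
    by (rule local_class_multiple[OF W4 yW(1) _ p rE[OF yW(2)] rcycle_0_rel[OF a(1)] a_nonzero[OF yW(1)]]) simp
  define E' where "E' = E - cmul k a"
  have rE': "rcycle p 4 W S E'" if "N \<subseteq> S" for S
    unfolding E'_def by (intro rcycle_diff rcycle_scale rcycle_0_rel[OF a(1)] rcycle_dvd[OF rE, of S p] that) simp
  have "rbound p 4 W (topspace W - {z}) E'" if "z \<in> V" for z
    using locally_constant_connected[OF W4 _ V(1,2) rE' y that] k V(3) N_subset by (auto simp: E'_def)
  moreover have "compactin W (topspace W - Q)" using Wc Q(1) closedin_compact_space by blast
  then have "top_vanishing p 4 W (topspace W - Q)" using top_vanishing_compact[OF W4] by simp
  moreover have KN: "topspace W - (topspace W - Q) = Q" using VW by blast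
  ultimately have "rbound p 4 W Q E'" using rE'[OF Q(2)] Q(3) unfolding top_vanishing_def KN by blast
  then obtain b where b: "schain 5 W b" "rchain p 4 W Q (E' - bdry 5 b)" unfolding rbound_def by auto
  then obtain d e where de: "schain 4 W d" "schain 4 (subtopology W Q) e"
    "E' - bdry 5 b = cmul p d + e" using rchain_decomp by blast
  have bb: "bdry 4 (bdry 5 b) = 0" using chain_boundary_boundary_alt[of 4 W b] b(1) by (simp add: numeral_eq_Suc)
  have "bdry 4 (E' - bdry 5 b) = chain_map 3 f m0"
    unfolding E'_def using E(2) bb a(1) by (simp add: chain_boundary_diff chain_boundary_cmul rcycle_empty_zero)
  then have eq: "chain_map 3 f m0 = cmul p (bdry 4 d) + bdry 4 e"
    unfolding de(3) by (simp add: chain_boundary_add chain_boundary_cmul)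
  have e3: "schain 3 (subtopology W Q) (bdry 4 e)" using singular_chain_boundary[OF de(2)] by simp
  have "schain 3 (subtopology W Q) (cmul p (bdry 4 d))"
    using singular_chain_diff[OF f_chain_sub[OF m0c Q(2)] e3] eq by simp
  \<comment> \<open>As \<open>p\<close> is nonzero, \<open>d\<close> has the same boundary simplices
    as \<open>cmul p d\<close>.\<close>
  then have "schain 3 (subtopology W Q) (bdry 4 d)" using p1 unfolding singular_chain_def by (auto simp: subset_iff)
  then show ?thesis
    unfolding eq using de(2) rbound_boundary[of 3 "subtopology W Q" e] by (intro rbound_add rbound_cmul) simp_all
qed

text \<open>Were the complement connected, it could serve as \<open>V\<close>; the image of
  \<open>m0\<close> would bound modulo \<open>p\<close> in \<open>Np\<close>, and by the retraction
  \<open>m0\<close> would bound modulo \<open>p\<close> in \<open>M\<close>.\<close>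

lemma complement_disconnected: "\<not> connectedin W (topspace W - N)"
proof
  assume conn: "connectedin W (topspace W - N)"
  obtain y where y: "y \<in> topspace W - N" using complement_nonempty[OF Wconn N_connected N_ne] by blast
  have "rbound p 3 (subtopology W Np) {} (chain_map 3 f m0)"
    using N_closed HV(3) by (intro fundamental_bounds_near[OF _ conn _ y HV(2,3)]) auto
  from rbound_map[OF this R_cont] have "rbound p 3 M {} m0" using chain_R_f rcycle_chain[OF m0] by simp
  then show False using m0_nonzero by blast
qed

lemma two_comps:
  obtains C D where "comps = {C, D}" "C \<noteq> D"
proof -
  have ne: "comps \<noteq> {}" using complement_nonempty[OF Wconn N_connected N_ne] comps_Union by auto
  then obtain C where C: "C \<in> comps" by blast
  have "comps \<noteq> {C}"
  proof
    assume "comps = {C}"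
    then have "topspace W - N = C" using comps_Union by simp
    then show False using comps_connected[OF C] complement_disconnected by simp
  qed
  then obtain D where "D \<in> comps" "D \<noteq> C" using C by blast
  then show thesis using that[of C D] comps_two[OF Wconn N_connected N_ne C, of D] by auto
qed

end

section \<open>Linking numbers\<close>

lemma span_of_simplices: "c \<in> span_of (singular_simplex_set k X) \<longleftrightarrow> schain k X c"
  by (simp add: span_of_def singular_chain_def)

lemma cap_chain_cong:
  assumes "schain (k + l) X c" "!!s. singular_simplex k X s ==> \<phi> s = \<psi> s"
  shows "cap k l c \<phi> = cap k l c \<psi>" unfolding cap_chain_def
proof (rule frag_extend_eq)
  fix s assume "s \<in> supp c"
  then have "singular_simplex (k + l) X s" using assms(1) by (auto simp: singular_chain_def)
  then show "cmul (\<phi> (front_face k s)) (frag_of (back_face k l s)) =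
      cmul (\<psi> (front_face k s)) (frag_of (back_face k l s))" using front_face_singular(1) assms(2) by metis
qed

lemma cap_chain_fun_cmul: "cap k l c (%s. j * \<phi> s) = cmul j (cap k l c \<phi>)"
proof -
  have "cmul j (cap k l c \<phi>) =
      frag_extend (%s. cmul j (cmul (\<phi> (front_face k s)) (frag_of (back_face k l s)))) c"
    unfolding cap_chain_def by (rule additive_extend) (rule frag_cmul_diff)
  then show ?thesis unfolding cap_chain_def by simp
qed

lemma ev_rbound:
  assumes "cocyc m k X \<phi>" "rbound m k X {} c" shows "m dvd ev \<phi> c"
proof -
  obtain b d where "schain (Suc k) X b" "c = bdry (Suc k) b + cmul m d"
    using assms(2) unfolding rbound_empty_iff by (elim exE conjE) (rule that)
  then show ?thesis using cocycD[OF assms(1)] by (simp add: ev_add)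
qed

lemma cap_rbound:
  assumes \<phi>: "cocyc m k X \<phi>" and c: "rbound m (k + l) X {} c"
  shows "rbound m l X {} (cap k l c \<phi>)"
proof -
  obtain b d where b: "schain (Suc (k + l)) X b" and d: "schain (k + l) X d"
    and c: "c = bdry (Suc (k + l)) b + cmul m d" using c unfolding rbound_empty_iff by (elim exE conjE) (rule that)
  let ?A = "bdry (Suc l) (cap k (Suc l) b \<phi>)"
    and ?B = "cap k l (bdry (Suc (k + l)) b) \<phi>"
  have "rbound m l X {} (?A - (?A - cmul ((-1) ^ k) ?B))"
    using b by (intro rbound_diff rbound_boundary rbound_rchain cap_cocycle_boundary[OF \<phi>] singular_chain_cap) auto
  then have "rbound m l X {} (cmul ((-1) ^ k) ?B)" by simp
  note rbound_scale[OF this, of "(-1) ^ k"]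
  moreover have "cmul ((-1) ^ k) (cmul ((-1) ^ k) ?B) = ?B" by simp
  ultimately have "rbound m l X {} ?B" by (simp only:)
  moreover have "rbound m l X {} (cmul m (cap k l d \<phi>))" using d by (intro rbound_cmul singular_chain_cap)
  ultimately show ?thesis unfolding c cap_chain_add cap_chain_cmul by (rule rbound_add)
qed

lemma cap_rcycle:
  assumes \<phi>: "cocyc m k X \<phi>" and c: "rcycle m (Suc (k + l)) X {} c"
  shows "rcycle m (Suc l) X {} (cap k (Suc l) c \<phi>)"
proof -
  have cc: "schain (Suc (k + l)) X c" using c rcycle_chain by blast
  obtain d where d: "schain (k + l) X d" "bdry (Suc (k + l)) c = cmul m d"
    using c unfolding rcycle_def rchain_empty_iff by auto
  have "rchain m l X {} (cmul ((-1) ^ k) (cap k l (bdry (Suc (k + l)) c) \<phi>))"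
    unfolding d(2) cap_chain_cmul using d(1) by (intro rchain_scale rchain_cmul singular_chain_cap)
  from rchain_add[OF cap_cocycle_boundary[OF \<phi> cc] this]
  show ?thesis unfolding rcycle_def using cc by (simp add: singular_chain_cap)
qed

text \<open>\<open>g\<close> integrates \<open>\<phi>\<close> along chosen paths from a base point.
  Closing \<open>c\<close> up with these paths gives a cycle, on which \<open>\<phi>\<close>
  vanishes modulo \<open>m\<close>.\<close>

lemma coboundary_of_vanishing:
  assumes X: "path_connected_space X" and van: "!!z. rcycle 0 1 X {} z ==> m dvd ev \<phi> z"
  obtains g where "!!c. schain 1 X c ==> m dvd ev \<phi> c - ev g (bdry 1 c)"
proof (cases "topspace X = {}")
  case True
  have "m dvd ev \<phi> c - ev (%_. 0) (bdry 1 c)" if "schain 1 X c" for c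
  proof -
    have "c = 0" using True that singular_chain_empty by blast
    then show ?thesis by simp
  qed
  then show thesis using that by blast
next
  case False
  then obtain v where v: "v \<in> topspace X" by blast
  let ?pv = "frag_of (point_simplex v)"
  have "\<exists>s. singular_simplex 0 X t --> schain 1 X s \<and> bdry 1 s = frag_of t - ?pv" for t
  proof (cases "singular_simplex 0 X t")
    case True
    then have "schain 0 X (frag_of t)" by (simp add: singular_chain_of)
    then obtain s where "schain 1 X s" "bdry 1 s = frag_of t - cmul (ev (%_. 1) (frag_of t)) ?pv"
      using path_connected_zero_chains[OF X v] by blast
    then show ?thesis by auto
  qed simp
  from choice[OF allI[OF this]] obtain s where
    s: "\<forall>t. singular_simplex 0 X t --> schain 1 X (s t) \<and> bdry 1 (s t) = frag_of t - ?pv" ..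
  define g where "g t = ev \<phi> (s t)" for t
  have "m dvd ev \<phi> c - ev g (bdry 1 c)" if c: "schain 1 X c" for c
  proof -
    let ?q = "bdry 1 c"
    have q: "schain 0 X ?q" using singular_chain_boundary[OF c] by simp
    have e: "schain 1 X (frag_extend s ?q)" using q s by (intro singular_chain_extend) (auto simp: singular_chain_def)
    \<comment> \<open>Boundaries have total weight zero, so the base point cancels.\<close>
    have q1: "ev (%_. 1) ?q = 0"
    proof -
      have "ev (%_. 1) (bdry 1 (frag_of \<sigma>)) = 0" for \<sigma> :: "(nat => real) => 'a"
        by (simp add: chain_boundary_of ev_diff One_nat_def)
      then have "cobdry 0 (%_. 1) \<sigma> = 0" for \<sigma> :: "(nat => real) => 'a"
        unfolding cobdry_def by (simp add: One_nat_def)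
      then show ?thesis using ev_cobdry[of 0 "%_. 1" c] by (simp add: ev_def One_nat_def)
    qed
    have "bdry 1 (frag_extend s ?q) = frag_extend (%t. bdry 1 (s t)) ?q"
      by (rule additive_extend) (rule chain_boundary_diff)
    also have "\<dots> = frag_extend (%t. frag_of t - cmul 1 ?pv) ?q"
      using q s by (intro frag_extend_eq) (auto simp: singular_chain_def)
    also have "\<dots> = ?q - frag_extend (%t. ?pv) ?q" by (simp add: frag_extend_fun_diff flip: frag_expansion)
    also have "frag_extend (%t. ?pv) ?q = cmul (ev (%_. 1) ?q) ?pv"
      by (simp add: frag_extend_def ev_def frag_cmul_sum_left)
    finally have "bdry 1 (c - frag_extend s ?q) = 0" using q1 by (simp add: chain_boundary_diff)
    then have "m dvd ev \<phi> (c - frag_extend s ?q)"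
      using van singular_chain_diff[OF c e] unfolding rcycle_empty_zero by blast
    then show ?thesis by (simp add: ev_diff ev_extend g_def[abs_def])
  qed
  then show thesis using that by blast
qed

section \<open>Linking with a 1-cycle as evaluation of a cochain\<close>

text \<open>That 2-cycles are torsion makes integral 2-cocycles vanish on them, so that their values
  on a 2-chain depend only on its boundary.\<close>

locale linking_manifold = oriented_manifold 3 2 M m0 for M :: "'a topology" and m0 +
  fixes p :: int
  assumes prime_p: "prime p"
    and Mpc: "path_connected_space M"
    and expo: "!!z. rcycle 0 1 M {} z ==> rbound 0 1 M {} (cmul p z)"
    and tors2: "!!z. rcycle 0 2 M {} z ==> \<exists>n. n \<noteq> 0 \<and> rbound 0 2 M {} (cmul n z)"
begin

lemma p_nonzero: "p \<noteq> 0" using prime_p by auto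

lemma cocycle_vanishes:
  assumes "cocyc 0 2 M \<beta>" "rcycle 0 2 M {} c" shows "ev \<beta> c = 0"
proof -
  obtain n where n: "n \<noteq> 0" "rbound 0 2 M {} (cmul n c)" using tors2[OF assms(2)] by blast
  have "0 dvd ev \<beta> (cmul n c)" by (rule ev_rbound[OF assms(1) n(2)])
  then show ?thesis using n(1) by simp
qed

lemma multiple_bounds:
  assumes "rcycle 0 1 M {} z"
  shows "\<exists>C. schain 2 M C \<and> bdry 2 C = cmul p z"
  using expo[OF assms] unfolding homologous_zero_iff by simp

lemma cap_cycle:
  assumes "cocyc 0 2 M \<beta>" "rcycle 0 3 M {} c"
  shows "rcycle 0 1 M {} (cap 2 1 c \<beta>)"
  using cap_rcycle[of 0 2 M \<beta> 0 c] assms by (simp add: One_nat_def numeral_3_eq_3 numeral_2_eq_2)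

lemma cap_coboundary:
  assumes c: "rcycle 0 3 M {} c" and \<gamma>: "!!b. schain 2 M b ==> ev \<gamma> (bdry 2 b) = j * ev \<zeta> b"
  shows "bdry 2 (cap 1 2 c \<gamma>) = cmul j (cap 2 1 c \<zeta>)"
proof -
  have c': "schain 3 M c" "bdry 3 c = 0" using c by (auto simp: rcycle_empty_zero)
  have "bdry 2 (cap 1 2 c \<gamma>) = cap 2 1 c (cobdry 1 \<gamma>)"
    using cap_chain_boundary[of 1 1 c \<gamma>] c'(2) by simp
  also have "\<dots> = cap 2 1 c (%s. j * \<zeta> s)"
  proof (rule cap_chain_cong)
    show "schain (2 + 1) M c" using c' by simp
    fix s assume "singular_simplex 2 M s"
    then show "cobdry 1 \<gamma> s = j * \<zeta> s"
      using \<gamma>[of "frag_of s"] by (simp add: cobdry_def singular_chain_of)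
  qed
  finally show ?thesis unfolding cap_chain_fun_cmul .
qed

text \<open>A 1-cycle \<open>z\<close> is sent to the value of \<open>\<zeta>\<close> on a chain
  with boundary \<open>p z\<close>. This does not depend on the chain since \<open>\<zeta>\<close>
  vanishes on 2-cycles, and it extends from cycles to a cochain.\<close>

lemma torsion_cochain:
  assumes \<zeta>: "cocyc 0 2 M \<zeta>"
  obtains \<gamma> where "!!c. schain 2 M c ==> ev \<gamma> (bdry 2 c) = p * ev \<zeta> c"
proof -
  define C where "C z = (SOME C. schain 2 M C \<and> bdry 2 C = cmul p z)" for z
  have C: "schain 2 M (C z)" "bdry 2 (C z) = cmul p z" if "rcycle 0 1 M {} z" for z
    using someI_ex[OF multiple_bounds[OF that]] unfolding C_def by auto
  have Ceq: "ev \<zeta> (C z) = ev \<zeta> b" if "rcycle 0 1 M {} z" "schain 2 M b" "bdry 2 b = cmul p z" for z b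
  proof -
    have "rcycle 0 2 M {} (C z - b)"
      using C[OF that(1)] that(2,3) by (simp add: rcycle_empty_zero singular_chain_diff chain_boundary_diff)
    then have "ev \<zeta> (C z - b) = 0" by (rule cocycle_vanishes[OF \<zeta>])
    then show ?thesis by (simp add: ev_diff)
  qed
  obtain \<gamma> where \<gamma>: "!!c. c \<in> span_of (singular_simplex_set 1 M) ==> bdry 1 c = 0 ==> 0 dvd ev \<gamma> c - ev \<zeta> (C c)"
  proof (rule functional_extension[of "bdry 1" "singular_simplex_set 1 M" 0 "%z. ev \<zeta> (C z)"])
    fix a b assume "a \<in> span_of (singular_simplex_set 1 M)" "b \<in> span_of (singular_simplex_set 1 M)"
      "bdry 1 a = 0" "bdry 1 b = 0"
    then have ab: "rcycle 0 1 M {} a" "rcycle 0 1 M {} b" unfolding span_of_simplices rcycle_empty_zero by auto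
    have "ev \<zeta> (C (a - b)) = ev \<zeta> (C a - C b)" using C[OF ab(1)] C[OF ab(2)]
      by (intro Ceq rcycle_diff ab) (simp_all add: singular_chain_diff chain_boundary_diff frag_cmul_diff)
    then show "0 dvd ev \<zeta> (C (a - b)) - (ev \<zeta> (C a) - ev \<zeta> (C b))" by (simp add: ev_diff)
  qed (auto intro: chain_boundary_diff)
  have "ev \<gamma> (bdry 2 c) = p * ev \<zeta> c" if c: "schain 2 M c" for c
  proof -
    have z: "rcycle 0 1 M {} (bdry 2 c)" using rcycle_boundary[of 1 M c 0 "{}"] c by simp
    have "ev \<gamma> (bdry 2 c) = ev \<zeta> (C (bdry 2 c))"
      using \<gamma>[of "bdry 2 c"] z unfolding span_of_simplices rcycle_empty_zero by simp
    also have "\<dots> = ev \<zeta> (cmul p c)"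
      by (rule Ceq[OF z]) (simp_all add: singular_chain_cmul c chain_boundary_cmul)
    finally show ?thesis by simp
  qed
  then show thesis using that by blast
qed

text \<open>The quantifiers run over every choice that enters a linking number: representative,
  bounding chain, dual cocycle and fundamental cycle. Independence of the choices is thus part of
  the property, as the definite description in \<open>linking_form\<close> requires.\<close>

definition links :: "'a chain => (((nat => real) => 'a) => int) => bool" where
  "links z \<gamma> \<longleftrightarrow> cocyc p 1 M \<gamma> \<and>
     (\<forall>z' C \<beta> m1. rcycle 0 1 M {} z' --> rbound 0 1 M {} (z - z') --> schain 2 M C -->
       bdry 2 C = cmul p z' --> cocyc 0 2 M \<beta> --> rcycle 0 3 M {} m1 --> rbound 0 3 M {} (m1 - m0) -->
       p dvd ev \<beta> C - ev \<gamma> (cap 2 1 m1 \<beta>))"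

text \<open>If \<open>z\<close> is Poincare dual to \<open>\<zeta>\<close> and \<open>\<delta>\<gamma> = p\<zeta>\<close>, then the cap product of the fundamental cycle with
  \<open>\<gamma>\<close> bounds \<open>pz\<close>, and linking with \<open>z\<close> is evaluation of \<open>\<gamma>\<close>. If \<open>\<gamma>\<close> vanishes
  modulo \<open>p\<close> on cycles then \<open>\<gamma>/p\<close> extends from cycles to a cochain with coboundary \<open>\<zeta>\<close>.\<close>

lemma linking_functional:
  assumes z: "rcycle 0 1 M {} z"
  obtains \<gamma> where "links z \<gamma>" "(!!u. rcycle 0 1 M {} u ==> p dvd ev \<gamma> u) ==> rbound 0 1 M {} z"
proof -
  obtain \<zeta> m2 where \<zeta>: "cocyc 0 2 M \<zeta>" and m2: "rcycle 0 3 M {} m2" "rbound 0 3 M {} (m2 - m0)"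
    and zd: "rbound 0 1 M {} (z - cap 2 1 m2 \<zeta>)" by (rule Poincare_dual_exists[OF z])
  obtain \<gamma> where \<gamma>: "!!c. schain 2 M c ==> ev \<gamma> (bdry 2 c) = p * ev \<zeta> c"
    using torsion_cochain[OF \<zeta>] by metis
  have \<gamma>c: "cocyc p 1 M \<gamma>" unfolding cocyc_def using \<gamma> by simp
  have m2c: "schain 3 M m2" "bdry 3 m2 = 0" using m2(1) by (auto simp: rcycle_empty_zero)
  obtain e where e: "schain 2 M e" "bdry 2 e = z - cap 2 1 m2 \<zeta>" using zd unfolding homologous_zero_iff by auto
  \<comment> \<open>A chain with boundary \<open>p z\<close> on which \<open>\<beta>\<close> takes
    the value of the cup product of \<open>\<gamma>\<close> and \<open>\<beta>\<close>, up to
    multiples of \<open>p\<close>.\<close>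
  define C0 where "C0 = cap 1 2 m2 \<gamma> + cmul p e"
  have C0: "schain 2 M C0" "bdry 2 C0 = cmul p z"
  proof -
    show "schain 2 M C0" unfolding C0_def
      using m2c(1) by (intro singular_chain_add singular_chain_cmul e singular_chain_cap) simp
    show "bdry 2 C0 = cmul p z" using cap_coboundary[OF m2(1) \<gamma>]
      unfolding C0_def chain_boundary_add chain_boundary_cmul e(2) by (simp add: frag_cmul_diff)
  qed
  have A: "p dvd ev \<beta> C - ev \<gamma> (cap 2 1 m1 \<beta>)"
    if z': "rcycle 0 1 M {} z'" and zz': "rbound 0 1 M {} (z - z')" and C: "schain 2 M C"
      "bdry 2 C = cmul p z'" and \<beta>: "cocyc 0 2 M \<beta>"
      and m1: "rcycle 0 3 M {} m1" "rbound 0 3 M {} (m1 - m0)" for z' C \<beta> m1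
  proof -
    obtain e' where e': "schain 2 M e'" "bdry 2 e' = z - z'" using zz' unfolding homologous_zero_iff by auto
    have "rcycle 0 2 M {} (C0 - C - cmul p e')"
      using C C0 e' by (simp add: rcycle_empty_zero singular_chain_diff singular_chain_cmul chain_boundary_diff
          chain_boundary_cmul frag_cmul_diff)
    then have 1: "ev \<beta> C = ev \<beta> C0 - p * ev \<beta> e'"
      using cocycle_vanishes[OF \<beta>] by (fastforce simp: ev_diff)
    have 2: "ev \<beta> C0 = ev (cup 1 2 \<gamma> \<beta>) m2 + p * ev \<beta> e" unfolding C0_def ev_cup by (simp add: ev_add)
    \<comment> \<open>Commutativity turns the intersection of the bounding chain with
      \<open>\<beta>\<close> into the value of \<open>\<gamma>\<close> on the 1-cycle dual to
      \<open>\<beta>\<close>.\<close>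
    have 3: "p dvd ev (cup 1 2 \<gamma> \<beta>) m2 - ev \<gamma> (cap 2 1 m2 \<beta>)"
      using cup_commute_1_2[OF \<gamma>c cocyc_dvd[OF \<beta>] m2c] unfolding ev_cup[of 2 1] by simp
    have "rbound 0 3 M {} ((m2 - m0) - (m1 - m0))" using m1 m2 rbound_diff by blast
    then have "rbound 0 (2 + 1) M {} (m2 - m1)" by (simp add: numeral_eq_Suc)
    then have "rbound 0 1 M {} (cap 2 1 m2 \<beta> - cap 2 1 m1 \<beta>)"
      using cap_rbound[OF \<beta>, of 1 "m2 - m1"] by (simp only: cap_chain_diff)
    then have 4: "p dvd ev \<gamma> (cap 2 1 m2 \<beta>) - ev \<gamma> (cap 2 1 m1 \<beta>)"
      using ev_rbound[OF \<gamma>c rbound_dvd[of 0]] unfolding ev_diff[symmetric] by simp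
    have "ev \<beta> C - ev \<gamma> (cap 2 1 m1 \<beta>) =
        (ev (cup 1 2 \<gamma> \<beta>) m2 - ev \<gamma> (cap 2 1 m2 \<beta>)) +
        (ev \<gamma> (cap 2 1 m2 \<beta>) - ev \<gamma> (cap 2 1 m1 \<beta>)) + p * (ev \<beta> e - ev \<beta> e')"
      using 1 2 by (simp add: algebra_simps)
    then show ?thesis using dvd_add[OF dvd_add[OF 3 4] dvd_triv_left] by (simp only:)
  qed
  have B: "rbound 0 1 M {} z" if van: "!!u. rcycle 0 1 M {} u ==> p dvd ev \<gamma> u"
  proof -
    obtain \<omega> where \<omega>: "!!c. c \<in> span_of (singular_simplex_set 1 M) ==> bdry 1 c = 0 ==> 0 dvd ev \<omega> c - ev \<gamma> c div p"
    proof (rule functional_extension[of "bdry 1" "singular_simplex_set 1 M" 0 "%z. ev \<gamma> z div p"])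
      fix a b assume "a \<in> span_of (singular_simplex_set 1 M)" "b \<in> span_of (singular_simplex_set 1 M)"
        "bdry 1 a = 0" "bdry 1 b = 0"
      then have "p dvd ev \<gamma> a" "p dvd ev \<gamma> b"
        using van unfolding span_of_simplices rcycle_empty_zero by auto
      then show "0 dvd ev \<gamma> (a - b) div p - (ev \<gamma> a div p - ev \<gamma> b div p)" by (simp add: ev_diff div_diff)
    qed (auto intro: chain_boundary_diff)
    have "ev \<omega> (bdry 2 c) = 1 * ev \<zeta> c" if c: "schain 2 M c" for c
    proof -
      have "rcycle 0 1 M {} (bdry 2 c)" using rcycle_boundary[of 1 M c 0 "{}"] c by simp
      then have "ev \<omega> (bdry 2 c) = ev \<gamma> (bdry 2 c) div p"
        using \<omega>[of "bdry 2 c"] unfolding span_of_simplices rcycle_empty_zero by simp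
      then show ?thesis using \<gamma>[OF c] p_nonzero by simp
    qed
    from cap_coboundary[OF m2(1) this]
    have "bdry 2 (cap 1 2 m2 \<omega> + e) = z" using e(2) by (simp add: chain_boundary_add)
    moreover have "schain 2 M (cap 1 2 m2 \<omega> + e)"
      using m2c(1) by (intro singular_chain_add e singular_chain_cap) simp
    ultimately show ?thesis unfolding homologous_zero_iff by auto
  qed
  have "links z \<gamma>" unfolding links_def using \<gamma>c A by blast
  then show thesis by (rule that[OF _ B])
qed

end

section \<open>Splitting cocycles along the submanifold\<close>

locale bisected = embedded M m0 W f p a + linking_manifold M m0 p
  for M :: "'a topology" and m0 and W :: "'b topology" and f and p and a +
  fixes C D
  assumes comps_CD: "comps = {C, D}" and CD: "C \<noteq> D"
begin

text \<open>The two sides play symmetric roles, so each result for \<open>WX\<close> is available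
  for \<open>WY\<close>.\<close>

lemma swap: "bisected M m0 W f p a D C" using comps_CD CD by unfold_locales auto

abbreviation "WX \<equiv> subtopology W (C \<union> N)"
abbreviation "WY \<equiv> subtopology W (D \<union> N)"

lemma CD_comps: "C \<in> comps" "D \<in> comps" using comps_CD by auto

lemma CD_disjoint: "C \<inter> D = {}" using CD_comps CD connected_components_of_disjoint by (metis disjnt_def)

lemma CD_N: "C \<inter> N = {}" "D \<inter> N = {}" "C \<subseteq> topspace W" "D \<subseteq> topspace W"
  using comps_subset CD_comps by blast+

lemma CD_union: "C \<union> D = topspace W - N" using comps_Union comps_CD by simp

lemma Xp: "openin W (C \<union> Np)" "openin W (D \<union> Np)" "topspace W \<subseteq> (C \<union> Np) \<union> (D \<union> Np)" "(C \<union> Np) \<inter> (D \<union> Np) = Np"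
proof -
  show "openin W (C \<union> Np)" "openin W (D \<union> Np)" using comps_open CD_comps HV(2) by (simp_all add: openin_Un)
  show "topspace W \<subseteq> (C \<union> Np) \<union> (D \<union> Np)" using CD_union HV(3) by blast
  show "(C \<union> Np) \<inter> (D \<union> Np) = Np" using CD_disjoint by blast
qed

lemma f_WX: "continuous_map M WX f" using f_cont(1) by (auto simp: continuous_map_in_subtopology)

lemma gamma_cont: "continuous_map (subtopology W (C \<union> Np)) WX \<gamma>"
  using gamma(1,3) gamma(4)[OF CD_comps(1)]
  by (auto simp: continuous_map_in_subtopology intro: continuous_map_from_subtopology)

lemma gamma_chain: "schain k (subtopology W (C \<union> Np)) c ==> schain k WX (chain_map k \<gamma> c)"
  by (rule singular_chain_chain_map[OF _ gamma_cont])

text \<open>The homotopy never leaves \<open>C \<union> N\<close>, so on this side the push is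
  homotopic to the identity.\<close>

lemma gamma_WX:
  assumes x: "rcycle 0 k WX {} x" shows "rbound 0 k WX {} (x - chain_map k \<gamma> x)"
proof -
  have H: "continuous_map (prod_topology (top_of_set {0..1}) W) W H" "!!w. w \<in> topspace W ==> H (0, w) = w"
    using HV(1) unfolding push_homotopy_def by auto
  have HX: "H (t, w) \<in> C \<union> N" if t: "t \<in> {0..1}" "w \<in> C \<union> N" for t w
  proof -
    have "\<forall>w\<in>N. H (t, w) = w" "\<forall>w\<in>C. H (t, w) \<in> C \<union> N"
      using t(1) HV(1) CD_comps unfolding push_homotopy_def by blast+
    then show ?thesis using t(2) by (metis UnE UnI2)
  qed
  have CN: "C \<union> N \<subseteq> topspace W" using CD_N N_subset by blast
  have "H ` (topspace (prod_topology (top_of_set {0..1}) W) \<inter> {0..1} \<times> (C \<union> N)) \<subseteq> C \<union> N"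
    using HX by blast
  then have "continuous_map (prod_topology (top_of_set {0..1}) WX) WX H"
    unfolding continuous_map_in_subtopology prod_topology_subtopology(2)
    using H(1) by (simp add: continuous_map_from_subtopology image_subset_iff_funcset Int_commute)
  then have "homotopic_with (%h. h \<in> {} \<rightarrow> {}) WX WX id \<gamma>"
    using H(2) CN by (subst homotopic_with) (auto simp: \<gamma>_def intro!: exI[of _ H])
  moreover have "singular_relcycle k WX {} x" using x by (simp add: rcycle_zero)
  ultimately have "homologous_rel k WX {} (chain_map k id x) (chain_map k \<gamma> x)"
    by (rule homotopic_imp_homologous_rel_chain_maps)
  moreover have "chain_map k id x = x" using chain_map_id_gen[of k WX x id] rcycle_chain[OF x] by simp
  ultimately show ?thesis by (simp add: homologous_rel_def rbound_zero)
qed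

text \<open>The homology of \<open>M\<close> maps onto that of the region: \<open>x\<close> bounds
  in \<open>W\<close>, and splitting a bounding chain between the two open neighbourhoods leaves a
  cycle near \<open>N\<close>, which the retraction carries to \<open>M\<close>.\<close>

lemma cycle_from_boundary:
  assumes k: "k \<in> {1, 2, 3}" and x: "rcycle 0 k WX {} x"
  obtains z where "rcycle 0 k M {} z" "rbound 0 k WX {} (x - chain_map k f z)"
proof -
  have k0: "k > 0" using k by auto
  have "rbound 0 k W {} x" using HW[OF k rcycle_from_subtopology[OF x]] .
  then obtain b where b: "schain (Suc k) W b" "bdry (Suc k) b = x" unfolding homologous_zero_iff by blast
  obtain Sd T u v where ops: "subdivision_ops Sd T"
    and u: "schain (Suc k) (subtopology W (C \<union> Np)) u"
    and v: "schain (Suc k) (subtopology W (D \<union> Np)) v" and uv: "Sd (Suc k) b = u + v"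
    by (rule chain_split_open[OF Xp(1,2,3) b(1)])
  define y where "y = bdry (Suc k) v"
  have y: "y = Sd k x - bdry (Suc k) u"
    using subdivision_ops_chain(3)[OF ops b(1)] b(2) by (simp add: uv chain_boundary_add y_def algebra_simps)
  have Sx: "rcycle 0 k WX {} (Sd k x)" using rcycle_subdivision[OF ops x] .
  have "schain k (subtopology W (C \<union> Np)) y"
    unfolding y using singular_chain_boundary[OF u] chain_subset[OF rcycle_chain[OF Sx] Un_mono[OF _ HV(3)]]
    by (intro singular_chain_diff) auto
  moreover have "schain k (subtopology W (D \<union> Np)) y"
    unfolding y_def using singular_chain_boundary[OF v] by simp
  ultimately have yN: "schain k (subtopology W Np) y" using chain_Int Xp(4) by metis
  moreover have "bdry k y = 0" unfolding y_def using chain_boundary_boundary_alt[of k _ v] v by simp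
  ultimately have yc: "rcycle 0 k (subtopology W Np) {} y" by (simp add: rcycle_empty_zero)
  show thesis
  proof (rule that)
    show "rcycle 0 k M {} (chain_map k R y)" by (rule rcycle_map[OF yc R_cont]) simp
    have "rbound 0 k WX {} ((Sd k x - chain_map k \<gamma> (Sd k x)) - (Sd k x - x) + bdry (Suc k) (chain_map (Suc k) \<gamma> u))"
      by (intro rbound_add rbound_diff rbound_boundary gamma_WX Sx gamma_chain u rbound_subdivision[OF ops x k0])
    moreover have eq: "chain_map k f (chain_map k R y) = chain_map k \<gamma> (Sd k x) - bdry (Suc k) (chain_map (Suc k) \<gamma> u)"
      unfolding chain_f_R[OF yN] using chain_boundary_chain_map[OF u, of \<gamma>] by (simp add: y chain_map_diff)
    ultimately show "rbound 0 k WX {} (x - chain_map k f (chain_map k R y))" unfolding eq by (simp add: algebra_simps)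
  qed
qed

text \<open>The bounding chains of the two sides differ by a cycle of \<open>W\<close>, which
  bounds. Splitting that bound produces a chain near \<open>N\<close> whose boundary is the
  subdivided image of \<open>z\<close>.\<close>

lemma bounds_both:
  assumes k: "k > 0" "Suc k \<in> {1, 2, 3}" and z: "rcycle 0 k M {} z"
    and X: "rbound 0 k WX {} (chain_map k f z)" and Y: "rbound 0 k WY {} (chain_map k f z)"
  shows "rbound 0 k M {} z"
proof -
  obtain b where b: "schain (Suc k) WX b" "bdry (Suc k) b = chain_map k f z"
    using X unfolding homologous_zero_iff by blast
  obtain b' where b': "schain (Suc k) WY b'" "bdry (Suc k) b' = chain_map k f z"
    using Y unfolding homologous_zero_iff by blast
  have bW: "schain (Suc k) W b" "schain (Suc k) W b'" using b b' by (auto simp: singular_chain_subtopology)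
  then have "rcycle 0 (Suc k) W {} (b - b')"
    using b(2) b'(2) by (simp add: rcycle_empty_zero singular_chain_diff chain_boundary_diff)
  then obtain E where E: "schain (Suc (Suc k)) W E" "bdry (Suc (Suc k)) E = b - b'"
    using HW[OF k(2)] unfolding homologous_zero_iff by blast
  obtain Sd T u v where ops: "subdivision_ops Sd T"
    and u: "schain (Suc (Suc k)) (subtopology W (C \<union> Np)) u"
    and v: "schain (Suc (Suc k)) (subtopology W (D \<union> Np)) v" and uv: "Sd (Suc (Suc k)) E = u + v"
    by (rule chain_split_open[OF Xp(1,2,3) E(1)])
  define y where "y = Sd (Suc k) b - bdry (Suc (Suc k)) u"
  have "bdry (Suc (Suc k)) u + bdry (Suc (Suc k)) v = Sd (Suc k) b - Sd (Suc k) b'"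
    using subdivision_ops_chain(3)[OF ops E(1)] E(2)
    by (simp add: uv subdivision_ops_diff[OF ops] flip: chain_boundary_add)
  then have y': "y = Sd (Suc k) b' + bdry (Suc (Suc k)) v" by (simp add: y_def algebra_simps)
  have "schain (Suc k) (subtopology W (C \<union> Np)) y"
    unfolding y_def using singular_chain_boundary[OF u] chain_subset[OF subdivision_ops_chain(1)[OF ops b(1)] Un_mono[OF _ HV(3)]]
    by (intro singular_chain_diff) auto
  moreover have "schain (Suc k) (subtopology W (D \<union> Np)) y"
    unfolding y' using singular_chain_boundary[OF v] chain_subset[OF subdivision_ops_chain(1)[OF ops b'(1)] Un_mono[OF _ HV(3)]]
    by (intro singular_chain_add) auto
  ultimately have yN: "schain (Suc k) (subtopology W Np) y" using chain_Int Xp(4) by metis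
  let ?w = "chain_map k f z"
  have "bdry (Suc k) y = Sd k ?w" unfolding y_def chain_boundary_diff using subdivision_ops_chain(3)[OF ops b(1)] b(2)
      chain_boundary_boundary_alt[of "Suc k" _ u] u by simp
  then have "bdry (Suc k) (chain_map (Suc k) R y) = chain_map k R (Sd k ?w)"
    using chain_boundary_chain_map[OF yN, of R] by simp
  then have 1: "rbound 0 k M {} (chain_map k R (Sd k ?w))"
    using singular_chain_chain_map[OF yN R_cont] unfolding homologous_zero_iff by blast
  have "continuous_map M (subtopology W Np) f" using f_cont(1) HV(3) by (auto simp: continuous_map_in_subtopology)
  then have w: "rcycle 0 k (subtopology W Np) {} ?w" by (rule rcycle_map[OF z]) simp
  have "rbound 0 k M {} (chain_map k R (Sd k ?w - ?w))"
    by (rule rbound_map[OF rbound_subdivision[OF ops w k(1)] R_cont]) simp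
  then have "rbound 0 k M {} (chain_map k R (Sd k ?w) - z)"
    using chain_R_f[OF rcycle_chain[OF z]] by (simp add: chain_map_diff)
  from rbound_diff[OF 1 this] show ?thesis by simp
qed

text \<open>The Mayer-Vietoris splitting of cohomology: extend \<open>\<beta>\<close> by the retraction to a cochain \<open>b\<close> supported near \<open>N\<close>.
  The cochain equal to \<open>\<delta>b\<close> on the side of \<open>C\<close> and to \<open>0\<close> on the other side is the coboundary of
  some \<open>\<eta>\<close> on small chains, as it vanishes on small cycles; the two pieces are \<open>b - \<eta>\<close> and \<open>\<eta>\<close>.\<close>

lemma cochain_split:
  assumes k: "k \<in> {1, 2, 3}" "Suc k \<in> {1, 2, 3}" and \<beta>: "cocyc m k M \<beta>"
  obtains bX bY where "cocyc m k WX bX" "cocyc m k WY bY"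
    "!!s. singular_simplex k M s ==> \<beta> s = bX (simplex_map k f s) + bY (simplex_map k f s)"
proof -
  let ?X = "C \<union> Np" and ?Y = "D \<union> Np"
  \<comment> \<open>The small simplices, lying in one of the two neighbourhoods.\<close>
  define S where "S j = singular_simplex_set j (subtopology W ?X) \<union> singular_simplex_set j (subtopology W ?Y)" for j
  have SX: "c \<in> span_of (S j)" if "schain j (subtopology W ?X) c" for j c
    using that unfolding span_of_def S_def singular_chain_def by auto
  have SY: "c \<in> span_of (S j)" if "schain j (subtopology W ?Y) c" for j c
    using that unfolding span_of_def S_def singular_chain_def by auto
  have Ssplit: "\<exists>u v. schain j (subtopology W ?X) u \<and> schain j (subtopology W ?Y) v \<and> c = u + v \<and>
      (\<forall>s\<in>supp v. \<not> singular_simplex j (subtopology W ?X) s)" if c: "c \<in> span_of (S j)" for j c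
  proof (intro exI conjI)
    let ?u = "frag_extend (%s. if singular_simplex j (subtopology W ?X) s then frag_of s else 0) c"
    let ?v = "frag_extend (%s. if singular_simplex j (subtopology W ?X) s then 0 else frag_of s) c"
    show "schain j (subtopology W ?X) ?u" by (rule singular_chain_extend) (simp add: singular_chain_of)
    show "schain j (subtopology W ?Y) ?v"
      using c by (intro singular_chain_extend) (auto simp: singular_chain_of span_of_def S_def)
    have "?u + ?v = frag_extend (%s. frag_of s) c"
      unfolding frag_extend_fun_add[symmetric] by (intro frag_extend_eq) auto
    then show "c = ?u + ?v" using frag_expansion[of c] by (simp add: o_def)
    have "supp ?v \<subseteq> {s. \<not> singular_simplex j (subtopology W ?X) s}"
      by (rule order_trans[OF keys_frag_extend]) (auto split: if_splits)
    then show "\<forall>s\<in>supp ?v. \<not> singular_simplex j (subtopology W ?X) s" by blast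
  qed
  have SW: "schain j W c" if "c \<in> span_of (S j)" for j c
    using Ssplit[OF that] by (auto simp: singular_chain_subtopology intro: singular_chain_add)
  have Sb: "bdry (Suc j) c \<in> span_of (S j)" if c: "c \<in> span_of (S (Suc j))" for j c
  proof -
    obtain u v where uv: "schain (Suc j) (subtopology W ?X) u" "schain (Suc j) (subtopology W ?Y) v" "c = u + v"
      using Ssplit[OF c] by blast
    show ?thesis unfolding uv(3) chain_boundary_add
      using singular_chain_boundary[OF uv(1)] singular_chain_boundary[OF uv(2)] by (intro span_of_add SX SY) auto
  qed
  define b where "b s = (if singular_simplex k (subtopology W Np) s then \<beta> (simplex_map k R s) else 0)" for s
  have evb: "ev b c = ev \<beta> (chain_map k R c)" if "schain k (subtopology W Np) c" for c
    unfolding ev_pull[symmetric] using that by (intro ev_cong) (auto simp: b_def singular_chain_def)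
  have b_cyc: "m dvd ev b (bdry (Suc k) c)" if c: "schain (Suc k) (subtopology W Np) c" for c
  proof -
    have "ev b (bdry (Suc k) c) = ev \<beta> (bdry (Suc k) (chain_map (Suc k) R c))"
      using evb[of "bdry (Suc k) c"] singular_chain_boundary[OF c] chain_boundary_chain_map[OF c, of R] by simp
    then show ?thesis using cocycD[OF \<beta> singular_chain_chain_map[OF c R_cont]] by simp
  qed
  define \<phi> where "\<phi> t = (if singular_simplex (Suc k) (subtopology W ?X) t then cobdry k b t else 0)" for t
  have \<phi>X: "ev \<phi> c = ev b (bdry (Suc k) c)" if "schain (Suc k) (subtopology W ?X) c" for c
    unfolding ev_cobdry[symmetric] using that by (intro ev_cong) (auto simp: \<phi>_def singular_chain_def)
  have \<phi>Y: "m dvd ev \<phi> c" if c: "schain (Suc k) (subtopology W ?Y) c" for c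
  proof (rule ev_dvd)
    fix s assume "s \<in> supp c"
    then have Y: "schain (Suc k) (subtopology W ?Y) (frag_of s)"
      using c by (auto simp: singular_chain_of singular_chain_def)
    show "m dvd \<phi> s"
    proof (cases "singular_simplex (Suc k) (subtopology W ?X) s")
      case True
      then have "schain (Suc k) (subtopology W ?X) (frag_of s)" by (simp add: singular_chain_of)
      then have "schain (Suc k) (subtopology W Np) (frag_of s)" using Y chain_Int Xp(4) by metis
      from b_cyc[OF this] show ?thesis using True by (simp add: \<phi>_def cobdry_def)
    qed (simp add: \<phi>_def)
  qed
  have k0: "k > 0" using k by auto
  obtain \<eta> :: "((nat => real) => 'b) => int" where
    \<eta>: "!!w. w \<in> span_of (S (Suc k)) ==> m dvd ev \<phi> w - ev \<eta> (bdry (Suc k) w)"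
  proof (rule cochain_vanishing_on_cycles[of "bdry (Suc k)" "bdry k" "S k" "S (Suc k)" m \<phi>])
    fix z assume z: "z \<in> span_of (S k)" "bdry k z = 0"
    then have zc: "rcycle 0 k W {} z" using SW by (simp add: rcycle_empty_zero)
    then obtain E where E: "schain (Suc k) W E" "bdry (Suc k) E = z"
      using HW[OF k(1)] unfolding homologous_zero_iff by blast
    obtain Sd T u v where ops: "subdivision_ops Sd T"
      and u: "schain (Suc k) (subtopology W ?X) u"
      and v: "schain (Suc k) (subtopology W ?Y) v" and uv: "Sd (Suc k) E = u + v"
      by (rule chain_split_open[OF Xp(1,2,3) E(1)])
    have "T k z \<in> span_of (S (Suc k))"
    proof -
      obtain u v where uv: "schain k (subtopology W ?X) u" "schain k (subtopology W ?Y) v" "z = u + v"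
        using Ssplit[OF z(1)] by blast
      have "T k (u + v) = T k u + T k v" using subdivision_ops_diff(2)[OF ops, of k "u + v" v] by simp
      then show ?thesis unfolding uv(3)
        using subdivision_ops_chain(2)[OF ops uv(1)] subdivision_ops_chain(2)[OF ops uv(2)]
        by (auto intro: span_of_add SX SY)
    qed
    moreover have "u + v \<in> span_of (S (Suc k))" using u v by (intro span_of_add SX SY)
    \<comment> \<open>The boundary of \<open>u + v\<close> is \<open>Sd k z\<close>; the homotopy
      \<open>T\<close> corrects it to \<open>z\<close> and keeps chains small.\<close>
    moreover have "bdry (Suc k) (u + v - T k z) = z"
    proof -
      have T0: "T (k - 1) 0 = 0" using subdivision_ops_diff(2)[OF ops, of "k - 1" 0 0] by simp
      show ?thesis
        using subdivision_ops_chain(3)[OF ops E(1)] E(2) subdivision_ops_chain(4)[OF ops rcycle_chain[OF zc]] z(2) T0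
        by (simp add: chain_boundary_diff flip: uv)
    qed
    ultimately show "\<exists>w\<in>span_of (S (Suc k)). bdry (Suc k) w = z"
      by (intro bexI[of _ "u + v - T k z"] span_of_diff)
  next
    fix w assume w: "w \<in> span_of (S (Suc k))"
    show "bdry (Suc k) w \<in> span_of (S k) \<and> bdry k (bdry (Suc k) w) = 0"
      using Sb[OF w] chain_boundary_boundary_alt[OF SW[OF w]] by simp
  next
    fix w assume w: "w \<in> span_of (S (Suc k))" "bdry (Suc k) w = 0"
    obtain w1 w2 where w1: "schain (Suc k) (subtopology W ?X) w1" and w2: "schain (Suc k) (subtopology W ?Y) w2"
      and w12: "w = w1 + w2" "\<forall>s\<in>supp w2. \<not> singular_simplex (Suc k) (subtopology W ?X) s"
      using Ssplit[OF w(1)] by blast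
    have "ev \<phi> w2 = ev (%_. 0) w2" using w12(2) by (intro ev_cong) (simp add: \<phi>_def)
    then have e: "ev \<phi> w = ev b (bdry (Suc k) w1)" unfolding w12(1) ev_add \<phi>X[OF w1] by (simp add: ev_def)
    \<comment> \<open>The two parts of the small cycle \<open>w\<close> have opposite boundaries, so
      \<open>y\<close> lies near \<open>N\<close>, and the value of \<open>\<phi>\<close> on
      \<open>w\<close> is that of \<open>b\<close> on \<open>y\<close>.\<close>
    define y where "y = bdry (Suc k) w1"
    have y': "y = - bdry (Suc k) w2"
      using w(2) unfolding w12(1) chain_boundary_add y_def by (simp add: eq_neg_iff_add_eq_0)
    have "schain k (subtopology W ?X) y" "schain k (subtopology W ?Y) y"
      using singular_chain_boundary[OF w1] singular_chain_boundary[OF w2]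
      by (simp add: y_def, simp add: y' singular_chain_minus)
    then have yN: "schain k (subtopology W Np) y" using chain_Int Xp(4) by metis
    then have yc: "rcycle 0 k (subtopology W Np) {} y"
      using chain_boundary_boundary_alt[OF w1] by (simp add: rcycle_empty_zero y_def)
    have "rcycle 0 (Suc k) W {} w" using SW[OF w(1)] w(2) by (simp add: rcycle_empty_zero)
    then obtain E where E: "schain (Suc (Suc k)) W E" "bdry (Suc (Suc k)) E = w"
      using HW[OF k(2)] unfolding homologous_zero_iff by blast
    obtain Sd T u v where ops: "subdivision_ops Sd T"
      and u: "schain (Suc (Suc k)) (subtopology W ?X) u"
      and v: "schain (Suc (Suc k)) (subtopology W ?Y) v" and uv: "Sd (Suc (Suc k)) E = u + v"
      by (rule chain_split_open[OF Xp(1,2,3) E(1)])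
    \<comment> \<open>Since \<open>w\<close> bounds in \<open>W\<close>, this chain lies near
      \<open>N\<close>; its boundary is the subdivided \<open>y\<close>, so the cocycle
      \<open>b\<close> vanishes there modulo \<open>m\<close>.\<close>
    define q where "q = Sd (Suc k) w1 - bdry (Suc (Suc k)) u"
    have "bdry (Suc (Suc k)) u + bdry (Suc (Suc k)) v = Sd (Suc k) w1 + Sd (Suc k) w2"
      using subdivision_ops_chain(3)[OF ops E(1)] E(2) subdivision_ops_diff(1)[OF ops, of "Suc k" w w2]
      by (simp add: uv w12(1) flip: chain_boundary_add)
    then have q': "q = bdry (Suc (Suc k)) v - Sd (Suc k) w2" by (simp add: q_def algebra_simps)
    have "schain (Suc k) (subtopology W ?X) q"
      unfolding q_def using singular_chain_boundary[OF u] subdivision_ops_chain(1)[OF ops w1]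
      by (intro singular_chain_diff) auto
    moreover have "schain (Suc k) (subtopology W ?Y) q"
      unfolding q' using singular_chain_boundary[OF v] subdivision_ops_chain(1)[OF ops w2]
      by (intro singular_chain_diff) auto
    ultimately have qN: "schain (Suc k) (subtopology W Np) q" using chain_Int Xp(4) by metis
    have "bdry (Suc k) q = Sd k y" unfolding q_def chain_boundary_diff using subdivision_ops_chain(3)[OF ops w1]
        chain_boundary_boundary_alt[of "Suc k" _ u] u by (simp add: y_def)
    then have 1: "m dvd ev b (Sd k y)" using b_cyc[OF qN] by simp
    have "rbound 0 k (subtopology W Np) {} (Sd k y - y)" by (rule rbound_subdivision[OF ops yc k0])
    then obtain e where "schain (Suc k) (subtopology W Np) e" "bdry (Suc k) e = Sd k y - y"
      unfolding homologous_zero_iff by blast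
    then have "m dvd ev b (Sd k y - y)" using b_cyc by metis
    then show "m dvd ev \<phi> w" using 1 unfolding e y_def[symmetric] by (simp add: ev_diff dvd_diff_right_iff)
  qed (auto intro: chain_boundary_diff)
  have sub: "schain j (subtopology W ?X) c" if "schain j WX c" for j c
    by (rule chain_subset[OF that]) (use HV(3) in blast)
  have sub': "schain j (subtopology W ?Y) c" if "schain j WY c" for j c
    by (rule chain_subset[OF that]) (use HV(3) in blast)
  show thesis
  proof (rule that[of "%s. b s - \<eta> s" \<eta>])
    show "cocyc m k WX (%s. b s - \<eta> s)" unfolding cocyc_def
    proof (intro allI impI)
      fix c assume "schain (Suc k) WX c"
      then have c: "schain (Suc k) (subtopology W ?X) c" by (rule sub)
      show "m dvd ev (%s. b s - \<eta> s) (bdry (Suc k) c)"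
        using \<eta>[OF SX[OF c]] unfolding \<phi>X[OF c] ev_fun_diff .
    qed
    show "cocyc m k WY \<eta>" unfolding cocyc_def
    proof (intro allI impI)
      fix c assume "schain (Suc k) WY c"
      then have c: "schain (Suc k) (subtopology W ?Y) c" by (rule sub')
      show "m dvd ev \<eta> (bdry (Suc k) c)"
        using \<phi>Y[OF c] \<eta>[OF SY[OF c]] by (simp add: dvd_diff_right_iff)
    qed
    fix s assume s: "singular_simplex k M s"
    then have "chain_map k R (chain_map k f (frag_of s)) = frag_of s"
      by (intro chain_R_f) (simp add: singular_chain_of)
    then have "supp (frag_of (simplex_map k R (simplex_map k f s))) = supp (frag_of s)" by simp
    then have "simplex_map k R (simplex_map k f s) = s" unfolding keys_frag_of by simp
    moreover have "schain k (subtopology W Np) (chain_map k f (frag_of s))"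
      using s HV(3) by (intro f_chain_sub) (simp_all add: singular_chain_of)
    ultimately show "\<beta> s = b (simplex_map k f s) - \<eta> (simplex_map k f s) + \<eta> (simplex_map k f s)"
      by (simp add: b_def singular_chain_of)
  qed
qed

end

context bisected
begin

text \<open>With \<open>V = D\<close> and \<open>Q = C \<union> Np\<close> the bounding chain is
  taken off the other side; the push moves what is left into \<open>C \<union> N\<close> and fixes
  the image of \<open>M\<close>.\<close>

lemma fundamental_bounds: "rbound p 3 WX {} (chain_map 3 f m0)"
proof -
  obtain y where y: "y \<in> D" using comps_nonempty CD_comps by blast
  have b: "rbound p 3 (subtopology W (C \<union> Np)) {} (chain_map 3 f m0)"
    using CD_union HV(3) CD_N Xp(1) comps_open[OF CD_comps(2)] comps_connected[OF CD_comps(2)]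
    by (intro fundamental_bounds_near[OF _ _ _ y]) auto
  have "rbound p 3 WX {} (chain_map 3 \<gamma> (chain_map 3 f m0))" by (rule rbound_map[OF b gamma_cont]) simp
  moreover have "chain_map 3 \<gamma> (chain_map 3 f m0) = chain_map 3 f m0"
    using chain_map_eq[OF rcycle_chain[OF m0], of "\<gamma> \<circ> f" f] gamma(2) by (simp add: chain_map_compose)
  ultimately show ?thesis by simp
qed

lemma fundamental_bounds':
  assumes "rbound 0 3 M {} (m1 - m0)" shows "rbound p 3 WX {} (chain_map 3 f m1)"
proof -
  have "rbound p 3 WX {} (chain_map 3 f (m1 - m0))"
    by (rule rbound_map[OF rbound_0_rel[OF assms, of p "{}"] f_WX]) simp
  from rbound_add[OF this fundamental_bounds] show ?thesis by (simp add: chain_map_diff)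
qed

lemma f_cycle: "rcycle 0 k M {} z ==> rcycle 0 k WX {} (chain_map k f z)" by (rule rcycle_map[OF _ f_WX]) auto

lemma f_bound: "rbound m k M {} z ==> rbound m k WX {} (chain_map k f z)" by (rule rbound_map[OF _ f_WX]) auto

text \<open>The first homology of \<open>M\<close> maps onto that of the region, which therefore
  inherits the exponent.\<close>

lemma WX_expo:
  assumes "rcycle 0 1 WX {} x" shows "rbound 0 1 WX {} (cmul p x)"
proof -
  obtain z where z: "rcycle 0 1 M {} z" "rbound 0 1 WX {} (x - chain_map 1 f z)"
    using cycle_from_boundary[OF _ assms] by auto
  have "rbound 0 1 WX {} (cmul p (x - chain_map 1 f z) + chain_map 1 f (cmul p z))"
    by (intro rbound_add f_bound expo z(1) rbound_scale z(2))
  then show ?thesis by (simp add: chain_map_cmul frag_cmul_diff)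
qed

lemma WX_cocycle_vanishes:
  assumes b: "cocyc 0 2 WX b" and x: "rcycle 0 2 WX {} x" shows "ev b x = 0"
proof -
  obtain z where z: "rcycle 0 2 M {} z" "rbound 0 2 WX {} (x - chain_map 2 f z)"
    using cycle_from_boundary[OF _ x] by auto
  have "ev (pull 2 f b) z = 0" by (rule cocycle_vanishes[OF cocyc_pull[OF b f_WX] z(1)])
  moreover have "0 dvd ev b (x - chain_map 2 f z)" by (rule ev_rbound[OF b z(2)])
  ultimately show ?thesis by (simp add: ev_diff ev_pull)
qed

text \<open>The image of \<open>m1\<close> is a boundary only up to \<open>p d\<close>. As
  \<open>p\<close> is nonzero, \<open>d\<close> is a cycle; its cap product with \<open>b\<close> is
  a 1-cycle of the region, and \<open>p\<close> times it bounds. So the conclusion is integral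
  although [M] bounds modulo \<open>p\<close>.\<close>

lemma restricted_cap_bounds:
  assumes b: "cocyc 0 2 WX b" and m1: "rcycle 0 3 M {} m1" "rbound 0 3 M {} (m1 - m0)"
  shows "rbound 0 1 WX {} (chain_map 1 f (cap 2 1 m1 (pull 2 f b)))"
proof -
  obtain E d where E: "schain 4 WX E" and d: "schain 3 WX d"
    and Ed: "chain_map 3 f m1 = bdry 4 E + cmul p d"
    using fundamental_bounds'[OF m1(2)] unfolding rbound_empty_iff by auto
  have "bdry 3 (chain_map 3 f m1) = 0" using f_cycle[OF m1(1)] by (simp add: rcycle_empty_zero)
  moreover have "bdry 3 (bdry 4 E) = 0" using chain_boundary_boundary_alt[of 3 _ E] E by simp
  ultimately have "cmul p (bdry 3 d) = 0" unfolding Ed chain_boundary_add chain_boundary_cmul by simp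
  then have dc: "rcycle 0 3 WX {} d" using d p_nonzero by (auto simp: rcycle_empty_zero)
  have "rcycle 0 1 WX {} (cap 2 1 d b)"
    using cap_rcycle[OF b, of 0 d] dc by (simp add: One_nat_def numeral_3_eq_3 numeral_2_eq_2)
  then have 1: "rbound 0 1 WX {} (cmul p (cap 2 1 d b))" by (rule WX_expo)
  have "rbound 0 3 WX {} (bdry 4 E)" using rbound_boundary[of 3 WX E] E by simp
  then have "rbound 0 1 WX {} (cap 2 1 (bdry 4 E) b)" using cap_rbound[OF b, of 1] by simp
  from rbound_add[OF this 1] have "rbound 0 1 WX {} (cap 2 1 (chain_map (2 + 1) f m1) b)"
    by (simp add: Ed cap_chain_add cap_chain_cmul)
  then show ?thesis unfolding cap_chain_map .
qed

end

section \<open>Duals of kernel elements and extension of cocycles\<close>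

context bisected
begin

lemma decompose:
  assumes z: "rcycle 0 1 M {} z"
  obtains b b' m1 where "cocyc 0 2 WX b" "cocyc 0 2 WY b'" "rcycle 0 3 M {} m1" "rbound 0 3 M {} (m1 - m0)"
    "rbound 0 1 M {} (z - (cap 2 1 m1 (pull 2 f b) + cap 2 1 m1 (pull 2 f b')))"
proof -
  obtain \<beta> m1 where \<beta>: "cocyc 0 2 M \<beta>" and m1: "rcycle 0 3 M {} m1" "rbound 0 3 M {} (m1 - m0)"
    and zd: "rbound 0 1 M {} (z - cap 2 1 m1 \<beta>)" by (rule Poincare_dual_exists[OF z])
  obtain b b' where b: "cocyc 0 2 WX b" "cocyc 0 2 WY b'"
    and bb': "!!s. singular_simplex 2 M s ==> \<beta> s = b (simplex_map 2 f s) + b' (simplex_map 2 f s)"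
    by (rule cochain_split[OF _ _ \<beta>]) (auto simp: that)
  have "cap 2 1 m1 \<beta> = cap 2 1 m1 (%s. pull 2 f b s + pull 2 f b' s)"
    using rcycle_chain[OF m1(1)] bb' by (intro cap_chain_cong) auto
  then show thesis using that[OF b m1] zd by (simp add: cap_chain_fun_add)
qed

lemma decompose_cycles:
  assumes z: "rcycle 0 1 M {} z"
  obtains x y where "rcycle 0 1 M {} x" "rcycle 0 1 M {} y" "rbound 0 1 WX {} (chain_map 1 f x)"
    "rbound 0 1 WY {} (chain_map 1 f y)" "rbound 0 1 M {} (z - (x + y))"
proof -
  interpret sw: bisected M m0 W f p a D C by (rule swap)
  obtain b b' m1 where *: "cocyc 0 2 WX b" "cocyc 0 2 WY b'" "rcycle 0 3 M {} m1" "rbound 0 3 M {} (m1 - m0)"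
    "rbound 0 1 M {} (z - (cap 2 1 m1 (pull 2 f b) + cap 2 1 m1 (pull 2 f b')))" by (rule decompose[OF z])
  show thesis by (rule that[OF _ _ restricted_cap_bounds[OF *(1,3,4)] sw.restricted_cap_bounds[OF *(2,3,4)] *(5)])
      (rule cap_cycle[OF cocyc_pull *(3)], rule * f_WX sw.f_WX, rule * f_WX sw.f_WX)+
qed

text \<open>Of the two summands of \<open>z\<close>, the one dual to a cocycle from the other side
  bounds in both regions, hence in \<open>M\<close>.\<close>

lemma dual_of_kernel:
  assumes z: "rcycle 0 1 M {} z" and zX: "rbound 0 1 WX {} (chain_map 1 f z)"
  obtains b m1 where "cocyc 0 2 WX b" "rcycle 0 3 M {} m1" "rbound 0 3 M {} (m1 - m0)"
    "rbound 0 1 M {} (z - cap 2 1 m1 (pull 2 f b))"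
proof -
  interpret sw: bisected M m0 W f p a D C by (rule swap)
  obtain b b' m1 where b: "cocyc 0 2 WX b" "cocyc 0 2 WY b'" and m1: "rcycle 0 3 M {} m1" "rbound 0 3 M {} (m1 - m0)"
    and zb: "rbound 0 1 M {} (z - (cap 2 1 m1 (pull 2 f b) + cap 2 1 m1 (pull 2 f b')))" by (rule decompose[OF z])
  let ?x = "cap 2 1 m1 (pull 2 f b)" and ?y = "cap 2 1 m1 (pull 2 f b')"
  have y: "rcycle 0 1 M {} ?y" by (rule cap_cycle[OF cocyc_pull[OF b(2) sw.f_WX] m1(1)])
  have "rbound 0 1 WX {} (chain_map 1 f z - chain_map 1 f ?x - chain_map 1 f (z - (?x + ?y)))"
    by (intro rbound_diff zX restricted_cap_bounds[OF b(1) m1] f_bound[OF zb])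
  then have "rbound 0 1 WX {} (chain_map 1 f ?y)" by (simp add: chain_map_diff chain_map_add)
  then have "rbound 0 1 M {} ?y" using sw.restricted_cap_bounds[OF b(2) m1] by (intro bounds_both[OF _ _ y]) auto
  from rbound_add[OF zb this] have "rbound 0 1 M {} (z - ?x)" by simp
  then show thesis using that[OF b(1) m1] by blast
qed

text \<open>The kernel of the map to \<open>X\<close> is isotropic: duals of its elements extend to \<open>X\<close>, where they
  are evaluated on \<open>p\<close> times a chain up to cycles.\<close>

lemma links_vanishes:
  assumes z: "rcycle 0 1 M {} z" "rbound 0 1 WX {} (chain_map 1 f z)" and \<zeta>: "links z \<zeta>"
    and u: "rcycle 0 1 M {} u" "rbound 0 1 WX {} (chain_map 1 f u)"
  shows "p dvd ev \<zeta> u"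
proof -
  obtain b m1 where b: "cocyc 0 2 WX b" and m1: "rcycle 0 3 M {} m1" "rbound 0 3 M {} (m1 - m0)"
    and ub: "rbound 0 1 M {} (u - cap 2 1 m1 (pull 2 f b))" by (rule dual_of_kernel[OF u])
  obtain E where E: "schain 2 WX E" "bdry 2 E = chain_map 1 f z" using z(2) unfolding homologous_zero_iff by auto
  obtain B where B: "schain 2 M B" "bdry 2 B = cmul p z" using multiple_bounds[OF z(1)] by blast
  \<comment> \<open>The integral cocycle \<open>b\<close> vanishes on 2-cycles of the region, so its
    value on the image of \<open>B\<close> is \<open>p\<close> times its value on
    \<open>E\<close>.\<close>
  have "rcycle 0 2 WX {} (chain_map 2 f B - cmul p E)"
    using E singular_chain_chain_map[OF B(1) f_WX] chain_boundary_chain_map[OF B(1), of f] B(2)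
    by (simp add: rcycle_empty_zero singular_chain_diff singular_chain_cmul chain_boundary_diff chain_boundary_cmul
        chain_map_cmul)
  from WX_cocycle_vanishes[OF b this] have 1: "p dvd ev (pull 2 f b) B" by (simp add: ev_diff ev_pull)
  have "rbound 0 1 M {} (z - z)" by simp
  then have "p dvd ev (pull 2 f b) B - ev \<zeta> (cap 2 1 m1 (pull 2 f b))"
    using \<zeta> z(1) B cocyc_pull[OF b f_WX] m1 unfolding links_def by blast
  then have 2: "p dvd ev \<zeta> (cap 2 1 m1 (pull 2 f b))" using 1 by (simp add: dvd_diff_right_iff)
  have "p dvd ev \<zeta> (u - cap 2 1 m1 (pull 2 f b))"
    using \<zeta> by (intro ev_rbound[OF _ rbound_dvd[OF ub]]) (auto simp: links_def)
  then show ?thesis using 2 by (simp add: ev_diff dvd_diff_left_iff)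
qed

text \<open>Splitting \<open>u\<close> into parts extending over \<open>X\<close> and \<open>Y\<close>, the second vanishes on all cycles, so it is
  a coboundary, and a coboundary extends over \<open>X\<close>.\<close>

lemma cocycle_extends:
  assumes u: "cocyc p 1 M u" and van: "!!z. rcycle 0 1 M {} z ==> rbound 0 1 WX {} (chain_map 1 f z) ==> p dvd ev u z"
  obtains b where "cocyc p 1 WX b" "!!s. singular_simplex 1 M s ==> p dvd u s - b (simplex_map 1 f s)"
proof -
  interpret sw: bisected M m0 W f p a D C by (rule swap)
  obtain b b' where b: "cocyc p 1 WX b" "cocyc p 1 WY b'"
    and bb': "!!s. singular_simplex 1 M s ==> u s = b (simplex_map 1 f s) + b' (simplex_map 1 f s)"
    by (rule cochain_split[OF _ _ u]) (auto simp: that)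
  let ?\<phi> = "pull 1 f b'"
  have \<phi>c: "cocyc p 1 M ?\<phi>" by (rule cocyc_pull[OF b(2) sw.f_WX])
  have "p dvd ev ?\<phi> z" if z: "rcycle 0 1 M {} z" for z
  proof -
    obtain x y where x: "rcycle 0 1 M {} x" "rbound 0 1 WX {} (chain_map 1 f x)"
      and y: "rcycle 0 1 M {} y" "rbound 0 1 WY {} (chain_map 1 f y)" and xy: "rbound 0 1 M {} (z - (x + y))"
      by (rule decompose_cycles[OF z])
    have "ev ?\<phi> x = ev u x - ev (pull 1 f b) x"
      unfolding ev_fun_diff[symmetric] using rcycle_chain[OF x(1)] bb' by (intro ev_cong) (auto simp: singular_chain_def)
    moreover have "p dvd ev u x" by (rule van[OF x])
    moreover have "p dvd ev (pull 1 f b) x" unfolding ev_pull by (rule ev_rbound[OF b(1) rbound_dvd[OF x(2)]]) simp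
    ultimately have 1: "p dvd ev ?\<phi> x" by simp
    have 2: "p dvd ev ?\<phi> y" unfolding ev_pull by (rule ev_rbound[OF b(2) rbound_dvd[OF y(2)]]) simp
    have 3: "p dvd ev ?\<phi> (z - (x + y))" by (rule ev_rbound[OF \<phi>c rbound_dvd[OF xy]]) simp
    have "ev ?\<phi> z = ev ?\<phi> (z - (x + y)) + ev ?\<phi> x + ev ?\<phi> y" by (simp add: ev_diff ev_add)
    then show ?thesis using 1 2 3 by (simp only: dvd_add)
  qed
  then obtain g where g: "!!c. schain 1 M c ==> p dvd ev ?\<phi> c - ev g (bdry 1 c)"
    using coboundary_of_vanishing[OF Mpc] by metis
  \<comment> \<open>The inverse of the embedding transports \<open>g\<close> to a 0-cochain on
    \<open>W\<close>; its values off \<open>N\<close> are arbitrary, as any coboundary is a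
    cocycle.\<close>
  define h where "h = pull 0 fi g"
  define b1 where "b1 s = b s + cobdry 0 h s" for s
  show thesis
  proof (rule that)
    show "cocyc p 1 WX b1" unfolding cocyc_def
    proof (intro allI impI)
      fix c assume c: "schain (Suc 1) WX c"
      have "bdry 1 (bdry (Suc 1) c) = 0" using chain_boundary_boundary_alt[OF c] .
      then have "ev (cobdry 0 h) (bdry (Suc 1) c) = 0" by (simp add: ev_cobdry flip: One_nat_def)
      then have "ev b1 (bdry (Suc 1) c) = ev b (bdry (Suc 1) c)" unfolding b1_def[abs_def] ev_fun_add by simp
      then show "p dvd ev b1 (bdry (Suc 1) c)" using cocycD[OF b(1) c] by simp
    qed
    fix s assume s: "singular_simplex 1 M s"
    then have sc: "schain 1 M (frag_of s)" by (simp add: singular_chain_of)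
    then have q: "schain 0 M (bdry 1 (frag_of s))" using singular_chain_boundary[OF sc] by simp
    have "cobdry 0 h (simplex_map 1 f s) = ev h (bdry 1 (chain_map 1 f (frag_of s)))"
      by (simp add: cobdry_def flip: One_nat_def)
    also have "\<dots> = ev g (chain_map 0 fi (chain_map 0 f (bdry 1 (frag_of s))))"
      unfolding h_def ev_pull using chain_boundary_chain_map[OF sc, of f] by simp
    also have "chain_map 0 fi (chain_map 0 f (bdry 1 (frag_of s))) = bdry 1 (frag_of s)"
      using chain_map_id_gen[of 0 M _ "fi \<circ> f"] q fi(2) by (simp add: chain_map_compose)
    finally have "u s - b1 (simplex_map 1 f s) = ev ?\<phi> (frag_of s) - ev g (bdry 1 (frag_of s))"
      using bb'[OF s] by (simp add: b1_def)
    then show "p dvd u s - b1 (simplex_map 1 f s)" using g[OF sc] by simp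
  qed
qed

text \<open>Each factor extends over the region modulo \<open>p\<close>, hence so does the product,
  and it is evaluated on the image of \<open>c\<close>, which bounds there modulo
  \<open>p\<close>.\<close>

theorem triple_product_vanishes:
  assumes c: "rbound 0 3 M {} (c - m0)"
    and uvw: "!!x. x \<in> {u, v, w} ==> cocyc p 1 M x"
    and van: "!!x z. x \<in> {u, v, w} ==> rcycle 0 1 M {} z ==> rbound 0 1 WX {} (chain_map 1 f z) ==> p dvd ev x z"
  shows "p dvd ev (cup 2 1 (cup 1 1 u v) w) c"
proof -
  obtain u' v' w' where u': "cocyc p 1 WX u'" "!!\<sigma>. singular_simplex 1 M \<sigma> ==> p dvd u \<sigma> - pull 1 f u' \<sigma>"
    and v': "cocyc p 1 WX v'" "!!\<sigma>. singular_simplex 1 M \<sigma> ==> p dvd v \<sigma> - pull 1 f v' \<sigma>"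
    and w': "cocyc p 1 WX w'" "!!\<sigma>. singular_simplex 1 M \<sigma> ==> p dvd w \<sigma> - pull 1 f w' \<sigma>"
  proof -
    have E: "\<exists>b. cocyc p 1 WX b \<and> (\<forall>\<sigma>. singular_simplex 1 M \<sigma> --> p dvd x \<sigma> - pull 1 f b \<sigma>)" if x: "x \<in> {u, v, w}" for x
    proof -
      obtain b where "cocyc p 1 WX b" "!!\<sigma>. singular_simplex 1 M \<sigma> ==> p dvd x \<sigma> - b (simplex_map 1 f \<sigma>)"
        by (rule cocycle_extends[OF uvw[OF x] van[OF x]]) (assumption+, rule that)
      then show ?thesis by blast
    qed
    show thesis using E[of u] E[of v] E[of w] that by auto
  qed
  have cc: "schain 3 M c" using rbound_chain[OF c] rcycle_chain[OF m0] singular_chain_add[of 3 M "c - m0" m0] by simp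
  let ?P = "cup 2 1 (cup 1 1 u' v') w'"
  have 1: "p dvd ev (cup 2 1 (cup 1 1 u v) w) c - ev (pull 3 f ?P) c"
  proof (rule ev_cong_mod)
    fix \<sigma> assume "\<sigma> \<in> supp c"
    then have \<sigma>: "singular_simplex 3 M \<sigma>" using cc by (auto simp: singular_chain_def)
    let ?f = "front_face 1 (front_face 2 \<sigma>)" and ?m = "back_face 1 1 (front_face 2 \<sigma>)" and ?b = "back_face 2 1 \<sigma>"
    have s2: "singular_simplex 2 M (front_face 2 \<sigma>)" using front_face_singular(1)[of 2 1 M \<sigma>] \<sigma> by simp
    have s: "singular_simplex 1 M ?f" "singular_simplex 1 M ?m" "singular_simplex 1 M ?b"
      using front_face_singular(1)[of 1 1 M "front_face 2 \<sigma>"] back_face_singular(1)[of 1 1 M "front_face 2 \<sigma>"]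
        back_face_singular(1)[of 2 1 M \<sigma>] \<sigma> s2 by simp_all
    have P: "pull 3 f ?P \<sigma> = pull 1 f u' ?f * pull 1 f v' ?m * pull 1 f w' ?b"
      using front_face_simplex_map[of 2 1 f \<sigma>] back_face_simplex_map[of 2 1 f \<sigma>]
        front_face_simplex_map[of 1 1 f "front_face 2 \<sigma>"] back_face_simplex_map[of 1 1 f "front_face 2 \<sigma>"]
      by (simp add: cup_def)
    have "[u ?f * v ?m * w ?b = pull 1 f u' ?f * pull 1 f v' ?m * pull 1 f w' ?b] (mod p)"
      using u'(2)[OF s(1)] v'(2)[OF s(2)] w'(2)[OF s(3)] unfolding cong_iff_dvd_diff[symmetric] by (intro cong_mult)
    then show "p dvd cup 2 1 (cup 1 1 u v) w \<sigma> - pull 3 f ?P \<sigma>"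
      unfolding P by (simp add: cong_iff_dvd_diff cup_def)
  qed
  have "cocyc p 2 WX (cup 1 1 u' v')" using cocyc_cup[OF u'(1) v'(1)] by simp
  from cocyc_cup[OF this w'(1)] have "cocyc p 3 WX ?P" by simp
  then have "p dvd ev ?P (chain_map 3 f c)" using fundamental_bounds'[OF c] by (rule ev_rbound)
  then have "p dvd ev (pull 3 f ?P) c" unfolding ev_pull .
  then show ?thesis using 1 by (simp add: dvd_diff_left_iff)
qed

lemma kernels_trivial:
  assumes "rcycle 0 1 M {} z" "rbound 0 1 WX {} (chain_map 1 f z)" "rbound 0 1 WY {} (chain_map 1 f z)"
  shows "rbound 0 1 M {} z" using assms by (intro bounds_both) auto

end

section \<open>Comparison with the homology and cohomology groups\<close>

lemma int_ring_add_pow: "[k] \<cdot>\<^bsub>\<Z>\<^esub> x = k * x" for k x :: int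
proof -
  have n: "[n] \<cdot>\<^bsub>\<Z>\<^esub> x = int n * x" for n :: nat
    by (induction n) (auto simp: add_pow_def nat_pow_def algebra_simps)
  show ?thesis
  proof (cases "k \<ge> 0")
    case True
    then show ?thesis by (simp add: add_pow_int_ge n)
  next
    case False
    then show ?thesis by (simp add: add_pow_int_lt n int_a_inv_eq)
  qed
qed

lemma cochain_eval_int: "cochain_eval \<Z> \<phi> c = ev \<phi> c"
  unfolding cochain_eval_def ev_def by (simp add: int_ring_add_pow int_finsum_eq)

lemma (in residues) res_add_pow:
  fixes k :: int
  assumes "x \<in> carrier R" shows "[k] \<cdot> x = (k * x) mod m"
proof -
  have n: "[n] \<cdot> x = (int n * x) mod m" for n :: nat
  proof (induction n)
    case 0
    show ?case by (simp add: res_zero_eq)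
  next
    case (Suc n)
    have "[Suc n] \<cdot> x = [n] \<cdot> x \<oplus> x" by simp
    then show ?case unfolding Suc by (simp add: res_add_eq algebra_simps mod_add_right_eq)
  qed
  show ?thesis
  proof (cases "k \<ge> 0")
    case True
    then show ?thesis by (simp add: add_pow_int_ge n)
  next
    case False
    then show ?thesis by (simp add: add_pow_int_lt n res_neg_eq mod_minus_eq)
  qed
qed

lemma cobdry_cong:
  assumes "singular_simplex (Suc k) X s" "!!t. singular_simplex k X t ==> d dvd g t - h t"
  shows "d dvd cobdry k g s - cobdry k h s" unfolding cobdry_def
proof (rule ev_cong_mod)
  fix t assume t: "t \<in> supp (bdry (Suc k) (frag_of s))"
  have "schain (Suc k) X (frag_of s)" using assms(1) by (simp add: singular_chain_of)
  from singular_chain_boundary[OF this] t show "d dvd g t - h t" using assms(2) by (auto simp: singular_chain_def)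
qed

lemma cocyc_cong:
  assumes "cocyc m k X \<phi>" "!!s. singular_simplex k X s ==> m dvd \<psi> s - \<phi> s"
  shows "cocyc m k X \<psi>"
proof (rule cocycI)
  fix t assume t: "singular_simplex (Suc k) X t"
  have "m dvd cobdry k \<psi> t - cobdry k \<phi> t" by (rule cobdry_cong[OF t assms(2)])
  then show "m dvd cobdry k \<psi> t" using cocyc_cobdry[OF assms(1) t] by (simp add: dvd_diff_left_iff)
qed

lemma cobdry_cocyc: "cocyc m (Suc k) X (cobdry k g)"
proof (rule cocycI)
  fix t assume "singular_simplex (Suc (Suc k)) X t"
  then have "schain (Suc (Suc k)) X (frag_of t)" by (simp add: singular_chain_of)
  from chain_boundary_boundary_alt[OF this]
  show "m dvd cobdry (Suc k) (cobdry k g) t" by (simp add: cobdry_def[of "Suc k"] ev_cobdry)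
qed

lemma cocyc_fun_add: "cocyc m k X \<phi> ==> cocyc m k X \<psi> ==> cocyc m k X (%s. \<phi> s + \<psi> s)"
  by (simp add: cocyc_def ev_fun_add)

lemma cocyc_fun_diff: "cocyc m k X \<phi> ==> cocyc m k X \<psi> ==> cocyc m k X (%s. \<phi> s - \<psi> s)"
  by (simp add: cocyc_def ev_fun_diff)

section \<open>Cochains with values in the residue ring\<close>

context
  fixes m :: int
  assumes m: "m > 1"
begin

interpretation residues m "residue_ring m" using m by unfold_locales auto

lemma cochain_eval_residue:
  assumes "!!s. s \<in> supp c ==> \<phi> s \<in> {0..m - 1}"
  shows "cochain_eval (residue_ring m) \<phi> c = ev \<phi> c mod m"
proof -
  have "cochain_eval (residue_ring m) \<phi> c = (\<Oplus>\<^bsub>residue_ring m\<^esub>s\<in>supp c. (wt c s * \<phi> s) mod m)"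
    unfolding cochain_eval_def using assms m
    by (intro finsum_cong') (auto simp: res_add_pow res_carrier_eq mod_in_carrier)
  then show ?thesis by (simp add: sum_cong ev_def)
qed

lemma carrier_cochain_residue: "carrier (cochain_group (residue_ring m) k X) = (\<Pi>\<^sub>E s\<in>singular_simplex_set k X. {0..m - 1})"
  by (simp add: cochain_group_def res_carrier_eq)

lemma cochain_eval_residue_chain:
  assumes "\<phi> \<in> (\<Pi>\<^sub>E s\<in>singular_simplex_set k X. {0..m - 1})" "schain k X c"
  shows "cochain_eval (residue_ring m) \<phi> c = ev \<phi> c mod m"
  using assms by (intro cochain_eval_residue) (auto simp: singular_chain_def)

lemma coboundary_residue:
  assumes "\<phi> \<in> (\<Pi>\<^sub>E s\<in>singular_simplex_set k X. {0..m - 1})"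
  shows "coboundary (residue_ring m) k X \<phi> = (\<lambda>s\<in>singular_simplex_set (Suc k) X. cobdry k \<phi> s mod m)"
  unfolding coboundary_def cobdry_def
proof (intro restrict_ext cochain_eval_residue_chain[OF assms])
  fix s assume "s \<in> singular_simplex_set (Suc k) X"
  then have "schain (Suc k) X (frag_of s)" by (simp add: singular_chain_of)
  from singular_chain_boundary[OF this] show "schain k X (bdry (Suc k) (frag_of s))" by simp
qed

lemma cocycle_set_residue:
  "\<phi> \<in> cocycle_set (residue_ring m) k X \<longleftrightarrow>
     \<phi> \<in> (\<Pi>\<^sub>E s\<in>singular_simplex_set k X. {0..m - 1}) \<and> cocyc m k X \<phi>"
proof (cases "\<phi> \<in> (\<Pi>\<^sub>E s\<in>singular_simplex_set k X. {0..m - 1})")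
  case True
  have "coboundary (residue_ring m) k X \<phi> = \<one>\<^bsub>cochain_group (residue_ring m) (Suc k) X\<^esub> \<longleftrightarrow>
      (\<forall>s. singular_simplex (Suc k) X s --> m dvd cobdry k \<phi> s)" unfolding coboundary_residue[OF True]
    by (auto simp: cochain_group_def res_zero_eq fun_eq_iff restrict_def dvd_eq_mod_eq_0)
  also have "\<dots> \<longleftrightarrow> cocyc m k X \<phi>" using cocycI cocyc_cobdry by blast
  finally show ?thesis using True by (simp add: cocycle_set_def kernel_def carrier_cochain_residue)
qed (simp add: cocycle_set_def kernel_def carrier_cochain_residue)

abbreviation "cobdry_coset k X \<phi> \<equiv>
  coboundary_set (residue_ring m) k X #>\<^bsub>cochain_group (residue_ring m) k X\<^esub> \<phi>"

text \<open>Cosets of coboundaries become congruences between integer cochains. The cochain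
  \<open>g\<close> is unrestricted, since reducing it modulo \<open>m\<close> changes its coboundary
  by multiples of \<open>m\<close>.\<close>

lemma cobdry_coset_iff:
  assumes k: "k > 0"
  shows "\<xi> \<in> cobdry_coset k X \<phi> \<longleftrightarrow> \<xi> \<in> (\<Pi>\<^sub>E s\<in>singular_simplex_set k X. {0..m - 1}) \<and>
    (\<exists>g. \<forall>s. singular_simplex k X s --> m dvd \<xi> s - \<phi> s - cobdry (k - 1) g s)"
proof -
  have k': "Suc (k - 1) = k" using k by simp
  let ?P = "%k. \<Pi>\<^sub>E s\<in>singular_simplex_set k X. {0..m - 1}"
  have 1: "\<xi> \<in> cobdry_coset k X \<phi> \<longleftrightarrow>
      (\<exists>g \<in> ?P (k - 1). \<xi> = (\<lambda>s\<in>singular_simplex_set k X. (cobdry (k - 1) g s mod m + \<phi> s) mod m))"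
  proof -
    have "coboundary_set (residue_ring m) k X =
        (%g. \<lambda>s\<in>singular_simplex_set k X. cobdry (k - 1) g s mod m) ` ?P (k - 1)"
      unfolding coboundary_set_def carrier_cochain_residue
      using k coboundary_residue[of _ "k - 1" X] by (simp add: k')
    then show ?thesis by (auto simp: r_coset_def cochain_group_def res_add_eq cong: restrict_cong)
  qed
  show ?thesis
  proof
    assume "\<xi> \<in> cobdry_coset k X \<phi>"
    then obtain g where \<xi>: "\<xi> = (\<lambda>s\<in>singular_simplex_set k X. (cobdry (k - 1) g s mod m + \<phi> s) mod m)"
      using 1 by blast
    have "m dvd \<xi> s - \<phi> s - cobdry (k - 1) g s" if "singular_simplex k X s" for s
      using that by (simp add: \<xi> mod_eq_dvd_iff[symmetric] mod_simps diff_diff_eq add.commute)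
    then show "\<xi> \<in> ?P k \<and> (\<exists>g. \<forall>s. singular_simplex k X s --> m dvd \<xi> s - \<phi> s - cobdry (k - 1) g s)"
      using m by (auto simp: \<xi>)
  next
    assume "\<xi> \<in> ?P k \<and> (\<exists>g. \<forall>s. singular_simplex k X s --> m dvd \<xi> s - \<phi> s - cobdry (k - 1) g s)"
    then obtain g where \<xi>: "\<xi> \<in> ?P k"
      and g: "!!s. singular_simplex k X s ==> m dvd \<xi> s - \<phi> s - cobdry (k - 1) g s" by blast
    let ?g = "\<lambda>t\<in>singular_simplex_set (k - 1) X. g t mod m"
    have "\<xi> = (\<lambda>s\<in>singular_simplex_set k X. (cobdry (k - 1) ?g s mod m + \<phi> s) mod m)"
    proof
      fix s
      show "\<xi> s = (\<lambda>s\<in>singular_simplex_set k X. (cobdry (k - 1) ?g s mod m + \<phi> s) mod m) s"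
      proof (cases "singular_simplex k X s")
        case True
        then have r: "0 \<le> \<xi> s" "\<xi> s < m" using \<xi> by (force simp: PiE_iff)+
        have "m dvd cobdry (k - 1) g s - cobdry (k - 1) ?g s"
          using True k' by (intro cobdry_cong[of _ X]) (simp_all add: mod_eq_dvd_iff[symmetric])
        from dvd_add[OF g[OF True] this] have "m dvd \<xi> s - (cobdry (k - 1) ?g s + \<phi> s)"
          by (simp add: algebra_simps)
        then have "\<xi> s mod m = (cobdry (k - 1) ?g s + \<phi> s) mod m" by (simp add: mod_eq_dvd_iff)
        then show ?thesis using True r by (simp add: mod_add_left_eq)
      next
        case False
        then show ?thesis using \<xi> by (auto simp: PiE_iff extensional_def)
      qed
    qed
    moreover have "?g \<in> ?P (k - 1)" using m by auto
    ultimately show "\<xi> \<in> cobdry_coset k X \<phi>" unfolding 1 by (rule bexI)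
  qed
qed

lemma subgroup_cocycle_set: "subgroup (cocycle_set (residue_ring m) k X) (cochain_group (residue_ring m) k X)"
proof -
  let ?G = "cochain_group (residue_ring m) k X"
  have G: "group ?G" unfolding cochain_group_def by (rule product_group) (rule add.is_group)
  then interpret G: group ?G .
  have z: "cocyc m k X (%_. 0)" by (simp add: cocyc_def ev_def)
  have md: "m dvd x mod m - x" for x by (simp add: mod_eq_dvd_iff[symmetric])
  show ?thesis
  proof (rule G.subgroupI)
    show "cocycle_set (residue_ring m) k X \<subseteq> carrier ?G" by (auto simp: cocycle_set_def kernel_def)
    have "(\<lambda>s\<in>singular_simplex_set k X. 0) \<in> cocycle_set (residue_ring m) k X"
      unfolding cocycle_set_residue using m by (auto intro!: cocyc_cong[OF z])
    then show "cocycle_set (residue_ring m) k X \<noteq> {}" by blast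
    show "inv\<^bsub>?G\<^esub> \<phi> \<in> cocycle_set (residue_ring m) k X" if \<phi>: "\<phi> \<in> cocycle_set (residue_ring m) k X" for \<phi>
    proof -
      have P: "\<phi> \<in> carrier ?G" "cocyc m k X \<phi>"
        using \<phi> by (auto simp: cocycle_set_residue carrier_cochain_residue)
      have "inv\<^bsub>?G\<^esub> \<phi> = (\<lambda>s\<in>singular_simplex_set k X. (- \<phi> s) mod m)" using P(1) m
        by (intro G.inv_equality) (auto simp: carrier_cochain_residue cochain_group_def res_add_eq res_zero_eq mod_simps
            res_carrier_eq intro!: restrict_ext)
      moreover have "cocyc m k X (%s. - \<phi> s)" using cocyc_fun_diff[OF z P(2)] by simp
      then have "cocyc m k X (\<lambda>s\<in>singular_simplex_set k X. - \<phi> s mod m)"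
      proof (rule cocyc_cong)
        show "m dvd (\<lambda>s\<in>singular_simplex_set k X. - \<phi> s mod m) s - - \<phi> s"
          if "singular_simplex k X s" for s using that md[of "- \<phi> s"] by simp
      qed
      ultimately show ?thesis unfolding cocycle_set_residue using m by auto
    qed
    show "\<phi> \<otimes>\<^bsub>?G\<^esub> \<psi> \<in> cocycle_set (residue_ring m) k X"
      if \<phi>\<psi>: "\<phi> \<in> cocycle_set (residue_ring m) k X" "\<psi> \<in> cocycle_set (residue_ring m) k X" for \<phi> \<psi>
    proof -
      have "\<phi> \<otimes>\<^bsub>?G\<^esub> \<psi> = (\<lambda>s\<in>singular_simplex_set k X. (\<phi> s + \<psi> s) mod m)"
        by (simp add: cochain_group_def res_add_eq)
      moreover have "cocyc m k X (%s. \<phi> s + \<psi> s)" using \<phi>\<psi> by (intro cocyc_fun_add) (auto simp: cocycle_set_residue)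
      ultimately show ?thesis unfolding cocycle_set_residue using m by (auto elim!: cocyc_cong simp: md)
    qed
  qed
qed

lemma carrier_cohomology_residue:
  "carrier (cohomology_group (residue_ring m) k X) = cobdry_coset k X ` cocycle_set (residue_ring m) k X"
proof -
  have "carrier (subgroup_generated (cochain_group (residue_ring m) k X) (cocycle_set (residue_ring m) k X)) =
      cocycle_set (residue_ring m) k X"
    by (rule subgroup.carrier_subgroup_generated_subgroup[OF subgroup_cocycle_set])
  then show ?thesis by (auto simp: cohomology_group_def FactGroup_def RCOSETS_def r_coset_def image_iff)
qed

lemma cobdry_coset_self:
  assumes "k > 0" "\<phi> \<in> (\<Pi>\<^sub>E s\<in>singular_simplex_set k X. {0..m - 1})" shows "\<phi> \<in> cobdry_coset k X \<phi>"
  unfolding cobdry_coset_iff[OF assms(1)] using assms(2) by (auto intro!: exI[of _ "%_. 0"] simp: cobdry_def ev_def)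

end

lemma cobdry_coset_eq:
  assumes m: "m > 1" and k: "k > 0"
    and h: "!!s. singular_simplex k X s ==> m dvd \<phi> s - \<psi> s - cobdry (k - 1) h s"
  shows "cobdry_coset m k X \<phi> = cobdry_coset m k X \<psi>"
proof (rule Set.set_eqI)
  fix \<xi>
  let ?D = "%\<phi> g. \<forall>s. singular_simplex k X s --> m dvd \<xi> s - \<phi> s - cobdry (k - 1) g s"
  have "?D \<psi> (%t. g t - - h t)" if "?D \<phi> g" for g
  proof (intro allI impI)
    fix s assume s: "singular_simplex k X s"
    have "cobdry (k - 1) (%t. g t - - h t) s = cobdry (k - 1) g s + cobdry (k - 1) h s"
      by (simp add: cobdry_def ev_fun_add)
    then show "m dvd \<xi> s - \<psi> s - cobdry (k - 1) (%t. g t - - h t) s"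
      using dvd_add[OF that[rule_format, OF s] h[OF s]] by (simp add: algebra_simps)
  qed
  moreover have "?D \<phi> (%t. g t - h t)" if "?D \<psi> g" for g
  proof (intro allI impI)
    fix s assume s: "singular_simplex k X s"
    have "cobdry (k - 1) (%t. g t - h t) s = cobdry (k - 1) g s - cobdry (k - 1) h s"
      by (simp add: cobdry_def ev_fun_diff)
    then show "m dvd \<xi> s - \<phi> s - cobdry (k - 1) (%t. g t - h t) s"
      using dvd_diff[OF that[rule_format, OF s] h[OF s]] by (simp only:) (simp add: algebra_simps)
  qed
  ultimately show "\<xi> \<in> cobdry_coset m k X \<phi> \<longleftrightarrow> \<xi> \<in> cobdry_coset m k X \<psi>"
    unfolding cobdry_coset_iff[OF m k] by blast
qed

section \<open>Homology classes and fractions modulo one\<close>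

lemma hrel_iff: "homologous_rel k X S z c \<longleftrightarrow> rbound 0 k X S (z - c)"
  by (simp add: homologous_rel_def rbound_zero)

lemma hclass_iff: "c \<in> homologous_rel_set k X S z \<longleftrightarrow> rbound 0 k X S (z - c)"
  by (simp add: homologous_rel_def rbound_zero)

lemma hclass_self: "rcycle 0 k X S z ==> z \<in> homologous_rel_set k X S z" by (simp add: hrel_iff)

lemma hclass_eq: "homologous_rel_set k X S z = homologous_rel_set k X S w \<longleftrightarrow> rbound 0 k X S (z - w)"
  unfolding homologous_rel_set_eq by (simp add: homologous_rel_def rbound_zero)

lemma carrier_homology_1: "u \<in> carrier (homology_group 1 X) \<longleftrightarrow> (\<exists>z. rcycle 0 1 X {} z \<and> u = homologous_rel_set 1 X {} z)"
  using carrier_relative_homology_group[of 1 X "{}"] by (auto simp: rcycle_zero)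

lemma rbound_sym: "rbound m k X S (a - b) ==> rbound m k X S (b - a)" using rbound_uminus[of m k X S "a - b"] by simp

lemma rat_class_eq: "rat_class x = rat_class y \<longleftrightarrow> x - y \<in> \<int>"
proof
  assume "rat_class x = rat_class y"
  moreover have "x \<in> rat_class x" by (auto simp: rat_class_def r_coset_def rat_ring_def intro: bexI[of _ 0])
  ultimately obtain h where "h \<in> \<int>" "x = h + y" by (auto simp: rat_class_def r_coset_def rat_ring_def)
  then show "x - y \<in> \<int>" by simp
next
  have *: "rat_class x \<subseteq> rat_class y" if "x - y \<in> \<int>" for x y
  proof
    fix z assume "z \<in> rat_class x"
    then obtain h where h: "h \<in> \<int>" "z = h + x" by (auto simp: rat_class_def r_coset_def rat_ring_def)
    define k where "k = h + (x - y)"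
    have "k \<in> \<int>" "z = k + y" using h that by (auto simp: k_def)
    then show "z \<in> rat_class y" by (auto simp: rat_class_def r_coset_def rat_ring_def)
  qed
  assume xy: "x - y \<in> \<int>"
  then have "y - x \<in> \<int>" using Ints_minus[OF xy] by simp
  then show "rat_class x = rat_class y" using *[OF xy] *[of y x] by blast
qed

lemma rat_class_fraction_eq:
  assumes "p > 0"
  shows "rat_class (of_int k / of_nat p) = rat_class (of_int l / of_nat p) \<longleftrightarrow> int p dvd k - l"
proof -
  have "(of_int k / of_nat p - of_int l / of_nat p :: rat) = of_int (k - l) / of_int (int p)"
    by (simp add: diff_divide_distrib)
  also have "\<dots> \<in> \<int> \<longleftrightarrow> int p dvd k - l"
  proof
    assume "(of_int (k - l) / of_int (int p) :: rat) \<in> \<int>"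
    then obtain j where "(of_int (k - l) / of_int (int p) :: rat) = of_int j" by (elim Ints_cases)
    then have "(of_int (k - l) :: rat) = of_int (int p * j)" using assms by (simp add: field_simps)
    then have "k - l = int p * j" by (simp only: of_int_eq_iff)
    then show "int p dvd k - l" by simp
  next
    assume "int p dvd k - l"
    then obtain j where "k - l = int p * j" by blast
    then have "(of_int (k - l) / of_int (int p) :: rat) = of_int j" using assms by simp
    then show "(of_int (k - l) / of_int (int p) :: rat) \<in> \<int>" by simp
  qed
  finally show ?thesis by (simp add: rat_class_eq)
qed

lemma one_rat_mod_int: "\<one>\<^bsub>rat_mod_int\<^esub> = rat_class 0"
  by (auto simp: rat_mod_int_def FactGroup_def rat_class_def r_coset_def rat_ring_def)

lemma kappa_eq:
  assumes "p > 0" shows "kappa p (rat_class (of_int k / of_nat p)) = k mod int p"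
  unfolding kappa_def rat_class_fraction_eq[OF assms] by (auto simp: mod_eq_dvd_iff[symmetric] intro!: the_equality)

lemma value_set_singleton:
  assumes "a \<in> A" "b \<in> B" "!!x y. x \<in> A ==> y \<in> B ==> h x y = v"
  shows "{h x y | x y. x \<in> A \<and> y \<in> B} = {v}"
proof -
  have "v = h a b" using assms by simp
  then show ?thesis using assms by blast
qed

locale linking_class = linking_manifold M m0 "int p" for M :: "'a topology" and m0 and p :: nat +
  fixes \<mu> assumes mu: "\<mu> = homologous_rel_set 3 M {} m0"
begin

abbreviation "cls z \<equiv> homologous_rel_set 1 M {} z"
abbreviation "S1 \<equiv> singular_simplex_set 1 M"
abbreviation "F \<equiv> residue_ring (int p)"

lemma p_gt: "int p > 1" "p > 0" using prime_p prime_gt_1_int[of "int p"] by auto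

lemma mu_cycle: "m1 \<in> \<mu> ==> rcycle 0 3 M {} m1 \<and> rbound 0 3 M {} (m1 - m0)"
proof -
  assume "m1 \<in> \<mu>"
  then have b: "rbound 0 3 M {} (m1 - m0)" by (simp add: mu hrel_iff rbound_sym)
  have "rcycle 0 3 M {} ((m1 - m0) + m0)" by (rule rcycle_add[OF rcycle_rbound[OF b] m0])
  then show ?thesis using b by simp
qed

lemma cls_cycle:
  assumes "z' \<in> cls z" "rcycle 0 1 M {} z" shows "rcycle 0 1 M {} z'"
proof -
  have "rcycle 0 1 M {} (z - z')" using assms(1) by (intro rcycle_rbound) (simp add: hrel_iff)
  from rcycle_diff[OF assms(2) this]
  have "rcycle 0 1 M {} (z - (z - z'))" .
  then show ?thesis by simp
qed

text \<open>A Poincare dual of \<open>u\<close> and a bounding chain give one admissible value;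
  \<open>links\<close> says that every other choice gives the same one.\<close>

lemma linking_form_eq:
  assumes z: "rcycle 0 1 M {} z" and u: "rcycle 0 1 M {} u" and \<gamma>: "links z \<gamma>"
  shows "linking_form M \<mu> p (cls z) (cls u) = rat_class (of_int (ev \<gamma> u) / of_nat p)"
  unfolding linking_form_def
proof (rule the_equality)
  have \<gamma>c: "cocyc (int p) 1 M \<gamma>" using \<gamma> by (simp add: links_def)
  have ev\<gamma>: "int p dvd ev \<gamma> c - ev \<gamma> u" if "c \<in> cls u" for c
  proof -
    have "int p dvd ev \<gamma> (u - c)" using that by (intro ev_rbound[OF \<gamma>c rbound_dvd[of 0]]) (auto simp: hrel_iff)
    then show ?thesis by (simp add: ev_diff dvd_diff_commute)
  qed
  obtain B where B: "schain 2 M B" "bdry 2 B = cmul (int p) z" using multiple_bounds[OF z] by blast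
  obtain \<beta> m1 where \<beta>: "cocyc 0 2 M \<beta>" and m1: "rcycle 0 3 M {} m1" "rbound 0 3 M {} (m1 - m0)"
    and zd: "rbound 0 1 M {} (u - cap 2 1 m1 \<beta>)" by (rule Poincare_dual_exists[OF u])
  \<comment> \<open>Members of \<open>cocycle_set\<close> are extensional, so the dual is cut down
    to the simplices of \<open>M\<close>.\<close>
  define \<beta>' where "\<beta>' = restrict \<beta> (singular_simplex_set 2 M)"
  have \<beta>': "cocyc 0 2 M \<beta>'"
  proof (rule cocycI)
    fix t assume "singular_simplex (Suc 2) M t"
    then have "0 dvd cobdry 2 \<beta>' t - cobdry 2 \<beta> t" "0 dvd cobdry 2 \<beta> t"
      by (auto intro!: cobdry_cong[of _ M] cocyc_cobdry[OF \<beta>] simp: \<beta>'_def simp del: dvd_0_left_iff)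
    then show "0 dvd cobdry 2 \<beta>' t" by simp
  qed
  have cap: "cap 2 1 m1 \<beta>' = cap 2 1 m1 \<beta>"
    using rcycle_chain[OF m1(1)] by (intro cap_chain_cong) (auto simp: \<beta>'_def)
  have m1\<mu>: "m1 \<in> \<mu>" using m1(2) by (simp add: mu hrel_iff rbound_sym)
  have "cap 2 1 m1 \<beta>' \<in> cls u" unfolding cap hclass_iff by (rule zd)
  moreover have "\<beta>' \<in> cocycle_set \<Z> 2 M"
  proof -
    have "coboundary \<Z> 2 M \<beta>' = (\<lambda>s\<in>singular_simplex_set (Suc 2) M. 0)"
      unfolding coboundary_def cochain_eval_int using cocyc_cobdry[OF \<beta>'] by (intro restrict_ext) (simp add: cobdry_def)
    then show ?thesis by (simp add: cocycle_set_def kernel_def cochain_group_def \<beta>'_def)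
  qed
  ultimately have "ev \<beta>' B \<in> intersection_numbers M \<mu> B (cls u)"
    unfolding intersection_numbers_def cochain_eval_int using m1\<mu> by blast
  moreover have "rat_class (of_int (ev \<gamma> u) / of_nat p) = rat_class (of_int (ev \<beta>' B) / of_nat p)"
  proof -
    have "int p dvd ev \<beta>' B - ev \<gamma> (cap 2 1 m1 \<beta>')"
      using \<gamma> z B \<beta>' m1 unfolding links_def by simp
    from dvd_add[OF this ev\<gamma>[of "cap 2 1 m1 \<beta>'"]] show ?thesis
      using zd unfolding rat_class_fraction_eq[OF p_gt(2)] cap hclass_iff by (simp add: dvd_diff_commute)
  qed
  ultimately show "\<exists>z\<in>cls z. \<exists>C. schain 2 M C \<and> bdry 2 C = cmul (int p) z \<and>
      (\<exists>k\<in>intersection_numbers M \<mu> C (cls u). rat_class (of_int (ev \<gamma> u) / of_nat p) = rat_class (of_int k / of_nat p))"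
    using B hclass_self[OF z] by blast
  fix q assume "\<exists>z\<in>cls z. \<exists>C. schain 2 M C \<and> bdry 2 C = cmul (int p) z \<and>
      (\<exists>k\<in>intersection_numbers M \<mu> C (cls u). q = rat_class (of_int k / of_nat p))"
  then obtain z' C k where z': "z' \<in> cls z" and C: "schain 2 M C" "bdry 2 C = cmul (int p) z'"
    and k: "k \<in> intersection_numbers M \<mu> C (cls u)" and q: "q = rat_class (of_int k / of_nat p)" by blast
  obtain \<beta> m where \<beta>: "\<beta> \<in> cocycle_set \<Z> 2 M" and m: "m \<in> \<mu>" "cap 2 1 m \<beta> \<in> cls u" and k: "k = ev \<beta> C"
    using k unfolding intersection_numbers_def cochain_eval_int by blast
  have \<beta>c: "cocyc 0 2 M \<beta>"
  proof (rule cocycI)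
    fix t assume t: "singular_simplex (Suc 2) M t"
    have "coboundary \<Z> 2 M \<beta> = (\<lambda>s\<in>singular_simplex_set (Suc 2) M. 0)"
      using \<beta> by (simp add: cocycle_set_def kernel_def cochain_group_def)
    from fun_cong[OF this, of t] show "0 dvd cobdry 2 \<beta> t"
      using t by (simp add: coboundary_def cochain_eval_int cobdry_def)
  qed
  have "int p dvd ev \<beta> C - ev \<gamma> (cap 2 1 m \<beta>)"
    using \<gamma> cls_cycle[OF z' z] z' C \<beta>c mu_cycle[OF m(1)] unfolding links_def hclass_iff by blast
  from dvd_add[OF this ev\<gamma>[OF m(2)]]
  show "q = rat_class (of_int (ev \<gamma> u) / of_nat p)" unfolding q k rat_class_fraction_eq[OF p_gt(2)] by simp
qed

lemma ev_cobdry_cycle: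
  assumes "rcycle 0 (Suc k) M {} c" shows "ev (cobdry k g) c = 0"
  using assms by (simp add: ev_cobdry rcycle_empty_zero)

lemma kronecker_eq:
  assumes \<phi>: "\<phi> \<in> cocycle_set F 1 M" and w: "rcycle 0 1 M {} w"
  shows "kronecker F (cobdry_coset (int p) 1 M \<phi>) (cls w) = ev \<phi> w mod int p"
proof -
  have P: "\<phi> \<in> (\<Pi>\<^sub>E s\<in>S1. {0..int p - 1})" "cocyc (int p) 1 M \<phi>"
    using \<phi> unfolding cocycle_set_residue[OF p_gt(1)] by auto
  have "cochain_eval F \<xi> c = ev \<phi> w mod int p" if \<xi>: "\<xi> \<in> cobdry_coset (int p) 1 M \<phi>" and c: "c \<in> cls w" for \<xi> c
  proof -
    have \<xi>P: "\<xi> \<in> (\<Pi>\<^sub>E s\<in>S1. {0..int p - 1})" using \<xi> unfolding cobdry_coset_iff[OF p_gt(1) zero_less_one] by blast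
    obtain g where g: "!!s. singular_simplex 1 M s ==> int p dvd \<xi> s - (\<phi> s + cobdry 0 g s)"
      using \<xi> unfolding cobdry_coset_iff[OF p_gt(1) zero_less_one] by (auto simp: diff_diff_eq)
    have cc: "rcycle 0 1 M {} c" by (rule cls_cycle[OF c w])
    have "int p dvd ev \<xi> c - ev (%s. \<phi> s + cobdry 0 g s) c"
      using rcycle_chain[OF cc] g by (intro ev_cong_mod) (auto simp: singular_chain_def)
    then have 1: "int p dvd ev \<xi> c - ev \<phi> c"
      using ev_cobdry_cycle[of 0 c g] cc by (simp add: ev_fun_add One_nat_def)
    have "int p dvd ev \<phi> (c - w)"
      using c by (intro ev_rbound[OF P(2) rbound_dvd[of 0]]) (auto simp: hrel_iff rbound_sym)
    from dvd_add[OF 1 this] have "int p dvd ev \<xi> c - ev \<phi> w" by (simp add: ev_diff)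
    then show ?thesis
      using cochain_eval_residue_chain[OF p_gt(1) \<xi>P rcycle_chain[OF cc]] by (simp add: mod_eq_dvd_iff)
  qed
  moreover have "\<phi> \<in> cobdry_coset (int p) 1 M \<phi>" by (rule cobdry_coset_self[OF p_gt(1) _ P(1)]) simp
  moreover have "w \<in> cls w" by (rule hclass_self[OF w])
  ultimately have "{cochain_eval F \<xi> c | \<xi> c. \<xi> \<in> cobdry_coset (int p) 1 M \<phi> \<and> c \<in> cls w} = {ev \<phi> w mod int p}"
    by (intro value_set_singleton)
  then show ?thesis by (simp add: kronecker_def)
qed

text \<open>For uniqueness, two classes with equal Kronecker pairings differ by a cochain vanishing
  modulo \<open>p\<close> on cycles, which is a coboundary as \<open>M\<close> is
  path-connected.\<close>

lemma linking_dual_eq: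
  assumes z: "rcycle 0 1 M {} z" and \<gamma>: "links z \<gamma>"
  shows "linking_dual M \<mu> p (cls z) = cobdry_coset (int p) 1 M (\<lambda>s\<in>S1. \<gamma> s mod int p)"
proof -
  let ?\<gamma> = "\<lambda>s\<in>S1. \<gamma> s mod int p"
  have \<gamma>c: "cocyc (int p) 1 M \<gamma>" using \<gamma> by (simp add: links_def)
  have d: "int p dvd ?\<gamma> s - \<gamma> s" if "singular_simplex 1 M s" for s
    using that by (simp add: mod_eq_dvd_iff[symmetric])
  have \<gamma>Z: "?\<gamma> \<in> cocycle_set F 1 M" unfolding cocycle_set_residue[OF p_gt(1)]
  proof
    show "cocyc (int p) 1 M ?\<gamma>" by (rule cocyc_cong[OF \<gamma>c d])
  qed (use p_gt in auto)
  have ev\<gamma>: "int p dvd ev ?\<gamma> w - ev \<gamma> w" if "rcycle 0 1 M {} w" for w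
    using rcycle_chain[OF that] d by (intro ev_cong_mod) (auto simp: singular_chain_def)
  have pairing: "kappa p (linking_form M \<mu> p (cls z) (cls w)) = ev \<gamma> w mod int p" if "rcycle 0 1 M {} w" for w
    using linking_form_eq[OF z that \<gamma>] kappa_eq[OF p_gt(2)] by simp
  show ?thesis unfolding linking_dual_def
  proof (rule the_equality)
    have "ev ?\<gamma> w mod int p = ev \<gamma> w mod int p" if "rcycle 0 1 M {} w" for w
      unfolding mod_eq_dvd_iff by (rule ev\<gamma>[OF that])
    then show "cobdry_coset (int p) 1 M ?\<gamma> \<in> carrier (cohomology_group F 1 M) \<and>
      (\<forall>u\<in>carrier (homology_group 1 M).
        kronecker F (cobdry_coset (int p) 1 M ?\<gamma>) u = kappa p (linking_form M \<mu> p (cls z) u))"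
      using \<gamma>Z kronecker_eq[OF \<gamma>Z] pairing
      by (auto simp: carrier_cohomology_residue[OF p_gt(1)] carrier_homology_1)
    fix \<xi> assume \<xi>: "\<xi> \<in> carrier (cohomology_group F 1 M) \<and> (\<forall>u\<in>carrier (homology_group 1 M).
        kronecker F \<xi> u = kappa p (linking_form M \<mu> p (cls z) u))"
    then obtain \<phi> where \<phi>: "\<phi> \<in> cocycle_set F 1 M" and \<xi>\<phi>: "\<xi> = cobdry_coset (int p) 1 M \<phi>"
      unfolding carrier_cohomology_residue[OF p_gt(1)] by blast
    have van: "int p dvd ev (%s. \<phi> s - ?\<gamma> s) w" if w: "rcycle 0 1 M {} w" for w
    proof -
      have "cls w \<in> carrier (homology_group 1 M)" using w carrier_homology_1 by blast
      then have "ev \<phi> w mod int p = ev \<gamma> w mod int p"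
        using \<xi> pairing[OF w] kronecker_eq[OF \<phi> w] by (simp add: \<xi>\<phi>)
      moreover have "ev ?\<gamma> w mod int p = ev \<gamma> w mod int p" unfolding mod_eq_dvd_iff by (rule ev\<gamma>[OF w])
      ultimately have "ev \<phi> w mod int p = ev ?\<gamma> w mod int p" by (simp only:)
      then show ?thesis by (simp only: ev_fun_diff mod_eq_dvd_iff)
    qed
    obtain g where g: "!!c. schain 1 M c ==> int p dvd ev (%s. \<phi> s - ?\<gamma> s) c - ev g (bdry 1 c)"
      by (rule coboundary_of_vanishing[OF Mpc van]) (assumption, rule that)
    show "\<xi> = cobdry_coset (int p) 1 M ?\<gamma>" unfolding \<xi>\<phi>
    proof (rule cobdry_coset_eq[OF p_gt(1)])
      fix s assume "singular_simplex 1 M s"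
      then have "schain 1 M (frag_of s)" by (simp add: singular_chain_of)
      from g[OF this] show "int p dvd \<phi> s - ?\<gamma> s - cobdry (1 - 1) g s" by (simp add: cobdry_def One_nat_def)
    qed simp
  qed
qed

lemma linking_dual_member:
  assumes z: "rcycle 0 1 M {} z" and \<gamma>: "links z \<gamma>" and \<phi>: "\<phi> \<in> linking_dual M \<mu> p (cls z)"
  shows "\<phi> \<in> (\<Pi>\<^sub>E s\<in>S1. {0..int p - 1})" "cocyc (int p) 1 M \<phi>"
    "!!w. rcycle 0 1 M {} w ==> int p dvd ev \<phi> w - ev \<gamma> w"
proof -
  obtain g where P: "\<phi> \<in> (\<Pi>\<^sub>E s\<in>S1. {0..int p - 1})"
    and g: "!!s. singular_simplex 1 M s ==> int p dvd \<phi> s - \<gamma> s mod int p - cobdry 0 g s"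
    using \<phi> unfolding linking_dual_eq[OF z \<gamma>] cobdry_coset_iff[OF p_gt(1) zero_less_one] by auto
  show "\<phi> \<in> (\<Pi>\<^sub>E s\<in>S1. {0..int p - 1})" by (rule P)
  have d: "int p dvd \<phi> s - (\<gamma> s + cobdry 0 g s)" if "singular_simplex 1 M s" for s
  proof -
    have "int p dvd \<gamma> s mod int p - \<gamma> s" by (simp add: mod_eq_dvd_iff[symmetric])
    from dvd_add[OF g[OF that] this] show ?thesis by (simp add: algebra_simps)
  qed
  have "cocyc (int p) 1 M \<gamma>" using \<gamma> by (simp add: links_def)
  moreover have "cocyc (int p) 1 M (cobdry 0 g)" using cobdry_cocyc[of "int p" 0 M g] by (simp add: One_nat_def)
  ultimately show "cocyc (int p) 1 M \<phi>" using cocyc_cong[OF cocyc_fun_add, of _ 1 M _ _ \<phi>] d by simp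
  fix w assume w: "rcycle 0 1 M {} w"
  have "int p dvd ev \<phi> w - ev (%s. \<gamma> s + cobdry 0 g s) w"
    using rcycle_chain[OF w] d by (intro ev_cong_mod) (auto simp: singular_chain_def)
  then show "int p dvd ev \<phi> w - ev \<gamma> w"
    using ev_cobdry_cycle[of 0 w g] w by (simp add: ev_fun_add One_nat_def)
qed

lemma linking_dual_nonempty:
  assumes z: "rcycle 0 1 M {} z" and \<gamma>: "links z \<gamma>"
  shows "\<exists>\<phi>. \<phi> \<in> linking_dual M \<mu> p (cls z)"
  using cobdry_coset_self[OF p_gt(1) zero_less_one, of "\<lambda>s\<in>S1. \<gamma> s mod int p" M] p_gt
  unfolding linking_dual_eq[OF z \<gamma>] by (intro exI) auto

text \<open>On a cycle the cap product with a coboundary is a boundary. This removes the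
  indeterminacy of the inner product in a triple product.\<close>

lemma cobdry_cup_vanishes:
  assumes w: "cocyc (int p) 1 M w" and c: "rcycle 0 3 M {} c"
  shows "int p dvd ev (cup 2 1 (cobdry 1 g) w) c"
proof -
  have "bdry 2 (cap 1 2 c g) = cmul 1 (cap 2 1 c (cobdry 1 g))" by (rule cap_coboundary[OF c]) (simp add: ev_cobdry)
  moreover have "schain (Suc 1) M (cap 1 2 c g)" using singular_chain_cap[of 1 2 M c g] rcycle_chain[OF c] by simp
  ultimately show ?thesis using cocycD[OF w] unfolding ev_cup by fastforce
qed

lemma cup_cochain_residue:
  assumes "\<phi> \<in> (\<Pi>\<^sub>E s\<in>singular_simplex_set k M. {0..int p - 1})"
  shows "cup_cochain F k l M \<phi> \<psi> = (\<lambda>s\<in>singular_simplex_set (k + l) M. cup k l \<phi> \<psi> s mod int p)"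
  unfolding cup_cochain_def by (simp add: residue_ring_def cup_def)

text \<open>\<open>cup_product\<close> ranges over all representatives and adds coboundaries at both
  stages, so the value must vanish for every choice before \<open>the_elem\<close> is
  determined.\<close>

lemma triple_cup_eq_0:
  assumes mem: "!!\<xi> \<phi>. \<xi> \<in> {\<xi>1, \<xi>2, \<xi>3} ==> \<phi> \<in> \<xi> ==> \<phi> \<in> (\<Pi>\<^sub>E s\<in>S1. {0..int p - 1}) \<and> cocyc (int p) 1 M \<phi>"
    and ne: "\<phi>1 \<in> \<xi>1" "\<phi>2 \<in> \<xi>2" "\<phi>3 \<in> \<xi>3"
    and van: "!!\<phi>1 \<phi>2 \<phi>3 c. \<phi>1 \<in> \<xi>1 ==> \<phi>2 \<in> \<xi>2 ==> \<phi>3 \<in> \<xi>3 ==> c \<in> \<mu> ==>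
      int p dvd ev (cup 2 1 (cup 1 1 \<phi>1 \<phi>2) \<phi>3) c"
  shows "triple_cup M \<mu> p \<xi>1 \<xi>2 \<xi>3 = \<zero>\<^bsub>F\<^esub>"
proof -
  let ?K = "cup_product F 2 1 M (cup_product F 1 1 M \<xi>1 \<xi>2) \<xi>3"
  let ?P = "%k. \<Pi>\<^sub>E s\<in>singular_simplex_set k M. {0..int p - 1}"
  have val: "cochain_eval F \<xi> c = 0" if \<xi>: "\<xi> \<in> ?K" and c: "c \<in> \<mu>" for \<xi> c
  proof -
    obtain \<eta> \<phi>3 where \<eta>: "\<eta> \<in> cup_product F 1 1 M \<xi>1 \<xi>2" and \<phi>3: "\<phi>3 \<in> \<xi>3"
      and x: "\<xi> \<in> cobdry_coset (int p) 3 M (cup_cochain F 2 1 M \<eta> \<phi>3)"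
      using \<xi> unfolding cup_product_def by auto
    obtain \<phi>1 \<phi>2 where \<phi>1: "\<phi>1 \<in> \<xi>1" and \<phi>2: "\<phi>2 \<in> \<xi>2"
      and e: "\<eta> \<in> cobdry_coset (int p) 2 M (cup_cochain F 1 1 M \<phi>1 \<phi>2)"
      using \<eta> unfolding cup_product_def by auto
    have cc: "rcycle 0 3 M {} c" using mu_cycle[OF c] by blast
    have c3: "!!s. s \<in> supp c ==> singular_simplex 3 M s"
      using rcycle_chain[OF cc] by (auto simp: singular_chain_def)
    have \<phi>1P: "\<phi>1 \<in> ?P 1" using mem[OF _ \<phi>1] by simp
    obtain g where \<eta>P: "\<eta> \<in> ?P 2"
      and g: "!!s. singular_simplex 2 M s ==> int p dvd \<eta> s - cup 1 1 \<phi>1 \<phi>2 s mod int p - cobdry 1 g s"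
      using e unfolding cobdry_coset_iff[OF p_gt(1) zero_less_numeral] cup_cochain_residue[OF \<phi>1P] by (auto simp: One_nat_def[symmetric])
    obtain h where \<xi>P: "\<xi> \<in> ?P 3"
      and h: "!!s. singular_simplex 3 M s ==> int p dvd \<xi> s - cup 2 1 \<eta> \<phi>3 s mod int p - cobdry 2 h s"
      using x unfolding cobdry_coset_iff[OF p_gt(1) zero_less_numeral] cup_cochain_residue[OF \<eta>P] by auto
    have md: "int p dvd a mod int p - a" for a by (simp add: mod_eq_dvd_iff[symmetric])
    \<comment> \<open>\<open>g\<close> and \<open>h\<close> are the indeterminacies of the inner and
      of the outer product; both contributions vanish modulo \<open>p\<close> on a cycle.\<close>
    have "int p dvd ev \<xi> c - ev (%s. cup 2 1 (cup 1 1 \<phi>1 \<phi>2) \<phi>3 s + cup 2 1 (cobdry 1 g) \<phi>3 s + cobdry 2 h s) c"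
    proof (rule ev_cong_mod)
      fix s assume "s \<in> supp c"
      then have s: "singular_simplex 3 M s" by (rule c3)
      then have s2: "singular_simplex 2 M (front_face 2 s)" using front_face_singular(1)[of 2 1 M s] by simp
      let ?f = "front_face 2 s" and ?b = "\<phi>3 (back_face 2 1 s)"
      have "int p dvd (\<eta> ?f - cup 1 1 \<phi>1 \<phi>2 ?f - cobdry 1 g ?f) * ?b"
        using dvd_add[OF g[OF s2] md[of "cup 1 1 \<phi>1 \<phi>2 ?f"]] by (intro dvd_mult2) (simp add: algebra_simps)
      then have "int p dvd cup 2 1 \<eta> \<phi>3 s - cup 2 1 (cup 1 1 \<phi>1 \<phi>2) \<phi>3 s - cup 2 1 (cobdry 1 g) \<phi>3 s"
        by (simp add: cup_def algebra_simps)
      from dvd_add[OF dvd_add[OF h[OF s] md[of "cup 2 1 \<eta> \<phi>3 s"]] this]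
      show "int p dvd \<xi> s - (cup 2 1 (cup 1 1 \<phi>1 \<phi>2) \<phi>3 s + cup 2 1 (cobdry 1 g) \<phi>3 s + cobdry 2 h s)"
        by (simp add: algebra_simps)
    qed
    moreover have "ev (cobdry 2 h) c = 0" using ev_cobdry_cycle[of 2 c h] cc by simp
    moreover have "int p dvd ev (cup 2 1 (cobdry 1 g) \<phi>3) c"
      using mem[OF _ \<phi>3] by (intro cobdry_cup_vanishes cc) simp
    moreover have "int p dvd ev (cup 2 1 (cup 1 1 \<phi>1 \<phi>2) \<phi>3) c" by (rule van[OF \<phi>1 \<phi>2 \<phi>3 c])
    ultimately have "int p dvd ev \<xi> c" by (simp add: ev_fun_add dvd_diff_left_iff)
    then show ?thesis using cochain_eval_residue_chain[OF p_gt(1) \<xi>P rcycle_chain[OF cc]] by simp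
  qed
  have "\<exists>\<xi>. \<xi> \<in> ?K"
  proof -
    have \<phi>1P: "\<phi>1 \<in> ?P 1" using mem[OF _ ne(1)] by simp
    let ?\<eta> = "cup_cochain F 1 1 M \<phi>1 \<phi>2"
    have \<eta>P: "?\<eta> \<in> ?P 2" unfolding cup_cochain_residue[OF \<phi>1P] using p_gt by auto
    then have "?\<eta> \<in> cup_product F 1 1 M \<xi>1 \<xi>2"
      unfolding cup_product_def using ne cobdry_coset_self[OF p_gt(1), of 2 ?\<eta> M] by auto
    moreover have "cup_cochain F 2 1 M ?\<eta> \<phi>3 \<in> ?P 3" unfolding cup_cochain_residue[OF \<eta>P] using p_gt by auto
    ultimately show ?thesis
      unfolding cup_product_def[of F 2 1] using ne cobdry_coset_self[OF p_gt(1), of 3 "cup_cochain F 2 1 M ?\<eta> \<phi>3" M] by auto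
  qed
  then have "{cochain_eval F \<xi> c | \<xi> c. \<xi> \<in> ?K \<and> c \<in> \<mu>} = {0}"
  proof (elim exE)
    fix \<xi> assume \<xi>: "\<xi> \<in> ?K"
    have "m0 \<in> \<mu>" using hclass_self[OF m0] unfolding mu .
    from value_set_singleton[OF \<xi> this val] show ?thesis .
  qed
  then show ?thesis by (simp add: triple_cup_def kronecker_def residue_ring_def)
qed

end

section \<open>Counting by characters\<close>

text \<open>Translation by an element \<open>b\<close> multiplies the sum by \<open>e b\<close>, so
  the sum is zero unless \<open>e\<close> is trivial.\<close>

lemma (in group) character_sum:
  fixes e :: "'a => complex"
  assumes B: "subgroup B G" and e: "!!x y. x \<in> B ==> y \<in> B ==> e (x \<otimes> y) = e x * e y"
  shows "(\<Sum>x\<in>B. e x) = (if \<forall>b\<in>B. e b = 1 then of_nat (card B) else 0)"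
proof (cases "\<forall>b\<in>B. e b = 1")
  case False
  then obtain b where b: "b \<in> B" "e b \<noteq> 1" by blast
  have "bij_betw (%x. b \<otimes> x) B B" by (rule bij_betwI[where g = "%x. inv b \<otimes> x"])
      (use b(1) B in \<open>auto simp: subgroup.m_closed subgroup.m_inv_closed subgroup.mem_carrier m_assoc[symmetric]\<close>)
  then have "(\<Sum>x\<in>B. e x) = (\<Sum>x\<in>B. e (b \<otimes> x))" by (simp add: sum.reindex_bij_betw)
  also have "\<dots> = e b * (\<Sum>x\<in>B. e x)" using e b(1) by (simp add: sum_distrib_left)
  finally have "(1 - e b) * (\<Sum>x\<in>B. e x) = 0" by (simp add: algebra_simps)
  then have "(\<Sum>x\<in>B. e x) = 0" using b(2) by simp
  then show ?thesis unfolding if_not_P[OF False] .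
qed simp

text \<open>Summing the values of the pairing over \<open>A \<times> B\<close> in both orders, orthogonality of characters
  gives \<open>|B|\<close> and \<open>r|A|\<close>, where \<open>r \<ge> 1\<close> is the order of the right kernel.\<close>

lemma (in group) pairing_card_le:
  fixes k :: "'a => 'a => int"
  assumes A: "subgroup A G" and B: "subgroup B G" and p: "p > 0" and fin: "finite B"
    and k1: "!!a a' b. a \<in> A ==> a' \<in> A ==> b \<in> B ==> int p dvd k (a \<otimes> a') b - (k a b + k a' b)"
    and k2: "!!a b b'. a \<in> A ==> b \<in> B ==> b' \<in> B ==> int p dvd k a (b \<otimes> b') - (k a b + k a b')"
    and nondeg: "!!a. a \<in> A ==> (!!b. b \<in> B ==> int p dvd k a b) ==> a = \<one>"
  shows "finite A" "card A \<le> card B"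
proof -
  note sub = subgroup.m_closed subgroup.m_inv_closed subgroup.mem_carrier subgroup.one_closed
  \<comment> \<open>An element of \<open>A\<close> is determined by its table of residues against
    the finite \<open>B\<close>, by nondegeneracy.\<close>
  have "inj_on (%a. \<lambda>b\<in>B. k a b mod int p) A"
  proof
    fix a a' assume a: "a \<in> A" "a' \<in> A" and eq: "(\<lambda>b\<in>B. k a b mod int p) = (\<lambda>b\<in>B. k a' b mod int p)"
    let ?c = "a \<otimes> inv a'"
    have c: "?c \<in> A" "?c \<otimes> a' = a" using a A by (auto simp: sub m_assoc)
    have "?c = \<one>"
    proof (rule nondeg[OF c(1)])
      fix b assume b: "b \<in> B"
      have "k a b mod int p = k a' b mod int p" using fun_cong[OF eq, of b] b by simp
      then have "int p dvd k a b - k a' b" by (simp add: mod_eq_dvd_iff)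
      moreover have "int p dvd k a b - (k ?c b + k a' b)" using k1[OF c(1) a(2) b] c(2) by simp
      ultimately have "int p dvd (k a b - k a' b) - (k a b - (k ?c b + k a' b))" by (rule dvd_diff)
      then show "int p dvd k ?c b" by simp
    qed
    then show "a = a'" using c(2) a A by (simp add: sub)
  qed
  moreover have "(%a. \<lambda>b\<in>B. k a b mod int p) ` A \<subseteq> (\<Pi>\<^sub>E b\<in>B. {0..<int p})" using p by auto
  moreover have "finite (\<Pi>\<^sub>E b\<in>B. {0..<int p})" using fin by (intro finite_PiE) auto
  ultimately show "finite A" using inj_on_finite by blast
  \<comment> \<open>Roots of unity turn the pairing modulo \<open>p\<close> into characters of both
    groups.\<close>
  define e where "e a b = cis (2 * pi * (of_int (k a b) / of_nat p))" for a b
  have econg: "cis (2 * pi * (of_int i / of_nat p)) = cis (2 * pi * (of_int j / of_nat p))" if ij: "int p dvd i - j" for i j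
  proof -
    obtain t where "i - j = int p * t" using ij by blast
    then have "i = j + int p * t" by simp
    then have "real_of_int i / real p = of_int j / real p + of_int t" using p by (simp add: field_simps)
    then have "cis (2 * pi * (of_int i / of_nat p)) = cis (2 * pi * (of_int j / of_nat p) + 2 * pi * of_int t)"
      by (simp add: algebra_simps)
    then show ?thesis by (simp flip: cis_mult)
  qed
  have e1: "e (a \<otimes> a') b = e a b * e a' b" if "a \<in> A" "a' \<in> A" "b \<in> B" for a a' b
    using econg[OF k1[OF that]] by (simp add: e_def cis_mult add_divide_distrib distrib_left)
  have e2: "e a (b \<otimes> b') = e a b * e a b'" if "a \<in> A" "b \<in> B" "b' \<in> B" for a b b'
    using econg[OF k2[OF that]] by (simp add: e_def cis_mult add_divide_distrib distrib_left)
  have e0: "e a b \<noteq> 0" for a b by (simp add: e_def)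
  have one: "e a \<one> = 1" if "a \<in> A" for a
    using e2[OF that, of \<one> \<one>] e0[of a \<one>] B by (simp add: sub)
  have onel: "e \<one> b = 1" if "b \<in> B" for b
    using e1[of \<one> \<one> b] e0[of \<one> b] that A by (simp add: sub)
  have dvd: "int p dvd k a b" if "e a b = 1" for a b
  proof -
    have "cos (2 * pi * (of_int (k a b) / of_nat p)) = 1" using arg_cong[OF that, of Re] by (simp add: e_def)
    then obtain n :: int where "2 * pi * (of_int (k a b) / of_nat p) = of_int n * 2 * pi"
      using cos_one_2pi_int by blast
    then have "real_of_int (k a b) = of_int (int p * n)" using p by (simp add: field_simps)
    then have "k a b = int p * n" by (simp only: of_int_eq_iff)
    then show ?thesis by simp
  qed
  have triv: "(\<forall>b\<in>B. e a b = 1) \<longleftrightarrow> a = \<one>" if "a \<in> A" for a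
    using nondeg[OF that] dvd onel by blast
  have "(\<Sum>a\<in>A. \<Sum>b\<in>B. e a b) = (\<Sum>a\<in>A. if a = \<one> then of_nat (card B) else 0)"
  proof (intro sum.cong refl)
    fix a assume a: "a \<in> A"
    have "(\<Sum>b\<in>B. e a b) = (if \<forall>b\<in>B. e a b = 1 then of_nat (card B) else 0)"
      by (rule character_sum[OF B]) (rule e2[OF a])
    then show "(\<Sum>b\<in>B. e a b) = (if a = \<one> then of_nat (card B) else 0)" unfolding triv[OF a] .
  qed
  also have "\<dots> = of_nat (card B)" using \<open>finite A\<close> A by (simp add: sub)
  finally have 1: "(\<Sum>a\<in>A. \<Sum>b\<in>B. e a b) = of_nat (card B)" .
  let ?r = "{b \<in> B. \<forall>a\<in>A. e a b = 1}"
  have "(\<Sum>a\<in>A. \<Sum>b\<in>B. e a b) = (\<Sum>b\<in>B. \<Sum>a\<in>A. e a b)" by (rule sum.swap)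
  also have "\<dots> = (\<Sum>b\<in>B. if \<forall>a\<in>A. e a b = 1 then of_nat (card A) else 0)"
    by (intro sum.cong refl character_sum[OF A]) (rule e1)
  also have "\<dots> = (\<Sum>b\<in>?r. of_nat (card A))" by (rule sum.inter_filter[OF fin, symmetric])
  also have "\<dots> = of_nat (card ?r * card A)" by simp
  finally have "of_nat (card B) = (of_nat (card ?r * card A) :: complex)" using 1 by simp
  then have "card B = card ?r * card A" by (simp only: of_nat_eq_iff)
  moreover have "\<one> \<in> ?r" using B one by (simp add: sub)
  then have "card ?r \<noteq> 0" using fin by (subst card_0_eq) auto
  ultimately show "card A \<le> card B" using mult_le_mono1[of 1 "card ?r" "card A"] by simp
qed

lemma hclass_one:
  assumes "rcycle 0 1 X {} z"
  shows "homologous_rel_set 1 X {} z = \<one>\<^bsub>homology_group 1 X\<^esub> \<longleftrightarrow> rbound 0 1 X {} z"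
  using one_relative_homology_group[of 1 X "{}"] by (simp add: homologous_rel_set_eq_relboundary rbound_zero)

lemma hclass_mult:
  assumes "rcycle 0 1 X {} z" "rcycle 0 1 X {} w"
  shows "homologous_rel_set 1 X {} z \<otimes>\<^bsub>homology_group 1 X\<^esub> homologous_rel_set 1 X {} w = homologous_rel_set 1 X {} (z + w)"
  using relhom_class_add[of 1 X "{}" z w] assms by (simp add: rcycle_zero)

section \<open>The two kernels as a dual pair\<close>

locale bisected_class = bisected M m0 W f "int p" a C D + linking_class M m0 p \<mu>
  for M :: "'a topology" and m0 and W :: "'b topology" and f and p :: nat and a C D \<mu>
begin

lemma swap_class: "bisected_class M m0 W f p a D C \<mu>"
  using swap mu by (intro_locales) (auto simp: bisected_def bisected_axioms_def)

abbreviation "A \<equiv> region_kernel M W f (C \<union> N)"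
abbreviation "B \<equiv> region_kernel M W f (D \<union> N)"

lemma kernel_iff: "x \<in> A \<longleftrightarrow> (\<exists>z. x = cls z \<and> rcycle 0 1 M {} z \<and> rbound 0 1 WX {} (chain_map 1 f z))"
proof -
  have "hom_induced 1 M {} WX {} f (cls z) = \<one>\<^bsub>homology_group 1 WX\<^esub> \<longleftrightarrow> rbound 0 1 WX {} (chain_map 1 f z)"
    if z: "rcycle 0 1 M {} z" for z
    using hom_induced_chain_map[OF f_WX _ z[unfolded rcycle_zero], of "{}"] hclass_one[OF f_cycle[OF z]] by simp
  then show ?thesis unfolding region_kernel_def kernel_def carrier_homology_1 by blast
qed

lemma triple_cup_vanishes_kernel: "triple_cup_vanishes M \<mu> p A" unfolding triple_cup_vanishes_def
proof (intro ballI)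
  have mem: "\<phi> \<in> (\<Pi>\<^sub>E s\<in>S1. {0..int p - 1}) \<and> cocyc (int p) 1 M \<phi> \<and>
      (\<forall>w. rcycle 0 1 M {} w --> rbound 0 1 WX {} (chain_map 1 f w) --> int p dvd ev \<phi> w)"
    if x: "\<xi> \<in> linking_dual M \<mu> p ` A" and \<phi>: "\<phi> \<in> \<xi>" for \<xi> \<phi>
  proof -
    obtain z where z: "rcycle 0 1 M {} z" "rbound 0 1 WX {} (chain_map 1 f z)" and \<xi>: "\<xi> = linking_dual M \<mu> p (cls z)"
      using x kernel_iff by auto
    obtain \<zeta> where \<zeta>: "links z \<zeta>" by (rule linking_functional[OF z(1)])
    note m = linking_dual_member[OF z(1) \<zeta> \<phi>[unfolded \<xi>]]
    have "int p dvd ev \<phi> w" if w: "rcycle 0 1 M {} w" "rbound 0 1 WX {} (chain_map 1 f w)" for w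
      using m(3)[OF w(1)] links_vanishes[OF z \<zeta> w] by (simp add: dvd_diff_left_iff)
    then show "\<phi> \<in> (\<Pi>\<^sub>E s\<in>S1. {0..int p - 1}) \<and> cocyc (int p) 1 M \<phi> \<and>
      (\<forall>w. rcycle 0 1 M {} w --> rbound 0 1 WX {} (chain_map 1 f w) --> int p dvd ev \<phi> w)" using m(1,2) by blast
  qed
  have ne: "\<exists>\<phi>. \<phi> \<in> \<xi>" if x: "\<xi> \<in> linking_dual M \<mu> p ` A" for \<xi>
  proof -
    obtain z where z: "rcycle 0 1 M {} z" and \<xi>: "\<xi> = linking_dual M \<mu> p (cls z)"
      using x kernel_iff by auto
    obtain \<zeta> where \<zeta>: "links z \<zeta>" by (rule linking_functional[OF z])
    show ?thesis using linking_dual_nonempty[OF z \<zeta>] \<xi> by simp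
  qed
  fix u v w assume uvw: "u \<in> linking_dual M \<mu> p ` A" "v \<in> linking_dual M \<mu> p ` A" "w \<in> linking_dual M \<mu> p ` A"
  obtain \<phi>1 \<phi>2 \<phi>3 where "\<phi>1 \<in> u" "\<phi>2 \<in> v" "\<phi>3 \<in> w" using ne[OF uvw(1)] ne[OF uvw(2)] ne[OF uvw(3)] by blast
  then show "triple_cup M \<mu> p u v w = \<zero>\<^bsub>F\<^esub>"
  proof (rule triple_cup_eq_0[rotated])
    fix \<phi>1 \<phi>2 \<phi>3 c assume *: "\<phi>1 \<in> u" "\<phi>2 \<in> v" "\<phi>3 \<in> w" "c \<in> \<mu>"
    show "int p dvd ev (cup 2 1 (cup 1 1 \<phi>1 \<phi>2) \<phi>3) c"
    proof (rule triple_product_vanishes)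
      show "rbound 0 3 M {} (c - m0)" using mu_cycle[OF *(4)] by blast
      show "cocyc (int p) 1 M x" if "x \<in> {\<phi>1, \<phi>2, \<phi>3}" for x using that mem uvw * by blast
      show "int p dvd ev x z" if "x \<in> {\<phi>1, \<phi>2, \<phi>3}" "rcycle 0 1 M {} z" "rbound 0 1 WX {} (chain_map 1 f z)" for x z
        using that mem uvw * by blast
    qed
  next
    fix \<xi> \<phi> assume "\<xi> \<in> {u, v, w}" "\<phi> \<in> \<xi>"
    then show "\<phi> \<in> (\<Pi>\<^sub>E s\<in>S1. {0..int p - 1}) \<and> cocyc (int p) 1 M \<phi>" using mem uvw by blast
  qed
qed

abbreviation "G \<equiv> homology_group 1 M"

definition "pairing x y = kappa p (linking_form M \<mu> p x y)"

lemma pairing_eq: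
  assumes "rcycle 0 1 M {} z" "rcycle 0 1 M {} u" "links z \<zeta>"
  shows "pairing (cls z) (cls u) = ev \<zeta> u mod int p"
  unfolding pairing_def linking_form_eq[OF assms] kappa_eq[OF p_gt(2)] ..

lemma pairing_add_right:
  assumes z: "rcycle 0 1 M {} z" and u: "rcycle 0 1 M {} u" "rcycle 0 1 M {} v"
  shows "int p dvd pairing (cls z) (cls (u + v)) - (pairing (cls z) (cls u) + pairing (cls z) (cls v))"
proof -
  obtain \<zeta> where \<zeta>: "links z \<zeta>" by (rule linking_functional[OF z])
  show ?thesis
    unfolding pairing_eq[OF z rcycle_add[OF u] \<zeta>] pairing_eq[OF z u(1) \<zeta>] pairing_eq[OF z u(2) \<zeta>]
    by (simp add: ev_add mod_simps flip: mod_eq_dvd_iff)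
qed

text \<open>The representing cochains are chosen separately for each class and need not add up. They
  are compared through one dual cocycle \<open>\<beta>\<close> of \<open>u\<close>, evaluated on
  \<open>E\<close>, \<open>E'\<close> and their sum.\<close>

lemma pairing_add_left:
  assumes z: "rcycle 0 1 M {} z" "rcycle 0 1 M {} z'" and u: "rcycle 0 1 M {} u"
  shows "int p dvd pairing (cls (z + z')) (cls u) - (pairing (cls z) (cls u) + pairing (cls z') (cls u))"
proof -
  note zz = rcycle_add[OF z]
  obtain \<zeta> where \<zeta>: "links z \<zeta>" by (rule linking_functional[OF z(1)])
  obtain \<zeta>' where \<zeta>': "links z' \<zeta>'" by (rule linking_functional[OF z(2)])
  obtain \<eta> where \<eta>: "links (z + z') \<eta>" by (rule linking_functional[OF zz])
  obtain E where E: "schain 2 M E" "bdry 2 E = cmul (int p) z" using multiple_bounds[OF z(1)] by blast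
  obtain E' where E': "schain 2 M E'" "bdry 2 E' = cmul (int p) z'" using multiple_bounds[OF z(2)] by blast
  have EE: "schain 2 M (E + E')" "bdry 2 (E + E') = cmul (int p) (z + z')"
    using E E' by (simp_all add: singular_chain_add chain_boundary_add frag_cmul_distrib2)
  obtain \<beta> m1 where \<beta>: "cocyc 0 2 M \<beta>" and m1: "rcycle 0 3 M {} m1" "rbound 0 3 M {} (m1 - m0)"
    and zd: "rbound 0 1 M {} (u - cap 2 1 m1 \<beta>)" by (rule Poincare_dual_exists[OF u])
  let ?c = "cap 2 1 m1 \<beta>"
  have 1: "int p dvd ev \<beta> E - ev \<zeta> ?c" using \<zeta> z(1) E \<beta> m1 unfolding links_def by simp
  have 2: "int p dvd ev \<beta> E' - ev \<zeta>' ?c" using \<zeta>' z(2) E' \<beta> m1 unfolding links_def by simp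
  have 3: "int p dvd ev \<beta> (E + E') - ev \<eta> ?c" using \<eta> zz EE \<beta> m1 unfolding links_def by simp
  have uc: "int p dvd ev \<phi> u - ev \<phi> ?c" if "links w \<phi>" for w \<phi>
    using that ev_rbound[OF _ rbound_dvd[OF zd], of "int p" \<phi>] by (simp add: links_def ev_diff)
  have "int p dvd (ev \<eta> u - ev \<eta> ?c) - (ev \<zeta> u - ev \<zeta> ?c) - (ev \<zeta>' u - ev \<zeta>' ?c)
      - (ev \<beta> (E + E') - ev \<eta> ?c) + (ev \<beta> E - ev \<zeta> ?c) + (ev \<beta> E' - ev \<zeta>' ?c)"
    by (intro dvd_add dvd_diff uc[OF \<eta>] uc[OF \<zeta>] uc[OF \<zeta>'] 1 2 3)
  then have "int p dvd ev \<eta> u - (ev \<zeta> u + ev \<zeta>' u)" by (simp add: ev_add algebra_simps)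
  then show ?thesis unfolding pairing_eq[OF zz u \<eta>] pairing_eq[OF z(1) u \<zeta>] pairing_eq[OF z(2) u \<zeta>']
    by (simp add: mod_simps flip: mod_eq_dvd_iff)
qed

lemma subgroup_kernel: "subgroup A G"
proof -
  have "group_hom G (homology_group 1 WX) (hom_induced 1 M {} WX {} f)"
    by (simp add: group_hom_def group_hom_axioms_def hom_induced_hom)
  then show ?thesis unfolding region_kernel_def by (rule group_hom.subgroup_kernel)
qed

lemma isotropic:
  assumes "x \<in> A" "y \<in> A" shows "linking_form M \<mu> p x y = \<one>\<^bsub>rat_mod_int\<^esub>"
proof -
  obtain z where z: "x = cls z" "rcycle 0 1 M {} z" "rbound 0 1 WX {} (chain_map 1 f z)" using assms kernel_iff by blast
  obtain u where u: "y = cls u" "rcycle 0 1 M {} u" "rbound 0 1 WX {} (chain_map 1 f u)" using assms kernel_iff by blast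
  obtain \<zeta> where \<zeta>: "links z \<zeta>" by (rule linking_functional[OF z(2)])
  have "int p dvd ev \<zeta> u - 0" using links_vanishes[OF z(2,3) \<zeta> u(2,3)] by simp
  then have "rat_class (of_int (ev \<zeta> u) / of_nat p) = rat_class (of_int 0 / of_nat p)"
    using rat_class_fraction_eq[OF p_gt(2)] by blast
  then show ?thesis unfolding z(1) u(1) linking_form_eq[OF z(2) u(2) \<zeta>] one_rat_mod_int by simp
qed

text \<open>Nondegeneracy: an element of \<open>A\<close> that pairs trivially with \<open>B\<close>
  also does so with \<open>A\<close> by isotropy, hence with all classes, these being sums from both
  kernels; \<open>linking_functional\<close> then makes it zero.\<close>

lemma card_kernel_le:
  assumes "finite B" shows "finite A" "card A \<le> card B"
proof -
  interpret sw: bisected_class M m0 W f p a D C \<mu> by (rule swap_class)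
  interpret G: group G by simp
  have nondeg: "x = \<one>\<^bsub>G\<^esub>" if x: "x \<in> A" and van: "!!y. y \<in> B ==> int p dvd pairing x y" for x
  proof -
    obtain z where z: "x = cls z" "rcycle 0 1 M {} z" "rbound 0 1 WX {} (chain_map 1 f z)" using x kernel_iff by blast
    obtain \<zeta> where \<zeta>: "links z \<zeta>" "(\<forall>u. rcycle 0 1 M {} u --> int p dvd ev \<zeta> u) --> rbound 0 1 M {} z"
      by (rule linking_functional[OF z(2)]) blast
    have "rbound 0 1 M {} z"
    proof (intro \<zeta>(2)[rule_format])
      fix u assume "rcycle 0 1 M {} u"
      then obtain v w where v: "rcycle 0 1 M {} v" "rbound 0 1 WX {} (chain_map 1 f v)"
        and w: "rcycle 0 1 M {} w" "rbound 0 1 WY {} (chain_map 1 f w)" and vw: "rbound 0 1 M {} (u - (v + w))"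
        by (rule decompose_cycles)
      have 1: "int p dvd ev \<zeta> v" by (rule links_vanishes[OF z(2,3) \<zeta>(1) v])
      have "cls w \<in> B" using w sw.kernel_iff by blast
      then have 2: "int p dvd ev \<zeta> w" using van[of "cls w"] unfolding z(1) pairing_eq[OF z(2) w(1) \<zeta>(1)] by (simp add: dvd_mod_iff)
      have "int p dvd ev \<zeta> (u - (v + w))"
        using \<zeta>(1) by (intro ev_rbound[OF _ rbound_dvd[OF vw]]) (auto simp: links_def)
      from dvd_add[OF this dvd_add[OF 1 2]] show "int p dvd ev \<zeta> u" by (simp add: ev_diff ev_add)
    qed
    then show ?thesis unfolding z(1) hclass_one[OF z(2)] .
  qed
  have "finite A \<and> card A \<le> card B"
  proof (intro conjI G.pairing_card_le[OF subgroup_kernel sw.subgroup_kernel p_gt(2) assms, of pairing] nondeg; (assumption | blast)?)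
    show "int p dvd pairing (x \<otimes>\<^bsub>G\<^esub> x') y - (pairing x y + pairing x' y)" if "x \<in> A" "x' \<in> A" "y \<in> B" for x x' y
      using that pairing_add_left unfolding kernel_iff sw.kernel_iff by (auto simp: hclass_mult)
    show "int p dvd pairing x (y \<otimes>\<^bsub>G\<^esub> y') - (pairing x y + pairing x y')" if "x \<in> A" "y \<in> B" "y' \<in> B" for x y y'
      using that pairing_add_right unfolding kernel_iff sw.kernel_iff by (auto simp: hclass_mult)
    show "int p dvd pairing (x \<otimes>\<^bsub>G\<^esub> x') y - (pairing x y + pairing x' y)" if "x \<in> A" "x' \<in> A" "y \<in> B" for x x' y
      using that pairing_add_left unfolding kernel_iff sw.kernel_iff by (auto simp: hclass_mult)
    show "int p dvd pairing x (y \<otimes>\<^bsub>G\<^esub> y') - (pairing x y + pairing x y')" if "x \<in> A" "y \<in> B" "y' \<in> B" for x y y'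
      using that pairing_add_right unfolding kernel_iff sw.kernel_iff by (auto simp: hclass_mult)
  qed
  then show "finite A" "card A \<le> card B" by blast+
qed

lemma kernels_intersect: "A \<inter> B = {\<one>\<^bsub>G\<^esub>}"
proof -
  interpret sw: bisected_class M m0 W f p a D C \<mu> by (rule swap_class)
  have "x = \<one>\<^bsub>G\<^esub>" if x: "x \<in> A" "x \<in> B" for x
  proof -
    obtain z where z: "x = cls z" "rcycle 0 1 M {} z" "rbound 0 1 WX {} (chain_map 1 f z)" using x kernel_iff by blast
    obtain u where u: "x = cls u" "rcycle 0 1 M {} u" "rbound 0 1 WY {} (chain_map 1 f u)" using x sw.kernel_iff by blast
    have "rbound 0 1 M {} (z - u)" using z(1) u(1) hclass_eq by metis
    then have "rbound 0 1 WY {} (chain_map 1 f (z - u))" by (rule sw.f_bound)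
    from rbound_add[OF this u(3)] have "rbound 0 1 WY {} (chain_map 1 f z)" by (simp add: chain_map_diff)
    from kernels_trivial[OF z(2,3) this] show ?thesis unfolding z(1) hclass_one[OF z(2)] .
  qed
  moreover have "\<one>\<^bsub>G\<^esub> \<in> A" "\<one>\<^bsub>G\<^esub> \<in> B"
    using subgroup.one_closed[OF subgroup_kernel] subgroup.one_closed[OF sw.subgroup_kernel] by auto
  ultimately show ?thesis by blast
qed

lemma kernels_span: "A <#>\<^bsub>G\<^esub> B = carrier G"
proof
  interpret sw: bisected_class M m0 W f p a D C \<mu> by (rule swap_class)
  interpret G: group G by simp
  show "A <#>\<^bsub>G\<^esub> B \<subseteq> carrier G"
    by (rule G.setmult_subset_G) (use subgroup.subset[OF subgroup_kernel] subgroup.subset[OF sw.subgroup_kernel] in auto)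
  show "carrier G \<subseteq> A <#>\<^bsub>G\<^esub> B"
  proof
    fix u assume "u \<in> carrier G"
    then obtain z where z: "rcycle 0 1 M {} z" "u = cls z" using carrier_homology_1 by blast
    obtain v w where v: "rcycle 0 1 M {} v" "rbound 0 1 WX {} (chain_map 1 f v)"
      and w: "rcycle 0 1 M {} w" "rbound 0 1 WY {} (chain_map 1 f w)" and vw: "rbound 0 1 M {} (z - (v + w))"
      by (rule decompose_cycles[OF z(1)])
    have "u = cls v \<otimes>\<^bsub>G\<^esub> cls w" unfolding hclass_mult[OF v(1) w(1)] z(2) using vw hclass_eq by blast
    moreover have "cls v \<in> A" "cls w \<in> B" using v w kernel_iff sw.kernel_iff by blast+
    ultimately show "u \<in> A <#>\<^bsub>G\<^esub> B" unfolding set_mult_def by blast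
  qed
qed

lemma card_kernels: "card A = card B" "(card A)\<^sup>2 = order G"
proof -
  interpret sw: bisected_class M m0 W f p a D C \<mu> by (rule swap_class)
  interpret G: group G by simp
  interpret SA: subgroup A G by (rule subgroup_kernel)
  interpret SB: subgroup B G by (rule sw.subgroup_kernel)
  show AB: "card A = card B"
  proof (cases "finite B")
    case True
    show ?thesis using card_kernel_le[OF True] sw.card_kernel_le[OF card_kernel_le(1)[OF True]] by simp
  next
    case False
    \<comment> \<open>Infinite sets have \<open>card\<close> zero, so the equality holds here
      too.\<close>
    then have "infinite A" using sw.card_kernel_le(1) by blast
    then show ?thesis using False by simp
  qed
  have "inj_on (%(x, y). x \<otimes>\<^bsub>G\<^esub> y) (A \<times> B)"
  proof (rule inj_onI, clarify)
    fix x y x' y' assume *: "x \<in> A" "y \<in> B" "x' \<in> A" "y' \<in> B" "x \<otimes>\<^bsub>G\<^esub> y = x' \<otimes>\<^bsub>G\<^esub> y'"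
    have c: "x \<in> carrier G" "y \<in> carrier G" "x' \<in> carrier G" "y' \<in> carrier G" using * by auto
    have "inv\<^bsub>G\<^esub> x' \<otimes>\<^bsub>G\<^esub> x = inv\<^bsub>G\<^esub> x' \<otimes>\<^bsub>G\<^esub> (x \<otimes>\<^bsub>G\<^esub> y) \<otimes>\<^bsub>G\<^esub> inv\<^bsub>G\<^esub> y"
      using c by (simp add: G.m_assoc)
    also have "\<dots> = y' \<otimes>\<^bsub>G\<^esub> inv\<^bsub>G\<^esub> y" unfolding *(5) using c by (simp flip: G.m_assoc)
    finally have e: "inv\<^bsub>G\<^esub> x' \<otimes>\<^bsub>G\<^esub> x = y' \<otimes>\<^bsub>G\<^esub> inv\<^bsub>G\<^esub> y" .
    have "inv\<^bsub>G\<^esub> x' \<otimes>\<^bsub>G\<^esub> x \<in> A" using * by simp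
    moreover have "inv\<^bsub>G\<^esub> x' \<otimes>\<^bsub>G\<^esub> x \<in> B" unfolding e using * by simp
    ultimately have 1: "inv\<^bsub>G\<^esub> x' \<otimes>\<^bsub>G\<^esub> x = \<one>\<^bsub>G\<^esub>" using kernels_intersect by blast
    have "x = x' \<otimes>\<^bsub>G\<^esub> (inv\<^bsub>G\<^esub> x' \<otimes>\<^bsub>G\<^esub> x)" using c by (simp flip: G.m_assoc)
    also have "\<dots> = x'" unfolding 1 using c by simp
    finally have "x = x'" .
    moreover have "y' = (y' \<otimes>\<^bsub>G\<^esub> inv\<^bsub>G\<^esub> y) \<otimes>\<^bsub>G\<^esub> y" using c by (simp add: G.m_assoc)
    then have "y' = y" unfolding e[symmetric] 1 using c by simp
    ultimately show "x = x' \<and> y = y'" by simp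
  qed
  moreover have "(%(x, y). x \<otimes>\<^bsub>G\<^esub> y) ` (A \<times> B) = carrier G"
    unfolding kernels_span[symmetric] set_mult_def by force
  ultimately have "card (carrier G) = card (A \<times> B)" using card_image by metis
  then show "(card A)\<^sup>2 = order G" using AB by (simp add: order_def card_cartesian_product power2_eq_square)
qed

theorem dual_pair: "dual_hantzsche_pair M \<mu> p A B"
proof -
  interpret sw: bisected_class M m0 W f p a D C \<mu> by (rule swap_class)
  show ?thesis unfolding dual_hantzsche_pair_def hantzsche_lagrangian_def
    using subgroup_kernel sw.subgroup_kernel isotropic sw.isotropic card_kernels sw.card_kernels
      kernels_intersect kernels_span by auto
qed

end

section \<open>Rational homology\<close>

text \<open>A path stays in one component, so the indicator of a component is a 0-cocycle; it
  separates points of different components in homology.\<close>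

lemma path_component_functional:
  assumes c: "schain 1 X c"
  shows "ev (%t. if path_component_of X v (t vertex0) then 1 else 0) (bdry 1 c) = 0"
proof -
  let ?\<phi> = "%t. if path_component_of X v (t vertex0) then 1 else 0 :: int"
  have "cobdry 0 ?\<phi> s = 0" if s: "singular_simplex 1 X s" for s
  proof -
    let ?S = "s ` Simplex 1"
    have "continuous_map (subtopology (powertop_real UNIV) (Simplex 1)) X s"
      using s by (simp add: singular_simplex_def)
    moreover have "path_connectedin (subtopology (powertop_real UNIV) (Simplex 1)) (Simplex 1)"
      by (simp add: path_connectedin_subtopology path_connectedin_standard_simplex)
    ultimately have pc: "path_connectedin X ?S" using path_connectedin_continuous_map_image by blast
    have "singular_simplex 1 (subtopology X ?S) s" using s by (simp add: singular_simplex_subtopology)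
    then have "singular_simplex 0 (subtopology X ?S) (singular_face 1 i s)" if "i \<le> 1" for i
      using singular_simplex_singular_face[of 1 "subtopology X ?S" s i] that by (simp add: One_nat_def)
    then have "singular_simplex 0 (subtopology X ?S) (singular_face 1 0 s)"
      "singular_simplex 0 (subtopology X ?S) (singular_face 1 1 s)" by simp_all
    from this[THEN singular_simplex_0_in]
    have "singular_face 1 0 s vertex0 \<in> ?S" "singular_face 1 1 s vertex0 \<in> ?S" by simp_all
    then have "path_component_of X (singular_face 1 0 s vertex0) (singular_face 1 1 s vertex0)"
      using path_component_of_maximal[OF pc, of "singular_face 1 0 s vertex0"] by blast
    then have "path_component_of X v (singular_face 1 0 s vertex0) \<longleftrightarrow> path_component_of X v (singular_face 1 1 s vertex0)"
      by (intro iffI) (erule path_component_of_trans, assumption, erule path_component_of_trans, erule path_component_of_sym)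
    then show ?thesis unfolding cobdry_def by (simp add: chain_boundary_of ev_diff One_nat_def)
  qed
  then have "ev (cobdry 0 ?\<phi>) c = ev (%_. 0) c" using c by (intro ev_cong) (auto simp: singular_chain_def)
  also have "ev (%_. 0) c = 0" by (simp add: ev_def)
  finally show ?thesis by (simp only: ev_cobdry One_nat_def)
qed

text \<open>The difference of two points has augmentation zero, hence bounds by the triviality of
  reduced homology; the indicator of a path component then puts both points into one
  component.\<close>

lemma path_connected_nsphere:
  assumes "n > 0" shows "path_connected_space (nsphere n)" unfolding path_connected_space_iff_path_component
proof (intro ballI)
  fix v w assume vw: "v \<in> topspace (nsphere n)" "w \<in> topspace (nsphere n)"
  let ?X = "nsphere n" and ?P = "discrete_topology {()}"
  let ?q = "frag_of (point_simplex v) - frag_of (point_simplex w)"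
  have qc: "singular_relcycle 0 ?X {} ?q" using singular_point_simplex[OF vw(1)] singular_point_simplex[OF vw(2)]
    by (simp add: singular_cycle singular_chain_diff singular_chain_of chain_boundary_def)
  let ?u = "homologous_rel_set 0 ?X {} ?q"
  have "hom_induced 0 ?X {} ?P {} (%x. ()) ?u = homologous_rel_set 0 ?P {} (chain_map 0 (%x. ()) ?q)"
    using hom_induced_chain_map[of ?X ?P "%x. ()" "{}" "{}" 0 ?q] qc by simp
  also have "chain_map 0 (%x. ()) ?q = 0" by (simp add: chain_map_diff simplex_map_def point_simplex_def o_def)
  also have "homologous_rel_set 0 ?P {} 0 = \<one>\<^bsub>homology_group 0 ?P\<^esub>"
    using one_relative_homology_group[of 0 ?P "{}"] by (simp add: homologous_rel_set_eq_relboundary)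
  finally have 1: "hom_induced 0 ?X {} ?P {} (%x. ()) ?u = \<one>\<^bsub>homology_group 0 ?P\<^esub>" .
  have "?u \<in> carrier (homology_group 0 ?X)" using qc by (auto simp: carrier_relative_homology_group_0)
  then have "?u \<in> carrier (reduced_homology_group 0 ?X)"
    unfolding carrier_reduced_homology_group using 1 by (simp add: kernel_def)
  moreover have "trivial_group (reduced_homology_group 0 ?X)"
    using assms trivial_reduced_homology_group_nsphere[of 0 n] by simp
  ultimately have "?u = \<one>\<^bsub>homology_group 0 ?X\<^esub>"
    by (simp add: trivial_group_def reduced_homology_group_def)
  then have "singular_relboundary 0 ?X {} ?q"
    using one_relative_homology_group[of 0 ?X "{}"] by (simp add: homologous_rel_set_eq_relboundary)
  then obtain c where "schain 1 ?X c" "bdry 1 c = ?q" by (auto simp: singular_boundary One_nat_def)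
  then have "ev (%t. if path_component_of ?X v (t vertex0) then 1 else 0) ?q = 0"
    using path_component_functional by metis
  then show "path_component_of ?X v w" using vw by (auto simp: ev_diff path_component_of_refl split: if_splits)
qed

lemma abelian_group_rat_ring: "abelian_group rat_ring"
  by (rule abelian_groupI) (auto simp: rat_ring_def intro: exI[of _ "- x" for x])

interpretation rat_ring: abelian_group rat_ring by (rule abelian_group_rat_ring)

lemma rat_ring_simps: "carrier rat_ring = UNIV" "\<zero>\<^bsub>rat_ring\<^esub> = 0" "x \<oplus>\<^bsub>rat_ring\<^esub> y = x + y"
  by (simp_all add: rat_ring_def)

lemma finsum_rat_ring: "finite A ==> finsum rat_ring f A = sum f A"
proof (induction A rule: finite_induct)
  case (insert x F)
  then show ?case by (simp add: rat_ring.finsum_insert Pi_iff rat_ring_simps)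
qed (simp add: rat_ring_simps)

lemma a_inv_rat_ring: "\<ominus>\<^bsub>rat_ring\<^esub> x = - x"
  using rat_ring.minus_equality[of "- x" x] by (simp add: rat_ring_def)

lemma add_pow_rat_ring: "[k] \<cdot>\<^bsub>rat_ring\<^esub> x = of_int k * x" for k :: int
proof -
  have n: "[n] \<cdot>\<^bsub>rat_ring\<^esub> x = of_nat n * x" for n :: nat
    by (induction n) (auto simp: add_pow_def nat_pow_def rat_ring_def algebra_simps)
  show ?thesis
  proof (cases "k \<ge> 0")
    case True
    then show ?thesis by (simp add: add_pow_int_ge n)
  next
    case False
    then show ?thesis by (simp add: add_pow_int_lt n a_inv_rat_ring)
  qed
qed

section \<open>Rational chains with a common denominator\<close>

text \<open>A rational chain is stored as an integral chain over one denominator, so that relations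
  over the rationals become integral ones after clearing denominators.\<close>

definition rat_chain :: "nat => 'a topology => int => 'a chain => ((nat => real) => 'a) => rat" where
  "rat_chain k X N z = (\<lambda>s\<in>singular_simplex_set k X. of_int (wt z s) / of_int N)"

abbreviation "rat_chains \<equiv> coeff_chain_group rat_ring"

lemma carrier_rat_chains: "carrier (rat_chains k X) =
    {x \<in> extensional (singular_simplex_set k X). finite {s \<in> singular_simplex_set k X. x s \<noteq> 0}}"
  unfolding coeff_chain_group_def
  by (subst carrier_sum_group, rule rat_ring.a_group) (auto simp: rat_ring_simps PiE_iff)

lemma comm_group_rat_chains: "comm_group (rat_chains k X)"
proof (rule group.group_comm_groupI)
  show "group (rat_chains k X)" unfolding coeff_chain_group_def by (rule sum_group, rule rat_ring.a_group)
qed (auto simp: coeff_chain_group_def rat_ring_def add.commute)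

lemma rat_chain_carrier:
  assumes "schain k X z" shows "rat_chain k X N z \<in> carrier (rat_chains k X)"
proof -
  have "{s \<in> singular_simplex_set k X. rat_chain k X N z s \<noteq> 0} \<subseteq> supp z"
    by (auto simp: rat_chain_def in_keys_iff)
  then have "finite {s \<in> singular_simplex_set k X. rat_chain k X N z s \<noteq> 0}" by (rule finite_subset) simp
  moreover have "rat_chain k X N z \<in> extensional (singular_simplex_set k X)" by (simp add: rat_chain_def)
  ultimately show ?thesis by (simp add: carrier_rat_chains)
qed

lemma rat_chain_exists:
  assumes "x \<in> carrier (rat_chains k X)"
  obtains N z where "N \<noteq> 0" "schain k X z" "x = rat_chain k X N z"
proof -
  define T where "T = {s \<in> singular_simplex_set k X. x s \<noteq> 0}"
  have T: "finite T" "T \<subseteq> singular_simplex_set k X" and ext: "x \<in> extensional (singular_simplex_set k X)"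
    using assms by (auto simp: carrier_rat_chains T_def)
  have "\<exists>N. N \<noteq> 0 \<and> (\<forall>s\<in>T. \<exists>a. of_int N * x s = of_int a)" using T(1)
  proof (induction T rule: finite_induct)
    case (insert s T)
    then obtain N where N: "N \<noteq> 0" "\<forall>s\<in>T. \<exists>a. of_int N * x s = of_int a" by blast
    obtain a b where q: "quotient_of (x s) = (a, b)" by fastforce
    have ab: "x s = of_int a / of_int b" "b \<noteq> 0"
      using quotient_of_div[OF q] quotient_of_denom_pos[OF q] by simp_all
    have "\<exists>a. of_int (b * N) * x t = of_int a" if t: "t \<in> insert s T" for t
    proof (cases "t = s")
      case True
      then have "of_int (b * N) * x t = of_int (N * a)" using ab by simp
      then show ?thesis by blast
    next
      case False
      then obtain a' where "of_int N * x t = of_int a'" using N(2) t by blast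
      then have "of_int (b * N) * x t = of_int (b * a')" by (simp add: mult.assoc)
      then show ?thesis by blast
    qed
    then show ?case using N(1) ab(2) by (intro exI[of _ "b * N"]) simp
  qed (auto intro: exI[of _ 1])
  then obtain N where N0: "N \<noteq> 0" "\<forall>s\<in>T. \<exists>a. of_int N * x s = of_int a"
    by (elim exE conjE) (rule that)
  from bchoice[OF N0(2)] obtain a where a: "\<forall>s\<in>T. of_int N * x s = of_int (a s)" ..
  note N = N0(1) a[rule_format]
  define z where "z = (\<Sum>s\<in>T. cmul (a s) (frag_of s))"
  have lz: "wt z s = (if s \<in> T then a s else 0)" for s
    unfolding z_def lookup_sum using T(1) by (simp add: lookup_frag_of if_distrib sum.delta sum.delta' cong: if_cong)
  show thesis
  proof (rule that[OF N(1)])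
    show "schain k X z" unfolding z_def
      using T(2) by (intro singular_chain_sum singular_chain_cmul) (auto simp: singular_chain_of)
    show "x = rat_chain k X N z"
    proof
      fix s show "x s = rat_chain k X N z s"
        using N ext by (cases "s \<in> T") (auto simp: rat_chain_def lz T_def field_simps extensional_def)
    qed
  qed
qed

lemma rat_chain_eq_iff:
  assumes N: "N \<noteq> 0" "N' \<noteq> 0" and z: "schain k X z" "schain k X z'"
  shows "rat_chain k X N z = rat_chain k X N' z' \<longleftrightarrow> cmul N' z = cmul N z'"
proof -
  have "rat_chain k X N z = rat_chain k X N' z' \<longleftrightarrow> (\<forall>s. singular_simplex k X s -->
      (of_int (N' * wt z s) :: rat) = of_int (N * wt z' s))"
    using N by (auto simp: rat_chain_def fun_eq_iff restrict_def field_simps)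
  also have "\<dots> \<longleftrightarrow> (\<forall>s. singular_simplex k X s --> N' * wt z s = N * wt z' s)"
    by (simp only: of_int_eq_iff)
  also have "\<dots> \<longleftrightarrow> (\<forall>s. N' * wt z s = N * wt z' s)"
  proof -
    have "wt z s = 0 \<and> wt z' s = 0" if "\<not> singular_simplex k X s" for s
      using z that by (auto simp: singular_chain_def in_keys_iff subset_iff)
    then show ?thesis by (metis mult_zero_right)
  qed
  also have "\<dots> \<longleftrightarrow> cmul N' z = cmul N z'" by (simp add: poly_mapping_eq_iff fun_eq_iff)
  finally show ?thesis .
qed

lemma rat_chain_mult:
  assumes "N \<noteq> 0" "N' \<noteq> 0"
  shows "rat_chain k X N z \<otimes>\<^bsub>rat_chains k X\<^esub> rat_chain k X N' z' = rat_chain k X (N * N') (cmul N' z + cmul N z')"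
  using assms by (auto simp: coeff_chain_group_def rat_chain_def rat_ring_def lookup_add field_simps intro!: restrict_ext)

lemma one_rat_chains: "\<one>\<^bsub>rat_chains k X\<^esub> = rat_chain k X 1 0"
  by (simp add: coeff_chain_group_def rat_chain_def rat_ring_def)

lemma rat_chain_boundary:
  assumes z: "schain n X z" and N: "N \<noteq> 0"
  shows "coeff_boundary rat_ring n X (rat_chain n X N z) = rat_chain (n - 1) X N (bdry n z)"
proof -
  have S: "{s \<in> singular_simplex_set n X. rat_chain n X N z s \<noteq> \<zero>\<^bsub>rat_ring\<^esub>} = supp z"
    using z N by (auto simp: rat_chain_def rat_ring_def in_keys_iff singular_chain_def)
  have "(\<Oplus>\<^bsub>rat_ring\<^esub>s\<in>supp z. [wt (bdry n (frag_of s)) t] \<cdot>\<^bsub>rat_ring\<^esub> rat_chain n X N z s)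
      = of_int (wt (bdry n z) t) / of_int N" for t
  proof -
    have "bdry n (frag_extend frag_of z) = frag_extend (%s. bdry n (frag_of s)) z"
      by (rule additive_extend) (rule chain_boundary_diff)
    then have "bdry n z = frag_extend (%s. bdry n (frag_of s)) z" unfolding frag_expansion[symmetric] .
    then have "wt (bdry n z) t =
        (\<Sum>s\<in>supp z. wt z s * wt (bdry n (frag_of s)) t)" by (simp add: frag_extend_def lookup_sum)
    moreover have "s \<in> singular_simplex_set n X" if "s \<in> supp z" for s
      using z that by (auto simp: singular_chain_def)
    ultimately show ?thesis
      by (simp add: finsum_rat_ring add_pow_rat_ring rat_chain_def sum_divide_distrib mult.commute cong: sum.cong)
  qed
  then show ?thesis unfolding coeff_boundary_def S by (simp add: rat_chain_def)
qed

lemma coeff_boundary_hom: "group_hom (rat_chains n X) (rat_chains (n - 1) X) (coeff_boundary rat_ring n X)"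
proof -
  have b: "schain (n - 1) X (bdry n z)" if "schain n X z" for z
    using singular_chain_boundary[OF that] by (simp add: One_nat_def)
  have "coeff_boundary rat_ring n X \<in> hom (rat_chains n X) (rat_chains (n - 1) X)"
  proof (rule homI)
    fix x assume "x \<in> carrier (rat_chains n X)"
    then obtain N z where x: "N \<noteq> 0" "schain n X z" "x = rat_chain n X N z" by (rule rat_chain_exists)
    show "coeff_boundary rat_ring n X x \<in> carrier (rat_chains (n - 1) X)"
      unfolding x(3) rat_chain_boundary[OF x(2,1)] by (intro rat_chain_carrier b x)
    fix y assume "y \<in> carrier (rat_chains n X)"
    then obtain N' z' where y: "N' \<noteq> 0" "schain n X z'" "y = rat_chain n X N' z'" by (rule rat_chain_exists)
    show "coeff_boundary rat_ring n X (x \<otimes>\<^bsub>rat_chains n X\<^esub> y) =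
        coeff_boundary rat_ring n X x \<otimes>\<^bsub>rat_chains (n - 1) X\<^esub> coeff_boundary rat_ring n X y"
      using x y by (simp add: rat_chain_mult rat_chain_boundary singular_chain_add singular_chain_cmul
          chain_boundary_add chain_boundary_cmul)
  qed
  then show ?thesis by (intro group_hom.intro group_hom_axioms.intro comm_group.axioms(2) comm_group_rat_chains)
qed

abbreviation "rat_boundaries n X \<equiv> coeff_boundary rat_ring (Suc n) X ` carrier (rat_chains (Suc n) X)"

abbreviation "rat_class_of n X N z \<equiv> rat_boundaries n X #>\<^bsub>rat_chains n X\<^esub> rat_chain n X N z"

lemma subgroup_rat_boundaries: "subgroup (rat_boundaries n X) (rat_chains n X)"
  using group_hom.img_is_subgroup[OF coeff_boundary_hom[of "Suc n" X]] by simp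

lemma rat_boundaries_iff: "y \<in> rat_boundaries n X \<longleftrightarrow>
    (\<exists>M b. M \<noteq> 0 \<and> schain (Suc n) X b \<and> y = rat_chain n X M (bdry (Suc n) b))"
proof
  assume "y \<in> rat_boundaries n X"
  then obtain x where x: "x \<in> carrier (rat_chains (Suc n) X)" "y = coeff_boundary rat_ring (Suc n) X x" by blast
  obtain N z where z: "N \<noteq> 0" "schain (Suc n) X z" "x = rat_chain (Suc n) X N z" by (rule rat_chain_exists[OF x(1)])
  then show "\<exists>M b. M \<noteq> 0 \<and> schain (Suc n) X b \<and> y = rat_chain n X M (bdry (Suc n) b)"
    using rat_chain_boundary[OF z(2,1)] x(2) by auto
next
  assume "\<exists>M b. M \<noteq> 0 \<and> schain (Suc n) X b \<and> y = rat_chain n X M (bdry (Suc n) b)"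
  then obtain M b where b: "M \<noteq> 0" "schain (Suc n) X b" "y = rat_chain n X M (bdry (Suc n) b)" by blast
  then have "y = coeff_boundary rat_ring (Suc n) X (rat_chain (Suc n) X M b)" using rat_chain_boundary[OF b(2,1)] by simp
  then show "y \<in> rat_boundaries n X" using rat_chain_carrier[OF b(2)] by blast
qed

lemma carrier_rat_homology:
  "x \<in> carrier (coeff_homology_group rat_ring n X) \<longleftrightarrow>
     (\<exists>N z. N \<noteq> 0 \<and> rcycle 0 n X {} z \<and> x = rat_class_of n X N z)"
proof -
  let ?K = "kernel (rat_chains n X) (rat_chains (n - 1) X) (coeff_boundary rat_ring n X)"
  have sub: "subgroup ?K (rat_chains n X)" by (rule group_hom.subgroup_kernel[OF coeff_boundary_hom])
  have K: "y \<in> ?K \<longleftrightarrow> (\<exists>N z. N \<noteq> 0 \<and> rcycle 0 n X {} z \<and> y = rat_chain n X N z)" for y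
  proof -
    have iff: "rat_chain n X N z \<in> ?K \<longleftrightarrow> rcycle 0 n X {} z" if z: "schain n X z" "N \<noteq> 0" for N z
    proof -
      have "schain (n - 1) X (bdry n z)" using singular_chain_boundary[OF z(1)] by (simp add: One_nat_def)
      then have "rat_chain (n - 1) X N (bdry n z) = rat_chain (n - 1) X 1 0 \<longleftrightarrow> bdry n z = 0"
        using z(2) by (subst rat_chain_eq_iff) auto
      then show ?thesis using z rat_chain_carrier[OF z(1), of N]
        by (simp add: kernel_def rat_chain_boundary one_rat_chains rcycle_empty_zero)
    qed
    show ?thesis
    proof
      assume y: "y \<in> ?K"
      then have "y \<in> carrier (rat_chains n X)" by (simp add: kernel_def)
      then obtain N z where z: "N \<noteq> 0" "schain n X z" "y = rat_chain n X N z" by (rule rat_chain_exists)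
      then show "\<exists>N z. N \<noteq> 0 \<and> rcycle 0 n X {} z \<and> y = rat_chain n X N z" using iff[OF z(2,1)] y by (intro exI conjI) auto
    next
      assume "\<exists>N z. N \<noteq> 0 \<and> rcycle 0 n X {} z \<and> y = rat_chain n X N z"
      then obtain N z where z: "N \<noteq> 0" "rcycle 0 n X {} z" "y = rat_chain n X N z" by (elim exE conjE) (rule that)
      then show "y \<in> ?K" using iff[OF rcycle_chain[OF z(2)] z(1)] by simp
    qed
  qed
  have "carrier (coeff_homology_group rat_ring n X) = (%y. rat_boundaries n X #>\<^bsub>rat_chains n X\<^esub> y) ` ?K"
    unfolding coeff_homology_group_def FactGroup_def RCOSETS_def r_coset_def
    by (simp add: subgroup.carrier_subgroup_generated_subgroup[OF sub] UNION_singleton_eq_range)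
  then have "x \<in> carrier (coeff_homology_group rat_ring n X) \<longleftrightarrow>
      (\<exists>y. (\<exists>N z. N \<noteq> 0 \<and> rcycle 0 n X {} z \<and> y = rat_chain n X N z) \<and> x = rat_boundaries n X #>\<^bsub>rat_chains n X\<^esub> y)"
    by (simp only: image_iff Bex_def K)
  then show ?thesis by blast
qed

lemma rat_class_mult:
  assumes "N \<noteq> 0" "N' \<noteq> 0" "schain n X z" "schain n X z'"
  shows "rat_class_of n X N z \<otimes>\<^bsub>coeff_homology_group rat_ring n X\<^esub> rat_class_of n X N' z' =
    rat_class_of n X (N * N') (cmul N' z + cmul N z')"
proof -
  have "normal (rat_boundaries n X) (rat_chains n X)"
    using comm_group.normal_iff_subgroup[OF comm_group_rat_chains] subgroup_rat_boundaries by blast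
  from normal.rcos_sum[OF this rat_chain_carrier[OF assms(3)] rat_chain_carrier[OF assms(4)]]
  show ?thesis by (simp add: coeff_homology_group_def FactGroup_def set_mult_def rat_chain_mult assms)
qed

lemma rat_class_eqD:
  assumes N: "N \<noteq> 0" "N' \<noteq> 0" and z: "schain n X z" "schain n X z'"
    and eq: "rat_class_of n X N z = rat_class_of n X N' z'"
  obtains j b where "j \<noteq> 0" "schain (Suc n) X b"
    "bdry (Suc n) b = cmul j (cmul N' z - cmul N z')"
proof -
  interpret comm_group "rat_chains n X" by (rule comm_group_rat_chains)
  have "rat_chain n X N z \<in> rat_class_of n X N' z'"
    using rcos_self[OF rat_chain_carrier[OF z(1), of N] subgroup_rat_boundaries] unfolding eq .
  then obtain y where y: "y \<in> rat_boundaries n X" "rat_chain n X N z = y \<otimes>\<^bsub>rat_chains n X\<^esub> rat_chain n X N' z'"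
    unfolding r_coset_def by blast
  then obtain M b where M: "M \<noteq> 0" "schain (Suc n) X b"
    "rat_chain n X N z = rat_chain n X M (bdry (Suc n) b) \<otimes>\<^bsub>rat_chains n X\<^esub> rat_chain n X N' z'"
    using y(1)[unfolded rat_boundaries_iff] by (elim exE conjE) simp
  have cb: "schain n X (bdry (Suc n) b)" using singular_chain_boundary[OF M(2)] by simp
  have "cmul (M * N') z = cmul N (cmul N' (bdry (Suc n) b) + cmul M z')"
    using M(3) rat_chain_eq_iff[OF N(1) _ z(1), of "M * N'"] N M(1) cb z(2)
    by (simp add: rat_chain_mult singular_chain_add singular_chain_cmul)
  then have "bdry (Suc n) (cmul (N * N') b) = cmul M (cmul N' z - cmul N z')"
    by (simp add: chain_boundary_cmul frag_cmul_diff frag_cmul_distrib2 mult.commute)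
  then show thesis using that M(1) singular_chain_cmul[OF M(2)] by blast
qed

lemma rat_class_eqI:
  assumes N: "N \<noteq> 0" "N' \<noteq> 0" and z: "schain n X z" "schain n X z'"
    and j: "j \<noteq> 0" "schain (Suc n) X b" "bdry (Suc n) b = cmul j (cmul N' z - cmul N z')"
  shows "rat_class_of n X N z = rat_class_of n X N' z'"
proof -
  interpret comm_group "rat_chains n X" by (rule comm_group_rat_chains)
  have cb: "schain n X (bdry (Suc n) b)" using singular_chain_boundary[OF j(2)] by simp
  let ?M = "j * N * N'"
  have "cmul (?M * N') z = cmul N (cmul N' (bdry (Suc n) b) + cmul ?M z')"
    unfolding j(3) by (simp add: frag_cmul_diff frag_cmul_distrib2 mult_ac)
  then have "rat_chain n X N z = rat_chain n X ?M (bdry (Suc n) b) \<otimes>\<^bsub>rat_chains n X\<^esub> rat_chain n X N' z'"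
    using rat_chain_eq_iff[OF N(1) _ z(1), of "?M * N'"] N j(1) cb z(2)
    by (simp add: rat_chain_mult singular_chain_add singular_chain_cmul)
  moreover have "rat_chain n X ?M (bdry (Suc n) b) \<in> rat_boundaries n X"
    unfolding rat_boundaries_iff using N j(1,2) by (intro exI conjI) auto
  ultimately have "rat_chain n X N z \<in> rat_class_of n X N' z'" by (auto simp: r_coset_def)
  from repr_independence[OF this rat_chain_carrier[OF z(2)] subgroup_rat_boundaries]
  show ?thesis by simp
qed

lemma nsphere_cycle_bounds:
  assumes "k > 0" "k \<noteq> n" "rcycle 0 k (nsphere n) {} z" shows "rbound 0 k (nsphere n) {} z"
proof -
  have "trivial_group (homology_group (int k) (nsphere n))"
    using trivial_reduced_homology_group_nsphere[of "int k" n] assms(1,2) by (simp add: un_reduced_homology_group)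
  then show ?thesis using relhom_trivialD assms(3) by (metis rbound_zero rcycle_zero)
qed

lemma rat_class_carrier: "rcycle 0 k X {} z ==> rat_class_of k X 1 z \<in> carrier (coeff_homology_group rat_ring k X)"
  unfolding carrier_rat_homology by (intro exI conjI, rule one_neq_zero, assumption, rule refl)

text \<open>The sphere has no homology in these degrees, so the rational class of \<open>z\<close>
  is zero; clearing denominators shows that a nonzero multiple of \<open>z\<close> bounds.\<close>

lemma rational_torsion:
  assumes iso: "coeff_homology_group rat_ring k X \<cong> coeff_homology_group rat_ring k (nsphere n)"
    and k: "k > 0" "k \<noteq> n" and z: "rcycle 0 k X {} z"
  shows "\<exists>j. j \<noteq> 0 \<and> rbound 0 k X {} (cmul j z)"
proof -
  let ?G = "coeff_homology_group rat_ring k X" and ?H = "coeff_homology_group rat_ring k (nsphere n)"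
  obtain h where h: "h \<in> iso ?G ?H" using iso unfolding is_iso_def by blast
  have hc: "inj_on h (carrier ?G)" "h ` carrier ?G = carrier ?H" using h by (auto simp: iso_def bij_betw_def)
  have triv: "y = rat_class_of k (nsphere n) 1 0" if y: "y \<in> carrier ?H" for y
  proof -
    obtain N z where z: "N \<noteq> 0" "rcycle 0 k (nsphere n) {} z" "y = rat_class_of k (nsphere n) N z"
      using y[unfolded carrier_rat_homology] by (elim exE conjE) (rule that)
    obtain b where b: "schain (Suc k) (nsphere n) b" "bdry (Suc k) b = z"
      using nsphere_cycle_bounds[OF k z(2)] unfolding homologous_zero_iff by blast
    show ?thesis unfolding z(3)
      by (rule rat_class_eqI[OF z(1) _ rcycle_chain[OF z(2)] _ _ b(1), of _ _ 1]) (simp_all add: b(2))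
  qed
  have G: "rat_class_of k X 1 z \<in> carrier ?G" "rat_class_of k X 1 0 \<in> carrier ?G"
    using z by (auto intro!: rat_class_carrier simp: rcycle_empty_zero)
  then have "h (rat_class_of k X 1 z) \<in> carrier ?H" "h (rat_class_of k X 1 0) \<in> carrier ?H" using hc(2) by blast+
  then have "h (rat_class_of k X 1 z) = h (rat_class_of k X 1 0)" using triv by metis
  then have "rat_class_of k X 1 z = rat_class_of k X 1 0" using hc(1) G by (simp add: inj_on_eq_iff)
  then obtain j b where "j \<noteq> 0" "schain (Suc k) X b"
    "bdry (Suc k) b = cmul j (cmul 1 z - cmul 1 0)"
    by (rule rat_class_eqD[rotated 4]) (use rcycle_chain[OF z] in auto)
  then show ?thesis unfolding homologous_zero_iff by auto
qed

text \<open>The isomorphism is one of groups, so multiples are treated as repeated sums; starting at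
  one avoids neutral elements.\<close>

lemma rat_iso_multiples:
  assumes h: "h \<in> iso (coeff_homology_group rat_ring n X) (coeff_homology_group rat_ring n Y)"
    and c: "rcycle 0 n X {} c" and N: "N \<noteq> 0" and z: "schain n Y z"
    and hc: "h (rat_class_of n X 1 c) = rat_class_of n Y N z"
  shows "h (rat_class_of n X 1 (cmul (int (Suc u)) c)) = rat_class_of n Y N (cmul (int (Suc u)) z)"
proof (induction u)
  case 0
  then show ?case using hc by simp
next
  case (Suc u)
  let ?G = "coeff_homology_group rat_ring n X" and ?H = "coeff_homology_group rat_ring n Y"
  let ?a = "cmul (int (Suc u)) c" and ?b = "cmul (int (Suc u)) z"
  have car: "rat_class_of n X 1 ?a \<in> carrier ?G" "rat_class_of n X 1 c \<in> carrier ?G"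
    by (intro rat_class_carrier rcycle_scale c)+
  have "rat_class_of n X 1 (cmul (int (Suc (Suc u))) c) = rat_class_of n X 1 ?a \<otimes>\<^bsub>?G\<^esub> rat_class_of n X 1 c"
  proof -
    have e: "cmul (int (Suc (Suc u))) c = cmul 1 ?a + cmul 1 c"
      by (rule poly_mapping_eqI) (simp add: lookup_add algebra_simps)
    show ?thesis unfolding e
      using rat_class_mult[of 1 1 n X ?a c] rcycle_chain[OF c] by (simp add: singular_chain_cmul del: of_nat_Suc)
  qed
  then have "h (rat_class_of n X 1 (cmul (int (Suc (Suc u))) c)) = h (rat_class_of n X 1 ?a) \<otimes>\<^bsub>?H\<^esub> h (rat_class_of n X 1 c)"
    using h car by (simp add: iso_def hom_mult)
  also have "\<dots> = rat_class_of n Y (N * N) (cmul N ?b + cmul N z)"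
    unfolding Suc hc using N z by (intro rat_class_mult) (simp_all add: singular_chain_cmul)
  also have "\<dots> = rat_class_of n Y N (cmul (int (Suc (Suc u))) z)"
  proof (rule rat_class_eqI[where j = 1 and b = 0])
    show "bdry (Suc n) 0 = cmul 1 (cmul N (cmul N ?b + cmul N z) -
        cmul (N * N) (cmul (int (Suc (Suc u))) z))"
      by (rule poly_mapping_eqI) (simp add: lookup_add lookup_minus algebra_simps)
  qed (use N z in \<open>auto intro: singular_chain_add singular_chain_cmul\<close>)
  finally show ?case .
qed

text \<open>In \<open>H\<^sub>0\<close> of a path-connected space any two rational classes satisfy a linear relation, written here with
  positive coefficients on both sides; the classes of points in distinct path components satisfy none.\<close>

lemma rational_path_connected:
  assumes iso: "coeff_homology_group rat_ring 0 X \<cong> coeff_homology_group rat_ring 0 (nsphere n)" and n: "n > 0"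
  shows "path_connected_space X" unfolding path_connected_space_iff_path_component
proof (intro ballI, rule ccontr)
  fix v w assume v: "v \<in> topspace X" and w: "w \<in> topspace X" and vw: "\<not> path_component_of X v w"
  let ?S = "nsphere n"
  let ?G = "coeff_homology_group rat_ring 0 X" and ?H = "coeff_homology_group rat_ring 0 ?S"
  let ?v = "frag_of (point_simplex v)" and ?w = "frag_of (point_simplex w)"
  have c0: "rcycle 0 0 Y {} c" if "schain 0 Y c" for Y :: "'c topology" and c
    using that by (simp add: rcycle_empty_zero chain_boundary_def)
  have vc: "rcycle 0 0 X {} ?v" and wc: "rcycle 0 0 X {} ?w"
    using singular_point_simplex[OF v] singular_point_simplex[OF w] by (simp_all add: c0 singular_chain_of)
  obtain h where h: "h \<in> iso ?G ?H" using iso unfolding is_iso_def by blast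
  have hc: "inj_on h (carrier ?G)" "h ` carrier ?G = carrier ?H" using h by (auto simp: iso_def bij_betw_def)
  have car: "rat_class_of 0 X 1 c \<in> carrier ?G" if "rcycle 0 0 X {} c" for c by (rule rat_class_carrier[OF that])
  have "h (rat_class_of 0 X 1 ?v) \<in> carrier ?H" "h (rat_class_of 0 X 1 ?w) \<in> carrier ?H"
    using car[OF vc] car[OF wc] hc(2) by blast+
  then obtain N z N' z' where N: "N \<noteq> 0" and z: "rcycle 0 0 ?S {} z" and hv: "h (rat_class_of 0 X 1 ?v) = rat_class_of 0 ?S N z"
    and N': "N' \<noteq> 0" and z': "rcycle 0 0 ?S {} z'" and hw: "h (rat_class_of 0 X 1 ?w) = rat_class_of 0 ?S N' z'"
    unfolding carrier_rat_homology by (elim exE conjE) (rule that)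
  obtain q where q: "q \<in> topspace ?S" using nonempty_nsphere[of n] null_topspace_iff_trivial[of "nsphere n"] by blast
  let ?q = "frag_of (point_simplex q)"
  obtain s where s: "schain 1 ?S s" "bdry 1 s = z - cmul (ev (%_. 1) z) ?q"
    by (rule path_connected_zero_chains[OF path_connected_nsphere[OF n] q rcycle_chain[OF z]])
  obtain s' where s': "schain 1 ?S s'" "bdry 1 s' = z' - cmul (ev (%_. 1) z') ?q"
    by (rule path_connected_zero_chains[OF path_connected_nsphere[OF n] q rcycle_chain[OF z']])
  define t where "t = ev (%_. 1) z"
  define t' where "t' = ev (%_. 1) z'"
  \<comment> \<open>A nontrivial solution of \<open>I * N' * t + J * N * t' = 0\<close>; the case
    distinction covers vanishing of both weights.\<close>
  define I where "I = (if t = 0 \<and> t' = 0 then 1 else N * t')"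
  define J where "J = (if t = 0 \<and> t' = 0 then 0 else - N' * t)"
  have IJ: "I \<noteq> 0 \<or> J \<noteq> 0" "I * N' * t + J * N * t' = 0" using N N' by (auto simp: I_def J_def)
  have comb: "rat_class_of 0 X 1 (cmul (int (Suc i)) ?v) \<otimes>\<^bsub>?G\<^esub> rat_class_of 0 X 1 (cmul (int (Suc j)) ?w) =
      rat_class_of 0 X 1 (cmul (int (Suc i)) ?v + cmul (int (Suc j)) ?w)" for i j
    using rat_class_mult[of 1 1 0 X "cmul (int (Suc i)) ?v" "cmul (int (Suc j)) ?w"]
      rcycle_chain[OF vc] rcycle_chain[OF wc] by (simp add: singular_chain_cmul del: of_nat_Suc)
  have hcomb: "h (rat_class_of 0 X 1 (cmul (int (Suc i)) ?v + cmul (int (Suc j)) ?w)) =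
      rat_class_of 0 ?S (N * N') (cmul N' (cmul (int (Suc i)) z) + cmul N (cmul (int (Suc j)) z'))" for i j
  proof -
    have "h (rat_class_of 0 X 1 (cmul (int (Suc i)) ?v + cmul (int (Suc j)) ?w)) =
        h (rat_class_of 0 X 1 (cmul (int (Suc i)) ?v)) \<otimes>\<^bsub>?H\<^esub> h (rat_class_of 0 X 1 (cmul (int (Suc j)) ?w))"
      unfolding comb[symmetric] using h by (intro hom_mult[of h ?G] car rcycle_scale vc wc) (simp add: iso_def)
    also have "\<dots> = rat_class_of 0 ?S N (cmul (int (Suc i)) z) \<otimes>\<^bsub>?H\<^esub> rat_class_of 0 ?S N' (cmul (int (Suc j)) z')"
      unfolding rat_iso_multiples[OF h vc N rcycle_chain[OF z] hv] rat_iso_multiples[OF h wc N' rcycle_chain[OF z'] hw] ..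
    finally show ?thesis
      using rat_class_mult[OF N N' singular_chain_cmul[OF rcycle_chain[OF z]] singular_chain_cmul[OF rcycle_chain[OF z']]] by simp
  qed
  let ?e = "%i j. cmul (int (Suc i)) ?v + cmul (int (Suc j)) ?w"
  let ?f = "%i j. cmul N' (cmul (int (Suc i)) z) + cmul N (cmul (int (Suc j)) z')"
  have fc: "schain 0 ?S (?f i j)" for i j
    using rcycle_chain[OF z] rcycle_chain[OF z'] by (intro singular_chain_add singular_chain_cmul)
  have ec: "rcycle 0 0 X {} (?e i j)" for i j by (intro rcycle_add rcycle_scale vc wc)
  \<comment> \<open>Each coefficient is a difference of two positive integers, matching the positive
    multiples treated above.\<close>
  have dI: "int (Suc (nat I)) = int (Suc (nat (- I))) + I" "int (Suc (nat J)) = int (Suc (nat (- J))) + J" by linarith+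
  have "rat_class_of 0 ?S (N * N') (?f (nat I) (nat J)) = rat_class_of 0 ?S (N * N') (?f (nat (- I)) (nat (- J)))"
  proof (rule rat_class_eqI[where j = 1 and b = "cmul (N * N') (cmul (I * N') s + cmul (J * N) s')"])
    have "bdry (Suc 0) (cmul (N * N') (cmul (I * N') s + cmul (J * N) s')) =
        cmul (N * N') (cmul (I * N') z + cmul (J * N) z' - cmul (I * N' * t + J * N * t') ?q)"
      unfolding One_nat_def[symmetric] chain_boundary_cmul chain_boundary_add s(2) s'(2) t_def[symmetric] t'_def[symmetric]
      by (rule poly_mapping_eqI) (simp add: lookup_add lookup_minus algebra_simps)
    also have "\<dots> = cmul (N * N') (cmul (I * N') z + cmul (J * N) z')" unfolding IJ(2) by simp
    also have "\<dots> = cmul 1 (cmul (N * N') (?f (nat I) (nat J)) - cmul (N * N') (?f (nat (- I)) (nat (- J))))"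
      unfolding dI by (rule poly_mapping_eqI) (simp add: lookup_add lookup_minus algebra_simps)
    finally show "bdry (Suc 0) (cmul (N * N') (cmul (I * N') s + cmul (J * N) s')) =
      cmul 1 (cmul (N * N') (?f (nat I) (nat J)) - cmul (N * N') (?f (nat (- I)) (nat (- J))))" .
    show "schain (Suc 0) ?S (cmul (N * N') (cmul (I * N') s + cmul (J * N) s'))"
      using s(1) s'(1) by (intro singular_chain_add singular_chain_cmul) (simp_all add: One_nat_def)
  qed (rule fc | (use N N' in \<open>simp\<close>))+
  then have "h (rat_class_of 0 X 1 (?e (nat I) (nat J))) = h (rat_class_of 0 X 1 (?e (nat (- I)) (nat (- J))))"
    unfolding hcomb .
  then have "rat_class_of 0 X 1 (?e (nat I) (nat J)) = rat_class_of 0 X 1 (?e (nat (- I)) (nat (- J)))"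
    using hc(1) car[OF ec] by (simp only: inj_on_eq_iff)
  then obtain j b where j: "j \<noteq> 0" "schain (Suc 0) X b"
    "bdry (Suc 0) b = cmul j (cmul 1 (?e (nat I) (nat J)) - cmul 1 (?e (nat (- I)) (nat (- J))))"
    by (rule rat_class_eqD[OF one_neq_zero one_neq_zero rcycle_chain[OF ec] rcycle_chain[OF ec]])
  have "bdry 1 b = cmul j (cmul I ?v + cmul J ?w)"
    using j(3) unfolding dI One_nat_def by (simp add: frag_cmul_distrib algebra_simps)
  then have E: "ev (%\<tau>. if path_component_of X x (\<tau> vertex0) then 1 else 0) (cmul j (cmul I ?v + cmul J ?w)) = 0" for x
    using path_component_functional[of X b x] j(2) by (simp add: One_nat_def)
  have nw: "\<not> path_component_of X w v" using vw path_component_of_sym by metis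
  have "I = 0" using E[of v] vw j(1) v by (simp add: ev_add path_component_of_refl)
  moreover have "J = 0" using E[of w] j(1) w nw by (simp add: ev_add path_component_of_refl)
  ultimately show False using IJ(1) by simp
qed

section \<open>From the hypotheses of the theorem to chains\<close>

lemma fundamental_class_oriented:
  assumes X: "topological_manifold 3 X" and mu: "fundamental_class 3 X \<mu>"
  obtains m0 where "oriented_manifold 3 2 X m0" "\<mu> = homologous_rel_set 3 X {} m0"
proof -
  obtain m0 where m0: "rcycle 0 3 X {} m0" "\<mu> = homologous_rel_set 3 X {} m0"
    using mu carrier_relative_homology_group[of 3 X "{}"] by (auto simp: fundamental_class_def rcycle_zero)
  have "\<exists>j. rbound 0 3 X (topspace X - {x}) (c - cmul j m0)"
    if x: "x \<in> topspace X" and c: "rcycle 0 3 X (topspace X - {x}) c" for x c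
  proof -
    let ?S = "topspace X - {x}"
    let ?R = "relative_homology_group (int 3) X ?S"
    interpret R: group ?R by simp
    have rel: "singular_relcycle 3 X ?S (cmul j m0)" for j
      using rcycle_mono[OF rcycle_scale[OF m0(1)]] unfolding rcycle_zero by blast
    have m3: "schain 3 X m0" using m0(1) rcycle_chain by blast
    have y: "hom_induced (int 3) X {} X ?S id \<mu> = homologous_rel_set 3 X ?S m0"
      using hom_induced_chain_map[of X X id "{}" ?S 3 m0] m0 chain_map_id_gen[OF m3, of id] by (simp add: rcycle_zero)
    have "homologous_rel_set 3 X ?S c \<in> carrier ?R"
      using c carrier_relative_homology_group[of 3 X ?S] by (auto simp: rcycle_zero)
    moreover have "carrier (subgroup_generated ?R {hom_induced (int 3) X {} X ?S id \<mu>}) = carrier ?R"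
      using mu x unfolding fundamental_class_def by blast
    ultimately have "homologous_rel_set 3 X ?S c \<in> generate ?R (carrier ?R \<inter> {homologous_rel_set 3 X ?S m0})"
      unfolding y carrier_subgroup_generated by blast
    then have "\<exists>j. homologous_rel_set 3 X ?S c = homologous_rel_set 3 X ?S (cmul j m0)"
    proof (induction rule: generate.induct)
      case one
      have "homologous_rel_set 3 X ?S (cmul 0 m0) = \<one>\<^bsub>?R\<^esub>"
        unfolding one_relative_homology_group homologous_rel_set_eq_relboundary by simp
      then show ?case by metis
    next
      case (incl h)
      then show ?case by (auto intro: exI[of _ 1])
    next
      case (inv h)
      have "inv\<^bsub>?R\<^esub> h = homologous_rel_set 3 X ?S (cmul (- 1) m0)"
      proof (rule R.inv_equality)
        have "homologous_rel_set 3 X ?S (cmul (- 1) m0) \<otimes>\<^bsub>?R\<^esub> h = homologous_rel_set 3 X ?S (cmul (- 1) m0 + cmul 1 m0)"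
          using relhom_class_add[OF rel rel, of "-1" 1] inv by simp
        then show "homologous_rel_set 3 X ?S (cmul (- 1) m0) \<otimes>\<^bsub>?R\<^esub> h = \<one>\<^bsub>?R\<^esub>"
          using one_relative_homology_group[of 3 X ?S] by (simp add: homologous_rel_set_eq_relboundary)
      qed (use inv rel[of "-1"] carrier_relative_homology_group[of 3 X ?S] in auto)
      then show ?case by blast
    next
      case (eng h1 h2)
      then obtain i j where "h1 = homologous_rel_set 3 X ?S (cmul i m0)" "h2 = homologous_rel_set 3 X ?S (cmul j m0)"
        by blast
      then have "h1 \<otimes>\<^bsub>?R\<^esub> h2 = homologous_rel_set 3 X ?S (cmul (i + j) m0)"
        using relhom_class_add[OF rel rel, of i j] by (simp add: frag_cmul_distrib)
      then show ?case by blast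
    qed
    then show ?thesis unfolding hclass_eq .
  qed
  then have "oriented_manifold 3 2 X m0" using X m0(1) by unfold_locales auto
  then show thesis using that m0(2) by blast
qed

lemma hclass_nat_pow:
  assumes "rcycle 0 1 X {} z"
  shows "homologous_rel_set 1 X {} z [^]\<^bsub>homology_group 1 X\<^esub> (n::nat) = homologous_rel_set 1 X {} (cmul (int n) z)"
proof (induction n)
  case 0
  have "rcycle 0 1 X {} 0" by (simp add: rcycle_empty_zero)
  then show ?case using hclass_one[of X 0] by (simp add: nat_pow_def)
next
  case (Suc n)
  have "homologous_rel_set 1 X {} z [^]\<^bsub>homology_group 1 X\<^esub> Suc n =
      homologous_rel_set 1 X {} z [^]\<^bsub>homology_group 1 X\<^esub> n \<otimes>\<^bsub>homology_group 1 X\<^esub> homologous_rel_set 1 X {} z"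
    by (simp add: nat_pow_def)
  also have "\<dots> = homologous_rel_set 1 X {} (cmul (int n) z + z)"
    unfolding Suc by (rule hclass_mult[OF rcycle_scale[OF assms] assms])
  finally show ?case by (simp add: frag_cmul_distrib add.commute)
qed

theorem linking_class_exists:
  assumes p: "prime p" and M: "rational_homology_sphere 3 M" and mu: "fundamental_class 3 M \<mu>"
    and exponent: "has_exponent (homology_group 1 M) p"
  obtains m0 where "linking_class M m0 p \<mu>" "topspace M \<noteq> {}" "compact_space M"
proof -
  have mM: "topological_manifold 3 M" "compact_space M" using M by (auto simp: rational_homology_sphere_def closed_manifold_def)
  have iso: "coeff_homology_group rat_ring k M \<cong> coeff_homology_group rat_ring k (nsphere 3)" for k
    using M by (simp add: rational_homology_sphere_def)
  obtain m0 where om: "oriented_manifold 3 2 M m0" "\<mu> = homologous_rel_set 3 M {} m0"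
    by (rule fundamental_class_oriented[OF mM(1) mu])
  interpret oriented_manifold 3 2 M m0 by (rule om(1))
  have "linking_class M m0 p \<mu>"
  proof unfold_locales
    show "prime (int p)" using p by simp
    show "path_connected_space M" by (rule rational_path_connected[OF iso]) simp
    show "rbound 0 1 M {} (cmul (int p) z)" if z: "rcycle 0 1 M {} z" for z
    proof -
      have "homologous_rel_set 1 M {} z \<in> carrier (homology_group 1 M)" using z carrier_homology_1 by blast
      then have "homologous_rel_set 1 M {} z [^]\<^bsub>homology_group 1 M\<^esub> p = \<one>\<^bsub>homology_group 1 M\<^esub>"
        using exponent by (simp add: has_exponent_def)
      then show ?thesis unfolding hclass_nat_pow[OF z] using hclass_one[OF rcycle_scale[OF z]] by blast
    qed
    show "\<exists>n. n \<noteq> 0 \<and> rbound 0 2 M {} (cmul n z)" if "rcycle 0 2 M {} z" for z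
      by (rule rational_torsion[OF iso _ _ that]) auto
  qed (rule om(2))
  \<comment> \<open>An empty space has trivial homology, whose exponent is one and not a
    prime.\<close>
  moreover have "topspace M \<noteq> {}"
  proof
    assume e: "topspace M = {}"
    have "x [^]\<^bsub>homology_group 1 M\<^esub> (1::nat) = \<one>\<^bsub>homology_group 1 M\<^esub>" if x: "x \<in> carrier (homology_group 1 M)" for x
    proof -
      obtain z where z: "rcycle 0 1 M {} z" "x = homologous_rel_set 1 M {} z" using x carrier_homology_1 by blast
      have "z = 0" using rcycle_chain[OF z(1)] e singular_chain_empty by blast
      then show ?thesis unfolding z(2) hclass_nat_pow[OF z(1)] using z(1) by (subst hclass_one) (auto simp: rcycle_empty_zero)
    qed
    then have "0 < (1::nat) \<and> (\<forall>x\<in>carrier (homology_group 1 M). x [^]\<^bsub>homology_group 1 M\<^esub> (1::nat) = \<one>\<^bsub>homology_group 1 M\<^esub>)"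
      by blast
    then have "p \<le> 1"
      by (rule exponent[unfolded has_exponent_def, THEN conjunct2, THEN conjunct2, THEN spec, THEN mp])
    then show False using prime_gt_1_nat[OF p] by simp
  qed
  ultimately show thesis using that mM(2) by blast
qed

section \<open>The sphere as a closed manifold, and homology spheres\<close>

lemma topspace_nsphere_iff: "x \<in> topspace (nsphere n) \<longleftrightarrow> (\<Sum>i\<le>n. (x i)\<^sup>2) = 1 \<and> (\<forall>i>n. x i = 0)"
  by (auto simp: nsphere)

text \<open>Stereographic projection from the poles \<open>x\<^sub>n = s\<close>, \<open>s = \<plusminus>1\<close>.\<close>

lemma nsphere_stereographic:
  fixes s :: real and n :: nat
  assumes s: "s\<^sup>2 = 1"
  defines "U \<equiv> {x \<in> topspace (nsphere n). s * x n \<noteq> 1}"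
  shows "openin (nsphere n) U" "subtopology (nsphere n) U homeomorphic_space Eucl n"
proof -
  show op: "openin (nsphere n) U"
  proof -
    have "continuous_map (nsphere n) euclideanreal (%x. s * x n)"
      by (intro continuous_intros continuous_map_nsphere_projection)
    moreover have "openin euclideanreal (- {1})" by (simp add: open_Compl)
    ultimately have "openin (nsphere n) {x \<in> topspace (nsphere n). s * x n \<in> - {1}}"
      by (rule openin_continuous_map_preimage)
    then show ?thesis by (simp add: U_def)
  qed
  define h where "h x = (%i. if i < n then x i / (1 - s * x n) else 0)" for x :: "nat => real"
  define q where "q y = (\<Sum>i<n. (y i)\<^sup>2)" for y :: "nat => real"
  \<comment> \<open>As \<open>q y\<close> grows, the last coordinate tends to \<open>s\<close>, the
    pole that is left out.\<close>
  define g where "g y = (%i. if i < n then 2 * y i / (q y + 1) else if i = n then s * (q y - 1) / (q y + 1) else 0)" for y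
  have q0: "q y \<ge> 0" for y unfolding q_def by (intro sum_nonneg) simp
  have qp: "q y + 1 \<noteq> 0" for y using q0[of y] by linarith
  have sphere: "x \<in> topspace (nsphere n) \<longleftrightarrow> q x + (x n)\<^sup>2 = 1 \<and> (\<forall>i>n. x i = 0)" for x
    unfolding topspace_nsphere_iff q_def by (simp flip: lessThan_Suc_atMost)
  have Usub: "U \<subseteq> topspace (nsphere n)" by (auto simp: U_def)
  have qg: "q (g y) = 4 * q y / (q y + 1)\<^sup>2" for y
  proof -
    have "q (g y) = (\<Sum>i<n. 4 * (y i)\<^sup>2 / (q y + 1)\<^sup>2)"
      unfolding q_def[of "g y"] by (intro sum.cong) (simp_all add: g_def power_divide power_mult_distrib)
    then show ?thesis by (simp add: q_def[of y] sum_distrib_left sum_divide_distrib)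
  qed
  have gS: "g y \<in> topspace (nsphere n)" for y
  proof -
    have "q (g y) + (g y n)\<^sup>2 = (4 * q y + s\<^sup>2 * (q y - 1)\<^sup>2) / (q y + 1)\<^sup>2"
      unfolding qg by (simp add: g_def power_divide power_mult_distrib add_divide_distrib)
    also have "4 * q y + s\<^sup>2 * (q y - 1)\<^sup>2 = (q y + 1)\<^sup>2" unfolding s by (simp add: power2_eq_square algebra_simps)
    finally show ?thesis using qp[of y] by (simp add: sphere g_def)
  qed
  have sg: "1 - s * g y n = 2 / (q y + 1)" for y
  proof -
    have "s * g y n = s\<^sup>2 * (q y - 1) / (q y + 1)" by (simp add: g_def power2_eq_square)
    then show ?thesis using qp[of y] unfolding s by (simp add: field_simps)
  qed
  have gU: "g y \<in> U" for y using gS[of y] sg[of y] qp[of y] by (auto simp: U_def)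
  have hg: "h (g y) = y" if y: "y \<in> EE n" for y
  proof
    fix i show "h (g y) i = y i" using y qp[of y] unfolding h_def sg by (auto simp: g_def EE_iff)
  qed
  have gh: "g (h x) = x" if x: "x \<in> U" for x
  proof -
    have xs: "q x = 1 - (x n)\<^sup>2" "!!i. i > n ==> x i = 0" "1 - s * x n \<noteq> 0"
      using x by (auto simp: U_def sphere algebra_simps)
    let ?d = "1 - s * x n"
    have "q (h x) = q x / ?d\<^sup>2" by (simp add: q_def h_def power_divide flip: sum_divide_distrib)
    also have "q x = ?d * (1 + s * x n)" using s unfolding xs(1) by (simp add: power2_eq_square algebra_simps)
    also have "?d * (1 + s * x n) / ?d\<^sup>2 = (1 + s * x n) / ?d" using xs(3) by (simp add: power2_eq_square)
    finally have qh: "q (h x) = (1 + s * x n) / ?d" .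
    have p: "q (h x) + 1 = 2 / ?d" unfolding qh using xs(3) by (simp add: field_simps)
    have m: "q (h x) - 1 = 2 * s * x n / ?d" unfolding qh using xs(3) by (simp add: field_simps)
    show ?thesis
    proof
      fix i
      consider "i < n" | "i = n" | "i > n" by linarith
      then show "g (h x) i = x i"
      proof cases
        case 1
        then show ?thesis using xs(3) by (simp add: g_def p) (simp add: h_def)
      next
        case 2
        then have "g (h x) i = s * (2 * s * x n / ?d) / (2 / ?d)" by (simp add: g_def p m)
        also have "\<dots> = s\<^sup>2 * x n" using xs(3) by (simp add: power2_eq_square)
        finally show ?thesis using 2 s by simp
      next
        case 3
        then show ?thesis using xs(2) by (simp add: g_def)
      qed
    qed
  qed
  have "continuous_map (subtopology (nsphere n) U) euclideanreal (%x. x i)" for i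
    by (intro continuous_map_from_subtopology continuous_map_nsphere_projection)
  then have "continuous_map (subtopology (nsphere n) U) euclideanreal (%x. h x i)" for i
    unfolding h_def by (cases "i < n") (auto intro!: continuous_intros simp: U_def)
  then have hc: "continuous_map (subtopology (nsphere n) U) (Eucl n) h"
    by (auto simp: Euclidean_space_def continuous_map_in_subtopology continuous_map_componentwise_UNIV h_def)
  have c: "continuous_map (Eucl n) euclideanreal (%x. x i)" for i
    unfolding Euclidean_space_def by (intro continuous_map_from_subtopology continuous_map_product_projection) simp
  then have qc: "continuous_map (Eucl n) euclideanreal q" unfolding q_def by (intro continuous_intros) auto
  have "continuous_map (Eucl n) euclideanreal (%y. g y i)" for i
    unfolding g_def using qp by (cases "i < n"; cases "i = n") (auto intro!: continuous_intros c qc)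
  then have "continuous_map (Eucl n) (powertop_real UNIV) g" by (simp add: continuous_map_componentwise_UNIV)
  then have gc: "continuous_map (Eucl n) (subtopology (nsphere n) U) g"
    using gS gU by (auto simp: nsphere subtopology_subtopology continuous_map_in_subtopology)
  have "homeomorphic_maps (subtopology (nsphere n) U) (Eucl n) h g"
    unfolding homeomorphic_maps_def using hc gc hg gh by auto
  then show "subtopology (nsphere n) U homeomorphic_space Eucl n" unfolding homeomorphic_space_def by blast
qed

lemma second_countable_powertop_real: "second_countable (powertop_real (UNIV :: nat set))"
proof -
  obtain B :: "(nat => real) set set" where B: "countable B" "topological_basis B" using ex_countable_basis by blast
  show ?thesis unfolding euclidean_product_topology second_countable_def
  proof (intro exI conjI allI impI ballI)
    show "openin euclidean V" if "V \<in> B" for V using topological_basis_open[OF B(2) that] by simp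
    fix U and x :: "nat => real" assume "openin euclidean U \<and> x \<in> U"
    then show "\<exists>V\<in>B. x \<in> V \<and> V \<subseteq> U" using topological_basisE[OF B(2)] by (metis open_openin)
  qed (rule B(1))
qed

lemma compact_nsphere: "compact_space (nsphere n)"
proof -
  let ?E = "Eucl (Suc n)"
  have c: "continuous_map ?E euclideanreal (%x. x i)" for i
    unfolding Euclidean_space_def by (intro continuous_map_from_subtopology continuous_map_product_projection) simp
  have "continuous_map ?E euclideanreal (%x. \<Sum>i\<le>n. (x i)\<^sup>2)" by (intro continuous_intros c) auto
  from closedin_continuous_map_preimage[OF this, of "{1}"]
  have cl: "closedin ?E {x \<in> topspace ?E. (\<Sum>i\<le>n. (x i)\<^sup>2) = 1}" by simp
  have "{x \<in> topspace ?E. (\<Sum>i\<le>n. (x i)\<^sup>2) = 1} \<subseteq> ccube (Suc n) (%_. 0) 1"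
  proof
    fix x assume x: "x \<in> {x \<in> topspace ?E. (\<Sum>i\<le>n. (x i)\<^sup>2) = 1}"
    have "(x i)\<^sup>2 \<le> 1" if "i \<le> n" for i
      using member_le_sum[of i "{..n}" "%i. (x i)\<^sup>2"] that x by simp
    then have "\<bar>x i\<bar> \<le> 1" if "i \<le> n" for i using that by (simp add: abs_square_le_1)
    then show "x \<in> ccube (Suc n) (%_. 0) 1" using x by (auto simp: ccube_def abs_le_iff)
  qed
  then have "compactin ?E {x \<in> topspace ?E. (\<Sum>i\<le>n. (x i)\<^sup>2) = 1}"
    using closed_compactin[OF ccube_compact _ cl] by blast
  then have "compactin ?E (topspace ?E \<inter> {x. (\<Sum>i\<le>n. (x i)\<^sup>2) = 1})" by (simp only: Int_def mem_Collect_eq)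
  then have "compact_space (subtopology ?E (topspace ?E \<inter> {x. (\<Sum>i\<le>n. (x i)\<^sup>2) = 1}))" by (rule compact_space_subtopology)
  then show ?thesis unfolding nsphere_def subtopology_restrict .
qed

lemma closed_manifold_nsphere: "closed_manifold n (nsphere n)"
proof -
  have "\<exists>U. openin (nsphere n) U \<and> x \<in> U \<and> subtopology (nsphere n) U homeomorphic_space Eucl n"
    if x: "x \<in> topspace (nsphere n)" for x
  proof (cases "x n = 1")
    case True
    then show ?thesis
      using nsphere_stereographic[of "-1" n] x by (intro exI[of _ "{x \<in> topspace (nsphere n). -1 * x n \<noteq> 1}"]) simp
  next
    case False
    then show ?thesis
      using nsphere_stereographic[of 1 n] x by (intro exI[of _ "{x \<in> topspace (nsphere n). 1 * x n \<noteq> 1}"]) simp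
  qed
  moreover have "Hausdorff_space (nsphere n)"
    unfolding nsphere_def by (intro Hausdorff_space_subtopology Hausdorff_Euclidean_space)
  moreover have "second_countable (nsphere n)"
    unfolding nsphere by (intro second_countable_subtopology second_countable_powertop_real)
  ultimately show ?thesis by (simp add: closed_manifold_def topological_manifold_def compact_nsphere)
qed

lemma closed_manifold_homeomorphic:
  assumes hom: "W homeomorphic_space Y" and Y: "closed_manifold n Y"
  shows "closed_manifold n W"
proof -
  obtain h where h: "homeomorphic_map W Y h" using hom unfolding homeomorphic_space by blast
  have "\<exists>U. openin W U \<and> x \<in> U \<and> subtopology W U homeomorphic_space Eucl n" if x: "x \<in> topspace W" for x
  proof -
    have "h x \<in> topspace Y" using h x homeomorphic_imp_surjective_map by blast
    then obtain V where V: "openin Y V" "h x \<in> V" "subtopology Y V homeomorphic_space Eucl n"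
      using Y by (auto simp: closed_manifold_def topological_manifold_def)
    let ?U = "{w \<in> topspace W. h w \<in> V}"
    have "openin W ?U" using openin_continuous_map_preimage[OF homeomorphic_imp_continuous_map[OF h] V(1)] .
    moreover have "homeomorphic_map (subtopology W ?U) (subtopology Y V) h"
      by (rule homeomorphic_map_subtopologies_alt[OF h]) simp
    then have "subtopology W ?U homeomorphic_space Eucl n"
      using V(3) homeomorphic_map_imp_homeomorphic_space homeomorphic_space_trans by blast
    ultimately show ?thesis using x V(2) by blast
  qed
  then show ?thesis
    using Y homeomorphic_Hausdorff_space[OF hom] homeomorphic_compact_space[OF hom] homeomorphic_space_second_countability[OF hom]
    by (simp add: closed_manifold_def topological_manifold_def)
qed

lemma integer_homology_sphere_homeomorphic:
  assumes "W homeomorphic_space nsphere n" shows "integer_homology_sphere n W" unfolding integer_homology_sphere_def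
  using closed_manifold_homeomorphic[OF assms closed_manifold_nsphere] homeomorphic_space_imp_isomorphic_homology_groups[OF assms] by blast

lemma homology_sphere_facts:
  assumes W: "integer_homology_sphere n W" and n: "n > 0"
  shows "connected_space W"
    and "!!k z. 0 < k ==> k \<noteq> n ==> rcycle 0 k W {} z ==> rbound 0 k W {} z"
    and "\<exists>a. rcycle 0 n W {} a \<and> (\<forall>p>1. \<not> rbound p n W {} a)"
proof -
  have iso: "homology_group k W \<cong> homology_group k (nsphere n)" for k using W by (simp add: integer_homology_sphere_def)
  have "path_connected_space W"
    using isomorphic_homology_imp_path_connectedness[OF iso[of 0]] path_connected_nsphere[OF n] by simp
  then show "connected_space W" by (rule path_connected_imp_connected_space)
  show "rbound 0 k W {} z" if k: "0 < k" "k \<noteq> n" and z: "rcycle 0 k W {} z" for k z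
  proof -
    have "trivial_group (homology_group (int k) (nsphere n))"
      using trivial_reduced_homology_group_nsphere[of "int k" n] k by (simp add: un_reduced_homology_group)
    then have "trivial_group (homology_group (int k) W)" using isomorphic_group_triviality[OF iso[of "int k"]] by simp
    then show ?thesis using relhom_trivialD z by (metis rbound_zero rcycle_zero)
  qed
  have "homology_group (int n) (nsphere n) \<cong> integer_group"
    using reduced_homology_group_nsphere(1)[of n] n by (simp add: un_reduced_homology_group)
  then have W_int: "homology_group (int n) W \<cong> integer_group" using iso iso_trans by blast
  obtain F :: "'a chain => int" and t where F:
    "!!a b. singular_relcycle n W {} a ==> singular_relcycle n W {} b ==> F (a + b) = F a + F b"
    "!!a b. singular_relcycle n W {} a ==> singular_relcycle n W {} b ==> F (a - b) = F a - F b"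
    "!!j a. singular_relcycle n W {} a ==> F (cmul j a) = j * F a"
    "!!a. singular_relcycle n W {} a ==> F a = 0 \<longleftrightarrow> singular_relboundary n W {} a"
    "singular_relcycle n W {} t" "F t = 1" by (rule relhom_integerE[OF W_int]) (assumption | rule that)+
  \<comment> \<open>A generator is not divisible by \<open>p\<close> up to boundaries: its degree
    one would be a multiple of \<open>p\<close>.\<close>
  have "\<not> rbound p n W {} t" if p: "p > 1" for p
  proof
    assume "rbound p n W {} t"
    then obtain b d where b: "schain (Suc n) W b" and d: "schain n W d"
      and t: "t = bdry (Suc n) b + cmul p d" unfolding rbound_empty_iff by (elim exE conjE) (rule that)
    have bc: "singular_relboundary n W {} (bdry (Suc n) b)" using b singular_boundary by blast
    have "bdry n t = 0" using F(5) by (simp add: singular_cycle)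
    moreover have "bdry n (bdry (Suc n) b) = 0" using chain_boundary_boundary_alt[OF b] .
    ultimately have "cmul p (bdry n d) = 0" by (simp add: t chain_boundary_add chain_boundary_cmul)
    then have dc: "singular_relcycle n W {} d" using d p by (simp add: singular_cycle)
    have "F t = F (bdry (Suc n) b) + F (cmul p d)"
      unfolding t by (intro F(1) singular_relcycle_cmul dc singular_relboundary_imp_relcycle bc)
    also have "\<dots> = p * F d" using F(3)[OF dc] F(4)[OF singular_relboundary_imp_relcycle[OF bc]] bc by simp
    finally have "p * F d = 1" using F(6) by simp
    then show False using p by (auto simp: zmult_eq_1_iff)
  qed
  then show "\<exists>a. rcycle 0 n W {} a \<and> (\<forall>p>1. \<not> rbound p n W {} a)" using F(5) unfolding rcycle_zero by blast
qed

section \<open>From locally flat embeddings to the two regions\<close>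

lemma embedded_exists:
  fixes W :: "'b topology"
  assumes lc: "linking_class M m0 p \<mu>" "topspace M \<noteq> {}" "compact_space M"
    and W: "integer_homology_sphere 4 W" and f: "locally_flat_embedding 3 M W f"
  obtains a where "embedded M m0 W f (int p) a"
proof -
  interpret linking_class M m0 p \<mu> by (rule lc(1))
  have mW: "topological_manifold 4 W" "compact_space W"
    using W by (auto simp: integer_homology_sphere_def closed_manifold_def)
  obtain a where a: "rcycle 0 4 W {} a" "\<not> rbound (int p) 4 W {} a"
    using homology_sphere_facts(3)[OF W] p_gt(1) by auto
  have emb: "embedding_map M W f" using f by (simp add: locally_flat_embedding_def)
  then have fc: "continuous_map M W f"
    using embedding_map_def homeomorphic_imp_continuous_map continuous_map_in_subtopology by blast
  have "embedded M m0 W f (int p) a"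
  proof unfold_locales
    show "topological_manifold (Suc 3) W" using mW by simp
    show "compactin W (f ` topspace M)"
      using image_compactin[OF _ fc, of "topspace M"] lc(3) by (simp add: compact_space_def)
    show "\<exists>U h g. flat_chart 3 W (f ` topspace M) U h g \<and> x \<in> U" if x: "x \<in> f ` topspace M" for x
    proof -
      obtain y where y: "y \<in> topspace M" "x = f y" using x by blast
      have "\<exists>U h. openin W U \<and> f y \<in> U \<and> homeomorphic_map (subtopology W U) (Eucl (Suc 3)) h \<and>
        h ` (U \<inter> f ` topspace M) = topspace (Eucl 3)"
        using f y(1) unfolding locally_flat_embedding_def by blast
      then obtain U h where U: "openin W U" "f y \<in> U" "homeomorphic_map (subtopology W U) (Eucl (Suc 3)) h"
        "h ` (U \<inter> f ` topspace M) = topspace (Eucl 3)" by (elim exE conjE) (rule that)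
      obtain g where "homeomorphic_maps (subtopology W U) (Eucl (Suc 3)) h g"
        using U(3) homeomorphic_map_maps by blast
      then have "flat_chart 3 W (f ` topspace M) U h g" using U(1,4) by (simp add: flat_chart_def chart_def)
      then show ?thesis using U(2) y(2) by blast
    qed
    show "connected_space M" by (rule path_connected_imp_connected_space[OF Mpc])
    show "connected_space W" using homology_sphere_facts(1)[OF W] by simp
    show "rbound 0 k W {} z" if "k \<in> {1, 2, 3}" "rcycle 0 k W {} z" for k z
      using homology_sphere_facts(2)[OF W _ _ _ that(2)] that(1) by auto
  qed (use mW lc prime_p emb a in simp_all)
  then show thesis using that by blast
qed

lemma bisected_class_exists:
  fixes W :: "'b topology"
  assumes lc: "linking_class M m0 p \<mu>" "topspace M \<noteq> {}" "compact_space M"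
    and W: "integer_homology_sphere 4 W" and f: "locally_flat_embedding 3 M W f"
    and UV: "U \<noteq> V" "connected_components_of (subtopology W (topspace W - f ` topspace M)) = {U, V}"
  obtains a where "bisected_class M m0 W f p a U V \<mu>"
    "W closure_of U = U \<union> f ` topspace M" "W closure_of V = V \<union> f ` topspace M"
proof -
  obtain a where "embedded M m0 W f (int p) a" by (rule embedded_exists[OF lc W f])
  then interpret embedded M m0 W f "int p" a .
  have "bisected_class M m0 W f p a U V \<mu>" using UV lc(1) embedded_axioms
    by (simp add: bisected_class_def bisected_def bisected_axioms_def linking_class_def)
  moreover have "W closure_of U = U \<union> N" "W closure_of V = V \<union> N"
    using comps_closure[OF Wconn N_connected N_ne] UV(2) by auto
  ultimately show thesis using that by blast
qed

lemma regions_vanish: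
  fixes W :: "'b topology"
  assumes M: "linking_class M m0 p \<mu>" "topspace M \<noteq> {}" "compact_space M"
    and W: "integer_homology_sphere 4 W" and f: "locally_flat_embedding 3 M W f"
    and XY: "complementary_regions W (f ` topspace M) X Y"
  shows "triple_cup_vanishes M \<mu> p (region_kernel M W f X)" "triple_cup_vanishes M \<mu> p (region_kernel M W f Y)"
    "dual_hantzsche_pair M \<mu> p (region_kernel M W f X) (region_kernel M W f Y)"
proof -
  obtain U V where UV: "U \<noteq> V" "connected_components_of (subtopology W (topspace W - f ` topspace M)) = {U, V}"
    and X: "X = W closure_of U" and Y: "Y = W closure_of V" using XY unfolding complementary_regions_def by blast
  obtain a where a: "bisected_class M m0 W f p a U V \<mu>"
    and cl: "W closure_of U = U \<union> f ` topspace M" "W closure_of V = V \<union> f ` topspace M"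
    by (rule bisected_class_exists[OF M W f UV])
  interpret bisected_class M m0 W f p a U V \<mu> by (rule a)
  interpret sw: bisected_class M m0 W f p a V U \<mu> by (rule swap_class)
  show "triple_cup_vanishes M \<mu> p (region_kernel M W f X)" "triple_cup_vanishes M \<mu> p (region_kernel M W f Y)"
    "dual_hantzsche_pair M \<mu> p (region_kernel M W f X) (region_kernel M W f Y)"
    unfolding X Y cl by (rule triple_cup_vanishes_kernel sw.triple_cup_vanishes_kernel dual_pair)+
qed

text \<open>By \<open>two_comps\<close> an embedding always has complementary regions, whose kernels
  then provide the pair.\<close>

lemma dual_pair_exists:
  fixes W :: "'b topology"
  assumes lc: "linking_class M m0 p \<mu>" "topspace M \<noteq> {}" "compact_space M"
    and hW: "integer_homology_sphere 4 W" and f: "locally_flat_embedding 3 M W f"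
  shows "\<exists>A' B'. dual_hantzsche_pair M \<mu> p A' B' \<and> triple_cup_vanishes M \<mu> p A' \<and> triple_cup_vanishes M \<mu> p B'"
proof -
  obtain a where "embedded M m0 W f (int p) a" by (rule embedded_exists[OF lc hW f])
  then interpret embedded M m0 W f "int p" a .
  obtain U V where "comps = {U, V}" "U \<noteq> V" by (rule two_comps)
  then have "complementary_regions W (f ` topspace M) (W closure_of U) (W closure_of V)"
    unfolding complementary_regions_def by blast
  from regions_vanish[OF lc hW f this] show ?thesis by blast
qed

theorem theorem4:
  fixes M :: "'a topology" and \<mu> :: "'a chain set" and p :: nat
  assumes "prime p" and "odd p"
    and "rational_homology_sphere 3 M" and "fundamental_class 3 M \<mu>"
    and "has_exponent (homology_group 1 M) p"
  shows "(\<forall>(W :: 'b topology) f X Y.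
      (W homeomorphic_space nsphere 4 \<or> integer_homology_sphere 4 W) \<and>
      locally_flat_embedding 3 M W f \<and> complementary_regions W (f ` topspace M) X Y \<longrightarrow>
      triple_cup_vanishes M \<mu> p (region_kernel M W f X) \<and>
      triple_cup_vanishes M \<mu> p (region_kernel M W f Y)) \<and>
    ((\<nexists>A' B'. dual_hantzsche_pair M \<mu> p A' B' \<and>
        triple_cup_vanishes M \<mu> p A' \<and> triple_cup_vanishes M \<mu> p B') \<longrightarrow>
      (\<nexists>f. locally_flat_embedding 3 M (nsphere 4) f) \<and>
      (\<nexists>(W :: 'b topology) f. integer_homology_sphere 4 W \<and> locally_flat_embedding 3 M W f))"
proof -
  obtain m0 where M: "linking_class M m0 p \<mu>" "topspace M \<noteq> {}" "compact_space M"
    by (rule linking_class_exists[OF assms(1,3,4,5)])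
  \<comment> \<open>The standard sphere is an integer homology sphere on its own point type, beside
    the arbitrary point type of \<open>W\<close>.\<close>
  have S: "integer_homology_sphere 4 (nsphere 4)"
    by (rule integer_homology_sphere_homeomorphic) (rule homeomorphic_space_refl)
  show ?thesis
    using regions_vanish[OF M] dual_pair_exists[OF M S] dual_pair_exists[OF M] integer_homology_sphere_homeomorphic
    by (intro conjI allI impI notI) blast+
qed

end
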